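(* Let $\mathbb{K}$ be a commutative ring with unit. There is an isomorphism of graded operads $$h^\bullet(\mathrm{MLT})\simeq \mathrm{Tree}$$ between the cohomology operad of the operadic poset species $\mathrm{MLT}$ of multilabeled trees and Kontsevich's operad of trees.
   Context: All finite sets are non-empty. A tree is an abstract graph without double edges or self-loops in which two vertices are connected by exactly one path. An $S$-multilabeled tree is a tree whose set of nodes is a partition of $S$ (each node is labeled by a block). $\mathrm{MLT}(S)$ is the poset of $S$-multilabeled trees, with $t\le t'$ iff $t$ is obtained from $t'$ by contracting edges and merging the corresponding blocks. For a finite poset $P$, $c^n(P)$ is the free $\mathbb{K}$-module on symbols $[x_0<\cdots<x_n]$ for chains with $x_0$ minimal and $x_n$ maximal in $P$, with $d[x_0<\cdots<x_n]=\sum_{i=1}^n(-1)^i\sum_{x_{i-1}<y<x_i}[\cdots<x_{i-1}<y<x_i<\cdots]$, and $h^\bullet(P)$ is its cohomology. For a poset morphism $f$, $f^*[y_0<\cdots<y_n]=\sum_{f(x_i)=y_i}[x_0<\cdots<x_n]$. Operad structure on $h^\bullet(\mathrm{MLT}):S\mapsto h^\bullet(\mathrm{MLT}(S))$ (graded modules carry the Koszul sign symmetry). It is determined by the following partial compositions. For disjoint finite sets $A$, $B$, let $\pi$ be the partition of $A\sqcup B$ with blocks $B$ and the singletons $\{a\}$, $a\in A$; identify its set of blocks with $A\sqcup\{*\}$. For each $t\in\mathrm{MLT}(A\sqcup B)$ whose set of nodes is $\pi$, let $\varphi_t:\mathrm{MLT}_{\le t}(A\sqcup B)\to\mathrm{MLT}(A\sqcup\{*\})$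 relabel trees by replacing the subset $B$ by $*$ in labels, and let $\psi_t:\mathrm{MLT}_{\ge t}(A\sqcup B)\to\mathrm{MLT}(B)$ send $t'\ge t$ to the component labeled by $B$ of the forest obtained from $t'$ by cutting the edges of $t$. Then $\circ_*:h^\bullet(\mathrm{MLT}(A\sqcup\{*\}))\otimes h^\bullet(\mathrm{MLT}(B))\to h^\bullet(\mathrm{MLT}(A\sqcup B))$ is $\sum_t\mu_t\circ(\varphi_t^*\otimes\psi_t^* )$, where $\mu_t([x_0<\cdots<x_m=t]\otimes[t=x_m<\cdots<x_{m+n}])=[x_0<\cdots<x_{m+n}]$. Kontsevich's operad of trees. An $S$-labeled tree is a tree whose set of nodes is $S$. $\mathrm{Tree}(S)$ is the $\mathbb{K}$-module, placed in degree $|S|-1$, spanned by pairs $(t,\omega)$ with $t$ an $S$-labeled tree and $\omega$ a linear order on its set of edges $E(t)$, modulo $(t,\omega)=\mathrm{sgn}(\sigma)(t,\sigma\cdot\omega)$ for permutations $\sigma$ of $E(t)$. The partial composition $\circ_*:\mathrm{Tree}(A\sqcup\{*\})\otimes\mathrm{Tree}(B)\to\mathrm{Tree}(A\sqcup B)$ is $(t,\omega)\circ_*(t',\omega')=\sum(t'',\omega'')$, where the sum ranges over the $(A\sqcup B)$-labeled trees $t''$ which have $t'$ as a $B$-labeled subtree and such that contracting $t'$ into a node labeled $*$ yields $t$, and $\omega''$ is the concatenation of $\omega$ and $\omega'$. *)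

theory Defs
  imports
    "HOL-Algebra.Module"
    "HOL-Combinatorics.Permutations"
    "HOL-Library.Disjoint_Sets"
begin

section \<open>Graded operads in modules\<close>

text \<open>
  The ground ring is a type of sort \<open>{comm_ring, comm_monoid_mult}\<close>. This is
  \<open>comm_ring_1\<close> without the axiom \<open>0 \<noteq> 1\<close>, so that the zero ring is not excluded.
\<close>

definition scalars :: "'k::{comm_ring,comm_monoid_mult} ring" where
  "scalars = \<lparr>carrier = UNIV, monoid.mult = (*), one = 1, zero = 0, add = (+)\<rparr>"

definition linear_maps ::
    "'k ring \<Rightarrow> ('k, 'x) module \<Rightarrow> ('k, 'y) module \<Rightarrow> ('x \<Rightarrow> 'y) set" where
  "linear_maps K M N =
     {h. h \<in> carrier M \<rightarrow> carrier N
       \<and> (\<forall>x\<in>carrier M. \<forall>y\<in>carrier M. h (x \<oplus>\<^bsub>M\<^esub> y) = h x \<oplus>\<^bsub>N\<^esub> h y)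
       \<and> (\<forall>c\<in>carrier K. \<forall>x\<in>carrier M. h (c \<odot>\<^bsub>M\<^esub> x) = c \<odot>\<^bsub>N\<^esub> h x)}"

text \<open>
  The groupoid of finite non-empty sets is rendered as the non-empty finite subsets of a label type
  \<open>'a\<close>. The component of arity \<open>S\<close> and degree \<open>n\<close> is \<open>op_space P S n\<close>; a bijection
  \<open>\<sigma> : S \<rightarrow> \<sigma> ` S\<close> acts by \<open>op_relabel P S \<sigma> n\<close>; and \<open>op_comp P A a B m n\<close> is
  \<open>\<circ>\<^sub>a : P(A \<squnion> {a})\<^sub>m \<otimes> P(B)\<^sub>n \<rightarrow> P(A \<squnion> B)\<^sub>m\<^sub>+\<^sub>n\<close>, where \<open>a \<notin> A\<close>, the sets \<open>A\<close> and \<open>B\<close> are disjoint,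
  \<open>B\<close> is non-empty and \<open>A\<close> may be empty (as the unit law needs). It is not required that \<open>a \<notin> B\<close>.
\<close>

record ('a, 'k, 'x) operad_data =
  op_space :: "'a set \<Rightarrow> nat \<Rightarrow> ('k, 'x) module"
  op_relabel :: "'a set \<Rightarrow> ('a \<Rightarrow> 'a) \<Rightarrow> nat \<Rightarrow> 'x \<Rightarrow> 'x"
  op_comp :: "'a set \<Rightarrow> 'a \<Rightarrow> 'a set \<Rightarrow> nat \<Rightarrow> nat \<Rightarrow> 'x \<Rightarrow> 'x \<Rightarrow> 'x"
  op_unit :: "'a \<Rightarrow> 'x"

definition arity :: "'a set \<Rightarrow> bool" where
  "arity S \<longleftrightarrow> finite S \<and> S \<noteq> {}"

definition composable :: "'a set \<Rightarrow> 'a \<Rightarrow> 'a set \<Rightarrow> bool" where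
  "composable A a B \<longleftrightarrow> finite A \<and> arity B \<and> A \<inter> B = {} \<and> a \<notin> A"

locale graded_operad =
  fixes K :: "'k ring" and P :: "('a, 'k, 'x) operad_data"
  assumes space_module:
      "arity S \<Longrightarrow> module K (op_space P S n)"
    and relabel_linear:
      "arity S \<Longrightarrow> inj_on \<sigma> S \<Longrightarrow>
       op_relabel P S \<sigma> n \<in> linear_maps K (op_space P S n) (op_space P (\<sigma> ` S) n)"
    and relabel_cong:
      "arity S \<Longrightarrow> inj_on \<sigma> S \<Longrightarrow> (\<And>s. s \<in> S \<Longrightarrow> \<sigma> s = \<tau> s) \<Longrightarrow> x \<in> carrier (op_space P S n) \<Longrightarrow>
       op_relabel P S \<sigma> n x = op_relabel P S \<tau> n x"
    and relabel_id:
      "arity S \<Longrightarrow> x \<in> carrier (op_space P S n) \<Longrightarrow> op_relabel P S id n x = x"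
    and relabel_comp:
      "arity S \<Longrightarrow> inj_on \<sigma> S \<Longrightarrow> inj_on \<tau> (\<sigma> ` S) \<Longrightarrow> x \<in> carrier (op_space P S n) \<Longrightarrow>
       op_relabel P (\<sigma> ` S) \<tau> n (op_relabel P S \<sigma> n x) = op_relabel P S (\<tau> \<circ> \<sigma>) n x"
    and comp_linear_right:
      "composable A a B \<Longrightarrow> x \<in> carrier (op_space P (insert a A) m) \<Longrightarrow>
       (\<lambda>y. op_comp P A a B m n x y)
         \<in> linear_maps K (op_space P B n) (op_space P (A \<union> B) (m + n))"
    and comp_linear_left:
      "composable A a B \<Longrightarrow> y \<in> carrier (op_space P B n) \<Longrightarrow>
       (\<lambda>x. op_comp P A a B m n x y)
         \<in> linear_maps K (op_space P (insert a A) m) (op_space P (A \<union> B) (m + n))"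
    and comp_equivariant:
      "composable A a B \<Longrightarrow> inj_on \<sigma> (A \<union> B) \<Longrightarrow> a' \<notin> \<sigma> ` A \<Longrightarrow>
       x \<in> carrier (op_space P (insert a A) m) \<Longrightarrow> y \<in> carrier (op_space P B n) \<Longrightarrow>
       op_relabel P (A \<union> B) \<sigma> (m + n) (op_comp P A a B m n x y)
         = op_comp P (\<sigma> ` A) a' (\<sigma> ` B) m n
             (op_relabel P (insert a A) (\<sigma>(a := a')) m x) (op_relabel P B \<sigma> n y)"
    and comp_sequential:
      "composable A a (insert b B) \<Longrightarrow> composable B b C \<Longrightarrow> A \<inter> C = {} \<Longrightarrow>
       x \<in> carrier (op_space P (insert a A) l) \<Longrightarrow>
       y \<in> carrier (op_space P (insert b B) m) \<Longrightarrow>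
       z \<in> carrier (op_space P C n) \<Longrightarrow>
       op_comp P (A \<union> B) b C (l + m) n (op_comp P A a (insert b B) l m x y) z
         = op_comp P A a (B \<union> C) l (m + n) x (op_comp P B b C m n y z)"
    and comp_parallel:
      "composable (insert b A) a B \<Longrightarrow> composable (insert a A) b C \<Longrightarrow> B \<inter> C = {} \<Longrightarrow>
       x \<in> carrier (op_space P (insert a (insert b A)) l) \<Longrightarrow>
       y \<in> carrier (op_space P B m) \<Longrightarrow>
       z \<in> carrier (op_space P C n) \<Longrightarrow>
       op_comp P (A \<union> B) b C (l + m) n (op_comp P (insert b A) a B l m x y) z
         = ((\<ominus>\<^bsub>K\<^esub> \<one>\<^bsub>K\<^esub>) [^]\<^bsub>K\<^esub> (m * n)) \<odot>\<^bsub>op_space P (A \<union> B \<union> C) (l + m + n)\<^esub>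
             op_comp P (A \<union> C) a B (l + n) m (op_comp P (insert a A) b C l n x z) y"
    and unit_closed:
      "op_unit P a \<in> carrier (op_space P {a} 0)"
    and unit_relabel:
      "op_relabel P {a} \<sigma> 0 (op_unit P a) = op_unit P (\<sigma> a)"
    and unit_left:
      "arity B \<Longrightarrow> y \<in> carrier (op_space P B n) \<Longrightarrow> op_comp P {} a B 0 n (op_unit P a) y = y"
    and unit_right:
      "composable A a {b} \<Longrightarrow> x \<in> carrier (op_space P (insert a A) m) \<Longrightarrow>
       op_comp P A a {b} m 0 x (op_unit P b) = op_relabel P (insert a A) (id(a := b)) m x"

definition graded_operad_iso ::
    "'k ring \<Rightarrow> ('a, 'k, 'x) operad_data \<Rightarrow> ('a, 'k, 'y) operad_data \<Rightarrow>
     ('a set \<Rightarrow> nat \<Rightarrow> 'x \<Rightarrow> 'y) \<Rightarrow> bool" where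
  "graded_operad_iso K P Q \<Phi> \<longleftrightarrow>
     graded_operad K P \<and> graded_operad K Q \<and>
     (\<forall>S n. arity S \<longrightarrow>
        \<Phi> S n \<in> linear_maps K (op_space P S n) (op_space Q S n) \<and>
        bij_betw (\<Phi> S n) (carrier (op_space P S n)) (carrier (op_space Q S n))) \<and>
     (\<forall>S \<sigma> n. \<forall>x\<in>carrier (op_space P S n). arity S \<longrightarrow> inj_on \<sigma> S \<longrightarrow>
        \<Phi> (\<sigma> ` S) n (op_relabel P S \<sigma> n x) = op_relabel Q S \<sigma> n (\<Phi> S n x)) \<and>
     (\<forall>A a B m n. \<forall>x\<in>carrier (op_space P (insert a A) m). \<forall>y\<in>carrier (op_space P B n).
        composable A a B \<longrightarrow>
        \<Phi> (A \<union> B) (m + n) (op_comp P A a B m n x y)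
          = op_comp Q A a B m n (\<Phi> (insert a A) m x) (\<Phi> B n y)) \<and>
     (\<forall>a. \<Phi> {a} 0 (op_unit P a) = op_unit Q a)"

section \<open>Quotients of modules of functions\<close>

text \<open>
  For finite \<open>X\<close>, the free module on \<open>X :: 'c set\<close> is the set of functions \<open>'c \<Rightarrow> 'k\<close> vanishing off \<open>X\<close>.
\<close>

definition free_module :: "'c set \<Rightarrow> ('c \<Rightarrow> 'k::zero) set" where
  "free_module X = {f. \<forall>x. x \<notin> X \<longrightarrow> f x = 0}"

definition basis_vec :: "'c \<Rightarrow> 'c \<Rightarrow> 'k::{zero,one}" where
  "basis_vec x = (\<lambda>y. if y = x then 1 else 0)"

definition cong_mod :: "('c \<Rightarrow> 'k::ab_group_add) set \<Rightarrow> ('c \<Rightarrow> 'k) set \<Rightarrow> ('c \<Rightarrow> 'k) rel" where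
  "cong_mod Z B = {(f, g). f \<in> Z \<and> g \<in> Z \<and> (\<lambda>x. f x - g x) \<in> B}"

text \<open>
  The module \<open>Z / B\<close>. The \<open>module\<close> record type extends that of rings, so it has a multiplication and a
  \<open>1\<close>; these are irrelevant to the locale \<open>module\<close>.
\<close>

definition quotient_module ::
    "('c \<Rightarrow> 'k::{comm_ring,comm_monoid_mult}) set \<Rightarrow> ('c \<Rightarrow> 'k) set \<Rightarrow> ('k, ('c \<Rightarrow> 'k) set) module" where
  "quotient_module Z B =
     \<lparr>carrier = Z // cong_mod Z B,
      monoid.mult = undefined,
      one = undefined,
      zero = cong_mod Z B `` {\<lambda>_. 0},
      add = (\<lambda>X Y. \<Union>f\<in>X. \<Union>g\<in>Y. cong_mod Z B `` {\<lambda>x. f x + g x}),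
      smult = (\<lambda>c X. \<Union>f\<in>X. cong_mod Z B `` {\<lambda>x. c * f x})\<rparr>"

section \<open>The cohomology of a finite poset\<close>

text \<open>A poset is given by a carrier \<open>P\<close> and an order relation \<open>leq\<close>, which is only used on \<open>P\<close>.\<close>

definition full_chains :: "'p set \<Rightarrow> ('p \<Rightarrow> 'p \<Rightarrow> bool) \<Rightarrow> nat \<Rightarrow> 'p list set" where
  "full_chains P leq n =
     {xs. length xs = Suc n \<and> set xs \<subseteq> P \<and> sorted_wrt (\<lambda>x y. leq x y \<and> x \<noteq> y) xs
        \<and> (\<forall>y\<in>P. leq y (hd xs) \<longrightarrow> y = hd xs)
        \<and> (\<forall>y\<in>P. leq (last xs) y \<longrightarrow> y = last xs)}"

definition cochains :: "'p set \<Rightarrow> ('p \<Rightarrow> 'p \<Rightarrow> bool) \<Rightarrow> nat \<Rightarrow> ('p list \<Rightarrow> 'k::zero) set" where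
  "cochains P leq n = free_module (full_chains P leq n)"

text \<open>
  The coefficient of \<open>d f\<close> at \<open>[z\<^sub>0 < \<dots> < z\<^sub>n\<^sub>+\<^sub>1]\<close>: this chain occurs, with sign \<open>(-1)\<^sup>i\<close>, in the
  differential of each chain obtained from it by deleting an inner element \<open>z\<^sub>i\<close>.
\<close>

definition coboundary ::
    "'p set \<Rightarrow> ('p \<Rightarrow> 'p \<Rightarrow> bool) \<Rightarrow> nat \<Rightarrow>
     ('p list \<Rightarrow> 'k::{comm_ring,comm_monoid_mult}) \<Rightarrow> 'p list \<Rightarrow> 'k" where
  "coboundary P leq n f =
     (\<lambda>z. if z \<in> full_chains P leq (Suc n)
           then \<Sum>i = 1..n. (- 1) ^ i * f (take i z @ drop (Suc i) z) else 0)"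

definition cocycles ::
    "'p set \<Rightarrow> ('p \<Rightarrow> 'p \<Rightarrow> bool) \<Rightarrow> nat \<Rightarrow> ('p list \<Rightarrow> 'k::{comm_ring,comm_monoid_mult}) set" where
  "cocycles P leq n = {f \<in> cochains P leq n. coboundary P leq n f = (\<lambda>_. 0)}"

definition coboundaries ::
    "'p set \<Rightarrow> ('p \<Rightarrow> 'p \<Rightarrow> bool) \<Rightarrow> nat \<Rightarrow> ('p list \<Rightarrow> 'k::{comm_ring,comm_monoid_mult}) set" where
  "coboundaries P leq n =
     (case n of 0 \<Rightarrow> {\<lambda>_. 0} | Suc k \<Rightarrow> coboundary P leq k ` cochains P leq k)"

definition cohomologous ::
    "'p set \<Rightarrow> ('p \<Rightarrow> 'p \<Rightarrow> bool) \<Rightarrow> nat \<Rightarrow> ('p list \<Rightarrow> 'k::{comm_ring,comm_monoid_mult}) rel" where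
  "cohomologous P leq n = cong_mod (cocycles P leq n) (coboundaries P leq n)"

definition cohomology ::
    "'p set \<Rightarrow> ('p \<Rightarrow> 'p \<Rightarrow> bool) \<Rightarrow> nat \<Rightarrow>
     ('k::{comm_ring,comm_monoid_mult}, ('p list \<Rightarrow> 'k) set) module" where
  "cohomology P leq n = quotient_module (cocycles P leq n) (coboundaries P leq n)"

text \<open>
  The linear map \<open>\<phi>\<^sup>*\<close> into the degree \<open>n\<close> cochains on \<open>Q\<close>, for \<open>\<phi>\<close> defined on \<open>Q\<close>: the coefficient of
  \<open>\<phi>\<^sup>* f\<close> at \<open>[x\<^sub>0 < \<dots> < x\<^sub>n]\<close> is the coefficient of \<open>f\<close> at \<open>[\<phi> x\<^sub>0, \<dots>, \<phi> x\<^sub>n]\<close>, which is \<open>0\<close> if the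
  latter is not a chain from a minimal to a maximal element of the target.
\<close>

definition pullback ::
    "'q set \<Rightarrow> ('q \<Rightarrow> 'q \<Rightarrow> bool) \<Rightarrow> nat \<Rightarrow> ('q \<Rightarrow> 'p) \<Rightarrow> ('p list \<Rightarrow> 'k::zero) \<Rightarrow> 'q list \<Rightarrow> 'k" where
  "pullback Q leq n \<phi> f = (\<lambda>xs. if xs \<in> full_chains Q leq n then f (map \<phi> xs) else 0)"

section \<open>Trees\<close>

type_synonym 'v tree = "'v set \<times> 'v set set"

abbreviation nodes :: "'v tree \<Rightarrow> 'v set" where "nodes \<equiv> fst"
abbreviation edges :: "'v tree \<Rightarrow> 'v set set" where "edges \<equiv> snd"

definition tree_path :: "'v tree \<Rightarrow> 'v \<Rightarrow> 'v \<Rightarrow> 'v list \<Rightarrow> bool" where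
  "tree_path t u v p \<longleftrightarrow>
     p \<noteq> [] \<and> hd p = u \<and> last p = v \<and> distinct p \<and> set p \<subseteq> nodes t
       \<and> successively (\<lambda>x y. {x, y} \<in> edges t) p"

definition is_tree :: "'v tree \<Rightarrow> bool" where
  "is_tree t \<longleftrightarrow>
     edges t \<subseteq> {{u, v} |u v. u \<in> nodes t \<and> v \<in> nodes t \<and> u \<noteq> v}
       \<and> (\<forall>u\<in>nodes t. \<forall>v\<in>nodes t. \<exists>!p. tree_path t u v p)"

definition map_tree :: "('v \<Rightarrow> 'w) \<Rightarrow> 'v tree \<Rightarrow> 'w tree" where
  "map_tree h t = (h ` nodes t, (`) h ` edges t)"

section \<open>The operad of multilabeled trees\<close>

definition MLT :: "'a set \<Rightarrow> 'a set tree set" where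
  "MLT S = {t. is_tree t \<and> partition_on S (nodes t)}"

text \<open>The block into which \<open>X\<close> is merged when the edges in \<open>F\<close> are contracted.\<close>

definition merged_block :: "'a set set set \<Rightarrow> 'a set \<Rightarrow> 'a set" where
  "merged_block F X = \<Union> {Y. (X, Y) \<in> {(U, V). {U, V} \<in> F}\<^sup>*}"

definition contract_edges :: "'a set set set \<Rightarrow> 'a set tree \<Rightarrow> 'a set tree" where
  "contract_edges F t = map_tree (merged_block F) (nodes t, edges t - F)"

definition mlt_le :: "'a set tree \<Rightarrow> 'a set tree \<Rightarrow> bool" where
  "mlt_le t t' \<longleftrightarrow> (\<exists>F \<subseteq> edges t'. t = contract_edges F t')"

text \<open>The multilabeled trees whose set of nodes is the partition into \<open>B\<close> and the singletons of \<open>A\<close>.\<close>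

definition mlt_over_partition :: "'a set \<Rightarrow> 'a set \<Rightarrow> 'a set tree set" where
  "mlt_over_partition A B = {t \<in> MLT (A \<union> B). nodes t = insert B ((\<lambda>a. {a}) ` A)}"

definition mlt_below :: "'a set \<Rightarrow> 'a set tree \<Rightarrow> 'a set tree set" where
  "mlt_below S t = {s \<in> MLT S. mlt_le s t}"

definition mlt_above :: "'a set \<Rightarrow> 'a set tree \<Rightarrow> 'a set tree set" where
  "mlt_above S t = {s \<in> MLT S. mlt_le t s}"

definition phi_map :: "'a \<Rightarrow> 'a set \<Rightarrow> 'a set tree \<Rightarrow> 'a set tree" where
  "phi_map a B = map_tree (\<lambda>X. if B \<subseteq> X then insert a (X - B) else X)"

text \<open>For \<open>t \<leq> t'\<close>, the edges of \<open>t\<close> viewed as edges of \<open>t'\<close>, i.e. those which are not contracted.\<close>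

definition lifted_edges :: "'a set tree \<Rightarrow> 'a set tree \<Rightarrow> 'a set set set" where
  "lifted_edges t t' =
     {e \<in> edges t'. \<exists>U V X Y. {U, V} \<in> edges t \<and> e = {X, Y} \<and> X \<subseteq> U \<and> Y \<subseteq> V}"

text \<open>
  The component labeled by \<open>B\<close> of the forest \<open>t'\<close> cut along the edges of \<open>t\<close>; its nodes are the
  nodes of \<open>t'\<close> that are merged into the node \<open>B\<close> of \<open>t\<close>.
\<close>

definition psi_map :: "'a set tree \<Rightarrow> 'a set \<Rightarrow> 'a set tree \<Rightarrow> 'a set tree" where
  "psi_map t B t' =
     ({X \<in> nodes t'. X \<subseteq> B}, {e \<in> edges t' - lifted_edges t t'. \<forall>X\<in>e. X \<subseteq> B})"

definition mu_map ::
    "'a set \<Rightarrow> 'a set tree \<Rightarrow> nat \<Rightarrow> nat \<Rightarrow> ('a set tree list \<Rightarrow> 'k) \<Rightarrow> ('a set tree list \<Rightarrow> 'k) \<Rightarrow>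
     'a set tree list \<Rightarrow> 'k::{comm_ring,comm_monoid_mult}" where
  "mu_map S t m n f g =
     (\<lambda>z. if z \<in> full_chains (MLT S) mlt_le (m + n) \<and> z ! m = t
           then f (take (Suc m) z) * g (drop m z) else 0)"

definition mlt_comp ::
    "'a set \<Rightarrow> 'a \<Rightarrow> 'a set \<Rightarrow> nat \<Rightarrow> nat \<Rightarrow> ('a set tree list \<Rightarrow> 'k) \<Rightarrow> ('a set tree list \<Rightarrow> 'k) \<Rightarrow>
     'a set tree list \<Rightarrow> 'k::{comm_ring,comm_monoid_mult}" where
  "mlt_comp A a B m n f g =
     (\<lambda>z. \<Sum>t\<in>mlt_over_partition A B.
        mu_map (A \<union> B) t m n
          (pullback (mlt_below (A \<union> B) t) mlt_le m (phi_map a B) f)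
          (pullback (mlt_above (A \<union> B) t) mlt_le n (psi_map t B) g) z)"

text \<open>
  A bijection \<open>\<sigma> : S \<rightarrow> \<sigma> ` S\<close> acts on cochains by the pullback along the isomorphism
  \<open>MLT (\<sigma> ` S) \<rightarrow> MLT S\<close> induced by \<open>\<sigma>\<^sup>-\<^sup>1\<close>. The unit is the class of the one-element chain in the
  one-element poset \<open>MLT {a}\<close>.
\<close>

definition h_MLT ::
    "('a, 'k::{comm_ring,comm_monoid_mult}, ('a set tree list \<Rightarrow> 'k) set) operad_data" where
  "h_MLT =
     \<lparr>op_space = (\<lambda>S n. cohomology (MLT S) mlt_le n),
      op_relabel = (\<lambda>S \<sigma> n X. \<Union>f\<in>X. cohomologous (MLT (\<sigma> ` S)) mlt_le n ``
        {pullback (MLT (\<sigma> ` S)) mlt_le n (map_tree ((`) (inv_into S \<sigma>))) f}),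
      op_comp = (\<lambda>A a B m n X Y. \<Union>f\<in>X. \<Union>g\<in>Y. cohomologous (MLT (A \<union> B)) mlt_le (m + n) ``
        {mlt_comp A a B m n f g}),
      op_unit = (\<lambda>a. cohomologous (MLT {a}) mlt_le 0 `` {basis_vec [({{a}}, {})]})\<rparr>"

section \<open>Kontsevich's operad of trees\<close>

definition labeled_trees :: "'a set \<Rightarrow> 'a tree set" where
  "labeled_trees S = {t. is_tree t \<and> nodes t = S}"

text \<open>
  The generators \<open>(t, \<omega>)\<close> of degree \<open>n\<close>; there are none unless \<open>n = |S| - 1\<close>. A linear order on the
  edges is given by the list of the edges in increasing order.
\<close>

definition tree_gens :: "'a set \<Rightarrow> nat \<Rightarrow> ('a tree \<times> 'a set list) set" where
  "tree_gens S n =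
     (if n = card S - 1
      then {(t, \<omega>). t \<in> labeled_trees S \<and> distinct \<omega> \<and> set \<omega> = edges t} else {})"

text \<open>The relators are the elements \<open>(t, \<omega>) - sgn \<sigma> (t, \<sigma> \<omega>)\<close>.\<close>

definition sign_relators ::
    "'a set \<Rightarrow> nat \<Rightarrow> ('a tree \<times> 'a set list \<Rightarrow> 'k::{comm_ring,comm_monoid_mult}) set" where
  "sign_relators S n =
     {(\<lambda>x. basis_vec (t, \<omega>) x
             - (if evenperm \<sigma> then 1 else - 1) * basis_vec (t, map \<sigma> \<omega>) x) |t \<omega> \<sigma>.
        (t, \<omega>) \<in> tree_gens S n \<and> \<sigma> permutes edges t}"

inductive_set fun_span :: "('c \<Rightarrow> 'k::{comm_ring,comm_monoid_mult}) set \<Rightarrow> ('c \<Rightarrow> 'k) set"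
  for G where
    fun_span_zero: "(\<lambda>_. 0) \<in> fun_span G"
  | fun_span_gen: "g \<in> G \<Longrightarrow> g \<in> fun_span G"
  | fun_span_add: "f \<in> fun_span G \<Longrightarrow> g \<in> fun_span G \<Longrightarrow> (\<lambda>x. f x + g x) \<in> fun_span G"
  | fun_span_smult: "f \<in> fun_span G \<Longrightarrow> (\<lambda>x. c * f x) \<in> fun_span G"

definition tree_cong ::
    "'a set \<Rightarrow> nat \<Rightarrow> ('a tree \<times> 'a set list \<Rightarrow> 'k::{comm_ring,comm_monoid_mult}) rel" where
  "tree_cong S n = cong_mod (free_module (tree_gens S n)) (fun_span (sign_relators S n))"

text \<open>
  The terms \<open>(t'', \<omega>'')\<close> of \<open>(t, \<omega>) \<circ>\<^sub>a (t', \<omega>')\<close>. Contracting the subtree \<open>t'\<close> of \<open>t''\<close> to a node \<open>a\<close>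
  gives a bijection from the edges of \<open>t''\<close> not in \<open>t'\<close> to the edges of \<open>t\<close>; its inverse is used to
  view \<open>\<omega>\<close> as an order on the former.
\<close>

definition graftings ::
    "'a set \<Rightarrow> 'a \<Rightarrow> 'a set \<Rightarrow> 'a tree \<times> 'a set list \<Rightarrow> 'a tree \<times> 'a set list \<Rightarrow>
     ('a tree \<times> 'a set list) set" where
  "graftings A a B = (\<lambda>(t, \<omega>) (t', \<omega>').
     let c = (\<lambda>x. if x \<in> B then a else x) in
       {(t'', map (inv_into (edges t'' - edges t') ((`) c)) \<omega> @ \<omega>') |t''.
          t'' \<in> labeled_trees (A \<union> B) \<and> nodes t' \<subseteq> nodes t'' \<and> edges t' \<subseteq> edges t'' \<and>
          map_tree c (nodes t'', edges t'' - edges t') = t})"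

definition tree_comp ::
    "'a set \<Rightarrow> 'a \<Rightarrow> 'a set \<Rightarrow> nat \<Rightarrow> nat \<Rightarrow> ('a tree \<times> 'a set list \<Rightarrow> 'k) \<Rightarrow>
     ('a tree \<times> 'a set list \<Rightarrow> 'k) \<Rightarrow> 'a tree \<times> 'a set list \<Rightarrow> 'k::{comm_ring,comm_monoid_mult}" where
  "tree_comp A a B m n f g =
     (\<lambda>z. \<Sum>x\<in>tree_gens (insert a A) m. \<Sum>y\<in>tree_gens B n.
        f x * g y * (if z \<in> graftings A a B x y then 1 else 0))"

definition tree_relabel ::
    "'a set \<Rightarrow> ('a \<Rightarrow> 'a) \<Rightarrow> nat \<Rightarrow> ('a tree \<times> 'a set list \<Rightarrow> 'k) \<Rightarrow>
     'a tree \<times> 'a set list \<Rightarrow> 'k::{comm_ring,comm_monoid_mult}" where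
  "tree_relabel S \<sigma> n f =
     (\<lambda>z. \<Sum>(t, \<omega>)\<in>tree_gens S n. f (t, \<omega>) * basis_vec (map_tree \<sigma> t, map ((`) \<sigma>) \<omega>) z)"

definition Tree_operad ::
    "('a, 'k::{comm_ring,comm_monoid_mult}, ('a tree \<times> 'a set list \<Rightarrow> 'k) set) operad_data" where
  "Tree_operad =
     \<lparr>op_space = (\<lambda>S n.
        quotient_module (free_module (tree_gens S n)) (fun_span (sign_relators S n))),
      op_relabel = (\<lambda>S \<sigma> n X. \<Union>f\<in>X. tree_cong (\<sigma> ` S) n `` {tree_relabel S \<sigma> n f}),
      op_comp = (\<lambda>A a B m n X Y. \<Union>f\<in>X. \<Union>g\<in>Y. tree_cong (A \<union> B) (m + n) ``
        {tree_comp A a B m n f g}),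
      op_unit = (\<lambda>a. tree_cong {a} 0 `` {basis_vec (({a}, {}), [])})\<rparr>"

end

theory Submission imports Defs begin

text \<open>
  The maximal elements of \<open>MLT S\<close> are the labeled trees \<open>(S, E)\<close>, and the elements below \<open>(S, E)\<close> are its
  quotients, one for each set \<open>F \<subseteq> E\<close> of remaining edges. Hence the cochain complex splits over the
  labeled trees into complexes of Boolean lattices. A cone homotopy onto a coatom shows by induction
  that the cohomology of a Boolean lattice vanishes below the top degree \<open>card S - 1\<close>. In the top degree
  every cochain is a cocycle, and a maximal chain is a linear order on \<open>E\<close>. A chain one shorter omits
  one step, which can be restored in exactly two ways that differ by an adjacent transposition, so
  the coboundaries are spanned by the relators \<open>(t, \<omega>) + (t, \<omega>')\<close>, with \<open>\<omega>'\<close> an adjacent transposition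
  of \<open>\<omega>\<close>. These generate the sign relators, which identifies the cohomology with \<open>Tree S\<close>. Cutting a
  maximal chain at the tree with block \<open>B\<close> corresponds to writing an order of edges as a concatenation,
  so the compositions agree. The operad axioms are checked for \<open>Tree\<close> and transferred to
  \<open>h_MLT\<close> along the isomorphism.
\<close>

section \<open>Trees and contractions\<close>

text \<open>The obstacle is that neither the sign relators nor the coboundaries come with an evident
  basis over an arbitrary ring. Both are compared with one intermediate space: the span of the
  coefficient functions on orders of edges that are invariant under one adjacent swap. Such a swap
  has no fixed orders, so an invariant function is a combination of sums over two-element orbits; no
  division by 2 occurs, and invariance is checked pointwise.

  Elements are handled by their coefficients throughout. A generator of the target of a composition
  determines where it has to be cut, so each composition has a closed formula with at most one term,
  and the formulas are compared without sums over graftings.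

  On cochains of multilabeled trees the parallel law holds only up to coboundaries, and independence
  of representatives would require explicit primitives. On orders of edges the former is the
  exchange of two adjacent blocks, which produces the Koszul sign, and the latter is visible from
  the positions of the swaps. This is why both questions are settled for
  \<open>Tree\<close>.\<close>

definition pairs :: "'v set \<Rightarrow> 'v set set" where
  "pairs V = {{u, v} |u v. u \<in> V \<and> v \<in> V \<and> u \<noteq> v}"

text \<open>The relation lives on the whole type, so no vertex set has to be carried along; a vertex
  on no edge is related only to itself.\<close>

definition conn :: "'v set set \<Rightarrow> 'v rel" where
  "conn F = {(u, v). {u, v} \<in> F}\<^sup>*"

definition component :: "'v set set \<Rightarrow> 'v \<Rightarrow> 'v set" where
  "component F x = {y. (x, y) \<in> conn F}"

section \<open>Connectivity by a set of edges\<close>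

lemma conn_refl [simp, intro]: "(u, u) \<in> conn F"
  by (simp add: conn_def)

lemma conn_edge: "{u, v} \<in> F \<Longrightarrow> (u, v) \<in> conn F"
  by (simp add: conn_def r_into_rtrancl)

lemma conn_trans: "(u, v) \<in> conn F \<Longrightarrow> (v, w) \<in> conn F \<Longrightarrow> (u, w) \<in> conn F"
  unfolding conn_def by (rule rtrancl_trans)

lemma conn_sym: "(u, v) \<in> conn F \<Longrightarrow> (v, u) \<in> conn F"
proof -
  have "sym {(u, v). {u, v} \<in> F}"
    by (auto simp: sym_def insert_commute)
  then show "(u, v) \<in> conn F \<Longrightarrow> (v, u) \<in> conn F"
    unfolding conn_def by (meson sym_rtrancl symD)
qed

lemma conn_mono: "F \<subseteq> G \<Longrightarrow> conn F \<subseteq> conn G"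
  unfolding conn_def by (intro rtrancl_mono) blast

lemma conn_monoD: "(u, v) \<in> conn F \<Longrightarrow> F \<subseteq> G \<Longrightarrow> (u, v) \<in> conn G"
  by (rule subsetD[OF conn_mono])

lemma conn_induct [consumes 1, case_names refl step]:
  assumes "(u, v) \<in> conn F" "P u"
    "\<And>v w. (u, v) \<in> conn F \<Longrightarrow> {v, w} \<in> F \<Longrightarrow> P v \<Longrightarrow> P w"
  shows "P v"
  using assms(1)[unfolded conn_def]
proof (induction rule: rtrancl_induct)
  case base
  show ?case by (rule assms(2))
next
  case (step y z)
  show ?case by (rule assms(3)[of y]) (use step in \<open>auto simp: conn_def\<close>)
qed

lemma conn_empty [simp]: "(u, v) \<in> conn {} \<longleftrightarrow> u = v"
  by (auto simp: conn_def)

lemma conn_closed: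
  assumes "(u, v) \<in> conn F" "F \<subseteq> Pow V" "u \<in> V"
  shows "v \<in> V"
  using assms(1) by (induction rule: conn_induct) (use assms in auto)

lemma pairs_Pow: "pairs V \<subseteq> Pow V"
  by (auto simp: pairs_def)

lemma conn_outside:
  assumes "(u, v) \<in> conn F" "F \<subseteq> Pow V" "u \<notin> V"
  shows "v = u"
  using assms(1) by (induction rule: conn_induct) (use assms in auto)

lemma component_self [simp, intro]: "x \<in> component F x"
  by (simp add: component_def)

lemma component_eq_iff: "component F x = component F y \<longleftrightarrow> (x, y) \<in> conn F"
proof
  assume "component F x = component F y"
  then have "y \<in> component F x" by (simp add: component_def)
  then show "(x, y) \<in> conn F" by (simp add: component_def)
next
  assume "(x, y) \<in> conn F"
  then have "(x, z) \<in> conn F \<longleftrightarrow> (y, z) \<in> conn F" for z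
    using conn_sym conn_trans by metis
  then show "component F x = component F y" by (simp add: component_def)
qed

lemma component_eq_iff_mem: "component F x = component F y \<longleftrightarrow> y \<in> component F x"
  by (subst component_eq_iff) (simp add: component_def)

lemma component_empty [simp]: "component {} x = {x}"
  by (auto simp: component_def)

lemma component_subset: "F \<subseteq> Pow V \<Longrightarrow> x \<in> V \<Longrightarrow> component F x \<subseteq> V"
  using conn_closed[of x _ F V] by (auto simp: component_def)

text \<open>The induction runs from the far end \<open>v\<close>, so that a new vertex is put in
  front of a path. If it already lies on the path, the part before it is dropped.\<close>

lemma conn_imp_path:
  assumes "(u, v) \<in> conn E" "E \<subseteq> pairs V" "u \<in> V"
  shows "\<exists>p. tree_path (V, E) u v p"
proof -
  have "(v, u) \<in> conn E" using assms(1) by (rule conn_sym)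
  moreover have "v \<in> V" using assms conn_closed pairs_Pow by (metis order_trans)
  ultimately show ?thesis
  proof (induction rule: conn_induct)
    case refl
    then show ?case by (intro exI[of _ "[v]"]) (auto simp: tree_path_def)
  next
    case (step x w)
    then obtain p where p: "tree_path (V, E) x v p" by blast
    have w: "w \<in> V" using step(2) assms(2) pairs_Pow by blast
    show ?case
    proof (cases "w \<in> set p")
      case True
      then obtain xs ys where "p = xs @ w # ys" by (meson split_list)
      then have "tree_path (V, E) w v (w # ys)"
        using p by (auto simp: tree_path_def successively_append_iff)
      then show ?thesis by blast
    next
      case False
      then have "tree_path (V, E) w v (w # p)"
        using p step(2) w by (cases p) (auto simp: tree_path_def insert_commute)
      then show ?thesis by blast
    qed
  qed
qed

text \<open>The edge set is cut down to edges between vertices of the path. This lets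
  \<open>path_unique\<close> conclude that a path avoids every edge at a vertex it does not
  visit.\<close>

lemma path_imp_conn:
  assumes "successively (\<lambda>x y. {x, y} \<in> E) p" "p \<noteq> []"
  shows "(hd p, last p) \<in> conn {e \<in> E. e \<subseteq> set p}"
  using assms
proof (induction p)
  case (Cons x p)
  show ?case
  proof (cases p)
    case Nil
    then show ?thesis by simp
  next
    case (Cons y p')
    then have e: "{x, y} \<in> E" and s: "successively (\<lambda>x y. {x, y} \<in> E) p"
      using Cons.prems by auto
    have "(y, last p) \<in> conn {e \<in> E. e \<subseteq> set p}"
      using Cons.IH[OF s] Cons by simp
    then have "(y, last p) \<in> conn {e \<in> E. e \<subseteq> set (x # p)}"
      by (rule conn_monoD) auto
    moreover have "(x, y) \<in> conn {e \<in> E. e \<subseteq> set (x # p)}"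
      using e Cons by (intro conn_edge) auto
    ultimately show ?thesis using Cons conn_trans by fastforce
  qed
qed simp

text \<open>Two paths that leave \<open>u\<close> along different edges would together join the ends
  of the first edge without using it, against the bridge hypothesis.\<close>

lemma path_unique:
  assumes bridge: "\<And>x y. {x, y} \<in> E \<Longrightarrow> (x, y) \<notin> conn (E - {{x, y}})"
    and "tree_path (V, E) u v p" "tree_path (V, E) u v q"
  shows "p = q"
  using assms(2,3)
proof (induction p arbitrary: u q)
  case Nil
  then show ?case by (simp add: tree_path_def)
next
  case (Cons u' p)
  then have u': "u' = u" by (simp add: tree_path_def)
  obtain q' where q: "q = u # q'"
    using Cons.prems(2) by (cases q) (auto simp: tree_path_def)
  show ?case
  proof (cases "u = v")
    case True
    have "p = []" using Cons.prems(1) True u'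
      by (cases p rule: rev_cases) (auto simp: tree_path_def)
    moreover have "q' = []" using Cons.prems(2) True q
      by (cases q' rule: rev_cases) (auto simp: tree_path_def)
    ultimately show ?thesis using q u' by simp
  next
    case False
    then obtain x p' where p: "p = x # p'"
      using Cons.prems(1) u' by (cases p) (auto simp: tree_path_def)
    obtain y q'' where q': "q' = y # q''"
      using False Cons.prems(2) q by (cases q') (auto simp: tree_path_def)
    have P: "tree_path (V, E) x v p" "{u, x} \<in> E" "u \<notin> set p"
      using Cons.prems(1) p u' by (auto simp: tree_path_def)
    have Q: "tree_path (V, E) y v q'" "{u, y} \<in> E" "u \<notin> set q'"
      using Cons.prems(2) q q' by (auto simp: tree_path_def)
    show ?thesis
    proof (cases "x = y")
      case True
      then show ?thesis using Cons.IH[OF P(1)] Q(1) q u' by simp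
    next
      case False
      let ?D = "E - {{u, x}}"
      have "(x, v) \<in> conn {e \<in> E. e \<subseteq> set p}"
        using path_imp_conn[of E p] P(1) by (auto simp: tree_path_def)
      then have 1: "(x, v) \<in> conn ?D"
        by (rule conn_monoD) (use P(3) in auto)
      have "(y, v) \<in> conn {e \<in> E. e \<subseteq> set q'}"
        using path_imp_conn[of E q'] Q(1) by (auto simp: tree_path_def)
      then have 2: "(y, v) \<in> conn ?D"
        by (rule conn_monoD) (use Q(3) in auto)
      have "(u, y) \<in> conn ?D"
        using Q(2) False by (intro conn_edge) (auto simp: doubleton_eq_iff)
      then have "(u, x) \<in> conn ?D"
        using 1 2 conn_sym conn_trans by metis
      then show ?thesis using bridge[OF P(2)] by blast
    qed
  qed
qed

text \<open>Unique paths are traded for connectedness plus the condition that every edge is a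
  bridge. In this form contractions can be treated by computing \<open>conn\<close> of sets of
  edges, with no manipulation of paths.\<close>

lemma is_tree_iff:
  "is_tree (V, E) \<longleftrightarrow> E \<subseteq> pairs V \<and> (\<forall>u\<in>V. \<forall>v\<in>V. (u, v) \<in> conn E)
     \<and> (\<forall>u v. {u, v} \<in> E \<longrightarrow> (u, v) \<notin> conn (E - {{u, v}}))"
proof (intro iffI)
  assume t: "is_tree (V, E)"
  then have E: "E \<subseteq> pairs V" and
    U: "\<And>u v. u \<in> V \<Longrightarrow> v \<in> V \<Longrightarrow> \<exists>!p. tree_path (V, E) u v p"
    by (auto simp: is_tree_def pairs_def)
  have "(u, v) \<in> conn E" if uv: "u \<in> V" "v \<in> V" for u v
  proof -
    obtain p where "tree_path (V, E) u v p" using U[OF uv] by (elim ex1E)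
    then have "(u, v) \<in> conn {e \<in> E. e \<subseteq> set p}"
      using path_imp_conn[of E p] by (auto simp: tree_path_def)
    then show ?thesis by (rule conn_monoD) auto
  qed
  moreover have "(u, v) \<notin> conn (E - {{u, v}})" if e: "{u, v} \<in> E" for u v
  proof
    assume c: "(u, v) \<in> conn (E - {{u, v}})"
    have V: "u \<in> V" "v \<in> V" "u \<noteq> v"
      using e E by (auto simp: pairs_def doubleton_eq_iff)
    have "E - {{u, v}} \<subseteq> pairs V" using E by blast
    from conn_imp_path[OF c this V(1)]
    obtain p where p: "tree_path (V, E - {{u, v}}) u v p" by blast
    then have "tree_path (V, E) u v p"
      by (auto simp: tree_path_def intro: successively_mono)
    moreover have "tree_path (V, E) u v [u, v]"
      using V e by (auto simp: tree_path_def)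
    ultimately have "p = [u, v]" using U V by blast
    then show False using p by (simp add: tree_path_def)
  qed
  ultimately show "E \<subseteq> pairs V \<and> (\<forall>u\<in>V. \<forall>v\<in>V. (u, v) \<in> conn E)
     \<and> (\<forall>u v. {u, v} \<in> E \<longrightarrow> (u, v) \<notin> conn (E - {{u, v}}))"
    using E by blast
next
  assume a: "E \<subseteq> pairs V \<and> (\<forall>u\<in>V. \<forall>v\<in>V. (u, v) \<in> conn E)
     \<and> (\<forall>u v. {u, v} \<in> E \<longrightarrow> (u, v) \<notin> conn (E - {{u, v}}))"
  have "\<exists>!p. tree_path (V, E) u v p" if "u \<in> V" "v \<in> V" for u v
  proof (rule ex_ex1I)
    show "\<exists>p. tree_path (V, E) u v p"
      using conn_imp_path[of u v E V] a that by blast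
    show "\<And>p q. tree_path (V, E) u v p \<Longrightarrow> tree_path (V, E) u v q \<Longrightarrow> p = q"
      using a by (intro path_unique[of E V u v]) blast+
  qed
  moreover have "E \<subseteq> pairs V" using a by blast
  ultimately show "is_tree (V, E)"
    unfolding is_tree_def pairs_def fst_conv snd_conv by blast
qed

lemma tree_pairs: "is_tree (V, E) \<Longrightarrow> E \<subseteq> pairs V"
  and tree_connected: "is_tree (V, E) \<Longrightarrow> u \<in> V \<Longrightarrow> v \<in> V \<Longrightarrow> (u, v) \<in> conn E"
  by (simp_all add: is_tree_iff)

lemma tree_edges_Pow: "is_tree (V, E) \<Longrightarrow> E \<subseteq> Pow V"
  using tree_pairs pairs_Pow by blast

lemma pairsE:
  assumes "e \<in> pairs V"
  obtains u v where "e = {u, v}" "u \<in> V" "v \<in> V" "u \<noteq> v"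
  using assms unfolding pairs_def by (elim CollectE exE conjE) (rule that)

lemma tree_edgeE:
  assumes "is_tree (V, E)" "e \<in> E"
  obtains u v where "e = {u, v}" "u \<in> V" "v \<in> V" "u \<noteq> v"
proof -
  have "e \<in> pairs V" using assms(2) tree_pairs[OF assms(1)] by blast
  then show thesis using that by (elim pairsE)
qed

text \<open>The bridge property in contrapositive form. Most later arguments that two edges or two
  sets of edges coincide reduce to it.\<close>

lemma tree_edge_of_conn:
  assumes "is_tree (V, E)" "D \<subseteq> E" "{u, v} \<in> E" "(u, v) \<in> conn D"
  shows "{u, v} \<in> D"
proof (rule ccontr)
  assume "{u, v} \<notin> D"
  then have "D \<subseteq> E - {{u, v}}" using assms(2) by blast
  then have "(u, v) \<in> conn (E - {{u, v}})" using assms(4) conn_monoD by metis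
  then show False using assms(1,3) unfolding is_tree_iff by blast
qed

text \<open>Expresses that \<open>h\<close> realises the contraction of \<open>K\<close> while the
  names of the new vertices stay free. Both \<open>component\<close>, whose values are blocks, and
  \<open>merge\<close>, whose values are labels, are instances.\<close>

definition fibres :: "'v set \<Rightarrow> 'v set set \<Rightarrow> ('v \<Rightarrow> 'w) \<Rightarrow> bool" where
  "fibres V K h \<longleftrightarrow> (\<forall>u\<in>V. \<forall>v\<in>V. h u = h v \<longleftrightarrow> (u, v) \<in> conn K)"

lemma fibres_component: "fibres V K (component K)"
  by (simp add: fibres_def component_eq_iff)

lemma fibres_inj: "inj_on h V \<Longrightarrow> fibres V {} h"
  by (auto simp: fibres_def inj_on_def)

text \<open>An edge of the image lifts to an edge of \<open>G\<close>, and two lifts of the same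
  vertex are joined by \<open>K\<close>; so walks in the image are walks along \<open>G\<close> and
  \<open>K\<close>.\<close>

lemma conn_image_iff:
  assumes fib: "fibres V K h" and K: "K \<subseteq> pairs V" and G: "G \<subseteq> pairs V"
    and uv: "u \<in> V" "v \<in> V"
  shows "(h u, h v) \<in> conn ((`) h ` G) \<longleftrightarrow> (u, v) \<in> conn (G \<union> K)"
proof
  assume "(u, v) \<in> conn (G \<union> K)"
  then have "(h u, h v) \<in> conn ((`) h ` G) \<and> v \<in> V"
  proof (induction rule: conn_induct)
    case refl
    then show ?case using uv by simp
  next
    case (step x y)
    have xy: "x \<in> V" "y \<in> V" using step(2) K G by (auto simp: pairs_def doubleton_eq_iff)
    have "(h x, h y) \<in> conn ((`) h ` G)"
    proof (cases "{x, y} \<in> G")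
      case True
      then have "h ` {x, y} \<in> (`) h ` G" by blast
      then show ?thesis by (intro conn_edge) simp
    next
      case False
      then have "(x, y) \<in> conn K" using step(2) by (intro conn_edge) simp
      then have "h x = h y" using fib xy by (simp add: fibres_def)
      then show ?thesis by simp
    qed
    then show ?case using step xy conn_trans by metis
  qed
  then show "(h u, h v) \<in> conn ((`) h ` G)" by blast
next
  assume "(h u, h v) \<in> conn ((`) h ` G)"
  \<comment> \<open>The claim is made for every lift of the current vertex, because lifts of
    consecutive image edges need not meet.\<close>
  then have "\<forall>w\<in>V. h v = h w \<longrightarrow> (u, w) \<in> conn (G \<union> K)"
  proof (induction rule: conn_induct)
    case refl
    show ?case using fib uv conn_monoD[of u _ K "G \<union> K"] by (auto simp: fibres_def)
  next
    case (step p r)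
    obtain e where e: "e \<in> G" "h ` e = {p, r}" using step(2) by auto
    then obtain x' y' where e': "e = {x', y'}" "x' \<in> V" "y' \<in> V" using G by (metis pairsE subsetD)
    obtain x y where xy: "p = h x" "r = h y" "x \<in> V" "y \<in> V" "{x, y} \<in> G"
      using e e' by (auto simp: doubleton_eq_iff insert_commute)
    have "(u, x) \<in> conn (G \<union> K)" using step.IH xy by blast
    moreover have "(x, y) \<in> conn (G \<union> K)" using xy by (intro conn_edge) blast
    ultimately have "(u, y) \<in> conn (G \<union> K)" by (rule conn_trans)
    moreover have "(y, w) \<in> conn (G \<union> K)" if "w \<in> V" "r = h w" for w
    proof (rule conn_monoD)
      show "(y, w) \<in> conn K" using fib xy(2,4) that unfolding fibres_def by blast
    qed blast
    ultimately show ?case using conn_trans[of u y] by simp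
  qed
  then show "(u, v) \<in> conn (G \<union> K)" using uv by blast
qed

lemma component_image:
  assumes "fibres V K h" "K \<subseteq> pairs V" "G \<subseteq> pairs V" "u \<in> V"
  shows "component ((`) h ` G) (h u) = h ` component (G \<union> K) u"
proof -
  have GP: "(`) h ` G \<subseteq> Pow (h ` V)" using assms(3) pairs_Pow by blast
  have GV: "G \<union> K \<subseteq> Pow V" using assms pairs_Pow by blast
  show ?thesis
  proof (intro Set.set_eqI iffI)
    fix y assume y: "y \<in> component ((`) h ` G) (h u)"
    then have "y \<in> h ` V" using component_subset[OF GP] assms(4) by blast
    then obtain v where "v \<in> V" "y = h v" by blast
    then show "y \<in> h ` component (G \<union> K) u"
      using y conn_image_iff[OF assms(1-4)] by (auto simp: component_def)
  next
    fix y assume "y \<in> h ` component (G \<union> K) u"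
    then obtain v where v: "y = h v" "(u, v) \<in> conn (G \<union> K)" by (auto simp: component_def)
    then have "v \<in> V" using conn_closed[OF _ GV] assms(4) by blast
    then show "y \<in> component ((`) h ` G) (h u)"
      using v conn_image_iff[OF assms(1-4)] by (auto simp: component_def)
  qed
qed

text \<open>No double edges arise: a second edge with the same image would, together with
  \<open>K\<close>, connect the ends of the first, and in a tree the first would then be one of
  these edges.\<close>

lemma contraction_edges_distinct:
  assumes t: "is_tree (V, E)" and K: "K \<subseteq> E" and fib: "fibres V K h"
    and e: "{u, v} \<in> E - K" and e': "e' \<in> E - K" "h ` e' = h ` {u, v}"
  shows "e' = {u, v}"
proof (rule ccontr)
  assume ne: "e' \<noteq> {u, v}"
  have P: "E \<subseteq> pairs V" using t tree_pairs by blast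
  have uv: "u \<in> V" "v \<in> V" using e P pairs_Pow by blast+
  have "(h u, h v) \<in> conn ((`) h ` {e'})" using e'(2) by (intro conn_edge) auto
  then have "(u, v) \<in> conn ({e'} \<union> K)"
    using conn_image_iff[OF fib, of "{e'}" u v] K P e' uv by blast
  moreover have "{e'} \<union> K \<subseteq> E" using K e' by blast
  ultimately have "{u, v} \<in> {e'} \<union> K" using tree_edge_of_conn[OF t] e by blast
  then show False using ne e by blast
qed

lemma contraction_inj:
  assumes t: "is_tree (V, E)" and K: "K \<subseteq> E" and fib: "fibres V K h"
  shows "inj_on ((`) h) (E - K)"
proof (rule inj_onI)
  fix e e' assume a: "e \<in> E - K" "e' \<in> E - K" "h ` e = h ` e'"
  then obtain u v where "e = {u, v}" using a(1) by (metis tree_edgeE[OF t] DiffD1)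
  then show "e = e'" using contraction_edges_distinct[OF t K fib, of u v e'] a by simp
qed

text \<open>Connectedness and the bridge condition are pulled back along
  \<open>conn_image_iff\<close>. Loops are excluded because an edge whose ends are connected by
  \<open>K\<close> belongs to \<open>K\<close>.\<close>

lemma contraction_tree:
  assumes t: "is_tree (V, E)" and K: "K \<subseteq> E" and fib: "fibres V K h"
  shows "is_tree (h ` V, (`) h ` (E - K))"
proof -
  have P: "E \<subseteq> pairs V" using t tree_pairs by blast
  have KP: "K \<subseteq> pairs V" and EP: "E - K \<subseteq> pairs V" using K P by blast+
  have ne: "h u \<noteq> h v" if "{u, v} \<in> E - K" for u v
  proof
    assume "h u = h v"
    moreover have "u \<in> V" "v \<in> V" using that P pairs_Pow by blast+
    ultimately have "(u, v) \<in> conn K" using fib by (simp add: fibres_def)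
    then have "{u, v} \<in> K" using tree_edge_of_conn[OF t K, of u v] that by simp
    then show False using that by simp
  qed
  have "h ` e \<in> pairs (h ` V)" if e: "e \<in> E - K" for e
  proof -
    obtain u v where "e = {u, v}" "u \<in> V" "v \<in> V" using e tree_edgeE[OF t, of e] by (metis DiffD1)
    then show ?thesis using ne e by (auto simp: pairs_def)
  qed
  then have 1: "(`) h ` (E - K) \<subseteq> pairs (h ` V)" by blast
  have 2: "(x, y) \<in> conn ((`) h ` (E - K))" if xy: "x \<in> h ` V" "y \<in> h ` V" for x y
  proof -
    obtain u v where uv: "x = h u" "y = h v" "u \<in> V" "v \<in> V" using xy by blast
    have "(u, v) \<in> conn (E - K \<union> K)"
      by (rule conn_monoD[OF tree_connected[OF t uv(3,4)]]) blast
    then show ?thesis using conn_image_iff[OF fib KP EP uv(3,4)] uv by simp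
  qed
  have 3: "(x, y) \<notin> conn ((`) h ` (E - K) - {{x, y}})" if xy: "{x, y} \<in> (`) h ` (E - K)" for x y
  proof
    assume c: "(x, y) \<in> conn ((`) h ` (E - K) - {{x, y}})"
    obtain e where e: "e \<in> E - K" "h ` e = {x, y}" using xy by auto
    obtain u' v' where "e = {u', v'}" "u' \<in> V" "v' \<in> V" using e by (metis tree_edgeE[OF t] DiffD1)
    then obtain u v where uv: "e = {u, v}" "u \<in> V" "v \<in> V" "x = h u" "y = h v"
      using e by (auto simp: doubleton_eq_iff insert_commute)
    let ?G = "E - K - {e}"
    have "(`) h ` (E - K) - {{x, y}} \<subseteq> (`) h ` ?G" using e by auto
    then have "(h u, h v) \<in> conn ((`) h ` ?G)" using c uv conn_monoD by metis
    then have "(u, v) \<in> conn (?G \<union> K)"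
      using conn_image_iff[OF fib KP, of ?G u v] EP uv by blast
    moreover have "?G \<union> K \<subseteq> E - {e}" using K e by blast
    ultimately have "{u, v} \<in> E - {e}"
      using tree_edge_of_conn[OF t, of "E - {e}" u v] conn_monoD[of u v _ "E - {e}"] e uv by simp
    then show False using uv by simp
  qed
  show ?thesis using 1 2 3 by (auto simp: is_tree_iff)
qed

text \<open>Contracting a single edge lowers the number of vertices and the number of edges by one
  each.\<close>

lemma tree_card_edges:
  assumes "finite V" "is_tree (V, E)" "V \<noteq> {}"
  shows "Suc (card E) = card V"
  using assms
proof (induction "card V" arbitrary: V E rule: less_induct)
  case less
  have P: "E \<subseteq> pairs V" using less(3) tree_pairs by blast
  have fE: "finite E"
    using P pairs_Pow less(2) by (meson finite_Pow_iff finite_subset)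
  show ?case
  proof (cases "E = {}")
    case True
    obtain x where x: "x \<in> V" using less(4) by blast
    have "y = x" if "y \<in> V" for y
      using tree_connected[OF less(3) x that] True by simp
    then have "V = {x}" using x by blast
    then show ?thesis using True by simp
  next
    case False
    then obtain e where "e \<in> E" by blast
    then obtain u v where uv: "{u, v} \<in> E" "u \<in> V" "v \<in> V" "u \<noteq> v"
      using tree_edgeE[OF less(3), of e] by metis
    define h where "h = (\<lambda>x. if x = v then u else x)"
    have Kc: "(x, y) \<in> conn {{u, v}} \<longleftrightarrow> x = y \<or> {x, y} = {u, v}" for x y
    proof
      assume "(x, y) \<in> conn {{u, v}}"
      then show "x = y \<or> {x, y} = {u, v}"
        by (induction rule: conn_induct) (auto simp: doubleton_eq_iff)
    qed (auto intro: conn_edge)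
    have fib: "fibres V {{u, v}} h"
      unfolding fibres_def Kc
    proof (intro ballI)
      fix x y show "(h x = h y) = (x = y \<or> {x, y} = {u, v})"
        using uv(4) by (cases "x = v"; cases "y = v") (auto simp: h_def doubleton_eq_iff)
    qed
    have hV: "h ` V = V - {v}" using uv by (auto simp: h_def)
    have T: "is_tree (h ` V, (`) h ` (E - {{u, v}}))"
      using contraction_tree[OF less(3) _ fib] uv by blast
    have c: "card (h ` V) < card V"
      unfolding hV using less(2) uv by (intro card_Diff1_less) auto
    have "Suc (card ((`) h ` (E - {{u, v}}))) = card (h ` V)"
      using less(1)[OF c _ T] less(2,4) by blast
    moreover have "card ((`) h ` (E - {{u, v}})) = card (E - {{u, v}})"
      using contraction_inj[OF less(3) _ fib] uv by (intro card_image) blast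
    moreover have "card (E - {{u, v}}) = card E - 1" "card E > 0"
      using uv fE card_gt_0_iff by auto
    moreover have "card (h ` V) = card V - 1" using hV uv less(2) by simp
    moreover have "card V > 0" using less(2,4) by (simp add: card_gt_0_iff)
    ultimately show ?thesis by linarith
  qed
qed

section \<open>The poset of multilabeled trees\<close>

text \<open>Parametrised by the surviving edges rather than the contracted ones, so that
  \<open>mlt_le\<close> corresponds to inclusion and not to its reverse.\<close>

definition quotient_tree :: "'a set \<Rightarrow> 'a set set \<Rightarrow> 'a set set \<Rightarrow> 'a set tree" where
  "quotient_tree S E F = map_tree (component (E - F)) (S, F)"

section \<open>The quotients of a fixed labeled tree\<close>

lemma nodes_quotient_tree: "nodes (quotient_tree S E F) = component (E - F) ` S"
  and edges_quotient_tree: "edges (quotient_tree S E F) = (`) (component (E - F)) ` F"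
  by (simp_all add: quotient_tree_def map_tree_def)

lemma partition_on_components:
  assumes "K \<subseteq> Pow S"
  shows "partition_on S (component K ` S)"
proof (rule partition_onI)
  show "\<Union> (component K ` S) = S"
    using component_subset[OF assms] by auto
  show "disjnt p q" if pq: "p \<in> component K ` S" "q \<in> component K ` S" "p \<noteq> q" for p q
  proof -
    obtain x y where xy: "p = component K x" "q = component K y" using pq by blast
    have "component K z = p" if "z \<in> p" for z
      using that xy by (simp add: component_eq_iff_mem[symmetric])
    moreover have "component K z = q" if "z \<in> q" for z
      using that xy by (simp add: component_eq_iff_mem[symmetric])
    ultimately show ?thesis using \<open>p \<noteq> q\<close> by (auto simp: disjnt_def)
  qed
  show "{} \<notin> component K ` S" by auto
qed

lemma quotient_tree_MLT:
  assumes "is_tree (S, E)" "F \<subseteq> E"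
  shows "quotient_tree S E F \<in> MLT S"
proof -
  have "E - (E - F) = F" using assms(2) by blast
  then have "is_tree (quotient_tree S E F)"
    using contraction_tree[OF assms(1) _ fibres_component, of "E - F"]
    by (simp add: quotient_tree_def map_tree_def)
  moreover have "partition_on S (nodes (quotient_tree S E F))"
    unfolding nodes_quotient_tree
    using partition_on_components tree_edges_Pow[OF assms(1)] by blast
  ultimately show ?thesis by (simp add: MLT_def)
qed

lemma inj_on_component_edges:
  assumes "is_tree (S, E)" "F \<subseteq> E"
  shows "inj_on ((`) (component (E - F))) F"
proof -
  have "E - (E - F) = F" using assms(2) by blast
  then show ?thesis
    using contraction_inj[OF assms(1) _ fibres_component, of "E - F"] by simp
qed

lemma merged_block_eq: "merged_block F X = \<Union> (component F X)"
  by (simp add: merged_block_def component_def conn_def)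

text \<open>Contracting in two stages amounts to contracting at once. The second stage merges blocks
  of the first, so a union of components indexed by a component has to be flattened.\<close>

lemma contract_quotient_tree:
  assumes t: "is_tree (S, E)" and "G \<subseteq> E" "H \<subseteq> G"
  shows "contract_edges ((`) (component (E - G)) ` H) (quotient_tree S E G)
    = quotient_tree S E (G - H)"
proof -
  let ?c = "component (E - G)" and ?d = "component (E - (G - H))"
  have un: "H \<union> (E - G) = E - (G - H)" using assms by blast
  have P: "E - G \<subseteq> pairs S" "H \<subseteq> pairs S" using tree_pairs[OF t] assms by blast+
  have mb: "merged_block ((`) ?c ` H) (?c x) = ?d x" if x: "x \<in> S" for x
  proof -
    have "merged_block ((`) ?c ` H) (?c x) = \<Union> (?c ` ?d x)"
      unfolding merged_block_eq
      using component_image[OF fibres_component P x] un by simp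
    also have "\<dots> = ?d x"
    proof
      show "\<Union> (?c ` ?d x) \<subseteq> ?d x"
      proof
        fix z assume "z \<in> \<Union> (?c ` ?d x)"
        then obtain y where "(x, y) \<in> conn (E - (G - H))" "(y, z) \<in> conn (E - G)"
          by (auto simp: component_def)
        moreover from this have "(y, z) \<in> conn (E - (G - H))"
          by (elim conn_monoD) blast
        ultimately show "z \<in> ?d x" by (auto simp: component_def intro: conn_trans)
      qed
    qed auto
    finally show ?thesis .
  qed
  have im: "merged_block ((`) ?c ` H) ` ?c ` A = ?d ` A" if A: "A \<subseteq> S" for A
  proof -
    have "merged_block ((`) ?c ` H) ` ?c ` A = (\<lambda>x. merged_block ((`) ?c ` H) (?c x)) ` A"
      by (simp add: image_image)
    also have "\<dots> = ?d ` A" using A by (intro image_cong) (auto simp: mb)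
    finally show ?thesis .
  qed
  have ed: "(`) ?c ` G - (`) ?c ` H = (`) ?c ` (G - H)"
    by (rule inj_on_image_set_diff[OF inj_on_component_edges[OF t assms(2)], symmetric])
      (use assms(3) in blast)+
  have "(`) (merged_block ((`) ?c ` H)) ` (`) ?c ` (G - H) = (`) ?d ` (G - H)"
    unfolding image_image
  proof (rule image_cong[OF refl])
    fix e assume e: "e \<in> G - H"
    show "(\<lambda>x. merged_block ((`) ?c ` H) (?c x)) ` e = ?d ` e"
      using im[unfolded image_image, of e] e assms(2) tree_edges_Pow[OF t] by blast
  qed
  then show ?thesis
    using im[of S] ed
    by (simp add: contract_edges_def map_tree_def quotient_tree_def)
qed

lemma quotient_tree_le:
  assumes t: "is_tree (S, E)" and G: "G \<subseteq> E"
  shows "mlt_le s (quotient_tree S E G) \<longleftrightarrow> (\<exists>F\<subseteq>G. s = quotient_tree S E F)"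
proof
  assume "mlt_le s (quotient_tree S E G)"
  then obtain H' where H': "H' \<subseteq> (`) (component (E - G)) ` G"
    "s = contract_edges H' (quotient_tree S E G)"
    by (auto simp: mlt_le_def edges_quotient_tree)
  then obtain H where H: "H \<subseteq> G" "H' = (`) (component (E - G)) ` H"
    by (meson subset_imageE)
  then have "s = quotient_tree S E (G - H)"
    using contract_quotient_tree[OF t G H(1)] H' by simp
  then show "\<exists>F\<subseteq>G. s = quotient_tree S E F" by blast
next
  assume "\<exists>F\<subseteq>G. s = quotient_tree S E F"
  then obtain F where F: "F \<subseteq> G" "s = quotient_tree S E F" by blast
  have "G - (G - F) = F" using F by blast
  then have "s = contract_edges ((`) (component (E - G)) ` (G - F)) (quotient_tree S E G)"
    using contract_quotient_tree[OF t G, of "G - F"] F by simp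
  then show "mlt_le s (quotient_tree S E G)"
    unfolding mlt_le_def edges_quotient_tree
    by (intro exI[of _ "(`) (component (E - G)) ` (G - F)"]) auto
qed

text \<open>The partition into blocks already determines \<open>F\<close>: in a tree, an edge is
  contracted exactly when its ends lie in one block.\<close>

lemma quotient_tree_inj:
  assumes t: "is_tree (S, E)" and "F \<subseteq> E" "G \<subseteq> E"
    and eq: "quotient_tree S E F = quotient_tree S E G"
  shows "F = G"
proof -
  have *: "F' \<subseteq> G'" if F': "F' \<subseteq> E" and G': "G' \<subseteq> E"
    and n: "component (E - F') ` S = component (E - G') ` S" for F' G'
  proof (rule subsetI, rule ccontr)
    fix e assume e: "e \<in> F'" "e \<notin> G'"
    have "e \<in> E" using e(1) F' by blast
    then obtain u v where uv: "e = {u, v}" "u \<in> S" "v \<in> S" by (rule tree_edgeE[OF t])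
    have "component (E - G') u \<in> component (E - F') ` S" using n uv by blast
    then obtain w where w: "component (E - G') u = component (E - F') w" by blast
    have "v \<in> component (E - G') u"
      using e uv F' by (auto simp: component_def intro: conn_edge)
    then have "v \<in> component (E - F') w" using w by simp
    then have "(w, v) \<in> conn (E - F')" by (simp add: component_def)
    moreover have "(w, u) \<in> conn (E - F')"
      using w component_self[of u "E - G'"] by (simp add: component_def)
    ultimately have "(u, v) \<in> conn (E - F')" using conn_sym conn_trans by metis
    moreover have "{u, v} \<in> E" using uv e F' by blast
    ultimately have "{u, v} \<in> E - F'" using tree_edge_of_conn[OF t, of "E - F'" u v] by blast
    then show False using e uv by blast
  qed
  have "component (E - F) ` S = component (E - G) ` S"
    using eq by (metis nodes_quotient_tree)
  then show ?thesis using *[OF assms(2,3)] *[OF assms(3,2)] by blast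
qed

lemma quotient_tree_le_iff:
  assumes t: "is_tree (S, E)" and "F \<subseteq> E" "G \<subseteq> E"
  shows "mlt_le (quotient_tree S E F) (quotient_tree S E G) \<longleftrightarrow> F \<subseteq> G"
proof
  assume "mlt_le (quotient_tree S E F) (quotient_tree S E G)"
  then obtain F' where F': "F' \<subseteq> G" "quotient_tree S E F = quotient_tree S E F'"
    unfolding quotient_tree_le[OF t assms(3)] by blast
  then have "F = F'" using quotient_tree_inj[OF t assms(2) order_trans[OF F'(1) assms(3)]] by simp
  then show "F \<subseteq> G" using F'(1) by simp
qed (use quotient_tree_le[OF t assms(3)] in blast)

text \<open>
  Every multilabeled tree is a quotient of a labeled tree: attach the elements of each block as
  leaves to a chosen representative of the block.
\<close>

lemma MLT_cases:
  assumes t: "t \<in> MLT S"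
  obtains E F where "is_tree (S, E)" "F \<subseteq> E" "t = quotient_tree S E F"
proof -
  obtain N D where ND: "t = (N, D)" by (cases t)
  have tree: "is_tree (N, D)" and part: "partition_on S N" using t ND by (auto simp: MLT_def)
  define r where "r X = (SOME x. x \<in> X)" for X :: "'a set"
  define b where "b x = (THE X. X \<in> N \<and> x \<in> X)" for x
  have ex1: "\<exists>!X. X \<in> N \<and> x \<in> X" if "x \<in> S" for x
    using that part by (auto simp: partition_on_def disjoint_def)
  have bN: "b x \<in> N" "x \<in> b x" if "x \<in> S" for x
    using theI'[OF ex1[OF that]] by (auto simp: b_def)
  have b_eq: "b x = X" if "X \<in> N" "x \<in> X" for x X
  proof -
    have "x \<in> S" using that part by (auto simp: partition_on_def)
    then show ?thesis using ex1 bN that by metis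
  qed
  have rX: "r X \<in> X" if "X \<in> N" for X
    using that part unfolding r_def by (metis partition_onD3 some_in_eq)
  have NS: "X \<subseteq> S" if "X \<in> N" for X using that part by (auto simp: partition_on_def)
  have br: "b (r X) = X" if "X \<in> N" for X using b_eq rX that by blast
  \<comment> \<open>\<open>K\<close> consists of a star inside each block, centred at the
    representative. \<open>F\<close> copies the edges of \<open>t\<close> to the centres, so that
    contracting \<open>K\<close> gives back \<open>t\<close>.\<close>
  define K where "K = {{r X, x} |X x. X \<in> N \<and> x \<in> X \<and> x \<noteq> r X}"
  define F where "F = (`) r ` D"
  have KP: "K \<subseteq> pairs S"
  proof
    fix e assume "e \<in> K"
    then obtain X x where "e = {r X, x}" "X \<in> N" "x \<in> X" "x \<noteq> r X" by (auto simp: K_def)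
    then show "e \<in> pairs S" using rX[of X] NS[of X] unfolding pairs_def by blast
  qed
  have rN: "b ` r ` e = e" if "e \<subseteq> N" for e
    using that br by (force simp: image_image)
  have DN: "e \<subseteq> N" if "e \<in> D" for e using tree_edges_Pow[OF tree] that by blast
  have FP: "F \<subseteq> pairs S"
  proof
    fix e assume "e \<in> F"
    then obtain d where d: "d \<in> D" "e = r ` d" by (auto simp: F_def)
    obtain X Y where XY: "d = {X, Y}" "X \<in> N" "Y \<in> N" "X \<noteq> Y"
      by (rule tree_edgeE[OF tree d(1)])
    have "r X \<noteq> r Y" using XY br by metis
    then show "e \<in> pairs S" using d XY rX NS unfolding pairs_def by blast
  qed
  have Kb: "b x = b y" if "(x, y) \<in> conn K" for x y
    using that
  proof (induction rule: conn_induct)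
    case (step y z)
    then obtain X w where "{y, z} = {r X, w}" "X \<in> N" "w \<in> X" by (auto simp: K_def)
    then have "b y = X" "b z = X" using b_eq rX by (auto simp: doubleton_eq_iff)
    then show ?case using step by simp
  qed simp
  have toK: "(r X, x) \<in> conn K" if "X \<in> N" "x \<in> X" for X x
    using that by (cases "x = r X") (auto simp: K_def intro!: conn_edge)
  have fib: "fibres S K b"
    unfolding fibres_def
  proof (intro ballI iffI)
    fix x y assume S: "x \<in> S" "y \<in> S" and "b x = b y"
    then show "(x, y) \<in> conn K"
      using toK[OF bN[OF S(1)]] toK[OF bN[OF S(2)]] conn_sym conn_trans by metis
  qed (rule Kb)
  have bF: "(`) b ` F = D"
    unfolding F_def using rN DN by (force simp: image_image)
  have bF': "(`) b ` (F - {r ` d}) = D - {d}" if d: "d \<in> D" for d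
  proof -
    have "r ` d' \<noteq> r ` d" if "d' \<in> D" "d' \<noteq> d" for d'
      using that rN[OF DN] d by metis
    then have "F - {r ` d} = (`) r ` (D - {d})"
      unfolding F_def by blast
    moreover have "(`) b ` (`) r ` (D - {d}) = D - {d}"
      using rN DN by (force simp: image_image)
    ultimately show ?thesis by simp
  qed
  have bS: "b ` S = N"
  proof
    show "N \<subseteq> b ` S" using br rX NS by (metis image_eqI subsetD subsetI)
  qed (use bN in blast)
  have FKdisj: "F \<inter> K = {}"
  proof -
    have False if "e \<in> F" "e \<in> K" for e
    proof -
      obtain d where d: "d \<in> D" "e = r ` d" using \<open>e \<in> F\<close> by (auto simp: F_def)
      obtain X Y where XY: "d = {X, Y}" "X \<in> N" "Y \<in> N" "X \<noteq> Y"
        by (rule tree_edgeE[OF tree d(1)])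
      have "(r X, r Y) \<in> conn K" using \<open>e \<in> K\<close> d XY by (intro conn_edge) simp
      then show False using Kb br XY by metis
    qed
    then show ?thesis by blast
  qed
  have conn: "(x, y) \<in> conn (F \<union> K)" if "x \<in> S" "y \<in> S" for x y
    using conn_image_iff[OF fib KP FP that] tree_connected[OF tree, of "b x" "b y"] bN that bF
    by simp
  have bridge: "(x, y) \<notin> conn (F \<union> K - {{x, y}})" if e: "{x, y} \<in> F \<union> K" for x y
  proof
    assume c: "(x, y) \<in> conn (F \<union> K - {{x, y}})"
    have xyS: "x \<in> S" "y \<in> S" "x \<noteq> y"
      using e KP FP by (auto simp: pairs_def doubleton_eq_iff)
    show False
    proof (cases "{x, y} \<in> F")
      case True
      \<comment> \<open>An edge of \<open>F\<close> is a bridge because its image under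
        \<open>b\<close> is a bridge of the given tree.\<close>
      then obtain d where d: "d \<in> D" "{x, y} = r ` d" by (auto simp: F_def)
      have bd: "{b x, b y} = d" using rN[OF DN[OF d(1)]] d(2) by (metis image_insert image_empty)
      have "(x, y) \<in> conn ((F - {r ` d}) \<union> K)"
        using c by (rule conn_monoD) (use d in blast)
      then have "(b x, b y) \<in> conn (D - {d})"
        using conn_image_iff[OF fib KP _ xyS(1,2), of "F - {r ` d}"] FP bF'[OF d(1)] by auto
      then show False using tree_edge_of_conn[OF tree, of "D - {d}" "b x" "b y"] bd d(1) by blast
    next
      case False
      then obtain X w where w: "{x, y} = {r X, w}" "X \<in> N" "w \<in> X" "w \<noteq> r X"
        using e by (auto simp: K_def)
      \<comment> \<open>A star edge is a bridge because its outer end \<open>w\<close> is a leaf: no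
        other edge contains it.\<close>
      have iso: "e' = {r X, w}" if e': "e' \<in> F \<union> K" "w \<in> e'" for e'
      proof -
        have "e' \<notin> F"
        proof
          assume "e' \<in> F"
          then obtain d where "d \<in> D" "e' = r ` d" by (auto simp: F_def)
          then obtain Y where "Y \<in> N" "w = r Y" using e' DN by blast
          then show False using b_eq[OF w(2,3)] br w(4) by metis
        qed
        then obtain Y z where z: "e' = {r Y, z}" "Y \<in> N" "z \<in> Y" "z \<noteq> r Y"
          using e' by (auto simp: K_def)
        have "w \<in> Y" using z e' rX by blast
        then have "Y = X" using b_eq w z by metis
        then show ?thesis using z e' w by blast
      qed
      have stay: "z = w" if "(w, z) \<in> conn (F \<union> K - {{x, y}})" for z
        using that
      proof (induction rule: conn_induct)
        case (step p q)
        then have "{p, q} = {r X, w}" using iso[of "{p, q}"] by blast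
        then show ?case using step(2) w(1) by blast
      qed simp
      have "(w, r X) \<in> conn (F \<union> K - {{x, y}})"
        using c w(1) conn_sym by (metis doubleton_eq_iff)
      then show False using stay w(4) by metis
    qed
  qed
  have "is_tree (S, F \<union> K)"
    using KP FP conn bridge by (simp add: is_tree_iff)
  moreover have "t = quotient_tree S (F \<union> K) F"
  proof -
    have FK: "F \<union> K - F = K" using FKdisj by blast
    have cb: "component K x = b x" if "x \<in> S" for x
    proof (intro Set.set_eqI iffI)
      fix y assume "y \<in> component K x"
      then have xy: "(x, y) \<in> conn K" by (simp add: component_def)
      then have "y \<in> S" using conn_closed that KP pairs_Pow by (metis order_trans)
      then show "y \<in> b x" using bN Kb[OF xy] by simp
    next
      fix y assume "y \<in> b x"
      then show "y \<in> component K x"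
        using toK[OF bN(1)[OF that]] bN(2)[OF that] conn_sym conn_trans
        by (metis component_def mem_Collect_eq)
    qed
    have "component K ` S = N" using cb bS by (metis image_cong)
    moreover have "(`) (component K) ` F = (`) b ` F"
    proof (rule image_cong[OF refl])
      fix e assume "e \<in> F"
      then have "e \<subseteq> S" using FP pairs_Pow by blast
      then show "component K ` e = b ` e" using cb by (intro image_cong) auto
    qed
    ultimately show ?thesis
      using bF ND by (simp add: quotient_tree_def map_tree_def FK)
  qed
  ultimately show thesis using that by blast
qed

section \<open>Full chains of multilabeled trees as full chains of Boolean lattices\<close>

lemma full_chains_Pow:
  "Fs \<in> full_chains (Pow E) (\<subseteq>) n \<longleftrightarrow>
     length Fs = Suc n \<and> set Fs \<subseteq> Pow E \<and> sorted_wrt (\<subset>) Fs \<and> hd Fs = {} \<and> last Fs = E"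
proof -
  have lt: "(\<lambda>x y. x \<subseteq> y \<and> x \<noteq> y) = ((\<subset>) :: 'a set \<Rightarrow> 'a set \<Rightarrow> bool)" by auto
  have *: "hd Fs \<subseteq> E" "last Fs \<subseteq> E" if "length Fs = Suc n" "set Fs \<subseteq> Pow E"
  proof -
    have "Fs \<noteq> []" using that by auto
    then have "hd Fs \<in> set Fs" "last Fs \<in> set Fs" by simp_all
    then show "hd Fs \<subseteq> E" "last Fs \<subseteq> E" using that(2) by auto
  qed
  have m: "(\<forall>y\<in>Pow E. y \<subseteq> hd Fs \<longrightarrow> y = hd Fs) \<longleftrightarrow> hd Fs = {}"
  proof
    assume a: "\<forall>y\<in>Pow E. y \<subseteq> hd Fs \<longrightarrow> y = hd Fs"
    show "hd Fs = {}" using bspec[OF a, of "{}"] by simp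
  qed simp
  have m': "(\<forall>y\<in>Pow E. last Fs \<subseteq> y \<longrightarrow> y = last Fs) \<longleftrightarrow> last Fs = E" if l: "last Fs \<subseteq> E"
  proof
    assume a: "\<forall>y\<in>Pow E. last Fs \<subseteq> y \<longrightarrow> y = last Fs"
    show "last Fs = E" using bspec[OF a, of E] l by simp
  qed auto
  show ?thesis
  proof (cases "length Fs = Suc n \<and> set Fs \<subseteq> Pow E")
    case True
    then show ?thesis using * m m' by (simp add: full_chains_def lt)
  next
    case False
    then show ?thesis by (auto simp: full_chains_def)
  qed
qed

text \<open>All blocks here are singletons, and contracting any edge would create a block with two
  elements; so nothing was contracted on the way down from \<open>y\<close>.\<close>

lemma quotient_tree_maximal:
  assumes t: "is_tree (S, E)" and y: "y \<in> MLT S" and le: "mlt_le (quotient_tree S E E) y"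
  shows "y = quotient_tree S E E"
proof -
  obtain E' G where E': "is_tree (S, E')" "G \<subseteq> E'" "y = quotient_tree S E' G"
    using y by (rule MLT_cases)
  obtain F where F: "F \<subseteq> G" "quotient_tree S E E = quotient_tree S E' F"
    using le[unfolded E'(3) quotient_tree_le[OF E'(1,2)]] by blast
  have n: "component (E' - F) ` S = (\<lambda>x. {x}) ` S"
    using F(2) nodes_quotient_tree[of S E E] nodes_quotient_tree[of S E' F] by simp
  have "E' - F = {}"
  proof (rule ccontr)
    assume "E' - F \<noteq> {}"
    then obtain e where e: "e \<in> E' - F" by blast
    then have eE: "e \<in> E'" by blast
    obtain u v where uv: "e = {u, v}" "u \<in> S" "v \<in> S" "u \<noteq> v"
      by (rule tree_edgeE[OF E'(1) eE])
    have "component (E' - F) u \<in> (\<lambda>x. {x}) ` S" unfolding n[symmetric] using uv(2) by (rule imageI)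
    then obtain w where w: "component (E' - F) u = {w}" by (elim imageE)
    have "v \<in> {w}"
      unfolding w[symmetric] using e uv(1) by (simp add: component_def conn_edge)
    moreover have "u \<in> {w}" unfolding w[symmetric] by (rule component_self)
    ultimately show False using uv(4) by simp
  qed
  then have "G = F" using F(1) E'(2) by blast
  then show ?thesis using E'(3) F(2) by simp
qed

lemma sorted_wrt_quotient_tree:
  assumes "is_tree (S, E)" "set Fs \<subseteq> Pow E"
  shows "sorted_wrt (\<lambda>x y. mlt_le x y \<and> x \<noteq> y) (map (quotient_tree S E) Fs) \<longleftrightarrow> sorted_wrt (\<subset>) Fs"
proof -
  have *: "mlt_le (quotient_tree S E F) (quotient_tree S E G)
      \<and> quotient_tree S E F \<noteq> quotient_tree S E G \<longleftrightarrow> F \<subset> G"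
    if "F \<in> set Fs" "G \<in> set Fs" for F G
  proof -
    have "F \<subseteq> E" "G \<subseteq> E" using that assms(2) by auto
    then show ?thesis
      using quotient_tree_le_iff[OF assms(1)] quotient_tree_inj[OF assms(1)] by blast
  qed
  show ?thesis
    unfolding sorted_wrt_map
  proof
    assume "sorted_wrt (\<lambda>x y. mlt_le (quotient_tree S E x) (quotient_tree S E y)
       \<and> quotient_tree S E x \<noteq> quotient_tree S E y) Fs"
    then show "sorted_wrt (\<subset>) Fs"
      by (rule sorted_wrt_mono_rel[rotated]) (use * in blast)
  next
    assume "sorted_wrt (\<subset>) Fs"
    then show "sorted_wrt (\<lambda>x y. mlt_le (quotient_tree S E x) (quotient_tree S E y)
       \<and> quotient_tree S E x \<noteq> quotient_tree S E y) Fs"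
      by (rule sorted_wrt_mono_rel[rotated]) (use * in blast)
  qed
qed

lemma full_chains_MLT_I:
  assumes t: "is_tree (S, E)" and Fs: "Fs \<in> full_chains (Pow E) (\<subseteq>) n"
  shows "map (quotient_tree S E) Fs \<in> full_chains (MLT S) mlt_le n"
proof -
  have F: "length Fs = Suc n" "set Fs \<subseteq> Pow E" "sorted_wrt (\<subset>) Fs" "hd Fs = {}" "last Fs = E"
    using Fs by (auto simp: full_chains_Pow)
  then have ne: "Fs \<noteq> []" by auto
  have "hd (map (quotient_tree S E) Fs) = quotient_tree S E {}"
    "last (map (quotient_tree S E) Fs) = quotient_tree S E E"
    using F ne by (simp_all add: hd_map last_map)
  moreover have "y = quotient_tree S E {}" if "mlt_le y (quotient_tree S E {})" for y
    using that quotient_tree_le[OF t, of "{}" y] by auto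
  moreover have "set (map (quotient_tree S E) Fs) \<subseteq> MLT S"
    using F(2) quotient_tree_MLT[OF t] by auto
  ultimately show ?thesis
    using F(1,3) quotient_tree_maximal[OF t] sorted_wrt_quotient_tree[OF t F(2)]
    unfolding full_chains_def by simp
qed

lemma sorted_wrt_last: "sorted_wrt R xs \<Longrightarrow> x \<in> set xs \<Longrightarrow> x \<noteq> last xs \<Longrightarrow> R x (last xs)"
  by (induction xs rule: rev_induct) (auto simp: sorted_wrt_append)

text \<open>The last tree of the chain is some quotient of a labeled tree \<open>(S, E)\<close>;
  maximality forces it to be the uncontracted one, and everything below it is then a quotient of
  \<open>(S, E)\<close>.\<close>

lemma full_chains_MLT_E:
  assumes z: "z \<in> full_chains (MLT S) mlt_le n"
  obtains E Fs where "is_tree (S, E)" "Fs \<in> full_chains (Pow E) (\<subseteq>) n"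
    "z = map (quotient_tree S E) Fs"
proof -
  have Z: "length z = Suc n" "set z \<subseteq> MLT S" "sorted_wrt (\<lambda>x y. mlt_le x y \<and> x \<noteq> y) z"
    "\<And>y. y \<in> MLT S \<Longrightarrow> mlt_le y (hd z) \<Longrightarrow> y = hd z"
    "\<And>y. y \<in> MLT S \<Longrightarrow> mlt_le (last z) y \<Longrightarrow> y = last z"
    using z by (auto simp: full_chains_def)
  then have ne: "z \<noteq> []" by auto
  have "last z \<in> MLT S" using Z(2) ne by auto
  then obtain E G where E: "is_tree (S, E)" "G \<subseteq> E" "last z = quotient_tree S E G"
    by (rule MLT_cases)
  have "quotient_tree S E E = last z"
    using Z(5)[OF quotient_tree_MLT[OF E(1)]] quotient_tree_le_iff[OF E(1,2), of E] E by auto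
  then have l: "last z = quotient_tree S E E" by simp
  have below: "x \<in> quotient_tree S E ` Pow E" if x: "x \<in> set z" for x
  proof -
    have "mlt_le x (last z)"
    proof (cases "x = last z")
      case True
      then show ?thesis using l quotient_tree_le_iff[OF E(1), of E E] by simp
    next
      case False
      show ?thesis using sorted_wrt_last[OF Z(3) x False] by blast
    qed
    then have "\<exists>F\<subseteq>E. x = quotient_tree S E F" using quotient_tree_le[OF E(1), of E x] l by simp
    then show ?thesis by blast
  qed
  define Fs where "Fs = map (inv_into (Pow E) (quotient_tree S E)) z"
  have zFs: "z = map (quotient_tree S E) Fs"
    unfolding Fs_def map_map using below
    by (intro map_idI[symmetric]) (simp add: f_inv_into_f)
  have Fs: "set Fs \<subseteq> Pow E"
  proof
    fix F assume "F \<in> set Fs"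
    then obtain x where "x \<in> set z" "F = inv_into (Pow E) (quotient_tree S E) x"
      unfolding Fs_def by auto
    then show "F \<in> Pow E" using inv_into_into[OF below] by blast
  qed
  have neF: "Fs \<noteq> []" using ne zFs by auto
  have "sorted_wrt (\<subset>) Fs"
    using sorted_wrt_quotient_tree[OF E(1) Fs] zFs Z(3) by simp
  moreover have "last Fs = E"
  proof -
    have le: "last Fs \<subseteq> E" using Fs last_in_set[OF neF] by blast
    have "quotient_tree S E (last Fs) = quotient_tree S E E"
      using l last_map[OF neF, of "quotient_tree S E"] zFs by metis
    then show ?thesis using quotient_tree_inj[OF E(1) le, of E] by blast
  qed
  moreover have "hd Fs = {}"
  proof -
    have h: "hd Fs \<subseteq> E" using Fs list.set_sel(1)[OF neF] by blast
    have hz: "hd z = quotient_tree S E (hd Fs)"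
      using hd_map[OF neF, of "quotient_tree S E"] zFs by metis
    have "mlt_le (quotient_tree S E {}) (hd z)"
      unfolding hz using quotient_tree_le_iff[OF E(1) _ h, of "{}"] by simp
    then have "quotient_tree S E {} = quotient_tree S E (hd Fs)"
      using Z(4)[OF quotient_tree_MLT[OF E(1) empty_subsetI]] hz by simp
    then show ?thesis using quotient_tree_inj[OF E(1) empty_subsetI h] by blast
  qed
  moreover have "length Fs = Suc n" using zFs Z(1) by (metis length_map)
  ultimately have "Fs \<in> full_chains (Pow E) (\<subseteq>) n"
    using Fs by (simp add: full_chains_Pow)
  then show thesis using that E(1) zFs by blast
qed

lemma quotient_tree_top_inj:
  assumes t: "is_tree (S, E)" and eq: "quotient_tree S E E = quotient_tree S E' E'"
  shows "E = E'"
proof -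
  have "(`) (\<lambda>x. {x}) ` E = (`) (\<lambda>x. {x}) ` E'"
    using eq edges_quotient_tree[of S E E] edges_quotient_tree[of S E' E']
    by (simp add: image_def)
  then have "(`) the_elem ` (`) (\<lambda>x. {x}) ` E = (`) the_elem ` (`) (\<lambda>x. {x}) ` E'" by simp
  then show ?thesis by (simp add: image_image)
qed

text \<open>The top of the chain recovers \<open>E\<close>, after which
  \<open>quotient_tree_inj\<close> applies entry by entry. With the two preceding descriptions of
  full chains this gives the splitting of the complex over labeled trees.\<close>

lemma chain_MLT_inj:
  assumes t: "is_tree (S, E)" and t': "is_tree (S, E')"
    and Fs: "Fs \<in> full_chains (Pow E) (\<subseteq>) n" and Fs': "Fs' \<in> full_chains (Pow E') (\<subseteq>) n"
    and eq: "map (quotient_tree S E) Fs = map (quotient_tree S E') Fs'"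
  shows "E = E' \<and> Fs = Fs'"
proof -
  have F: "Fs \<noteq> []" "last Fs = E" "set Fs \<subseteq> Pow E" "Fs' \<noteq> []" "last Fs' = E'" "set Fs' \<subseteq> Pow E'"
    using Fs Fs' by (auto simp: full_chains_Pow)
  have E: "E = E'"
    using arg_cong[OF eq, of last] F quotient_tree_top_inj[OF t] by (simp add: last_map)
  moreover have "Fs = Fs'"
  proof (rule map_inj_on[OF eq[folded E]])
    show "inj_on (quotient_tree S E) (set Fs \<union> set Fs')"
    proof (rule inj_onI)
      fix F G assume FG: "F \<in> set Fs \<union> set Fs'" "G \<in> set Fs \<union> set Fs'"
        and q: "quotient_tree S E F = quotient_tree S E G"
      have "F \<subseteq> E" "G \<subseteq> E" using FG F E by auto
      then show "F = G" using quotient_tree_inj[OF t _ _ q] by blast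
    qed
  qed
  ultimately show ?thesis ..
qed

subsection \<open>Functoriality\<close>

text \<open>Serves two purposes: with \<open>K\<close> empty it describes relabelling, and with
  \<open>K\<close> spanning a block \<open>B\<close> it describes the map \<phi>.\<close>

lemma quotient_tree_contraction:
  assumes t: "is_tree (S, E)" and K: "K \<subseteq> E" and fib: "fibres S K h" and F: "F \<subseteq> E - K"
  shows "map_tree ((`) h) (quotient_tree S E F)
    = quotient_tree (h ` S) ((`) h ` (E - K)) ((`) h ` F)"
proof -
  have inj: "inj_on ((`) h) (E - K)" by (rule contraction_inj[OF t K fib])
  have d: "(`) h ` (E - K) - (`) h ` F = (`) h ` (E - K - F)"
    by (rule inj_on_image_set_diff[OF inj, symmetric]) (use F in blast)+
  have un: "E - K - F \<union> K = E - F" using K F by blast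
  have P: "K \<subseteq> pairs S" "E - K - F \<subseteq> pairs S" using K tree_pairs[OF t] by blast+
  have c: "h ` component (E - F) x = component ((`) h ` (E - K - F)) (h x)" if "x \<in> S" for x
    using component_image[OF fib P that] un by simp
  have im: "(`) h ` component (E - F) ` A = component ((`) h ` (E - K - F)) ` h ` A"
    if A: "A \<subseteq> S" for A
    unfolding image_image using A c by (intro image_cong) auto
  have "(`) ((`) h) ` (`) (component (E - F)) ` F
      = (`) (component ((`) h ` (E - K - F))) ` (`) h ` F"
    unfolding image_image
  proof (rule image_cong[OF refl])
    fix e assume "e \<in> F"
    then have "e \<subseteq> S" using F tree_edges_Pow[OF t] by blast
    then show "(\<lambda>x. h ` component (E - F) x) ` e
        = (\<lambda>x. component ((\<lambda>x. h ` x) ` (E - K - F)) (h x)) ` e"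
      using im[of e] by (simp add: image_image)
  qed
  then show ?thesis
    using im[of S] by (simp add: quotient_tree_def map_tree_def d)
qed

text \<open>Contracting such a \<open>D\<close> turns \<open>B\<close> into one vertex and merges
  nothing else. Inside a tree, acyclicity is inherited, see \<open>subtree\<close>.\<close>

definition spans :: "'a set set \<Rightarrow> 'a set \<Rightarrow> bool" where
  "spans D B \<longleftrightarrow> D \<subseteq> Pow B \<and> (\<forall>u\<in>B. \<forall>v\<in>B. (u, v) \<in> conn D)"

definition merge :: "'a \<Rightarrow> 'a set \<Rightarrow> 'a \<Rightarrow> 'a" where
  "merge a B x = (if x \<in> B then a else x)"

lemma merge_image: "B \<noteq> {} \<Longrightarrow> A \<inter> B = {} \<Longrightarrow> merge a B ` (A \<union> B) = insert a A"
  by (auto simp: merge_def)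

lemma merge_fibres:
  assumes "spans D B" "a \<notin> A" "A \<inter> B = {}"
  shows "fibres (A \<union> B) D (merge a B)"
  unfolding fibres_def
proof (intro ballI)
  fix u v assume uv: "u \<in> A \<union> B" "v \<in> A \<union> B"
  have D: "D \<subseteq> Pow B" using assms(1) by (simp add: spans_def)
  consider "u \<in> B" "v \<in> B" | "u \<in> B" "v \<notin> B" | "u \<notin> B" by blast
  then show "merge a B u = merge a B v \<longleftrightarrow> (u, v) \<in> conn D"
  proof cases
    case 1
    then show ?thesis using assms(1) by (simp add: merge_def spans_def)
  next
    case 2
    then show ?thesis using uv assms(2) conn_closed[OF _ D] by (auto simp: merge_def)
  next
    case 3
    then show ?thesis using uv assms(2) conn_outside[OF _ D] by (auto simp: merge_def)
  qed
qed

text \<open>Translates the index set of the composition into a condition on contracted edges, which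
  is the form in which it also occurs for graftings of trees.\<close>

lemma quotient_tree_over_partition:
  assumes t: "is_tree (A \<union> B, E)" and G: "G \<subseteq> E" and AB: "A \<inter> B = {}" "B \<noteq> {}"
  shows "quotient_tree (A \<union> B) E G \<in> mlt_over_partition A B \<longleftrightarrow> spans (E - G) B"
proof -
  let ?D = "E - G"
  have "component ?D ` (A \<union> B) = insert B ((\<lambda>a. {a}) ` A) \<longleftrightarrow> spans ?D B"
  proof
    assume n: "component ?D ` (A \<union> B) = insert B ((\<lambda>a. {a}) ` A)"
    have cases: "component ?D x = B \<or> component ?D x = {x}" if x: "x \<in> A \<union> B" for x
    proof -
      have "component ?D x \<in> insert B ((\<lambda>a. {a}) ` A)" unfolding n[symmetric] using x by (rule imageI)
      then consider "component ?D x = B" | y where "component ?D x = {y}" by (elim insertE imageE)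
      then show ?thesis
      proof cases
        case 2
        have "x \<in> {y}" unfolding 2[symmetric] by (rule component_self)
        then show ?thesis using 2 by simp
      qed simp
    qed
    have "e \<subseteq> B" if e: "e \<in> ?D" for e
    proof -
      have eE: "e \<in> E" using e by blast
      obtain u v where uv: "e = {u, v}" "u \<in> A \<union> B" "v \<in> A \<union> B" "u \<noteq> v"
        by (rule tree_edgeE[OF t eE])
      have v: "v \<in> component ?D u" using e uv(1) by (simp add: component_def conn_edge)
      then have "component ?D u \<noteq> {u}" using uv(4) by auto
      then have "component ?D u = B" using cases[OF uv(2)] by blast
      moreover have "u \<in> component ?D u" by (rule component_self)
      ultimately show ?thesis using v uv(1) by simp
    qed
    moreover have m: "component ?D u = B" if u: "u \<in> B" for u
    proof -
      have "B \<in> component ?D ` (A \<union> B)" unfolding n by (rule insertI1)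
      then obtain w where w: "w \<in> A \<union> B" "B = component ?D w" by (elim imageE)
      have "u \<in> component ?D w" using u w(2) by simp
      then show ?thesis using w(2) component_eq_iff_mem[of ?D w u] by simp
    qed
    moreover have "(u, v) \<in> conn ?D" if "u \<in> B" "v \<in> B" for u v
      using m[OF that(1)] that(2) by (auto simp: component_def)
    ultimately show "spans ?D B" unfolding spans_def by blast
  next
    assume s: "spans ?D B"
    then have D: "?D \<subseteq> Pow B" by (simp add: spans_def)
    have 1: "component ?D u = B" if "u \<in> B" for u
    proof
      show "component ?D u \<subseteq> B" by (rule component_subset[OF D that])
      show "B \<subseteq> component ?D u" using s that by (auto simp: spans_def component_def)
    qed
    have 2: "component ?D u = {u}" if "u \<in> A" for u
    proof -
      have "u \<notin> B" using that AB by blast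
      then show ?thesis using conn_outside[OF _ D] by (auto simp: component_def)
    qed
    have "component ?D ` B = {B}" using 1 AB(2) by auto
    moreover have "component ?D ` A = (\<lambda>a. {a}) ` A" using 2 by (intro image_cong) auto
    ultimately show "component ?D ` (A \<union> B) = insert B ((\<lambda>a. {a}) ` A)"
      by (simp add: image_Un)
  qed
  then show ?thesis
    using quotient_tree_MLT[OF t G] by (simp add: mlt_over_partition_def nodes_quotient_tree)
qed

lemma map_tree_cong:
  assumes "edges t \<subseteq> Pow (nodes t)" "\<And>x. x \<in> nodes t \<Longrightarrow> f x = g x"
  shows "map_tree f t = map_tree g t"
proof -
  have "f ` nodes t = g ` nodes t" using assms(2) by (rule image_cong[OF refl])
  moreover have "(`) f ` edges t = (`) g ` edges t"
  proof (rule image_cong[OF refl])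
    fix e assume "e \<in> edges t"
    then have "e \<subseteq> nodes t" using assms(1) by blast
    then show "f ` e = g ` e" using assms(2) by (intro image_cong) auto
  qed
  ultimately show ?thesis by (simp add: map_tree_def)
qed

lemma MLT_edges_Pow: "t \<in> MLT S \<Longrightarrow> edges t \<subseteq> Pow (nodes t)"
  using tree_edges_Pow[of "nodes t" "edges t"] by (simp add: MLT_def)

text \<open>\<open>phi_map\<close> edits whole blocks whereas \<open>merge\<close> acts on labels.
  They agree because \<open>B\<close> is connected by contracted edges, so that a block either
  contains \<open>B\<close> or misses it.\<close>

lemma phi_map_quotient_tree:
  assumes t: "is_tree (A \<union> B, E)" and AB: "A \<inter> B = {}" "B \<noteq> {}" "a \<notin> A"
    and D: "D \<subseteq> E" "spans D B" and F: "F \<subseteq> E - D"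
  shows "phi_map a B (quotient_tree (A \<union> B) E F)
    = quotient_tree (insert a A) ((`) (merge a B) ` (E - D)) ((`) (merge a B) ` F)"
proof -
  have FE: "F \<subseteq> E" using F by blast
  have "phi_map a B (quotient_tree (A \<union> B) E F)
    = map_tree ((`) (merge a B)) (quotient_tree (A \<union> B) E F)"
    unfolding phi_map_def
  proof (rule map_tree_cong)
    show "edges (quotient_tree (A \<union> B) E F) \<subseteq> Pow (nodes (quotient_tree (A \<union> B) E F))"
      using MLT_edges_Pow quotient_tree_MLT[OF t FE] by blast
    fix X assume "X \<in> nodes (quotient_tree (A \<union> B) E F)"
    then obtain x where X: "X = component (E - F) x" by (auto simp: nodes_quotient_tree)
    show "(if B \<subseteq> X then insert a (X - B) else X) = merge a B ` X"
    proof (cases "X \<inter> B = {}")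
      case True
      then have "\<not> B \<subseteq> X" using AB(2) by blast
      moreover have "merge a B ` X = id ` X"
        using True by (intro image_cong) (auto simp: merge_def)
      ultimately show ?thesis by simp
    next
      case False
      then obtain u where u: "u \<in> X" "u \<in> B" by blast
      have "v \<in> X" if "v \<in> B" for v
      proof -
        have "(u, v) \<in> conn D" using D(2) u that by (auto simp: spans_def)
        then have "(u, v) \<in> conn (E - F)" by (rule conn_monoD) (use D F in blast)
        moreover have "(x, u) \<in> conn (E - F)" using u X by (simp add: component_def)
        ultimately show ?thesis using X conn_trans by (simp add: component_def)
      qed
      then have "B \<subseteq> X" by blast
      then show ?thesis using AB(2) by (auto simp: merge_def)
    qed
  qed
  also have "\<dots> = quotient_tree (merge a B ` (A \<union> B)) ((`) (merge a B) ` (E - D)) ((`) (merge a B) ` F)"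
    by (rule quotient_tree_contraction[OF t D(1) merge_fibres[OF D(2) AB(3,1)] F])
  finally show ?thesis by (simp only: merge_image[OF AB(2,1)])
qed

lemma lifted_edgesI:
  "{X, Y} \<in> edges t' \<Longrightarrow> {U, V} \<in> edges t \<Longrightarrow> X \<subseteq> U \<Longrightarrow> Y \<subseteq> V \<Longrightarrow> {X, Y} \<in> lifted_edges t t'"
  unfolding lifted_edges_def by (intro CollectI conjI exI) (assumption | rule refl)+

lemma lifted_edgesE:
  assumes "e \<in> lifted_edges t t'"
  obtains U V X Y where "{U, V} \<in> edges t" "e = {X, Y}" "X \<subseteq> U" "Y \<subseteq> V"
  using assms unfolding lifted_edges_def by (elim CollectE exE conjE) (rule that)

text \<open>The lifted edges are exactly the images of the edges in \<open>G\<close>, so cutting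
  them leaves \<open>F - G\<close>, all of whose edges lie inside \<open>B\<close>.\<close>

lemma psi_map_quotient_tree:
  assumes t: "is_tree (S, E)" and BS: "B \<subseteq> S" and G: "spans (E - G) B" "G \<subseteq> F" "F \<subseteq> E"
  shows "psi_map (quotient_tree S E G) B (quotient_tree S E F) = quotient_tree B (E - G) (F - G)"
proof -
  let ?c = "component (E - F)" and ?d = "component (E - G)"
  have D: "E - G \<subseteq> Pow B" using G(1) by (simp add: spans_def)
  have cD: "E - F \<subseteq> Pow B" using D G(2) by blast
  have eq: "E - G - (F - G) = E - F" using G by blast
  have n: "{X \<in> ?c ` S. X \<subseteq> B} = ?c ` B"
  proof (intro equalityI subsetI)
    fix X assume "X \<in> {X \<in> ?c ` S. X \<subseteq> B}"
    then obtain x where "X = ?c x" "?c x \<subseteq> B" by blast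
    then show "X \<in> ?c ` B" using component_self[of x "E - F"] by blast
  next
    fix X assume "X \<in> ?c ` B"
    then obtain x where "X = ?c x" "x \<in> B" by (elim imageE)
    then show "X \<in> {X \<in> ?c ` S. X \<subseteq> B}" using component_subset[OF cD, of x] BS by simp blast
  qed
  have "{e \<in> (`) ?c ` F - lifted_edges (quotient_tree S E G) (quotient_tree S E F). \<forall>X\<in>e. X \<subseteq> B}
      = (`) ?c ` (F - G)"
  proof (intro Set.set_eqI iffI)
    fix e assume "e \<in> {e \<in> (`) ?c ` F - lifted_edges (quotient_tree S E G) (quotient_tree S E F). \<forall>X\<in>e. X \<subseteq> B}"
    then obtain f where f: "f \<in> F" "e = ?c ` f"
      "e \<notin> lifted_edges (quotient_tree S E G) (quotient_tree S E F)" by blast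
    have "f \<notin> G"
    proof
      assume fG: "f \<in> G"
      have fE: "f \<in> E" using f G by blast
      obtain u v where uv: "f = {u, v}" by (rule tree_edgeE[OF t fE])
      have cd: "?c x \<subseteq> ?d x" for x
        using conn_mono[of "E - F" "E - G"] G(2) unfolding component_def by blast
      have 1: "{?d u, ?d v} \<in> (`) ?d ` G" using imageI[OF fG, of "(`) ?d"] uv by simp
      have 2: "{?c u, ?c v} \<in> (`) ?c ` F" using imageI[OF f(1), of "(`) ?c"] uv by simp
      have "{?c u, ?c v} \<in> lifted_edges (quotient_tree S E G) (quotient_tree S E F)"
        by (rule lifted_edgesI[OF _ _ cd cd]) (use 1 2 in \<open>simp_all only: edges_quotient_tree\<close>)
      then have "e \<in> lifted_edges (quotient_tree S E G) (quotient_tree S E F)"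
        using f(2) uv by simp
      then show False using f by blast
    qed
    then show "e \<in> (`) ?c ` (F - G)" using f by blast
  next
    fix e assume "e \<in> (`) ?c ` (F - G)"
    then obtain f where f: "f \<in> F" "f \<notin> G" "e = ?c ` f" by blast
    have fE: "f \<in> E" using f G by blast
    obtain u v where uv: "f = {u, v}" by (rule tree_edgeE[OF t fE])
    have fD: "f \<in> E - G" using fE f by blast
    then have B: "u \<in> B" "v \<in> B" using D uv by auto
    have duv: "?d u = ?d v" using fD uv by (simp add: component_eq_iff conn_edge)
    \<comment> \<open>Both ends of \<open>f\<close> lie in one block of the coarser tree. A lifted
      \<open>f\<close> would force some edge of \<open>G\<close> to have both ends in that block,
      hence to be contracted.\<close>
    have "e \<notin> lifted_edges (quotient_tree S E G) (quotient_tree S E F)"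
    proof
      assume "e \<in> lifted_edges (quotient_tree S E G) (quotient_tree S E F)"
      then obtain U V X Y where l: "{U, V} \<in> (`) ?d ` G" "e = {X, Y}" "X \<subseteq> U" "Y \<subseteq> V"
        by (rule lifted_edgesE[of e "quotient_tree S E G", unfolded edges_quotient_tree])
      obtain g where g: "g \<in> G" "{U, V} = ?d ` g" using l(1) by (elim imageE)
      have gE: "g \<in> E" using g G by blast
      obtain p q where pq: "g = {p, q}" "p \<noteq> q" by (rule tree_edgeE[OF t gE])
      have "U \<in> ?d ` g" "V \<in> ?d ` g" unfolding g(2)[symmetric] by simp_all
      then have Ud: "U \<in> range ?d" "V \<in> range ?d" by (elim imageE, simp)+
      have "{X, Y} = {?c u, ?c v}" using l(2) f uv by simp
      then have "X = ?c u \<and> Y = ?c v \<or> X = ?c v \<and> Y = ?c u" by (simp only: doubleton_eq_iff)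
      then have "(u \<in> U \<and> v \<in> V) \<or> (v \<in> U \<and> u \<in> V)"
        using l(3,4) component_self[of u "E - F"] component_self[of v "E - F"] by blast
      moreover have "W = ?d x" if "x \<in> W" "W \<in> range ?d" for W x
        using that by (metis component_eq_iff_mem imageE)
      ultimately have "U = V" using Ud duv by metis
      then have "?d p = ?d q" using g(2) pq(1) by (simp add: doubleton_eq_iff)
      then have "(p, q) \<in> conn (E - G)" by (simp add: component_eq_iff)
      then have "{p, q} \<in> E - G" using tree_edge_of_conn[OF t, of "E - G" p q] gE pq by blast
      then show False using g pq by blast
    qed
    moreover have "\<forall>X\<in>e. X \<subseteq> B"
      unfolding f(3) uv using component_subset[OF cD B(1)] component_subset[OF cD B(2)] by simp
    moreover have "e \<in> (`) ?c ` F" unfolding f(3) using f(1) by (rule imageI)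
    ultimately show "e \<in> {e \<in> (`) ?c ` F - lifted_edges (quotient_tree S E G) (quotient_tree S E F). \<forall>X\<in>e. X \<subseteq> B}"
      by blast
  qed
  then show ?thesis
    unfolding psi_map_def nodes_quotient_tree edges_quotient_tree n
    by (simp add: quotient_tree_def map_tree_def eq)
qed

section \<open>Chains and coboundaries\<close>

lemma sgn_square: "(- 1 :: 'k::{comm_ring,comm_monoid_mult}) ^ i * (- 1) ^ i = 1"
proof -
  have "(- 1 :: 'k) * (- 1) = 1" by simp
  then show ?thesis by (simp only: power_mult_distrib[symmetric] power_one)
qed

definition delete_nth :: "nat \<Rightarrow> 'p list \<Rightarrow> 'p list" where
  "delete_nth i z = take i z @ drop (Suc i) z"

section \<open>Faces of chains and the square of the coboundary\<close>

lemma length_delete_nth: "i < length z \<Longrightarrow> length (delete_nth i z) = length z - 1"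
  by (simp add: delete_nth_def)

lemma nth_delete_nth:
  "i < length z \<Longrightarrow> k < length z - 1 \<Longrightarrow> delete_nth i z ! k = (if k < i then z ! k else z ! Suc k)"
  by (auto simp: delete_nth_def nth_append)

lemma set_delete_nth: "set (delete_nth i z) \<subseteq> set z"
  by (auto simp: delete_nth_def dest: in_set_takeD in_set_dropD)

lemma map_delete_nth: "map h (delete_nth i z) = delete_nth i (map h z)"
  by (simp add: delete_nth_def take_map drop_map)

lemma delete_nth_append: "i < length xs \<Longrightarrow> delete_nth i (xs @ ys) = delete_nth i xs @ ys"
  by (simp add: delete_nth_def)

lemma delete_nth_commute:
  assumes "j < i" "i < length z"
  shows "delete_nth j (delete_nth i z) = delete_nth (i - 1) (delete_nth j z)"
  using assms by (intro nth_equalityI) (auto simp: length_delete_nth nth_delete_nth)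

lemma sorted_wrt_delete_nth: "sorted_wrt R z \<Longrightarrow> sorted_wrt R (delete_nth i z)"
proof -
  assume s: "sorted_wrt R z"
  have "sorted_wrt R (take i z @ drop i z)" using s by simp
  then have "sorted_wrt R (take i z)" "\<forall>x\<in>set (take i z). \<forall>y\<in>set (drop i z). R x y"
    unfolding sorted_wrt_append by blast+
  moreover have "sorted_wrt R (drop (Suc i) z)" using s by (rule sorted_wrt_drop)
  moreover have "set (drop (Suc i) z) \<subseteq> set (drop i z)" by (simp add: set_drop_subset_set_drop)
  ultimately show ?thesis
    unfolding delete_nth_def sorted_wrt_append by auto
qed

definition face_sum :: "nat \<Rightarrow> ('p list \<Rightarrow> 'k::{comm_ring,comm_monoid_mult}) \<Rightarrow> 'p list \<Rightarrow> 'k" where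
  "face_sum n f z = (\<Sum>i = 1..n. (- 1) ^ i * f (delete_nth i z))"

lemma coboundary_eq:
  "coboundary P leq n f z = (if z \<in> full_chains P leq (Suc n) then face_sum n f z else 0)"
  by (simp add: coboundary_def face_sum_def delete_nth_def)

lemma full_chains_delete_nth:
  assumes "z \<in> full_chains P leq (Suc n)" "1 \<le> i" "i \<le> n"
  shows "delete_nth i z \<in> full_chains P leq n"
proof -
  have l: "length z = Suc (Suc n)" using assms by (simp add: full_chains_def)
  then have ne: "z \<noteq> []" by auto
  have ne': "drop (Suc i) z \<noteq> []" using l assms by simp
  have "hd (delete_nth i z) = hd z"
    using ne assms(2) by (cases z; cases i) (auto simp: delete_nth_def)
  moreover have "last (delete_nth i z) = last z"
    using ne' by (simp add: delete_nth_def)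
  moreover have "length (delete_nth i z) = Suc n" using l assms by (simp add: length_delete_nth)
  ultimately show ?thesis
    using assms set_delete_nth[of i z] sorted_wrt_delete_nth[of _ z i]
    unfolding full_chains_def by auto
qed

text \<open>The simplicial cancellation: deleting at \<open>i\<close> and then at
  \<open>j < i\<close> gives the same chain as deleting at \<open>j\<close> and then at
  \<open>i - 1\<close>, with the opposite sign. The bijection between the two halves of the index
  square is \<open>(i, j)\<close> to \<open>(j, i - 1)\<close>.\<close>

lemma face_sum_face_sum:
  assumes l: "length z = Suc (Suc n)"
  shows "face_sum n (face_sum (n - 1) g) z = 0"
proof -
  define a where "a = (\<lambda>(i, j). (- 1) ^ i * ((- 1) ^ j * g (delete_nth j (delete_nth i z))))"
  define U where "U = {(i, j). j < i \<and> 1 \<le> j \<and> i \<le> n}"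
  define V where "V = {(i, j). i \<le> j \<and> 1 \<le> i \<and> j \<le> n - 1}"
  have UV: "{1..n} \<times> {1..n - 1} = U \<union> V" "U \<inter> V = {}"
    by (auto simp: U_def V_def)
  have fin: "finite U" "finite V"
    using UV(1) by (metis finite_SigmaI finite_Un finite_atLeastAtMost)+
  have "face_sum n (face_sum (n - 1) g) z = sum a ({1..n} \<times> {1..n - 1})"
    unfolding face_sum_def a_def sum.cartesian_product[symmetric] by (simp add: sum_distrib_left)
  also have "\<dots> = sum a U + sum a V"
    unfolding UV(1) using fin UV(2) by (rule sum.union_disjoint)
  also have "sum a U = (\<Sum>x\<in>V. - a x)"
  proof (rule sum.reindex_bij_witness[where i = "\<lambda>(i, j). (Suc j, i)" and j = "\<lambda>(i, j). (j, i - 1)"])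
    fix x assume "x \<in> U"
    then obtain i j where x: "x = (i, j)" "j < i" "1 \<le> j" "i \<le> n" by (auto simp: U_def)
    then obtain i' where i': "i = Suc i'" by (cases i) auto
    have "delete_nth j (delete_nth i z) = delete_nth (i - 1) (delete_nth j z)"
      using x l by (intro delete_nth_commute) auto
    then show "- a (case x of (i, j) \<Rightarrow> (j, i - 1)) = a x"
      using x i' by (simp add: a_def algebra_simps)
  qed (auto simp: U_def V_def)
  finally show ?thesis by (simp add: sum_negf)
qed

lemma coboundary_coboundary:
  "coboundary P leq (Suc n) (coboundary P leq n g) = (\<lambda>_. 0)"
proof
  fix z
  show "coboundary P leq (Suc n) (coboundary P leq n g) z = 0"
  proof (cases "z \<in> full_chains P leq (Suc (Suc n))")
    case True
    then have l: "length z = Suc (Suc (Suc n))" by (simp add: full_chains_def)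
    have "face_sum (Suc n) (coboundary P leq n g) z = face_sum (Suc n) (face_sum n g) z"
      unfolding face_sum_def[of "Suc n"]
      by (intro sum.cong) (auto simp: coboundary_eq full_chains_delete_nth[OF True])
    then show ?thesis using face_sum_face_sum[OF l, of g] True by (simp add: coboundary_eq)
  qed (simp add: coboundary_eq)
qed

section \<open>The cohomology of Boolean lattices\<close>

text \<open>The entry at position \<open>j\<close> occurs twice, as itself and as its image under
  \<open>r\<close>. These are the simplices of the standard triangulation of the prism over a
  chain.\<close>

definition prism :: "('p \<Rightarrow> 'p) \<Rightarrow> nat \<Rightarrow> 'p list \<Rightarrow> 'p list" where
  "prism r j z = take (Suc j) z @ map r (drop j z)"

lemma length_prism: "j < length z \<Longrightarrow> length (prism r j z) = Suc (length z)"
  by (simp add: prism_def)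

lemma nth_prism:
  "j < length z \<Longrightarrow> k \<le> length z \<Longrightarrow> prism r j z ! k = (if k \<le> j then z ! k else r (z ! (k - 1)))"
  by (auto simp: prism_def nth_append)

lemma delete_nth_prism_less:
  assumes "i \<le> j" "Suc j < length z"
  shows "delete_nth i (prism r (Suc j) z) = prism r j (delete_nth i z)"
proof (rule nth_equalityI)
  show "length (delete_nth i (prism r (Suc j) z)) = length (prism r j (delete_nth i z))"
    using assms by (simp add: length_delete_nth length_prism)
  fix k assume "k < length (delete_nth i (prism r (Suc j) z))"
  then have k: "k < length z" using assms by (simp add: length_delete_nth length_prism)
  have "delete_nth i (prism r (Suc j) z) ! k = prism r (Suc j) z ! (if k < i then k else Suc k)"
    using assms k by (simp add: nth_delete_nth length_prism)
  also have "\<dots> = prism r j (delete_nth i z) ! k"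
    using assms k by (cases k) (auto simp: nth_prism nth_delete_nth length_delete_nth)
  finally show "delete_nth i (prism r (Suc j) z) ! k = prism r j (delete_nth i z) ! k" .
qed

lemma delete_nth_prism_greater:
  assumes "j < i" "i < length z"
  shows "delete_nth (Suc i) (prism r j z) = prism r j (delete_nth i z)"
proof (rule nth_equalityI)
  show "length (delete_nth (Suc i) (prism r j z)) = length (prism r j (delete_nth i z))"
    using assms by (simp add: length_delete_nth length_prism)
  fix k assume "k < length (delete_nth (Suc i) (prism r j z))"
  then have k: "k < length z" using assms by (simp add: length_delete_nth length_prism)
  have "delete_nth (Suc i) (prism r j z) ! k = prism r j z ! (if k < Suc i then k else Suc k)"
    using assms k by (simp add: nth_delete_nth length_prism)
  also have "\<dots> = prism r j (delete_nth i z) ! k"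
    using assms k by (cases k) (auto simp: nth_prism nth_delete_nth length_delete_nth)
  finally show "delete_nth (Suc i) (prism r j z) ! k = prism r j (delete_nth i z) ! k" .
qed

lemma delete_nth_prism_same:
  "j < length z \<Longrightarrow> delete_nth j (prism r j z) = take j z @ map r (drop j z)"
  by (simp add: prism_def delete_nth_def)

lemma delete_nth_prism_Suc:
  "j < length z \<Longrightarrow> delete_nth (Suc j) (prism r j z) = take (Suc j) z @ map r (drop (Suc j) z)"
  by (simp add: prism_def delete_nth_def drop_map)

text \<open>The prism \<open>j = n\<close> is left out: \<open>r\<close> will fix the last element,
  so that prism would merely repeat it.\<close>

definition cone :: "('p \<Rightarrow> 'p) \<Rightarrow> nat \<Rightarrow> ('p list \<Rightarrow> 'k::{comm_ring,comm_monoid_mult}) \<Rightarrow> 'p list \<Rightarrow> 'k" where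
  "cone r n f z = (\<Sum>j<n. (- 1) ^ j * f (prism r j z))"

text \<open>
  The prism operator is a homotopy between the identity and the map induced by \<open>r\<close>; the latter is
  absent from the formula because a first element is never deleted.
\<close>

lemma cone_homotopy:
  assumes l: "length z = Suc n" and n: "n \<noteq> 0" and last: "r (last z) = last z"
  shows "cone r n (face_sum n f) z = - f z - face_sum (n - 1) (cone r (n - 1) f) z"
proof -
  define a where "a = (\<lambda>(i, j). (- 1) ^ j * ((- 1) ^ i * f (delete_nth i (prism r j z))))"
  define b where "b = (\<lambda>(i, j). (- 1) ^ i * ((- 1) ^ j * f (prism r j (delete_nth i z))))"
  \<comment> \<open>The value at \<open>j = 0\<close> is a default that matches the missing term:
    position 0 is never deleted. The value at \<open>j = n\<close> is \<open>f z\<close>, because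
    \<open>r\<close> fixes the last element.\<close>
  define q where "q j = (if j = 0 then 0 else f (take j z @ map r (drop j z)))" for j
  \<comment> \<open>The four regions are: deletion below the doubled entry, of its lower copy, of
    its upper copy, and above it. The outer two give the other term of the homotopy formula, the
    middle two telescope.\<close>
  define I1 where "I1 = {(i, j). i < j \<and> 1 \<le> i \<and> j < n}"
  define I2 where "I2 = {(i, j). i = j \<and> 1 \<le> i \<and> j < n}"
  define I3 where "I3 = {(i, j). i = Suc j \<and> j < n}"
  define I4 where "I4 = {(i, j). Suc j < i \<and> i \<le> n}"
  define J1 where "J1 = {(i, j). i \<le> j \<and> 1 \<le> i \<and> j < n - 1}"
  define J2 where "J2 = {(i, j). j < i \<and> i \<le> n - 1}"
  have I: "{1..n} \<times> {..<n} = ((I1 \<union> I2) \<union> I3) \<union> I4"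
    by (auto simp: I1_def I2_def I3_def I4_def)
  have J: "{1..n - 1} \<times> {..<n - 1} = J1 \<union> J2" "J1 \<inter> J2 = {}"
    by (auto simp: J1_def J2_def)
  have "finite ({1..n} \<times> {..<n})" "finite ({1..n - 1} \<times> {..<n - 1})" by simp_all
  then have fin: "finite I1" "finite I2" "finite I3" "finite I4" "finite J1" "finite J2"
    unfolding I J by simp_all
  have 1: "cone r n (face_sum n f) z = sum a ({1..n} \<times> {..<n})"
    unfolding cone_def face_sum_def a_def sum.cartesian_product[symmetric]
    by (subst sum.swap) (simp add: sum_distrib_left)
  have 2: "sum a ({1..n} \<times> {..<n}) = sum a I1 + sum a I2 + sum a I3 + sum a I4"
    unfolding I
    by (subst sum.union_disjoint, use fin in \<open>auto simp: I1_def I2_def I3_def I4_def\<close>)+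
  have 3: "face_sum (n - 1) (cone r (n - 1) f) z = sum b J1 + sum b J2"
  proof -
    have "face_sum (n - 1) (cone r (n - 1) f) z = sum b ({1..n - 1} \<times> {..<n - 1})"
      unfolding cone_def face_sum_def b_def sum.cartesian_product[symmetric]
      by (simp add: sum_distrib_left)
    then show ?thesis unfolding J(1) using fin J(2) by (simp add: sum.union_disjoint)
  qed
  have 4: "sum a I1 = - sum b J1"
  proof -
    have "sum a I1 = (\<Sum>x\<in>J1. - b x)"
    proof (rule sum.reindex_bij_witness[where i = "\<lambda>(i, j). (i, Suc j)" and j = "\<lambda>(i, j). (i, j - 1)"])
      fix x assume "x \<in> I1"
      then obtain i j where x: "x = (i, j)" "i < j" "1 \<le> i" "j < n" by (auto simp: I1_def)
      then obtain j' where j': "j = Suc j'" by (cases j) auto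
      have "delete_nth i (prism r (Suc j') z) = prism r j' (delete_nth i z)"
        using x j' l by (intro delete_nth_prism_less) auto
      then show "- b (case x of (i, j) \<Rightarrow> (i, j - 1)) = a x"
        using x j' by (simp add: a_def b_def algebra_simps)
    qed (auto simp: I1_def J1_def)
    then show ?thesis by (simp add: sum_negf)
  qed
  have 5: "sum a I4 = - sum b J2"
  proof -
    have "sum a I4 = (\<Sum>x\<in>J2. - b x)"
    proof (rule sum.reindex_bij_witness[where i = "\<lambda>(i, j). (Suc i, j)" and j = "\<lambda>(i, j). (i - 1, j)"])
      fix x assume "x \<in> I4"
      then obtain i j where x: "x = (i, j)" "Suc j < i" "i \<le> n" by (auto simp: I4_def)
      then obtain i' where i': "i = Suc i'" by (cases i) auto
      have "delete_nth (Suc i') (prism r j z) = prism r j (delete_nth i' z)"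
        using x i' l by (intro delete_nth_prism_greater) auto
      then show "- b (case x of (i, j) \<Rightarrow> (i - 1, j)) = a x"
        using x i' by (simp add: a_def b_def algebra_simps)
    qed (auto simp: I4_def J2_def)
    then show ?thesis by (simp add: sum_negf)
  qed
  have 6: "sum a I2 = (\<Sum>j<n. q j)"
  proof -
    have "(\<Sum>j<n. q j) = (\<Sum>j\<in>{1..<n}. q j)"
      by (intro sum.mono_neutral_right) (auto simp: q_def)
    also have "\<dots> = sum a I2"
    proof (rule sum.reindex_bij_witness[where i = fst and j = "\<lambda>j. (j, j)"])
      fix j assume "j \<in> {1..<n}"
      then have j: "1 \<le> j" "j < n" by auto
      have "a (j, j) = ((- 1) ^ j * (- 1) ^ j) * f (delete_nth j (prism r j z))"
        unfolding a_def by (simp add: mult.assoc)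
      also have "\<dots> = q j"
        using j l by (simp add: sgn_square delete_nth_prism_same q_def)
      finally show "a (j, j) = q j" .
    qed (auto simp: I2_def)
    finally show ?thesis ..
  qed
  have 7: "sum a I3 = (\<Sum>j<n. - q (Suc j))"
  proof (rule sum.reindex_bij_witness[where i = "\<lambda>j. (Suc j, j)" and j = snd])
    fix x assume "x \<in> I3"
    then obtain j where x: "x = (Suc j, j)" and j: "j < n" by (auto simp: I3_def)
    have "a (Suc j, j) = - (((- 1) ^ j * (- 1) ^ j) * f (delete_nth (Suc j) (prism r j z)))"
      unfolding a_def by (simp add: mult.assoc)
    also have "\<dots> = - q (Suc j)"
      using j l by (simp add: sgn_square delete_nth_prism_Suc q_def)
    finally show "- q (Suc (snd x)) = a x" using x by simp
  qed (auto simp: I3_def)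
  have "sum a I2 + sum a I3 = (\<Sum>j<n. q j - q (Suc j))"
    unfolding 6 7 by (simp add: sum_subtractf sum_negf)
  also have "\<dots> = q 0 - q n" by (rule sum_lessThan_telescope')
  also have "\<dots> = - f z"
  proof -
    have "drop n z = [last z]"
      using l by (metis Suc_n_not_le_n append_butlast_last_id append_eq_conv_conj diff_Suc_1
        length_butlast length_0_conv nat.simps(3))
    then have "take n z @ map r (drop n z) = z"
      using last by (metis append_take_drop_id list.simps(8) list.simps(9))
    then show ?thesis using n by (simp add: q_def)
  qed
  finally show ?thesis unfolding 1 2 3 4 5 by (simp add: algebra_simps)
qed

text \<open>Only the two faces that delete one of the equal neighbours can be free of repetitions.
  They are the same chain and carry opposite signs.\<close>

lemma face_sum_repetition:
  assumes f: "\<And>w. \<not> distinct w \<Longrightarrow> f w = 0"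
    and k: "1 \<le> k" "Suc k \<le> n" "w ! k = w ! Suc k" and l: "length w = Suc (Suc n)"
  shows "face_sum n f w = 0"
proof -
  let ?t = "\<lambda>i. (- 1) ^ i * f (delete_nth i w)"
  have z: "f (delete_nth i w) = 0" if "i \<in> {1..n} - {k, Suc k}" for i
  proof (rule f)
    define k' where "k' = (if i < k then k - 1 else k)"
    have "k' < length w - 1" "Suc k' < length w - 1" using that k l by (auto simp: k'_def)
    moreover have "i < length w" using that l by auto
    ultimately have "delete_nth i w ! k' = delete_nth i w ! Suc k'"
      using that k by (auto simp: nth_delete_nth k'_def)
    then show "\<not> distinct (delete_nth i w)"
      using \<open>Suc k' < length w - 1\<close> \<open>i < length w\<close>
      by (metis Suc_lessD length_delete_nth n_not_Suc_n nth_eq_iff_index_eq)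
  qed
  have "face_sum n f w = sum ?t {k, Suc k}"
    unfolding face_sum_def by (rule sum.mono_neutral_right) (use z k in auto)
  moreover have "delete_nth k w = delete_nth (Suc k) w"
  proof (rule nth_equalityI)
    show "length (delete_nth k w) = length (delete_nth (Suc k) w)"
      using k l by (simp add: length_delete_nth)
    fix i assume "i < length (delete_nth k w)"
    then have "i < length w - 1" using k l by (simp add: length_delete_nth)
    then show "delete_nth k w ! i = delete_nth (Suc k) w ! i"
      using k l by (cases "i = k") (auto simp: nth_delete_nth)
  qed
  ultimately show ?thesis by simp
qed

text \<open>The homotopy is applied with \<open>insert e\<close>. Each prism over \<open>z\<close>
  is either a full chain, on which the cocycle condition applies, or has a repetition at inner
  positions, where the faces cancel.\<close>

lemma pow_cocycle_cone:
  assumes e: "e \<in> E" and f: "f \<in> cocycles (Pow E) (\<subseteq>) n" and n: "n \<noteq> 0"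
    and z: "z \<in> full_chains (Pow E) (\<subseteq>) n" and c: "E - {e} \<notin> set z"
  shows "f z = - face_sum (n - 1) (cone (insert e) (n - 1) f) z"
proof -
  have Z: "length z = Suc n" "set z \<subseteq> Pow E" "sorted_wrt (\<subset>) z" "hd z = {}" "last z = E"
    using z by (auto simp: full_chains_Pow)
  have ne: "z \<noteq> []" using Z(1) by auto
  have sup: "f w = 0" if "w \<notin> full_chains (Pow E) (\<subseteq>) n" for w
    using f that by (simp add: cocycles_def cochains_def free_module_def)
  have nd: "f w = 0" if "\<not> distinct w" for w
  proof (rule sup, rule notI)
    assume "w \<in> full_chains (Pow E) (\<subseteq>) n"
    then have "sorted_wrt (\<subset>) w" by (simp add: full_chains_Pow)
    then have "distinct w" by (induction w) auto
    then show False using that by blast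
  qed
  have z0: "z ! 0 = {}" using Z(4) ne by (simp add: hd_conv_nth)
  have zn: "z ! n = E" using Z(1,5) ne by (simp add: last_conv_nth)
  have zlt: "z ! i \<subset> z ! j" if "i < j" "j \<le> n" for i j
    using Z(1,3) that by (simp add: sorted_wrt_iff_nth_less)
  have zE: "z ! i \<subseteq> E" if "i \<le> n" for i
    using Z(1,2) that by (metis Pow_iff less_Suc_eq_le nth_mem subsetD)
  have "face_sum n f (prism (insert e) j z) = 0" if j: "j < n" for j
  proof -
    let ?w = "prism (insert e) j z"
    have lw: "length ?w = Suc (Suc n)" using j Z(1) by (simp add: length_prism)
    have nw: "?w ! k = (if k \<le> j then z ! k else insert e (z ! (k - 1)))" if "k \<le> Suc n" for k
      using that j Z(1) by (intro nth_prism) auto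
    have step: "?w ! k \<subseteq> ?w ! Suc k" if "Suc k \<le> Suc n" for k
    proof -
      consider "k < j" | "k = j" | "j < k" by linarith
      then show ?thesis
      proof cases
        case 1
        then show ?thesis using zlt[of k "Suc k"] j that by (simp add: nw psubset_imp_subset)
      next
        case 2
        then show ?thesis using j that by (auto simp: nw)
      next
        case 3
        then show ?thesis using zlt[of "k - 1" k] that by (auto simp: nw)
      qed
    qed
    show ?thesis
    proof (cases "\<exists>k. Suc k \<le> Suc n \<and> ?w ! k = ?w ! Suc k")
      case True
      then obtain k where k: "Suc k \<le> Suc n" "?w ! k = ?w ! Suc k" by blast
      \<comment> \<open>Position 0 is never deleted, so a repetition there would not cancel. The
        chain starts with \<open>{}\<close>, and its next entry is \<open>insert e {}\<close> or a
        strictly larger member of \<open>z\<close>.\<close>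
      have "k \<noteq> 0"
      proof
        assume k0: "k = 0"
        show False
        proof (cases "j = 0")
          case True
          then show False using k k0 z0 nw[of 0] nw[of 1] by simp
        next
          case False
          then show False using k k0 zlt[of 0 1] n by (simp add: nw)
        qed
      qed
      \<comment> \<open>The hypothesis on the coatom enters here: a repetition at the top end, where
        cancellation fails, means \<open>z ! (n - 1) = E - {e}\<close>.\<close>
      moreover have "k \<noteq> n"
      proof
        assume kn: "k = n"
        have "insert e (z ! (n - 1)) = insert e E" using k kn j zn by (simp add: nw)
        then have i: "insert e (z ! (n - 1)) = E" using e by (simp add: insert_absorb)
        have lt: "z ! (n - 1) \<subset> E" using zlt[of "n - 1" n] zn n by simp
        then have "z ! (n - 1) = E - {e}" using i by blast
        moreover have "z ! (n - 1) \<in> set z" using Z(1) by simp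
        ultimately show False using c by simp
      qed
      ultimately show ?thesis
        using k by (intro face_sum_repetition[OF nd, where k = k] lw) auto
    next
      case False
      then have "?w ! k \<subset> ?w ! Suc k" if "Suc k < length ?w" for k
        using step that lw by (metis less_Suc_eq_le psubsetI)
      then have "sorted_wrt (\<subset>) ?w"
        by (subst sorted_wrt_iff_nth_Suc_transp) (auto intro: transpI)
      moreover have "set ?w \<subseteq> Pow E"
      proof
        fix x assume "x \<in> set ?w"
        then obtain k where k: "k \<le> Suc n" "x = ?w ! k"
          using lw by (metis in_set_conv_nth less_Suc_eq_le)
        then show "x \<in> Pow E" using zE[of k] zE[of "k - 1"] e j by (auto simp: nw split: if_splits)
      qed
      moreover have "hd ?w = {}" using Z(4) ne by (cases z) (auto simp: prism_def)
      moreover have "last ?w = E"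
        using j Z(1,5) e by (simp add: prism_def last_map insert_absorb)
      ultimately have "?w \<in> full_chains (Pow E) (\<subseteq>) (Suc n)"
        using lw by (simp add: full_chains_Pow)
      moreover have "coboundary (Pow E) (\<subseteq>) n f ?w = 0"
        using f by (simp add: cocycles_def)
      ultimately show ?thesis by (simp add: coboundary_eq)
    qed
  qed
  then have "cone (insert e) n (face_sum n f) z = 0" by (simp add: cone_def)
  moreover have "insert e (last z) = last z" using e Z(5) by (simp add: insert_absorb)
  ultimately show ?thesis
    using cone_homotopy[OF Z(1) n, of "insert e" f] by (metis right_minus_eq minus_equation_iff)
qed

section \<open>Linearity of the coboundary\<close>

lemma face_sum_cong:
  "(\<And>i. 1 \<le> i \<Longrightarrow> i \<le> n \<Longrightarrow> f (delete_nth i z) = g (delete_nth i z)) \<Longrightarrow> face_sum n f z = face_sum n g z"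
  unfolding face_sum_def by (intro sum.cong) auto

lemma face_sum_diff: "face_sum n (\<lambda>x. f x - g x) z = face_sum n f z - face_sum n g z"
  by (simp add: face_sum_def sum_subtractf right_diff_distrib)

lemma face_sum_add: "face_sum n (\<lambda>x. f x + g x) z = face_sum n f z + face_sum n g z"
  by (simp add: face_sum_def sum.distrib distrib_left)

lemma face_sum_smult: "face_sum n (\<lambda>x. c * f x) z = c * face_sum n f z"
  by (simp add: face_sum_def sum_distrib_left mult.left_commute)

lemma coboundary_add:
  "coboundary P leq n (\<lambda>x. f x + g x) = (\<lambda>z. coboundary P leq n f z + coboundary P leq n g z)"
  by (auto simp: coboundary_eq face_sum_add)

lemma coboundary_diff:
  "coboundary P leq n (\<lambda>x. f x - g x) = (\<lambda>z. coboundary P leq n f z - coboundary P leq n g z)"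
  by (auto simp: coboundary_eq face_sum_diff)

lemma coboundary_smult:
  "coboundary P leq n (\<lambda>x. c * f x) = (\<lambda>z. c * coboundary P leq n f z)"
  by (auto simp: coboundary_eq face_sum_smult)

lemma coboundary_cochain: "coboundary P leq n f \<in> cochains P leq (Suc n)"
  by (simp add: coboundary_def cochains_def free_module_def)

text \<open>Nothing lies strictly between a coatom and the top, so in a strict chain the coatom is
  the last entry but one.\<close>

lemma full_chain_through_coatom:
  assumes e: "e \<in> E" and z: "z \<in> full_chains (Pow E) (\<subseteq>) (Suc n)" and c: "E - {e} \<in> set z"
  obtains w where "z = w @ [E]" "w \<in> full_chains (Pow (E - {e})) (\<subseteq>) n"
proof -
  have Z: "length z = Suc (Suc n)" "set z \<subseteq> Pow E" "sorted_wrt (\<subset>) z" "hd z = {}" "last z = E"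
    using z by (auto simp: full_chains_Pow)
  define w where "w = butlast z"
  have zw: "z = w @ [E]" using Z(1,5) unfolding w_def by (metis append_butlast_last_id list.size(3) nat.simps(3))
  have wne: "w \<noteq> []" using Z(1) zw by auto
  have sw: "sorted_wrt (\<subset>) w" "\<And>x. x \<in> set w \<Longrightarrow> x \<subset> E"
    using Z(3) by (auto simp: zw sorted_wrt_append)
  have cw: "E - {e} \<in> set w" using c e zw by auto
  have last: "last w = E - {e}"
  proof (rule ccontr)
    assume "last w \<noteq> E - {e}"
    then have "E - {e} \<subset> last w" using sorted_wrt_last[OF sw(1) cw] by blast
    moreover have "last w \<subset> E" using sw(2) wne by simp
    ultimately show False by blast
  qed
  have "x \<subseteq> E - {e}" if x: "x \<in> set w" for x
  proof (cases "x = last w")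
    case True
    then show ?thesis using last by simp
  next
    case False
    then have "x \<subset> last w" by (rule sorted_wrt_last[OF sw(1) x])
    then show ?thesis using last by simp
  qed
  moreover have "hd w = {}" using Z(4) zw wne by simp
  moreover have "length w = Suc n" using Z(1) zw by simp
  ultimately have "w \<in> full_chains (Pow (E - {e})) (\<subseteq>) n"
    using sw(1) last unfolding full_chains_Pow by blast
  then show thesis using that zw by blast
qed

lemma full_chain_extend_coatom:
  assumes e: "e \<in> E" and w: "w \<in> full_chains (Pow (E - {e})) (\<subseteq>) n"
  shows "w @ [E] \<in> full_chains (Pow E) (\<subseteq>) (Suc n)"
proof -
  have W: "length w = Suc n" "set w \<subseteq> Pow (E - {e})" "sorted_wrt (\<subset>) w" "hd w = {}"
    using w by (auto simp: full_chains_Pow)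
  then have "w \<noteq> []" by auto
  moreover have E: "x \<subset> E" if "x \<in> set w" for x using W(2) e that by auto
  moreover have "set w \<subseteq> Pow E" using E by blast
  ultimately show ?thesis
    using W(1,3,4) by (simp add: full_chains_Pow sorted_wrt_append)
qed

lemma full_chain_last_mem: "w \<in> full_chains (Pow E) (\<subseteq>) n \<Longrightarrow> E \<in> set w"
  using last_in_set[of w] by (cases "w = []") (simp_all add: full_chains_Pow)

text \<open>
  By the cone homotopy a cocycle is cohomologous to one supported on the chains through a fixed
  coatom, that is, to a cocycle of a smaller Boolean lattice.
\<close>

lemma pow_cocycle_coboundary:
  fixes f :: "'a set list \<Rightarrow> 'k::{comm_ring,comm_monoid_mult}"
  assumes "finite E" "n < card E" "f \<in> cocycles (Pow E) (\<subseteq>) n"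
  shows "f \<in> coboundaries (Pow E) (\<subseteq>) n"
  using assms
proof (induction E arbitrary: n f rule: finite_induct)
  case empty
  then show ?case by simp
next
  case (insert e c)
  let ?E = "insert e c"
  have e: "e \<in> ?E" and Ec: "?E - {e} = c" using insert.hyps by auto
  have supp: "f w = 0" if "w \<notin> full_chains (Pow ?E) (\<subseteq>) n" for w
    using insert.prems(2) that by (simp add: cocycles_def cochains_def free_module_def)
  show ?case
  proof (cases n)
    case 0
    have "full_chains (Pow ?E) (\<subseteq>) 0 = {}"
    proof -
      have "w \<notin> full_chains (Pow ?E) (\<subseteq>) 0" for w
        by (cases w) (auto simp: full_chains_Pow)
      then show ?thesis by blast
    qed
    then have "f = (\<lambda>_. 0)" using supp 0 by auto
    then show ?thesis using 0 by (simp add: coboundaries_def)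
  next
    case (Suc k)
    \<comment> \<open>Here \<open>c\<close> is at once the smaller set and the coatom
      \<open>?E - {e}\<close>. The homotopy formula is available only on chains avoiding
      \<open>c\<close>, so the primitive it provides is cut off to those.\<close>
    define g0 where "g0 w = (if w \<in> full_chains (Pow ?E) (\<subseteq>) k \<and> c \<notin> set w
      then - cone (insert e) k f w else 0)" for w
    define f1 where "f1 w = f w - coboundary (Pow ?E) (\<subseteq>) k g0 w" for w
    have f1_avoid: "f1 z = 0" if z: "z \<in> full_chains (Pow ?E) (\<subseteq>) n" "c \<notin> set z" for z
    proof -
      have "face_sum k g0 z = face_sum k (\<lambda>w. - cone (insert e) k f w) z"
      proof (rule face_sum_cong)
        fix i assume i: "1 \<le> i" "i \<le> k"
        have "delete_nth i z \<in> full_chains (Pow ?E) (\<subseteq>) k"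
          using full_chains_delete_nth[OF z(1)[unfolded Suc] i] .
        moreover have "c \<notin> set (delete_nth i z)" by (rule contra_subsetD[OF set_delete_nth z(2)])
        ultimately show "g0 (delete_nth i z) = - cone (insert e) k f (delete_nth i z)"
          by (simp add: g0_def)
      qed
      also have "\<dots> = - face_sum k (cone (insert e) k f) z"
        using face_sum_smult[of k "- 1" "cone (insert e) k f" z] by simp
      also have "\<dots> = f z"
        using pow_cocycle_cone[OF e insert.prems(2) _ z(1)] z(2) Ec Suc by simp
      finally show ?thesis using z(1) Suc by (simp add: f1_def coboundary_eq)
    qed
    have f1_supp: "f1 w = 0" if "w \<notin> full_chains (Pow ?E) (\<subseteq>) n" for w
      using supp[OF that] that Suc by (simp add: f1_def coboundary_eq)
    have f1_cocycle: "coboundary (Pow ?E) (\<subseteq>) n f1 = (\<lambda>_. 0)"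
    proof -
      have "coboundary (Pow ?E) (\<subseteq>) n f1
        = (\<lambda>z. coboundary (Pow ?E) (\<subseteq>) n f z
            - coboundary (Pow ?E) (\<subseteq>) n (coboundary (Pow ?E) (\<subseteq>) k g0) z)"
        unfolding f1_def by (rule coboundary_diff)
      then show ?thesis
        using insert.prems(2) Suc by (simp add: coboundary_coboundary cocycles_def)
    qed
    \<comment> \<open>The corrected cocycle \<open>f1\<close> lives on chains through
      \<open>c\<close>, which are the chains of the smaller lattice with the top appended; the
      degree drops by one.\<close>
    define f2 where "f2 w = (if w \<in> full_chains (Pow c) (\<subseteq>) k then f1 (w @ [?E]) else 0)" for w
    have "f2 \<in> cocycles (Pow c) (\<subseteq>) k"
    proof -
      have "coboundary (Pow c) (\<subseteq>) k f2 w = 0" for w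
      proof (cases "w \<in> full_chains (Pow c) (\<subseteq>) (Suc k)")
        case True
        let ?z = "w @ [?E]"
        have lw: "length w = Suc (Suc k)" using True by (simp add: full_chains_def)
        have z: "?z \<in> full_chains (Pow ?E) (\<subseteq>) (Suc n)"
          using full_chain_extend_coatom[OF e] True Ec Suc by simp
        have "0 = face_sum n f1 ?z"
          using z fun_cong[OF f1_cocycle, of ?z] by (simp add: coboundary_eq)
        \<comment> \<open>Position \<open>n\<close> of \<open>?z\<close> holds the coatom
          \<open>c\<close>. The face that deletes it avoids \<open>c\<close>, where
          \<open>f1\<close> vanishes, and the remaining faces are those of \<open>w\<close>.\<close>
        also have "\<dots> = face_sum k f1 ?z + (- 1) ^ n * f1 (delete_nth n ?z)"
          by (simp add: face_sum_def Suc)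
        also have "f1 (delete_nth n ?z) = 0"
        proof (rule f1_avoid)
          show "delete_nth n ?z \<in> full_chains (Pow ?E) (\<subseteq>) n"
            using full_chains_delete_nth[OF z, of n] Suc by simp
          have "delete_nth n ?z = butlast w @ [?E]"
            using lw Suc by (simp add: delete_nth_def butlast_conv_take)
          moreover have "c \<notin> set (butlast w)"
          proof -
            have "w = butlast w @ [c]"
              using True lw by (metis append_butlast_last_id full_chains_Pow list.size(3) nat.simps(3))
            then have "sorted_wrt (\<subset>) (butlast w @ [c])" using True by (simp add: full_chains_Pow)
            then show ?thesis by (auto simp: sorted_wrt_append)
          qed
          ultimately show "c \<notin> set (delete_nth n ?z)" using insert.hyps by auto
        qed
        also have "face_sum k f1 ?z = face_sum k f2 w"
          unfolding face_sum_def
        proof (rule sum.cong[OF refl])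
          fix i assume i: "i \<in> {1..k}"
          then have "delete_nth i ?z = delete_nth i w @ [?E]"
            using lw by (simp add: delete_nth_append)
          then show "(- 1) ^ i * f1 (delete_nth i ?z) = (- 1) ^ i * f2 (delete_nth i w)"
            using full_chains_delete_nth[OF True] i by (simp add: f2_def)
        qed
        finally show ?thesis using True by (simp add: coboundary_eq)
      qed (simp add: coboundary_eq)
      then show ?thesis by (auto simp: cocycles_def cochains_def free_module_def f2_def)
    qed
    moreover have "k < card c" using insert.prems(1) insert.hyps Suc by simp
    ultimately have f2_cob: "f2 \<in> coboundaries (Pow c) (\<subseteq>) k" using insert.IH by blast
    \<comment> \<open>For \<open>k = 0\<close> there is no lower degree and \<open>f2\<close> itself
      is zero. The disjunction keeps both cases together, with an arbitrary \<open>g2\<close> in the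
      second.\<close>
    obtain g2 where g2: "f2 = coboundary (Pow c) (\<subseteq>) (k - 1) g2 \<or> (k = 0 \<and> f2 = (\<lambda>_. 0))"
      using f2_cob by (cases k) (auto simp: coboundaries_def)
    \<comment> \<open>The primitive of \<open>f2\<close>, moved to the chains through
      \<open>c\<close> by putting the top back.\<close>
    define g1 where "g1 w = (if w \<in> full_chains (Pow ?E) (\<subseteq>) k \<and> c \<in> set w
      then g2 (butlast w) else 0)" for w
    have f1: "f1 = coboundary (Pow ?E) (\<subseteq>) k g1"
    proof
      fix z
      show "f1 z = coboundary (Pow ?E) (\<subseteq>) k g1 z"
      proof (cases "z \<in> full_chains (Pow ?E) (\<subseteq>) n")
        case z: True
        show ?thesis
        proof (cases "c \<in> set z")
          case True
          then obtain w where w: "z = w @ [?E]" "w \<in> full_chains (Pow c) (\<subseteq>) k"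
            using full_chain_through_coatom[OF e z[unfolded Suc]] Ec by metis
          have lw: "length w = Suc k" using w(2) by (simp add: full_chains_def)
          have fz: "f1 z = f2 w" using w by (simp add: f2_def)
          show ?thesis
          proof (cases k)
            case 0
            have "f2 w = 0" using g2 w(2) 0 by (auto simp: coboundary_eq face_sum_def)
            then show ?thesis using fz 0 by (simp add: coboundary_eq face_sum_def)
          next
            case k: (Suc m)
            have w_last: "w = butlast w @ [c]"
              using w(2) lw by (metis append_butlast_last_id full_chains_Pow list.size(3) nat.simps(3))
            have "face_sum k g1 z = face_sum m g1 z + (- 1) ^ k * g1 (delete_nth k z)"
              by (simp add: face_sum_def k)
            also have "g1 (delete_nth k z) = 0"
            proof -
              have "delete_nth k z = butlast w @ [?E]"
                using lw w(1) by (simp add: delete_nth_def butlast_conv_take)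
              moreover have "c \<notin> set (butlast w)"
              proof -
                have "sorted_wrt (\<subset>) (butlast w @ [c])"
                  using w(2) w_last by (simp add: full_chains_Pow)
                then show ?thesis by (auto simp: sorted_wrt_append)
              qed
              ultimately have "c \<notin> set (delete_nth k z)" using insert.hyps by auto
              then show ?thesis by (simp add: g1_def)
            qed
            also have "face_sum m g1 z = face_sum m g2 w"
              unfolding face_sum_def
            proof (rule sum.cong[OF refl])
              fix i assume i: "i \<in> {1..m}"
              then have d: "delete_nth i z = delete_nth i w @ [?E]"
                using lw k w(1) by (simp add: delete_nth_append)
              have "delete_nth i z \<in> full_chains (Pow ?E) (\<subseteq>) k"
                using full_chains_delete_nth[OF z[unfolded Suc], of i] i k by simp
              moreover have "delete_nth i w \<in> full_chains (Pow c) (\<subseteq>) m"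
                using full_chains_delete_nth[OF w(2)[unfolded k], of i] i by simp
              then have "c \<in> set (delete_nth i z)"
                unfolding d using full_chain_last_mem by auto
              ultimately have "g1 (delete_nth i z) = g2 (delete_nth i w)"
                unfolding g1_def using d by simp
              then show "(- 1) ^ i * g1 (delete_nth i z) = (- 1) ^ i * g2 (delete_nth i w)" by simp
            qed
            finally have "face_sum k g1 z = face_sum m g2 w" by simp
            moreover have "f2 w = face_sum m g2 w"
              using g2 w(2) k by (auto simp: coboundary_eq)
            ultimately show ?thesis using fz z Suc by (simp add: coboundary_eq)
          qed
        next
          case False
          have "face_sum k g1 z = face_sum k (\<lambda>_. 0) z"
            by (rule face_sum_cong) (simp add: g1_def contra_subsetD[OF set_delete_nth False])
          then have "face_sum k g1 z = 0" by (simp add: face_sum_def)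
          then show ?thesis using f1_avoid[OF z False] by (simp add: coboundary_eq)
        qed
      qed (use f1_supp Suc in \<open>simp add: coboundary_eq\<close>)
    qed
    have "f = coboundary (Pow ?E) (\<subseteq>) k (\<lambda>w. g1 w + g0 w)"
      unfolding coboundary_add f1[symmetric] by (simp add: f1_def)
    moreover have "(\<lambda>w. g1 w + g0 w) \<in> cochains (Pow ?E) (\<subseteq>) k"
      by (simp add: cochains_def free_module_def g0_def g1_def)
    ultimately show ?thesis using Suc by (simp add: coboundaries_def)
  qed
qed

section \<open>Quotients of modules of functions\<close>

lemma scalars_simps [simp]:
  "carrier scalars = UNIV" "x \<otimes>\<^bsub>scalars\<^esub> y = x * y" "\<one>\<^bsub>scalars\<^esub> = 1"
  "\<zero>\<^bsub>scalars\<^esub> = 0" "x \<oplus>\<^bsub>scalars\<^esub> y = x + y"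
  by (simp_all add: scalars_def)

lemma cring_scalars: "cring (scalars :: 'k::{comm_ring,comm_monoid_mult} ring)"
proof (rule cringI)
  show "abelian_group (scalars :: 'k ring)"
    by (rule abelian_groupI) (auto simp: ac_simps intro: exI[of _ "- _"] left_minus)
  show "comm_monoid (scalars :: 'k ring)"
    by (rule comm_monoidI) (auto simp: ac_simps)
qed (auto simp: distrib_right)

lemma scalars_pow_minus_one:
  "(\<ominus>\<^bsub>scalars\<^esub> \<one>\<^bsub>scalars\<^esub>) [^]\<^bsub>scalars\<^esub> (n::nat) = (- 1 :: 'k::{comm_ring,comm_monoid_mult}) ^ n"
proof -
  interpret cring "scalars :: 'k ring" by (rule cring_scalars)
  have "\<ominus>\<^bsub>scalars\<^esub> (1 :: 'k) = - 1" by (rule minus_equality) auto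
  then show ?thesis
    by (induction n) (simp_all add: mult.commute)
qed

definition fun_submodule :: "('c \<Rightarrow> 'k::{comm_ring,comm_monoid_mult}) set \<Rightarrow> bool" where
  "fun_submodule Z \<longleftrightarrow> (\<lambda>_. 0) \<in> Z \<and> (\<forall>f\<in>Z. \<forall>g\<in>Z. (\<lambda>x. f x + g x) \<in> Z)
     \<and> (\<forall>c. \<forall>f\<in>Z. (\<lambda>x. c * f x) \<in> Z)"

lemma fun_submoduleD:
  assumes "fun_submodule Z"
  shows fun_submodule_zero: "(\<lambda>_. 0) \<in> Z"
    and fun_submodule_add: "f \<in> Z \<Longrightarrow> g \<in> Z \<Longrightarrow> (\<lambda>x. f x + g x) \<in> Z"
    and fun_submodule_smult: "f \<in> Z \<Longrightarrow> (\<lambda>x. c * f x) \<in> Z"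
  using assms by (auto simp: fun_submodule_def)

lemma fun_submodule_neg:
  assumes "fun_submodule Z" "f \<in> Z"
  shows "(\<lambda>x. - f x) \<in> Z"
  using fun_submodule_smult[OF assms, of "- 1"] by simp

lemma fun_submodule_diff:
  assumes "fun_submodule Z" "f \<in> Z" "g \<in> Z"
  shows "(\<lambda>x. f x - g x) \<in> Z"
  using fun_submodule_add[OF assms(1,2) fun_submodule_neg[OF assms(1,3)]] by simp

definition quotient_class ::
    "('c \<Rightarrow> 'k::{comm_ring,comm_monoid_mult}) set \<Rightarrow> ('c \<Rightarrow> 'k) set \<Rightarrow> ('c \<Rightarrow> 'k) \<Rightarrow> ('c \<Rightarrow> 'k) set" where
  "quotient_class Z B f = cong_mod Z B `` {f}"

locale fun_quotient =
  fixes Z B :: "('c \<Rightarrow> 'k::{comm_ring,comm_monoid_mult}) set"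
  assumes Z: "fun_submodule Z" and B: "fun_submodule B" and BZ: "B \<subseteq> Z"
begin

abbreviation "cl \<equiv> quotient_class Z B"

lemma cl_mem_iff: "f \<in> Z \<Longrightarrow> g \<in> cl f \<longleftrightarrow> g \<in> Z \<and> (\<lambda>x. f x - g x) \<in> B"
  by (auto simp: quotient_class_def cong_mod_def)

lemma diff_sym: "(\<lambda>x. f x - g x) \<in> B \<Longrightarrow> (\<lambda>x. g x - f x) \<in> B"
  using fun_submodule_neg[OF B] by force

lemma diff_trans:
  assumes "(\<lambda>x. f x - g x) \<in> B" "(\<lambda>x. g x - h x) \<in> B"
  shows "(\<lambda>x. f x - h x) \<in> B"
  using fun_submodule_add[OF B assms] by simp

lemma diff_self: "(\<lambda>x. f x - f x) \<in> B"
  using fun_submodule_zero[OF B] by simp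

lemma cl_eqI:
  assumes "f \<in> Z" "g \<in> Z" "(\<lambda>x. f x - g x) \<in> B"
  shows "cl f = cl g"
proof (rule Set.set_eqI)
  fix h
  show "h \<in> cl f \<longleftrightarrow> h \<in> cl g"
    unfolding cl_mem_iff[OF assms(1)] cl_mem_iff[OF assms(2)]
    using diff_trans[OF assms(3), of h] diff_trans[OF diff_sym[OF assms(3)], of h] by blast
qed

lemma cl_self: "f \<in> Z \<Longrightarrow> f \<in> cl f"
  by (simp add: cl_mem_iff fun_submodule_zero[OF B])

lemma cl_eq_iff: "f \<in> Z \<Longrightarrow> g \<in> Z \<Longrightarrow> cl f = cl g \<longleftrightarrow> (\<lambda>x. f x - g x) \<in> B"
  using cl_eqI cl_self[of g] cl_mem_iff[of f g] by blast

lemma carrier_quotient: "carrier (quotient_module Z B) = cl ` Z"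
  by (auto simp: quotient_module_def quotient_def quotient_class_def)

text \<open>Operations on quotients are written as unions over representatives; such a union
  collapses once its terms do not depend on the representative.\<close>

lemma UN_cl:
  assumes "f \<in> Z" "\<And>g. g \<in> Z \<Longrightarrow> (\<lambda>x. f x - g x) \<in> B \<Longrightarrow> F g = F f"
  shows "(\<Union>g\<in>cl f. F g) = F f"
proof -
  have "F g = F f" if "g \<in> cl f" for g using assms that by (simp add: cl_mem_iff)
  then show ?thesis using cl_self[OF assms(1)] by blast
qed

lemma add_cl:
  assumes "f \<in> Z" "g \<in> Z"
  shows "cl f \<oplus>\<^bsub>quotient_module Z B\<^esub> cl g = cl (\<lambda>x. f x + g x)"
proof -
  have 1: "cl (\<lambda>x. f' x + g' x) = cl (\<lambda>x. f x + g x)"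
    if "f' \<in> Z" "(\<lambda>x. f x - f' x) \<in> B" "g' \<in> Z" "(\<lambda>x. g x - g' x) \<in> B" for f' g'
  proof (rule cl_eqI)
    have "(\<lambda>x. (f' x - f x) + (g' x - g x)) \<in> B"
      using fun_submodule_add[OF B diff_sym[OF that(2)] diff_sym[OF that(4)]] .
    then show "(\<lambda>x. f' x + g' x - (f x + g x)) \<in> B" by (simp add: algebra_simps)
  qed (use that assms fun_submodule_add[OF Z] in auto)
  have 2: "(\<Union>g'\<in>cl g. cl (\<lambda>x. f' x + g' x)) = cl (\<lambda>x. f x + g x)"
    if "f' \<in> Z" "(\<lambda>x. f x - f' x) \<in> B" for f'
  proof -
    have "(\<Union>g'\<in>cl g. cl (\<lambda>x. f' x + g' x)) = cl (\<lambda>x. f' x + g x)"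
      by (rule UN_cl[OF assms(2)]) (metis 1 assms diff_self that)
    then show ?thesis using 1[OF that assms(2) diff_self] by simp
  qed
  have "cl f \<oplus>\<^bsub>quotient_module Z B\<^esub> cl g = (\<Union>f'\<in>cl f. \<Union>g'\<in>cl g. cl (\<lambda>x. f' x + g' x))"
    by (simp add: quotient_module_def quotient_class_def)
  also have "\<dots> = (\<Union>g'\<in>cl g. cl (\<lambda>x. f x + g' x))"
    by (rule UN_cl[OF assms(1)]) (simp only: 2 assms(1) diff_self)
  finally show ?thesis using 2[OF assms(1) diff_self] by simp
qed

lemma smult_cl:
  assumes "f \<in> Z"
  shows "c \<odot>\<^bsub>quotient_module Z B\<^esub> cl f = cl (\<lambda>x. c * f x)"
proof -
  have "c \<odot>\<^bsub>quotient_module Z B\<^esub> cl f = (\<Union>f'\<in>cl f. cl (\<lambda>x. c * f' x))"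
    by (simp add: quotient_module_def quotient_class_def)
  also have "\<dots> = cl (\<lambda>x. c * f x)"
  proof (rule UN_cl[OF assms])
    fix g assume g: "g \<in> Z" "(\<lambda>x. f x - g x) \<in> B"
    show "cl (\<lambda>x. c * g x) = cl (\<lambda>x. c * f x)"
    proof (rule cl_eqI)
      show "(\<lambda>x. c * g x - c * f x) \<in> B"
        using fun_submodule_smult[OF B diff_sym[OF g(2)], of c] by (simp add: right_diff_distrib)
    qed (use g assms fun_submodule_smult[OF Z] in auto)
  qed
  finally show ?thesis .
qed

lemma zero_cl: "\<zero>\<^bsub>quotient_module Z B\<^esub> = cl (\<lambda>_. 0)"
  by (simp add: quotient_module_def quotient_class_def)

lemma module_quotient: "module scalars (quotient_module Z B)"
proof (rule moduleI)
  show "cring (scalars :: 'k ring)" by (rule cring_scalars)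
  show "abelian_group (quotient_module Z B)"
  proof (rule abelian_groupI)
    fix X assume "X \<in> carrier (quotient_module Z B)"
    then obtain f where f: "X = cl f" "f \<in> Z" by (auto simp: carrier_quotient)
    have "cl (\<lambda>x. - f x) \<oplus>\<^bsub>quotient_module Z B\<^esub> X = \<zero>\<^bsub>quotient_module Z B\<^esub>"
      using f by (simp add: add_cl zero_cl fun_submodule_neg[OF Z])
    then show "\<exists>y\<in>carrier (quotient_module Z B).
        y \<oplus>\<^bsub>quotient_module Z B\<^esub> X = \<zero>\<^bsub>quotient_module Z B\<^esub>"
      using fun_submodule_neg[OF Z f(2)] by (auto simp: carrier_quotient)
  qed (auto simp: carrier_quotient add_cl zero_cl ac_simps
      fun_submodule_add[OF Z] fun_submodule_zero[OF Z])
qed (auto simp: carrier_quotient add_cl smult_cl fun_submodule_add[OF Z] fun_submodule_smult[OF Z]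
    distrib_left distrib_right mult.assoc)

end

section \<open>Operads of quotients\<close>

text \<open>The common shape of both operads: quotients of modules of functions, with operations
  given on representatives. The two instances are \<open>Tree_operad_eq\<close> and
  \<open>h_MLT_eq\<close>.\<close>

definition quotient_operad ::
    "('a set \<Rightarrow> nat \<Rightarrow> ('c \<Rightarrow> 'k::{comm_ring,comm_monoid_mult}) set) \<Rightarrow>
     ('a set \<Rightarrow> nat \<Rightarrow> ('c \<Rightarrow> 'k) set) \<Rightarrow>
     ('a set \<Rightarrow> ('a \<Rightarrow> 'a) \<Rightarrow> nat \<Rightarrow> ('c \<Rightarrow> 'k) \<Rightarrow> 'c \<Rightarrow> 'k) \<Rightarrow>
     ('a set \<Rightarrow> 'a \<Rightarrow> 'a set \<Rightarrow> nat \<Rightarrow> nat \<Rightarrow> ('c \<Rightarrow> 'k) \<Rightarrow> ('c \<Rightarrow> 'k) \<Rightarrow> 'c \<Rightarrow> 'k) \<Rightarrow>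
     ('a \<Rightarrow> 'c \<Rightarrow> 'k) \<Rightarrow> ('a, 'k, ('c \<Rightarrow> 'k) set) operad_data" where
  "quotient_operad Z B rel cmp unt =
     \<lparr>op_space = (\<lambda>S n. quotient_module (Z S n) (B S n)),
      op_relabel = (\<lambda>S \<sigma> n X. \<Union>f\<in>X. quotient_class (Z (\<sigma> ` S) n) (B (\<sigma> ` S) n) (rel S \<sigma> n f)),
      op_comp = (\<lambda>A a B' m n X Y. \<Union>f\<in>X. \<Union>g\<in>Y.
        quotient_class (Z (A \<union> B') (m + n)) (B (A \<union> B') (m + n)) (cmp A a B' m n f g)),
      op_unit = (\<lambda>a. quotient_class (Z {a} 0) (B {a} 0) (unt a))\<rparr>"

lemma arity_composable:
  assumes "composable A a B"
  shows "arity B" "arity (A \<union> B)" "arity (insert a A)"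
  using assms by (auto simp: composable_def arity_def)

text \<open>Only closure and well-definedness are assumed and none of the operad laws, so the locale
  applies to \<open>h_MLT\<close> before that is known to be an operad.\<close>

locale quotient_operad_data =
  fixes Z B :: "'a set \<Rightarrow> nat \<Rightarrow> ('c \<Rightarrow> 'k::{comm_ring,comm_monoid_mult}) set"
    and rel cmp unt
  assumes quot: "arity S \<Longrightarrow> fun_quotient (Z S n) (B S n)"
    and rel_closed: "arity S \<Longrightarrow> inj_on \<sigma> S \<Longrightarrow> f \<in> Z S n \<Longrightarrow> rel S \<sigma> n f \<in> Z (\<sigma> ` S) n"
    and rel_cong: "arity S \<Longrightarrow> inj_on \<sigma> S \<Longrightarrow> f \<in> Z S n \<Longrightarrow> g \<in> Z S n \<Longrightarrow>
      (\<lambda>x. f x - g x) \<in> B S n \<Longrightarrow> (\<lambda>x. rel S \<sigma> n f x - rel S \<sigma> n g x) \<in> B (\<sigma> ` S) n"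
    and cmp_closed: "composable A a B' \<Longrightarrow> f \<in> Z (insert a A) m \<Longrightarrow> g \<in> Z B' n \<Longrightarrow>
      cmp A a B' m n f g \<in> Z (A \<union> B') (m + n)"
    and cmp_cong: "composable A a B' \<Longrightarrow> f \<in> Z (insert a A) m \<Longrightarrow> f' \<in> Z (insert a A) m \<Longrightarrow>
      g \<in> Z B' n \<Longrightarrow> g' \<in> Z B' n \<Longrightarrow> (\<lambda>x. f x - f' x) \<in> B (insert a A) m \<Longrightarrow>
      (\<lambda>x. g x - g' x) \<in> B B' n \<Longrightarrow>
      (\<lambda>x. cmp A a B' m n f g x - cmp A a B' m n f' g' x) \<in> B (A \<union> B') (m + n)"
    and unt_closed: "unt a \<in> Z {a} 0"
begin

abbreviation Op :: "('a, 'k, ('c \<Rightarrow> 'k) set) operad_data" where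
  "Op \<equiv> quotient_operad Z B rel cmp unt"

abbreviation cls :: "'a set \<Rightarrow> nat \<Rightarrow> ('c \<Rightarrow> 'k) \<Rightarrow> ('c \<Rightarrow> 'k) set" where
  "cls S n f \<equiv> quotient_class (Z S n) (B S n) f"

lemma op_space_Op: "op_space Op S n = quotient_module (Z S n) (B S n)"
  and op_unit_Op: "op_unit Op a = cls {a} 0 (unt a)"
  by (simp_all add: quotient_operad_def)

lemma carrier_Op: "arity S \<Longrightarrow> carrier (op_space Op S n) = cls S n ` Z S n"
  unfolding op_space_Op by (rule fun_quotient.carrier_quotient[OF quot])

lemma carrier_OpE:
  assumes "arity S" "X \<in> carrier (op_space Op S n)"
  obtains f where "f \<in> Z S n" "X = cls S n f"
  using assms carrier_Op by blast

lemma cls_carrier: "arity S \<Longrightarrow> f \<in> Z S n \<Longrightarrow> cls S n f \<in> carrier (op_space Op S n)"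
  by (simp add: carrier_Op)

lemma cls_eqI:
  "arity S \<Longrightarrow> f \<in> Z S n \<Longrightarrow> g \<in> Z S n \<Longrightarrow> (\<lambda>x. f x - g x) \<in> B S n \<Longrightarrow> cls S n f = cls S n g"
  by (rule fun_quotient.cl_eqI[OF quot])

lemma arity_image: "arity S \<Longrightarrow> arity (\<sigma> ` S)"
  by (simp add: arity_def)

lemma op_relabel_cls:
  assumes S: "arity S" "inj_on \<sigma> S" and f: "f \<in> Z S n"
  shows "op_relabel Op S \<sigma> n (cls S n f) = cls (\<sigma> ` S) n (rel S \<sigma> n f)"
proof -
  have "(\<Union>g\<in>cls S n f. cls (\<sigma> ` S) n (rel S \<sigma> n g)) = cls (\<sigma> ` S) n (rel S \<sigma> n f)"
  proof (rule fun_quotient.UN_cl[OF quot[OF S(1)] f])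
    fix g assume g: "g \<in> Z S n" "(\<lambda>x. f x - g x) \<in> B S n"
    show "cls (\<sigma> ` S) n (rel S \<sigma> n g) = cls (\<sigma> ` S) n (rel S \<sigma> n f)"
      by (rule cls_eqI[symmetric, OF arity_image[OF S(1)]])
        (use rel_closed[OF S] rel_cong[OF S] f g in blast)+
  qed
  then show ?thesis by (simp add: quotient_operad_def)
qed

lemma op_comp_cls:
  assumes c: "composable A a B'" and f: "f \<in> Z (insert a A) m" and g: "g \<in> Z B' n"
  shows "op_comp Op A a B' m n (cls (insert a A) m f) (cls B' n g)
    = cls (A \<union> B') (m + n) (cmp A a B' m n f g)"
proof -
  note ar = arity_composable[OF c]
  interpret X: fun_quotient "Z (insert a A) m" "B (insert a A) m" by (rule quot[OF ar(3)])
  interpret Y: fun_quotient "Z B' n" "B B' n" by (rule quot[OF ar(1)])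
  have 1: "cls (A \<union> B') (m + n) (cmp A a B' m n f' g') = cls (A \<union> B') (m + n) (cmp A a B' m n f g)"
    if "f' \<in> Z (insert a A) m" "(\<lambda>x. f x - f' x) \<in> B (insert a A) m"
      "g' \<in> Z B' n" "(\<lambda>x. g x - g' x) \<in> B B' n" for f' g'
    by (rule cls_eqI[symmetric, OF ar(2)])
      (use that f g cmp_closed[OF c] cmp_cong[OF c] in blast)+
  have 2: "(\<Union>g'\<in>cls B' n g. cls (A \<union> B') (m + n) (cmp A a B' m n f' g'))
      = cls (A \<union> B') (m + n) (cmp A a B' m n f g)"
    if f': "f' \<in> Z (insert a A) m" "(\<lambda>x. f x - f' x) \<in> B (insert a A) m" for f'
  proof -
    have "(\<Union>g'\<in>cls B' n g. cls (A \<union> B') (m + n) (cmp A a B' m n f' g'))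
        = cls (A \<union> B') (m + n) (cmp A a B' m n f' g)"
      by (rule Y.UN_cl[OF g]) (use 1[OF f'] g Y.diff_self in simp)
    then show ?thesis using 1[OF f' g Y.diff_self] by simp
  qed
  have "(\<Union>f'\<in>cls (insert a A) m f. \<Union>g'\<in>cls B' n g. cls (A \<union> B') (m + n) (cmp A a B' m n f' g'))
      = (\<Union>g'\<in>cls B' n g. cls (A \<union> B') (m + n) (cmp A a B' m n f g'))"
    by (rule X.UN_cl[OF f]) (simp only: 2 f X.diff_self)
  then show ?thesis using 2[OF f X.diff_self] by (simp add: quotient_operad_def)
qed

lemma add_cls: "arity S \<Longrightarrow> f \<in> Z S n \<Longrightarrow> g \<in> Z S n \<Longrightarrow>
    cls S n f \<oplus>\<^bsub>op_space Op S n\<^esub> cls S n g = cls S n (\<lambda>x. f x + g x)"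
  unfolding op_space_Op by (rule fun_quotient.add_cl[OF quot])

lemma smult_cls: "arity S \<Longrightarrow> f \<in> Z S n \<Longrightarrow>
    c \<odot>\<^bsub>op_space Op S n\<^esub> cls S n f = cls S n (\<lambda>x. c * f x)"
  unfolding op_space_Op by (rule fun_quotient.smult_cl[OF quot])

lemma space_module_Op: "arity S \<Longrightarrow> module scalars (op_space Op S n)"
  unfolding op_space_Op by (rule fun_quotient.module_quotient[OF quot])

lemma op_relabel_carrier:
  assumes "arity S" "inj_on \<sigma> S" "X \<in> carrier (op_space Op S n)"
  shows "op_relabel Op S \<sigma> n X \<in> carrier (op_space Op (\<sigma> ` S) n)"
proof -
  obtain f where f: "f \<in> Z S n" "X = cls S n f" using assms(1,3) by (rule carrier_OpE)
  then show ?thesis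
    using cls_carrier[OF arity_image[OF assms(1)] rel_closed[OF assms(1,2) f(1)]]
    by (simp add: op_relabel_cls[OF assms(1,2)])
qed

lemma op_comp_carrier:
  assumes c: "composable A a B'" and "X \<in> carrier (op_space Op (insert a A) m)"
    "Y \<in> carrier (op_space Op B' n)"
  shows "op_comp Op A a B' m n X Y \<in> carrier (op_space Op (A \<union> B') (m + n))"
proof -
  note ar = arity_composable[OF c]
  obtain f where f: "f \<in> Z (insert a A) m" "X = cls (insert a A) m f"
    using ar(3) assms(2) by (rule carrier_OpE)
  obtain g where g: "g \<in> Z B' n" "Y = cls B' n g"
    using ar(1) assms(3) by (rule carrier_OpE)
  show ?thesis
    using cls_carrier[OF ar(2) cmp_closed[OF c f(1) g(1)]] f g by (simp add: op_comp_cls[OF c])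
qed

end

section \<open>Transfer of operad structures\<close>

lemma linear_mapsD:
  assumes "h \<in> linear_maps K M N"
  shows linear_maps_closed: "x \<in> carrier M \<Longrightarrow> h x \<in> carrier N"
    and linear_maps_add: "x \<in> carrier M \<Longrightarrow> y \<in> carrier M \<Longrightarrow> h (x \<oplus>\<^bsub>M\<^esub> y) = h x \<oplus>\<^bsub>N\<^esub> h y"
    and linear_maps_smult: "c \<in> carrier K \<Longrightarrow> x \<in> carrier M \<Longrightarrow> h (c \<odot>\<^bsub>M\<^esub> x) = c \<odot>\<^bsub>N\<^esub> h x"
  using assms by (auto simp: linear_maps_def)

lemma linear_mapsI:
  assumes "\<And>x. x \<in> carrier M \<Longrightarrow> h x \<in> carrier N"
    "\<And>x y. x \<in> carrier M \<Longrightarrow> y \<in> carrier M \<Longrightarrow> h (x \<oplus>\<^bsub>M\<^esub> y) = h x \<oplus>\<^bsub>N\<^esub> h y"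
    "\<And>c x. c \<in> carrier K \<Longrightarrow> x \<in> carrier M \<Longrightarrow> h (c \<odot>\<^bsub>M\<^esub> x) = c \<odot>\<^bsub>N\<^esub> h x"
  shows "h \<in> linear_maps K M N"
  using assms by (auto simp: linear_maps_def)

text \<open>Equations in \<open>N\<close> can be tested after applying the injective
  \<open>g\<close>. In the transfer, \<open>g\<close> is the candidate isomorphism and
  \<open>h\<close> an operation whose linearity is wanted.\<close>

lemma linear_maps_pullback:
  assumes g: "g \<in> linear_maps K N N'" and inj: "inj_on g (carrier N)"
    and N: "module K N" and h: "\<And>x. x \<in> carrier M \<Longrightarrow> h x \<in> carrier N"
    and gh: "(\<lambda>x. g (h x)) \<in> linear_maps K M N'" and M: "module K M"
  shows "h \<in> linear_maps K M N"
proof (rule linear_mapsI)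
  interpret M: module K M by (rule M)
  interpret N: module K N by (rule N)
  fix x assume x: "x \<in> carrier M"
  show "h x \<in> carrier N" by (rule h[OF x])
  { fix y assume y: "y \<in> carrier M"
    have "g (h (x \<oplus>\<^bsub>M\<^esub> y)) = g (h x \<oplus>\<^bsub>N\<^esub> h y)"
      using linear_maps_add[OF gh x y] linear_maps_add[OF g h[OF x] h[OF y]] by simp
    then show "h (x \<oplus>\<^bsub>M\<^esub> y) = h x \<oplus>\<^bsub>N\<^esub> h y"
      using inj_onD[OF inj] h x y by simp }
  { fix c assume c: "c \<in> carrier K"
    have "g (h (c \<odot>\<^bsub>M\<^esub> x)) = g (c \<odot>\<^bsub>N\<^esub> h x)"
      using linear_maps_smult[OF gh c x] linear_maps_smult[OF g c h[OF x]] by simp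
    then show "h (c \<odot>\<^bsub>M\<^esub> x) = c \<odot>\<^bsub>N\<^esub> h x"
      using inj_onD[OF inj] h x c by simp }
qed

lemma linear_maps_comp:
  "g \<in> linear_maps K M N \<Longrightarrow> h \<in> linear_maps K N N' \<Longrightarrow> (\<lambda>x. h (g x)) \<in> linear_maps K M N'"
  by (auto simp: linear_maps_def Pi_iff)

lemma linear_maps_cong:
  assumes "h \<in> linear_maps K M N" "module K M" "\<And>x. x \<in> carrier M \<Longrightarrow> h x = h' x"
  shows "h' \<in> linear_maps K M N"
proof -
  interpret M: module K M by fact
  have "h' (x \<oplus>\<^bsub>M\<^esub> y) = h (x \<oplus>\<^bsub>M\<^esub> y)" "h' (c \<odot>\<^bsub>M\<^esub> x) = h (c \<odot>\<^bsub>M\<^esub> x)"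
    if "x \<in> carrier M" "y \<in> carrier M" "c \<in> carrier K" for x y c
    using that assms(3) by simp_all
  moreover have "h' x = h x" if "x \<in> carrier M" for x using that assms(3) by simp
  ultimately show ?thesis
    using linear_mapsD[OF assms(1)] M.M.zero_closed M.R.zero_closed
    by (intro linear_mapsI) metis+
qed

text \<open>Each operad law is an equation between elements of carriers of \<open>P\<close>, so it
  may be tested after applying the injective \<open>\<Phi>\<close>, where it becomes the same law of
  \<open>Q\<close>. Closure of the operations of \<open>P\<close> is a hypothesis because
  \<open>\<Phi>\<close> is injective only on carriers.\<close>

theorem graded_operad_iso_transfer:
  fixes P :: "('a, 'k, 'x) operad_data" and Q :: "('a, 'k, 'y) operad_data"
  assumes Q: "graded_operad K Q"
    and mod: "\<And>S n. arity S \<Longrightarrow> module K (op_space P S n)"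
    and rel_closed: "\<And>S \<sigma> n x. arity S \<Longrightarrow> inj_on \<sigma> S \<Longrightarrow> x \<in> carrier (op_space P S n) \<Longrightarrow>
      op_relabel P S \<sigma> n x \<in> carrier (op_space P (\<sigma> ` S) n)"
    and comp_closed: "\<And>A a B m n x y. composable A a B \<Longrightarrow> x \<in> carrier (op_space P (insert a A) m) \<Longrightarrow>
      y \<in> carrier (op_space P B n) \<Longrightarrow> op_comp P A a B m n x y \<in> carrier (op_space P (A \<union> B) (m + n))"
    and unit_closed: "\<And>a. op_unit P a \<in> carrier (op_space P {a} 0)"
    and lin: "\<And>S n. arity S \<Longrightarrow> \<Phi> S n \<in> linear_maps K (op_space P S n) (op_space Q S n)"
    and bij: "\<And>S n. arity S \<Longrightarrow> bij_betw (\<Phi> S n) (carrier (op_space P S n)) (carrier (op_space Q S n))"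
    and rel: "\<And>S \<sigma> n x. arity S \<Longrightarrow> inj_on \<sigma> S \<Longrightarrow> x \<in> carrier (op_space P S n) \<Longrightarrow>
      \<Phi> (\<sigma> ` S) n (op_relabel P S \<sigma> n x) = op_relabel Q S \<sigma> n (\<Phi> S n x)"
    and comp: "\<And>A a B m n x y. composable A a B \<Longrightarrow> x \<in> carrier (op_space P (insert a A) m) \<Longrightarrow>
      y \<in> carrier (op_space P B n) \<Longrightarrow>
      \<Phi> (A \<union> B) (m + n) (op_comp P A a B m n x y) = op_comp Q A a B m n (\<Phi> (insert a A) m x) (\<Phi> B n y)"
    and unit: "\<And>a. \<Phi> {a} 0 (op_unit P a) = op_unit Q a"
  shows "graded_operad_iso K P Q \<Phi>"
proof -
  interpret Q: graded_operad K Q by (rule Q)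
  have inj: "inj_on (\<Phi> S n) (carrier (op_space P S n))" if "arity S" for S n
    using bij[OF that] by (rule bij_betw_imp_inj_on)
  have eqI: "x = y" if "arity S" "x \<in> carrier (op_space P S n)" "y \<in> carrier (op_space P S n)"
    "\<Phi> S n x = \<Phi> S n y" for S n x y
    using inj_onD[OF inj[OF that(1)] that(4,2,3)] .
  have cl: "\<Phi> S n x \<in> carrier (op_space Q S n)" if "arity S" "x \<in> carrier (op_space P S n)" for S n x
    by (rule linear_maps_closed[OF lin[OF that(1)] that(2)])
  have im: "arity (\<sigma> ` S)" if "arity S" for \<sigma> :: "'a \<Rightarrow> 'a" and S using that by (simp add: arity_def)
  have "graded_operad K P"
  proof (rule graded_operad.intro)
    fix S :: "'a set" and n assume S: "arity S"
    show "module K (op_space P S n)" by (rule mod[OF S])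
    fix x assume x: "x \<in> carrier (op_space P S n)"
    have "op_relabel P S id n x \<in> carrier (op_space P S n)"
      using rel_closed[OF S _ x, of id] by simp
    moreover have "\<Phi> S n (op_relabel P S id n x) = \<Phi> S n x"
      using rel[OF S _ x, of id] Q.relabel_id[OF S cl[OF S x]] by simp
    ultimately show "op_relabel P S id n x = x" using eqI[OF S _ x] by blast
  next
    fix S :: "'a set" and \<sigma> :: "'a \<Rightarrow> 'a" and n assume S: "arity S" "inj_on \<sigma> S"
    have "(\<lambda>x. \<Phi> (\<sigma> ` S) n (op_relabel P S \<sigma> n x))
        \<in> linear_maps K (op_space P S n) (op_space Q (\<sigma> ` S) n)"
      by (rule linear_maps_cong[OF linear_maps_comp[OF lin[OF S(1)] Q.relabel_linear[OF S]] mod[OF S(1)]])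
        (simp add: rel[OF S])
    then show "op_relabel P S \<sigma> n \<in> linear_maps K (op_space P S n) (op_space P (\<sigma> ` S) n)"
      by (intro linear_maps_pullback[OF lin[OF im[OF S(1)]] inj[OF im[OF S(1)]] mod[OF im[OF S(1)]]
            _ _ mod[OF S(1)]] rel_closed[OF S])
  next
    fix S :: "'a set" and \<sigma> \<tau> :: "'a \<Rightarrow> 'a" and n x assume S: "arity S" "inj_on \<sigma> S" and e: "\<And>s. s \<in> S \<Longrightarrow> \<sigma> s = \<tau> s"
      and x: "x \<in> carrier (op_space P S n)"
    have S': "inj_on \<tau> S" "\<tau> ` S = \<sigma> ` S" using S(2) e by (auto simp: inj_on_def)
    show "op_relabel P S \<sigma> n x = op_relabel P S \<tau> n x"
    proof (rule eqI[OF im[OF S(1)] rel_closed[OF S x]])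
      show "op_relabel P S \<tau> n x \<in> carrier (op_space P (\<sigma> ` S) n)"
        using rel_closed[OF S(1) S'(1) x] S'(2) by simp
      show "\<Phi> (\<sigma> ` S) n (op_relabel P S \<sigma> n x) = \<Phi> (\<sigma> ` S) n (op_relabel P S \<tau> n x)"
        using rel[OF S x] rel[OF S(1) S'(1) x] S'(2) Q.relabel_cong[OF S e cl[OF S(1) x]] by simp
    qed
  next
    fix S :: "'a set" and \<sigma> \<tau> :: "'a \<Rightarrow> 'a" and n x assume S: "arity S" "inj_on \<sigma> S" and t: "inj_on \<tau> (\<sigma> ` S)"
      and x: "x \<in> carrier (op_space P S n)"
    have c: "inj_on (\<tau> \<circ> \<sigma>) S" using S(2) t by (rule comp_inj_on)
    have ic: "(\<tau> \<circ> \<sigma>) ` S = \<tau> ` \<sigma> ` S" by (rule image_comp[symmetric])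
    note r1 = rel_closed[OF S x]
    show "op_relabel P (\<sigma> ` S) \<tau> n (op_relabel P S \<sigma> n x) = op_relabel P S (\<tau> \<circ> \<sigma>) n x"
    proof (rule eqI[OF im[OF im[OF S(1)]] rel_closed[OF im[OF S(1)] t r1]])
      show "op_relabel P S (\<tau> \<circ> \<sigma>) n x \<in> carrier (op_space P (\<tau> ` \<sigma> ` S) n)"
        using rel_closed[OF S(1) c x] unfolding ic .
      show "\<Phi> (\<tau> ` \<sigma> ` S) n (op_relabel P (\<sigma> ` S) \<tau> n (op_relabel P S \<sigma> n x))
          = \<Phi> (\<tau> ` \<sigma> ` S) n (op_relabel P S (\<tau> \<circ> \<sigma>) n x)"
        using rel[OF im[OF S(1)] t r1] rel[OF S x] rel[OF S(1) c x, unfolded ic]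
          Q.relabel_comp[OF S t cl[OF S(1) x]] by simp
    qed
  next
    fix A B :: "'a set" and a x and m n :: nat
    assume c: "composable A a B" and x: "x \<in> carrier (op_space P (insert a A) m)"
    note ar = arity_composable[OF c]
    have "(\<lambda>y. \<Phi> (A \<union> B) (m + n) (op_comp P A a B m n x y))
        \<in> linear_maps K (op_space P B n) (op_space Q (A \<union> B) (m + n))"
      by (rule linear_maps_cong[OF linear_maps_comp[OF lin[OF ar(1)]
            Q.comp_linear_right[OF c cl[OF ar(3) x]]] mod[OF ar(1)]])
        (simp add: comp[OF c x])
    then show "(\<lambda>y. op_comp P A a B m n x y) \<in> linear_maps K (op_space P B n) (op_space P (A \<union> B) (m + n))"
      by (intro linear_maps_pullback[OF lin[OF ar(2)] inj[OF ar(2)] mod[OF ar(2)] _ _ mod[OF ar(1)]]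
          comp_closed[OF c x])
  next
    fix A B :: "'a set" and a y and m n :: nat
    assume c: "composable A a B" and y: "y \<in> carrier (op_space P B n)"
    note ar = arity_composable[OF c]
    have "(\<lambda>x. \<Phi> (A \<union> B) (m + n) (op_comp P A a B m n x y))
        \<in> linear_maps K (op_space P (insert a A) m) (op_space Q (A \<union> B) (m + n))"
      by (rule linear_maps_cong[OF linear_maps_comp[OF lin[OF ar(3)]
            Q.comp_linear_left[OF c cl[OF ar(1) y]]] mod[OF ar(3)]])
        (simp add: comp[OF c _ y])
    then show "(\<lambda>x. op_comp P A a B m n x y)
        \<in> linear_maps K (op_space P (insert a A) m) (op_space P (A \<union> B) (m + n))"
      by (intro linear_maps_pullback[OF lin[OF ar(2)] inj[OF ar(2)] mod[OF ar(2)] _ _ mod[OF ar(3)]]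
          comp_closed[OF c _ y])
  next
    fix A B :: "'a set" and a a' and \<sigma> :: "'a \<Rightarrow> 'a" and x y and m n :: nat
    assume c: "composable A a B" and s: "inj_on \<sigma> (A \<union> B)" and a': "a' \<notin> \<sigma> ` A"
      and x: "x \<in> carrier (op_space P (insert a A) m)" and y: "y \<in> carrier (op_space P B n)"
    note ar = arity_composable[OF c]
    have aA: "a \<notin> A" using c by (simp add: composable_def)
    have i1: "inj_on (\<sigma>(a := a')) (insert a A)"
      using s a' aA by (auto simp: inj_on_def)
    have i2: "inj_on \<sigma> B" using s by (rule inj_on_subset) blast
    have e: "(\<sigma>(a := a')) ` insert a A = insert a' (\<sigma> ` A)" using aA by auto
    have c': "composable (\<sigma> ` A) a' (\<sigma> ` B)"
      using c s a' by (auto simp: composable_def arity_def inj_on_def)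
    note rx = rel_closed[OF ar(3) i1 x, unfolded e]
    note ry = rel_closed[OF ar(1) i2 y]
    note k = comp_closed[OF c x y]
    show "op_relabel P (A \<union> B) \<sigma> (m + n) (op_comp P A a B m n x y)
         = op_comp P (\<sigma> ` A) a' (\<sigma> ` B) m n
             (op_relabel P (insert a A) (\<sigma>(a := a')) m x) (op_relabel P B \<sigma> n y)"
    proof (rule eqI[OF im[OF ar(2)] rel_closed[OF ar(2) s k]])
      show "op_comp P (\<sigma> ` A) a' (\<sigma> ` B) m n (op_relabel P (insert a A) (\<sigma>(a := a')) m x)
          (op_relabel P B \<sigma> n y) \<in> carrier (op_space P (\<sigma> ` (A \<union> B)) (m + n))"
        using comp_closed[OF c' rx ry] by (simp add: image_Un)
      show "\<Phi> (\<sigma> ` (A \<union> B)) (m + n) (op_relabel P (A \<union> B) \<sigma> (m + n) (op_comp P A a B m n x y))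
          = \<Phi> (\<sigma> ` (A \<union> B)) (m + n) (op_comp P (\<sigma> ` A) a' (\<sigma> ` B) m n
             (op_relabel P (insert a A) (\<sigma>(a := a')) m x) (op_relabel P B \<sigma> n y))"
        unfolding rel[OF ar(2) s k] comp[OF c x y]
          Q.comp_equivariant[OF c s a' cl[OF ar(3) x] cl[OF ar(1) y]]
          rel[OF ar(3) i1 x, symmetric] rel[OF ar(1) i2 y, symmetric] e
        by (simp only: comp[OF c' rx ry, symmetric] image_Un)
    qed
  next
    fix A B C :: "'a set" and a b and l m n :: nat and x y z
    assume c1: "composable A a (insert b B)" and c2: "composable B b C" and AC: "A \<inter> C = {}"
      and x: "x \<in> carrier (op_space P (insert a A) l)"
      and y: "y \<in> carrier (op_space P (insert b B) m)" and z: "z \<in> carrier (op_space P C n)"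
    have c3: "composable (A \<union> B) b C" and c4: "composable A a (B \<union> C)"
      using c1 c2 AC by (auto simp: composable_def arity_def)
    note a1 = arity_composable[OF c1] and a2 = arity_composable[OF c2]
      and a3 = arity_composable[OF c3] and a4 = arity_composable[OF c4]
    \<comment> \<open>The two sides of the law are indexed by sets and degrees that are bracketed
      differently; they must be identified before injectivity of \<open>\<Phi>\<close> can be
      used.\<close>
    have e: "A \<union> insert b B = insert b (A \<union> B)" "A \<union> B \<union> C = A \<union> (B \<union> C)" "l + m + n = l + (m + n)"
      by auto
    note xy = comp_closed[OF c1 x y, unfolded e] and yz = comp_closed[OF c2 y z]
    show "op_comp P (A \<union> B) b C (l + m) n (op_comp P A a (insert b B) l m x y) z
         = op_comp P A a (B \<union> C) l (m + n) x (op_comp P B b C m n y z)"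
    proof (rule eqI[OF a4(2)])
      show "op_comp P (A \<union> B) b C (l + m) n (op_comp P A a (insert b B) l m x y) z
          \<in> carrier (op_space P (A \<union> (B \<union> C)) (l + (m + n)))"
        using comp_closed[OF c3 xy z] unfolding e .
      show "op_comp P A a (B \<union> C) l (m + n) x (op_comp P B b C m n y z)
          \<in> carrier (op_space P (A \<union> (B \<union> C)) (l + (m + n)))"
        by (rule comp_closed[OF c4 x yz])
      show "\<Phi> (A \<union> (B \<union> C)) (l + (m + n))
            (op_comp P (A \<union> B) b C (l + m) n (op_comp P A a (insert b B) l m x y) z)
          = \<Phi> (A \<union> (B \<union> C)) (l + (m + n)) (op_comp P A a (B \<union> C) l (m + n) x (op_comp P B b C m n y z))"
        using comp[OF c3 xy z, unfolded e] comp[OF c1 x y, unfolded e] comp[OF c4 x yz] comp[OF c2 y z]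
          Q.comp_sequential[OF c1 c2 AC cl[OF a1(3) x] cl[OF a1(1) y] cl[OF a2(1) z]]
        by simp
    qed
  next
    fix A B C :: "'a set" and a b and l m n :: nat and x y z
    assume c1: "composable (insert b A) a B" and c2: "composable (insert a A) b C" and BC: "B \<inter> C = {}"
      and x: "x \<in> carrier (op_space P (insert a (insert b A)) l)"
      and y: "y \<in> carrier (op_space P B m)" and z: "z \<in> carrier (op_space P C n)"
    have c3: "composable (A \<union> B) b C" and c4: "composable (A \<union> C) a B"
      using c1 c2 BC by (auto simp: composable_def arity_def)
    note a1 = arity_composable[OF c1] and a2 = arity_composable[OF c2]
      and a3 = arity_composable[OF c3] and a4 = arity_composable[OF c4]
    have e: "insert b A \<union> B = insert b (A \<union> B)" "insert a A \<union> C = insert a (A \<union> C)"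
      "insert a (insert b A) = insert b (insert a A)"
      "A \<union> C \<union> B = A \<union> B \<union> C" "l + n + m = l + m + n"
      by auto
    note x' = x[unfolded e(3)]
    note xy = comp_closed[OF c1 x y, unfolded e(1)] and xz = comp_closed[OF c2 x' z, unfolded e(2)]
    note r = comp_closed[OF c4 xz y, unfolded e(4,5)]
    interpret M: module K "op_space P (A \<union> B \<union> C) (l + m + n)" by (rule mod[OF a3(2)])
    let ?s = "(\<ominus>\<^bsub>K\<^esub> \<one>\<^bsub>K\<^esub>) [^]\<^bsub>K\<^esub> (m * n)"
    have s: "?s \<in> carrier K" by simp
    show "op_comp P (A \<union> B) b C (l + m) n (op_comp P (insert b A) a B l m x y) z
         = ?s \<odot>\<^bsub>op_space P (A \<union> B \<union> C) (l + m + n)\<^esub>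
             op_comp P (A \<union> C) a B (l + n) m (op_comp P (insert a A) b C l n x z) y"
    proof (rule eqI[OF a3(2) comp_closed[OF c3 xy z]])
      show "?s \<odot>\<^bsub>op_space P (A \<union> B \<union> C) (l + m + n)\<^esub>
             op_comp P (A \<union> C) a B (l + n) m (op_comp P (insert a A) b C l n x z) y
          \<in> carrier (op_space P (A \<union> B \<union> C) (l + m + n))"
        using s r by (rule M.smult_closed)
      show "\<Phi> (A \<union> B \<union> C) (l + m + n)
            (op_comp P (A \<union> B) b C (l + m) n (op_comp P (insert b A) a B l m x y) z)
          = \<Phi> (A \<union> B \<union> C) (l + m + n) (?s \<odot>\<^bsub>op_space P (A \<union> B \<union> C) (l + m + n)\<^esub>
             op_comp P (A \<union> C) a B (l + n) m (op_comp P (insert a A) b C l n x z) y)"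
        unfolding linear_maps_smult[OF lin[OF a3(2)] s r]
        using comp[OF c3 xy z] comp[OF c1 x y, unfolded e(1)]
          comp[OF c4 xz y, unfolded e(4,5)] comp[OF c2 x' z, unfolded e(2)]
          Q.comp_parallel[OF c1 c2 BC cl[OF a1(3) x] cl[OF a1(1) y] cl[OF a2(1) z]]
        by (simp add: e(3))
    qed
  next
    fix a :: 'a and \<sigma> :: "'a \<Rightarrow> 'a"
    have ar: "arity {b}" for b :: 'a by (simp add: arity_def)
    show "op_unit P a \<in> carrier (op_space P {a} 0)" by (rule unit_closed)
    show "op_relabel P {a} \<sigma> 0 (op_unit P a) = op_unit P (\<sigma> a)"
    proof (rule eqI[OF ar _ unit_closed])
      show "op_relabel P {a} \<sigma> 0 (op_unit P a) \<in> carrier (op_space P {\<sigma> a} 0)"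
        using rel_closed[OF ar _ unit_closed, of \<sigma> a] by simp
      show "\<Phi> {\<sigma> a} 0 (op_relabel P {a} \<sigma> 0 (op_unit P a)) = \<Phi> {\<sigma> a} 0 (op_unit P (\<sigma> a))"
        using rel[OF ar _ unit_closed, of \<sigma> a] by (simp add: unit Q.unit_relabel)
    qed
  next
    fix B :: "'a set" and a y n assume B: "arity B" and y: "y \<in> carrier (op_space P B n)"
    have c: "composable {} a B" using B by (simp add: composable_def)
    show "op_comp P {} a B 0 n (op_unit P a) y = y"
    proof (rule eqI[OF B _ y])
      show "op_comp P {} a B 0 n (op_unit P a) y \<in> carrier (op_space P B n)"
        using comp_closed[OF c unit_closed y] by simp
      show "\<Phi> B n (op_comp P {} a B 0 n (op_unit P a) y) = \<Phi> B n y"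
        using comp[OF c unit_closed y] Q.unit_left[OF B cl[OF B y]] by (simp add: unit)
    qed
  next
    fix A :: "'a set" and a b x m
    assume c: "composable A a {b}" and x: "x \<in> carrier (op_space P (insert a A) m)"
    note ar = arity_composable[OF c]
    have i: "inj_on (id(a := b)) (insert a A)" using c by (auto simp: composable_def inj_on_def)
    have e: "(id(a := b)) ` insert a A = A \<union> {b}" using c by (auto simp: composable_def)
    show "op_comp P A a {b} m 0 x (op_unit P b) = op_relabel P (insert a A) (id(a := b)) m x"
    proof (rule eqI[OF ar(2)])
      show "op_comp P A a {b} m 0 x (op_unit P b) \<in> carrier (op_space P (A \<union> {b}) m)"
        using comp_closed[OF c x unit_closed] by simp
      show "op_relabel P (insert a A) (id(a := b)) m x \<in> carrier (op_space P (A \<union> {b}) m)"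
        using rel_closed[OF ar(3) i x] unfolding e .
      show "\<Phi> (A \<union> {b}) m (op_comp P A a {b} m 0 x (op_unit P b))
          = \<Phi> (A \<union> {b}) m (op_relabel P (insert a A) (id(a := b)) m x)"
        using comp[OF c x unit_closed] rel[OF ar(3) i x, unfolded e]
          Q.unit_right[OF c cl[OF ar(3) x]] by (simp add: unit)
    qed
  qed
  then show ?thesis
    unfolding graded_operad_iso_def using Q lin bij rel comp unit by blast
qed

section \<open>Generators of the operad of trees\<close>

text \<open>A generator of \<open>Tree\<close> is encoded by the order of its edges alone, the tree
  being recovered from the set of entries by \<open>gen\<close>. Positions in the list then describe
  both adjacent transpositions and concatenation.\<close>

definition edge_lists :: "'a set \<Rightarrow> nat \<Rightarrow> 'a set list set" where
  "edge_lists S n = {\<omega>. distinct \<omega> \<and> is_tree (S, set \<omega>) \<and> length \<omega> = n}"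

definition gen :: "'a set \<Rightarrow> 'a set list \<Rightarrow> 'a tree \<times> 'a set list" where
  "gen S \<omega> = ((S, set \<omega>), \<omega>)"

lemma gen_inject [simp]: "gen S \<omega> = gen S \<nu> \<longleftrightarrow> \<omega> = \<nu>"
  by (auto simp: gen_def)

text \<open>The degree condition becomes the length of the list, since a tree on \<open>S\<close>
  has \<open>card S - 1\<close> edges.\<close>

lemma tree_gens_eq:
  assumes "arity S"
  shows "tree_gens S n = gen S ` edge_lists S n"
proof -
  have c: "card (set \<omega>) = card S - 1" if "is_tree (S, set \<omega>)" for \<omega>
    using tree_card_edges[OF _ that] assms by (simp add: arity_def)
  show ?thesis
  proof (intro equalityI subsetI)
    fix x assume x: "x \<in> tree_gens S n"
    obtain N E \<omega> where x': "x = ((N, E), \<omega>)" by (metis prod.exhaust)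
    have n: "n = card S - 1" using x by (simp add: tree_gens_def split: if_splits)
    have h: "N = S" "is_tree (S, E)" "distinct \<omega>" "set \<omega> = E"
      using x x' by (auto simp: tree_gens_def labeled_trees_def split: if_splits)
    have "length \<omega> = n" using c[of \<omega>] distinct_card[OF h(3)] h n by simp
    then show "x \<in> gen S ` edge_lists S n"
      using h x' by (auto simp: edge_lists_def gen_def)
  next
    fix x assume "x \<in> gen S ` edge_lists S n"
    then obtain \<omega> where w: "x = gen S \<omega>" "distinct \<omega>" "is_tree (S, set \<omega>)" "length \<omega> = n"
      by (auto simp: edge_lists_def)
    then have "n = card S - 1" using c[of \<omega>] by (simp add: distinct_card)
    then show "x \<in> tree_gens S n"
      using w by (simp add: tree_gens_def labeled_trees_def gen_def)
  qed
qed

lemma edge_lists_rank: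
  assumes "arity S" "\<omega> \<in> edge_lists S n"
  shows "n = card S - 1"
  using assms tree_card_edges[of S "set \<omega>"] by (auto simp: edge_lists_def arity_def distinct_card)

lemma finite_edge_lists:
  assumes "arity S"
  shows "finite (edge_lists S n)"
proof (rule finite_subset)
  show "edge_lists S n \<subseteq> {\<omega>. set \<omega> \<subseteq> Pow S \<and> length \<omega> = n}"
    using tree_edges_Pow by (fastforce simp: edge_lists_def)
  show "finite {\<omega>. set \<omega> \<subseteq> Pow S \<and> length \<omega> = n}"
    using assms by (intro finite_lists_length_eq) (simp add: arity_def)
qed

lemma finite_tree_gens: "arity S \<Longrightarrow> finite (tree_gens S n)"
  by (simp add: tree_gens_eq finite_edge_lists)

lemma free_module_submodule: "fun_submodule (free_module X)"
  by (simp add: fun_submodule_def free_module_def)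

lemma fun_span_submodule: "fun_submodule (fun_span G)"
  by (auto simp: fun_submodule_def intro: fun_span.intros)

lemma fun_span_least: "fun_submodule Z \<Longrightarrow> G \<subseteq> Z \<Longrightarrow> fun_span G \<subseteq> Z"
proof
  fix f assume Z: "fun_submodule Z" "G \<subseteq> Z" and "f \<in> fun_span G"
  from this(3) show "f \<in> Z"
    by induction (use Z fun_submoduleD[OF Z(1)] in auto)
qed

lemma free_module_tree_gens_eqI:
  assumes "arity S" "f \<in> free_module (tree_gens S n)" "g \<in> free_module (tree_gens S n)"
    "\<And>\<omega>. \<omega> \<in> edge_lists S n \<Longrightarrow> f (gen S \<omega>) = g (gen S \<omega>)"
  shows "f = g"
proof
  fix x show "f x = g x"
  proof (cases "x \<in> tree_gens S n")
    case True
    then show ?thesis using assms(1,4) by (auto simp: tree_gens_eq)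
  next
    case False
    then show ?thesis using assms(2,3) by (simp add: free_module_def del: split_paired_All)
  qed
qed

lemma gen_mem_tree_gens: "arity S \<Longrightarrow> gen S \<omega> \<in> tree_gens S n \<longleftrightarrow> \<omega> \<in> edge_lists S n"
  by (auto simp: tree_gens_eq)

section \<open>Adjacent transpositions of edge lists\<close>

definition swap_nth :: "nat \<Rightarrow> 'c list \<Rightarrow> 'c list" where
  "swap_nth i \<omega> = \<omega>[i := \<omega> ! Suc i, Suc i := \<omega> ! i]"

lemma length_swap_nth [simp]: "length (swap_nth i \<omega>) = length \<omega>"
  by (simp add: swap_nth_def)

lemma set_swap_nth: "Suc i < length \<omega> \<Longrightarrow> set (swap_nth i \<omega>) = set \<omega>"
  by (simp add: swap_nth_def)

lemma distinct_swap_nth: "Suc i < length \<omega> \<Longrightarrow> distinct (swap_nth i \<omega>) = distinct \<omega>"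
  by (simp add: swap_nth_def)

lemma swap_nth_swap_nth: "Suc i < length \<omega> \<Longrightarrow> swap_nth i (swap_nth i \<omega>) = \<omega>"
  by (intro nth_equalityI) (auto simp: swap_nth_def nth_list_update)

lemma swap_nth_neq: "Suc i < length \<omega> \<Longrightarrow> distinct \<omega> \<Longrightarrow> swap_nth i \<omega> \<noteq> \<omega>"
proof
  assume a: "Suc i < length \<omega>" "distinct \<omega>" "swap_nth i \<omega> = \<omega>"
  have "swap_nth i \<omega> ! i = \<omega> ! Suc i" using a(1) by (simp add: swap_nth_def nth_list_update)
  then have "\<omega> ! i = \<omega> ! Suc i" using a(3) by simp
  then show False using nth_eq_iff_index_eq[OF a(2), of i "Suc i"] a(1) by simp
qed

lemma map_swap_nth: "Suc i < length \<omega> \<Longrightarrow> map h (swap_nth i \<omega>) = swap_nth i (map h \<omega>)"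
  by (intro nth_equalityI) (auto simp: swap_nth_def nth_list_update)

lemma take_swap_nth:
  assumes "Suc i < length \<omega>" "k \<noteq> Suc i"
  shows "take k (swap_nth i \<omega>) = (if k \<le> i then take k \<omega> else swap_nth i (take k \<omega>))"
  using assms by (intro nth_equalityI) (auto simp: swap_nth_def nth_list_update)

lemma drop_swap_nth:
  assumes "Suc i < length \<omega>" "k \<noteq> Suc i"
  shows "drop k (swap_nth i \<omega>) = (if k \<le> i then swap_nth (i - k) (drop k \<omega>) else drop k \<omega>)"
  using assms by (intro nth_equalityI) (auto simp: swap_nth_def nth_list_update)

lemma swap_nth_append: "swap_nth (length xs) (xs @ a # b # ys) = xs @ b # a # ys"
  by (simp add: swap_nth_def list_update_append nth_append)

lemma swap_nth_edge_lists:
  "Suc i < n \<Longrightarrow> \<omega> \<in> edge_lists S n \<Longrightarrow> swap_nth i \<omega> \<in> edge_lists S n"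
  by (simp add: edge_lists_def set_swap_nth distinct_swap_nth)

text \<open>Invariance instead of anti-invariance is right because these functions are to become
  zero: modulo the relators a swap acts as -1, so the sum over each orbit vanishes.\<close>

definition swap_invariants ::
    "'a set \<Rightarrow> nat \<Rightarrow> nat \<Rightarrow> ('a tree \<times> 'a set list \<Rightarrow> 'k::{comm_ring,comm_monoid_mult}) set" where
  "swap_invariants S n i = {f \<in> free_module (tree_gens S n).
     \<forall>\<omega>\<in>edge_lists S n. f (gen S (swap_nth i \<omega>)) = f (gen S \<omega>)}"

abbreviation swap_space ::
    "'a set \<Rightarrow> nat \<Rightarrow> ('a tree \<times> 'a set list \<Rightarrow> 'k::{comm_ring,comm_monoid_mult}) set" where
  "swap_space S n \<equiv> fun_span (\<Union>i\<in>{i. Suc i < n}. swap_invariants S n i)"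

lemma swap_invariants_subset_free: "swap_invariants S n i \<subseteq> free_module (tree_gens S n)"
  by (auto simp: swap_invariants_def)

lemma swap_space_subset_free: "swap_space S n \<subseteq> free_module (tree_gens S n)"
  by (rule fun_span_least[OF free_module_submodule]) (use swap_invariants_subset_free in blast)

lemma swap_invariants_swap_space: "Suc i < n \<Longrightarrow> f \<in> swap_invariants S n i \<Longrightarrow> f \<in> swap_space S n"
  by (intro fun_span_gen) blast

lemma basis_vec_free: "x \<in> X \<Longrightarrow> basis_vec x \<in> free_module X"
  by (auto simp: basis_vec_def free_module_def)

lemma basis_pair_swap_invariant:
  assumes "arity S" "Suc i < n" "\<omega> \<in> edge_lists S n"
  shows "(\<lambda>x. basis_vec (gen S \<omega>) x + basis_vec (gen S (swap_nth i \<omega>)) x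
      :: 'k::{comm_ring,comm_monoid_mult}) \<in> swap_invariants S n i"
proof -
  have s: "swap_nth i \<nu> = \<omega> \<longleftrightarrow> \<nu> = swap_nth i \<omega>" "swap_nth i \<nu> = swap_nth i \<omega> \<longleftrightarrow> \<nu> = \<omega>"
    if "\<nu> \<in> edge_lists S n" for \<nu>
  proof -
    have "swap_nth i (swap_nth i \<nu>) = \<nu>" "swap_nth i (swap_nth i \<omega>) = \<omega>"
      using that assms(2,3) by (intro swap_nth_swap_nth; simp add: edge_lists_def)+
    then show "swap_nth i \<nu> = \<omega> \<longleftrightarrow> \<nu> = swap_nth i \<omega>" "swap_nth i \<nu> = swap_nth i \<omega> \<longleftrightarrow> \<nu> = \<omega>"
      by metis+
  qed
  have "basis_vec (gen S \<omega>) \<in> free_module (tree_gens S n)"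
    "basis_vec (gen S (swap_nth i \<omega>)) \<in> free_module (tree_gens S n)"
    using assms(3) swap_nth_edge_lists[OF assms(2,3)]
    by (simp_all add: basis_vec_free gen_mem_tree_gens[OF assms(1)])
  then show ?thesis
    unfolding swap_invariants_def mem_Collect_eq
    by (intro conjI ballI fun_submodule_add[OF free_module_submodule])
      (simp_all add: basis_vec_def s add.commute)
qed

lemma map_transpose_adjacent:
  assumes "distinct \<omega>" "Suc i < length \<omega>"
  shows "map (transpose (\<omega> ! i) (\<omega> ! Suc i)) \<omega> = swap_nth i \<omega>"
  using assms by (intro nth_equalityI)
    (auto simp: swap_nth_def nth_list_update transpose_def nth_eq_iff_index_eq)

text \<open>A transposition is odd, which turns the minus sign of the relator into a plus.\<close>

lemma adjacent_relator:
  assumes "arity S" "Suc i < n" "\<omega> \<in> edge_lists S n"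
  shows "(\<lambda>x. basis_vec (gen S \<omega>) x + basis_vec (gen S (swap_nth i \<omega>)) x)
    \<in> (sign_relators S n :: ('a tree \<times> 'a set list \<Rightarrow> 'k::{comm_ring,comm_monoid_mult}) set)"
proof -
  have w: "distinct \<omega>" "Suc i < length \<omega>" using assms by (auto simp: edge_lists_def)
  let ?s = "transpose (\<omega> ! i) (\<omega> ! Suc i)"
  have ne: "\<omega> ! i \<noteq> \<omega> ! Suc i" using w by (simp add: nth_eq_iff_index_eq)
  have p: "?s permutes set \<omega>" using w by (intro permutes_swap_id) auto
  have "((S, set \<omega>), \<omega>) \<in> tree_gens S n"
    using gen_mem_tree_gens[OF assms(1)] assms(3) by (simp add: gen_def)
  moreover have "gen S (swap_nth i \<omega>) = ((S, set \<omega>), map ?s \<omega>)"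
    unfolding map_transpose_adjacent[OF w] by (simp add: gen_def set_swap_nth[OF w(2)])
  moreover have "\<not> evenperm ?s" using ne by (simp add: evenperm_swap)
  ultimately show ?thesis
    unfolding sign_relators_def mem_Collect_eq gen_def[of S \<omega>]
    by (intro exI[of _ "(S, set \<omega>)"] exI[of _ \<omega>] exI[of _ ?s]) (use p in auto)
qed

text \<open>Induction on the size of the support, removing one orbit at a time. An orbit consists of
  two distinct orders with the same coefficient, so one multiple of one relator clears both.\<close>

lemma swap_invariant_in_span:
  fixes f :: "'a tree \<times> 'a set list \<Rightarrow> 'k::{comm_ring,comm_monoid_mult}"
  assumes S: "arity S" and i: "Suc i < n" and "f \<in> swap_invariants S n i"
  shows "f \<in> fun_span (sign_relators S n)"
  using assms(3)
proof (induction "card {\<omega> \<in> edge_lists S n. f (gen S \<omega>) \<noteq> 0}" arbitrary: f rule: less_induct)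
  case less
  have inv: "f (gen S (swap_nth i \<omega>)) = f (gen S \<omega>)" if "\<omega> \<in> edge_lists S n" for \<omega>
    using less.prems that by (simp add: swap_invariants_def)
  have fr: "f \<in> free_module (tree_gens S n)" using less.prems swap_invariants_subset_free by blast
  show ?case
  proof (cases "\<exists>\<omega>\<in>edge_lists S n. f (gen S \<omega>) \<noteq> 0")
    case False
    have "f = (\<lambda>_. 0)"
      by (rule free_module_tree_gens_eqI[OF S fr fun_submodule_zero[OF free_module_submodule]])
        (use False in blast)
    then show ?thesis by (simp add: fun_span_zero)
  next
    case True
    then obtain \<omega> where w: "\<omega> \<in> edge_lists S n" "f (gen S \<omega>) \<noteq> 0" by blast
    define r where "r = (\<lambda>x. basis_vec (gen S \<omega>) x + basis_vec (gen S (swap_nth i \<omega>)) x :: 'k)"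
    define c where "c = f (gen S \<omega>)"
    define g where "g = (\<lambda>x. f x - c * r x)"
    have r: "r \<in> swap_invariants S n i" "r \<in> sign_relators S n"
      unfolding r_def using basis_pair_swap_invariant[OF S i w(1)] adjacent_relator[OF S i w(1)] by blast+
    have ne: "swap_nth i \<omega> \<noteq> \<omega>"
      using w(1) i by (intro swap_nth_neq) (auto simp: edge_lists_def)
    have g: "g \<in> swap_invariants S n i"
    proof -
      have "g \<in> free_module (tree_gens S n)"
        unfolding g_def using r(1) fr swap_invariants_subset_free
        by (intro fun_submodule_diff[OF free_module_submodule] fun_submodule_smult[OF free_module_submodule]) blast+
      then show ?thesis using inv r(1) by (simp add: swap_invariants_def g_def)
    qed
    have rw: "r (gen S \<omega>) = 1" using ne by (simp add: r_def basis_vec_def)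
    have rz: "r (gen S \<nu>) = 0" if "\<nu> \<noteq> \<omega>" "\<nu> \<noteq> swap_nth i \<omega>" for \<nu>
      using that by (simp add: r_def basis_vec_def)
    have "{\<nu> \<in> edge_lists S n. g (gen S \<nu>) \<noteq> 0} \<subset> {\<nu> \<in> edge_lists S n. f (gen S \<nu>) \<noteq> 0}"
    proof
      show "{\<nu> \<in> edge_lists S n. g (gen S \<nu>) \<noteq> 0} \<subseteq> {\<nu> \<in> edge_lists S n. f (gen S \<nu>) \<noteq> 0}"
      proof (clarify)
        fix \<nu> assume n: "\<nu> \<in> edge_lists S n" "g (gen S \<nu>) \<noteq> 0" "f (gen S \<nu>) = 0"
        then have "\<nu> \<noteq> \<omega>" using w by blast
        moreover have "\<nu> \<noteq> swap_nth i \<omega>" using n inv[OF w(1)] w(2) by auto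
        ultimately show False using n rz by (simp add: g_def)
      qed
      have "g (gen S \<omega>) = 0" by (simp add: g_def rw c_def)
      then show "{\<nu> \<in> edge_lists S n. g (gen S \<nu>) \<noteq> 0} \<noteq> {\<nu> \<in> edge_lists S n. f (gen S \<nu>) \<noteq> 0}"
        using w by blast
    qed
    then have "g \<in> fun_span (sign_relators S n)"
      by (intro less.hyps[OF psubset_card_mono g]) (simp_all add: finite_edge_lists[OF S])
    then have "(\<lambda>x. g x + c * r x) \<in> fun_span (sign_relators S n)"
      by (rule fun_span_add[OF _ fun_span_smult[OF fun_span_gen[OF r(2)]]])
    then show ?thesis by (simp add: g_def)
  qed
qed

text \<open>The entry \<open>a\<close> is moved one place to the right, exchanged with
  \<open>b\<close> by induction, and then \<open>b\<close> is moved one place to the left. The three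
  sums enter with alternating signs, so the outer terms survive with the same sign.\<close>

lemma basis_exchange:
  assumes S: "arity S" and "xs @ a # ys @ b # zs \<in> edge_lists S n"
  shows "(\<lambda>x. basis_vec (gen S (xs @ a # ys @ b # zs)) x
      + basis_vec (gen S (xs @ b # ys @ a # zs)) x :: 'k::{comm_ring,comm_monoid_mult}) \<in> swap_space S n"
  using assms(2)
proof (induction ys arbitrary: xs)
  case Nil
  have i: "Suc (length xs) < n" using Nil by (auto simp: edge_lists_def)
  show ?case
    using swap_invariants_swap_space[OF i basis_pair_swap_invariant[OF S i Nil]]
    by (simp add: swap_nth_append)
next
  case (Cons y ys)
  have i: "Suc (length xs) < n" using Cons.prems by (auto simp: edge_lists_def)
  have m1: "xs @ y # a # ys @ b # zs \<in> edge_lists S n"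
    using swap_nth_edge_lists[OF i Cons.prems] by (simp add: swap_nth_append)
  have m2: "xs @ y # b # ys @ a # zs \<in> edge_lists S n"
    using m1 by (auto simp: edge_lists_def insert_commute)
  have 1: "(\<lambda>x. basis_vec (gen S (xs @ a # y # ys @ b # zs)) x
      + basis_vec (gen S (xs @ y # a # ys @ b # zs)) x :: 'k) \<in> swap_space S n"
    using swap_invariants_swap_space[OF i basis_pair_swap_invariant[OF S i Cons.prems]]
    by (simp add: swap_nth_append)
  have 2: "(\<lambda>x. basis_vec (gen S (xs @ y # a # ys @ b # zs)) x
      + basis_vec (gen S (xs @ y # b # ys @ a # zs)) x :: 'k) \<in> swap_space S n"
    using Cons.IH[of "xs @ [y]"] m1 by simp
  have 3: "(\<lambda>x. basis_vec (gen S (xs @ y # b # ys @ a # zs)) x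
      + basis_vec (gen S (xs @ b # y # ys @ a # zs)) x :: 'k) \<in> swap_space S n"
    using swap_invariants_swap_space[OF i basis_pair_swap_invariant[OF S i m2]]
    by (simp add: swap_nth_append)
  have "(\<lambda>x. (basis_vec (gen S (xs @ a # y # ys @ b # zs)) x
      + basis_vec (gen S (xs @ y # a # ys @ b # zs)) x)
      - (basis_vec (gen S (xs @ y # a # ys @ b # zs)) x
      + basis_vec (gen S (xs @ y # b # ys @ a # zs)) x)
      + (basis_vec (gen S (xs @ y # b # ys @ a # zs)) x
      + basis_vec (gen S (xs @ b # y # ys @ a # zs)) x) :: 'k) \<in> swap_space S n"
    using fun_submodule_add[OF fun_span_submodule fun_submodule_diff[OF fun_span_submodule 1 2] 3] .
  then show ?case by (simp add: algebra_simps)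
qed

lemma map_transpose_exchange:
  assumes "distinct (xs @ a # ys @ b # zs)"
  shows "map (transpose a b) (xs @ a # ys @ b # zs) = xs @ b # ys @ a # zs"
proof -
  have "map (transpose a b) ws = ws" if "a \<notin> set ws" "b \<notin> set ws" for ws
    using that by (intro map_idI) (auto simp: transpose_def)
  then show ?thesis using assms by simp
qed

lemma basis_transpose:
  assumes S: "arity S" and w: "\<omega> \<in> edge_lists S n" and ab: "a \<in> set \<omega>" "b \<in> set \<omega>" "a \<noteq> b"
  shows "(\<lambda>x. basis_vec (gen S \<omega>) x + basis_vec (gen S (map (transpose a b) \<omega>)) x
      :: 'k::{comm_ring,comm_monoid_mult}) \<in> swap_space S n"
proof -
  obtain us vs where uv: "\<omega> = us @ a # vs" using ab(1) by (meson split_list)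
  have d: "distinct \<omega>" using w by (simp add: edge_lists_def)
  consider ys zs where "\<omega> = us @ a # ys @ b # zs" | xs ys where "\<omega> = xs @ b # ys @ a # vs"
  proof (cases "b \<in> set vs")
    case True
    then obtain ys zs where "vs = ys @ b # zs" by (meson split_list)
    then show ?thesis using that(1) uv by simp
  next
    case False
    then have "b \<in> set us" using ab uv by auto
    then obtain xs ys where "us = xs @ b # ys" by (meson split_list)
    then show ?thesis using that(2) uv by simp
  qed
  then show ?thesis
  proof cases
    case 1
    then show ?thesis
      using basis_exchange[OF S w[unfolded 1]] map_transpose_exchange[OF d[unfolded 1]] by simp
  next
    case 2
    then show ?thesis
      using basis_exchange[OF S w[unfolded 2]] map_transpose_exchange[OF d[unfolded 2]]
      by (simp add: transpose_commute)
  qed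
qed

text \<open>A permutation is built up from transpositions, each of which flips the parity and
  contributes one exchange of entries; the intermediate orders telescope.\<close>

lemma sign_relators_swap_space:
  assumes S: "arity S"
  shows "(sign_relators S n :: ('a tree \<times> 'a set list \<Rightarrow> 'k::{comm_ring,comm_monoid_mult}) set)
    \<subseteq> swap_space S n"
proof
  fix h :: "'a tree \<times> 'a set list \<Rightarrow> 'k"
  assume "h \<in> sign_relators S n"
  then obtain t \<omega> \<sigma> where h: "h = (\<lambda>x. basis_vec (t, \<omega>) x
      - (if evenperm \<sigma> then 1 else - 1) * basis_vec (t, map \<sigma> \<omega>) x)"
    and t: "(t, \<omega>) \<in> tree_gens S n" and s: "\<sigma> permutes edges t"
    by (auto simp: sign_relators_def)
  obtain \<omega>' where "(t, \<omega>) = gen S \<omega>'" "\<omega>' \<in> edge_lists S n"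
    using t tree_gens_eq[OF S] by blast
  then have tw: "t = (S, set \<omega>)" and w: "\<omega> \<in> edge_lists S n" by (auto simp: gen_def)
  have "\<sigma> permutes set \<omega>" using s tw by simp
  from this finite_set have "(\<lambda>x. basis_vec (gen S \<omega>) x
      - (if evenperm \<sigma> then 1 else - 1) * basis_vec (gen S (map \<sigma> \<omega>)) x :: 'k) \<in> swap_space S n"
  proof (induction \<sigma> rule: permutes_induct)
    case id
    show ?case by (simp add: fun_span_zero)
  next
    case (swap a b p)
    let ?s = "if evenperm p then 1 else - 1 :: 'k"
    have pw: "set (map p \<omega>) = set \<omega>" using permutes_image[OF swap.hyps(4)] by simp
    have mw: "map p \<omega> \<in> edge_lists S n"
      using w pw inj_on_subset[OF permutes_inj[OF swap.hyps(4)] subset_UNIV]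
      by (simp add: edge_lists_def distinct_map)
    have pp: "permutation p" using swap.hyps(4) permutation_permutes by blast
    have "evenperm (transpose a b \<circ> p) \<longleftrightarrow> \<not> evenperm p"
      using evenperm_comp[OF permutation_swap_id pp, of a b] swap.hyps(3) by (simp add: evenperm_swap)
    then have sg: "(if evenperm (transpose a b \<circ> p) then 1 else - 1 :: 'k) = - ?s" by simp
    have "(\<lambda>x. (basis_vec (gen S \<omega>) x - ?s * basis_vec (gen S (map p \<omega>)) x)
        + ?s * (basis_vec (gen S (map p \<omega>)) x + basis_vec (gen S (map (transpose a b) (map p \<omega>))) x))
        \<in> swap_space S n"
      by (intro fun_submodule_add[OF fun_span_submodule] fun_submodule_smult[OF fun_span_submodule]
          swap.IH basis_transpose[OF S mw]) (use swap.hyps(1,2,3) pw in auto)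
    moreover have "(a0 - s * b0) + s * (b0 + c0) = a0 - (- s) * c0" for a0 b0 c0 s :: 'k
      by (simp add: algebra_simps)
    ultimately show ?case unfolding sg by (simp only: map_map)
  qed
  moreover have "gen S (map \<sigma> \<omega>) = (t, map \<sigma> \<omega>)"
    using permutes_image[OF s] tw by (simp add: gen_def)
  ultimately show "h \<in> swap_space S n" using h tw by (simp add: gen_def)
qed

lemma span_sign_relators:
  assumes S: "arity S"
  shows "fun_span (sign_relators S n) =
    (swap_space S n :: ('a tree \<times> 'a set list \<Rightarrow> 'k::{comm_ring,comm_monoid_mult}) set)"
proof
  show "fun_span (sign_relators S n) \<subseteq> (swap_space S n :: ('a tree \<times> 'a set list \<Rightarrow> 'k) set)"
    by (rule fun_span_least[OF fun_span_submodule sign_relators_swap_space[OF S]])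
  show "swap_space S n \<subseteq> (fun_span (sign_relators S n) :: ('a tree \<times> 'a set list \<Rightarrow> 'k) set)"
    by (rule fun_span_least[OF fun_span_submodule]) (use swap_invariant_in_span[OF S] in blast)
qed

text \<open>The sum is invariant under the swap, because the swap is an involution. In use:
  precomposing with an adjacent swap acts as -1 modulo the relators.\<close>

lemma swap_plus_in_swap_space:
  assumes S: "arity S" and f: "f \<in> free_module (tree_gens S n)" and g: "g \<in> free_module (tree_gens S n)"
    and i: "Suc i < n" and fg: "\<And>\<omega>. \<omega> \<in> edge_lists S n \<Longrightarrow> g (gen S \<omega>) = f (gen S (swap_nth i \<omega>))"
  shows "(\<lambda>x. f x + g x) \<in> swap_space S n"
proof (rule swap_invariants_swap_space[OF i])
  have "f (gen S (swap_nth i \<omega>)) + g (gen S (swap_nth i \<omega>)) = f (gen S \<omega>) + g (gen S \<omega>)"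
    if w: "\<omega> \<in> edge_lists S n" for \<omega>
  proof -
    have "swap_nth i (swap_nth i \<omega>) = \<omega>"
      using w i by (intro swap_nth_swap_nth) (simp add: edge_lists_def)
    then show ?thesis using fg[OF w] fg[OF swap_nth_edge_lists[OF i w]] by (simp add: add.commute)
  qed
  then show "(\<lambda>x. f x + g x) \<in> swap_invariants S n i"
    using fun_submodule_add[OF free_module_submodule f g] by (simp add: swap_invariants_def)
qed

section \<open>The operad of trees\<close>

abbreviation merge_list :: "'a \<Rightarrow> 'a set \<Rightarrow> 'a set list \<Rightarrow> 'a set list" where
  "merge_list a B \<equiv> map ((`) (merge a B))"

text \<open>A bridge stays a bridge when the edge set shrinks, and connectedness is part of
  \<open>spans\<close>.\<close>

lemma subtree:
  assumes t: "is_tree (V, E)" and D: "D \<subseteq> E" "spans D B"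
  shows "is_tree (B, D)"
proof -
  have "D \<subseteq> pairs B"
  proof
    fix e assume e: "e \<in> D"
    then have eE: "e \<in> E" using D by blast
    obtain u v where "e = {u, v}" "u \<noteq> v" by (rule tree_edgeE[OF t eE])
    moreover have "e \<subseteq> B" using D(2) e by (auto simp: spans_def)
    ultimately show "e \<in> pairs B" unfolding pairs_def by blast
  qed
  moreover have "(u, v) \<notin> conn (D - {{u, v}})" if "{u, v} \<in> D" for u v
    using tree_edge_of_conn[OF t, of "D - {{u, v}}" u v] that D(1) by blast
  ultimately show ?thesis using D(2) by (simp add: is_tree_iff spans_def)
qed

lemma tree_spans: "is_tree (B, D) \<Longrightarrow> spans D B"
  using tree_edges_Pow[of B D] tree_connected[of B D] by (simp add: spans_def)

lemma set_take_drop_distinct: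
  assumes "distinct \<omega>"
  shows "set (take m \<omega>) = set \<omega> - set (drop m \<omega>)"
proof -
  have d: "distinct (take m \<omega> @ drop m \<omega>)" using assms by simp
  have s: "set \<omega> = set (take m \<omega>) \<union> set (drop m \<omega>)" by (metis append_take_drop_id set_append)
  show ?thesis using d unfolding s distinct_append by blast
qed

lemma composableD:
  assumes "composable A a B"
  shows "finite A" "finite B" "B \<noteq> {}" "A \<inter> B = {}" "a \<notin> A"
  using assms by (auto simp: composable_def arity_def)

text \<open>Cutting at position \<open>m\<close> undoes the concatenation of orders: the suffix
  orders the subtree on \<open>B\<close>, and the prefix, after merging \<open>B\<close>, orders the
  contracted tree.\<close>

lemma split_edge_list:
  assumes c: "composable A a B" and w: "\<omega> \<in> edge_lists (A \<union> B) (m + n)"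
    and s: "spans (set (drop m \<omega>)) B"
  shows "merge_list a B (take m \<omega>) \<in> edge_lists (insert a A) m" "drop m \<omega> \<in> edge_lists B n"
proof -
  note C = composableD[OF c]
  have W: "distinct \<omega>" "is_tree (A \<union> B, set \<omega>)" "length \<omega> = m + n"
    using w by (auto simp: edge_lists_def)
  have D: "set (drop m \<omega>) \<subseteq> set \<omega>" by (rule set_drop_subset)
  have fib: "fibres (A \<union> B) (set (drop m \<omega>)) (merge a B)" by (rule merge_fibres[OF s C(5,4)])
  have "is_tree (insert a A, (`) (merge a B) ` set (take m \<omega>))"
    using contraction_tree[OF W(2) D fib]
    by (simp add: merge_image[OF C(3,4)] set_take_drop_distinct[OF W(1)])
  moreover have "inj_on ((`) (merge a B)) (set (take m \<omega>))"
    using contraction_inj[OF W(2) D fib] by (simp add: set_take_drop_distinct[OF W(1)])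
  ultimately show "merge_list a B (take m \<omega>) \<in> edge_lists (insert a A) m"
    using W by (simp add: edge_lists_def distinct_map)
  show "drop m \<omega> \<in> edge_lists B n"
    using subtree[OF W(2) D s] W by (simp add: edge_lists_def)
qed

text \<open>Replaces the inverse edge bijection in \<open>graftings\<close> by a condition on a
  single edge list. The bijection exists because contracting the subtree is injective on the other
  edges.\<close>

lemma graftings_gen:
  assumes c: "composable A a B" and w1: "\<omega>1 \<in> edge_lists (insert a A) m" and w2: "\<omega>2 \<in> edge_lists B n"
  shows "graftings A a B (gen (insert a A) \<omega>1) (gen B \<omega>2) = {gen (A \<union> B) \<omega> |\<omega>.
    \<omega> \<in> edge_lists (A \<union> B) (m + n) \<and> spans (set (drop m \<omega>)) B
    \<and> merge_list a B (take m \<omega>) = \<omega>1 \<and> drop m \<omega> = \<omega>2}" (is "_ = ?R")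
proof -
  note C = composableD[OF c]
  let ?h = "(`) (merge a B)"
  have mrg: "(\<lambda>x. if x \<in> B then a else x) = merge a B" by (simp add: fun_eq_iff merge_def)
  have W1: "distinct \<omega>1" "length \<omega>1 = m" using w1 by (auto simp: edge_lists_def)
  have W2: "distinct \<omega>2" "length \<omega>2 = n" "is_tree (B, set \<omega>2)" using w2 by (auto simp: edge_lists_def)
  have s2: "spans (set \<omega>2) B" by (rule tree_spans[OF W2(3)])
  have G: "graftings A a B (gen (insert a A) \<omega>1) (gen B \<omega>2) =
      {((A \<union> B, E), map (inv_into (E - set \<omega>2) ?h) \<omega>1 @ \<omega>2) |E.
        is_tree (A \<union> B, E) \<and> set \<omega>2 \<subseteq> E \<and> ?h ` (E - set \<omega>2) = set \<omega>1}"
  proof -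
    have "map_tree (merge a B) (A \<union> B, E) = (insert a A, ?h ` E)" for E
      by (simp add: map_tree_def merge_image[OF C(3,4)])
    then show ?thesis
      unfolding graftings_def gen_def mrg Let_def labeled_trees_def by fastforce
  qed
  have fib: "fibres (A \<union> B) (set \<omega>2) (merge a B)" by (rule merge_fibres[OF s2 C(5,4)])
  show ?thesis
    unfolding G
  proof (intro equalityI subsetI)
    fix z assume "z \<in> {((A \<union> B, E), map (inv_into (E - set \<omega>2) ?h) \<omega>1 @ \<omega>2) |E.
        is_tree (A \<union> B, E) \<and> set \<omega>2 \<subseteq> E \<and> ?h ` (E - set \<omega>2) = set \<omega>1}"
    then obtain E where E: "is_tree (A \<union> B, E)" "set \<omega>2 \<subseteq> E" "?h ` (E - set \<omega>2) = set \<omega>1"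
      and z: "z = ((A \<union> B, E), map (inv_into (E - set \<omega>2) ?h) \<omega>1 @ \<omega>2)" by blast
    define \<nu> where "\<nu> = map (inv_into (E - set \<omega>2) ?h) \<omega>1"
    have inj: "inj_on ?h (E - set \<omega>2)" by (rule contraction_inj[OF E(1,2) fib])
    have sn: "set \<nu> = E - set \<omega>2"
      unfolding \<nu>_def set_map E(3)[symmetric] by (rule inv_into_image_cancel[OF inj subset_refl])
    have dn: "distinct \<nu>"
      unfolding \<nu>_def distinct_map using W1(1) E(3) by (simp add: inj_on_inv_into)
    have hn: "map ?h \<nu> = \<omega>1"
      unfolding \<nu>_def map_map using E(3) by (intro map_idI) (simp add: f_inv_into_f)
    have ln: "length \<nu> = m" by (simp add: \<nu>_def W1(2))
    have "\<nu> @ \<omega>2 \<in> edge_lists (A \<union> B) (m + n)"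
    proof -
      have "set (\<nu> @ \<omega>2) = E" using sn E(2) by auto
      then show ?thesis using E(1) dn W2 sn ln unfolding edge_lists_def by auto
    qed
    moreover have "z = gen (A \<union> B) (\<nu> @ \<omega>2)"
      using z sn E(2) by (auto simp: gen_def \<nu>_def[symmetric])
    moreover have "take m (\<nu> @ \<omega>2) = \<nu>" "drop m (\<nu> @ \<omega>2) = \<omega>2" using ln by simp_all
    ultimately show "z \<in> ?R" using s2 hn by (intro CollectI exI[of _ "\<nu> @ \<omega>2"]) simp
  next
    fix z assume "z \<in> ?R"
    then obtain \<omega> where z: "z = gen (A \<union> B) \<omega>" and w: "\<omega> \<in> edge_lists (A \<union> B) (m + n)"
      and h: "merge_list a B (take m \<omega>) = \<omega>1" "drop m \<omega> = \<omega>2" by blast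
    have W: "distinct \<omega>" "is_tree (A \<union> B, set \<omega>)" using w by (auto simp: edge_lists_def)
    have sub: "set \<omega>2 \<subseteq> set \<omega>" using h(2) set_drop_subset by metis
    have st: "set (take m \<omega>) = set \<omega> - set \<omega>2" using set_take_drop_distinct[OF W(1)] h(2) by simp
    have inj: "inj_on ?h (set \<omega> - set \<omega>2)" by (rule contraction_inj[OF W(2) sub fib])
    have "map (inv_into (set \<omega> - set \<omega>2) ?h) \<omega>1 = take m \<omega>"
      unfolding h(1)[symmetric] map_map
      by (intro map_idI) (simp add: st inv_into_f_f[OF inj])
    then have "\<omega> = map (inv_into (set \<omega> - set \<omega>2) ?h) \<omega>1 @ \<omega>2"
      using h(2) by (metis append_take_drop_id)
    moreover have "?h ` (set \<omega> - set \<omega>2) = set \<omega>1"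
      unfolding st[symmetric] h(1)[symmetric] by simp
    ultimately show "z \<in> {((A \<union> B, E), map (inv_into (E - set \<omega>2) ?h) \<omega>1 @ \<omega>2) |E.
        is_tree (A \<union> B, E) \<and> set \<omega>2 \<subseteq> E \<and> ?h ` (E - set \<omega>2) = set \<omega>1}"
      unfolding z gen_def using W(2) sub by (intro CollectI exI[of _ "set \<omega>"]) simp
  qed
qed

lemma tree_comp_free:
  assumes c: "composable A a B"
  shows "tree_comp A a B m n f g \<in> free_module (tree_gens (A \<union> B) (m + n))"
proof -
  note ar = arity_composable[OF c]
  have "z \<notin> graftings A a B x y" if "z \<notin> tree_gens (A \<union> B) (m + n)"
    "x \<in> tree_gens (insert a A) m" "y \<in> tree_gens B n" for x y z
    using that graftings_gen[OF c] by (auto simp: tree_gens_eq[OF ar(1)] tree_gens_eq[OF ar(2)] tree_gens_eq[OF ar(3)])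
  then show ?thesis
    unfolding free_module_def tree_comp_def mem_Collect_eq
    by (intro allI impI sum.neutral ballI) simp
qed

text \<open>A generator of the target determines both of its factors, so at most one term of the
  double sum survives. Equivariance, associativity and the unit laws are verified from this
  formula.\<close>

lemma tree_comp_gen:
  fixes f g :: "'a tree \<times> 'a set list \<Rightarrow> 'k::{comm_ring,comm_monoid_mult}"
  assumes c: "composable A a B" and w: "\<omega> \<in> edge_lists (A \<union> B) (m + n)"
  shows "tree_comp A a B m n f g (gen (A \<union> B) \<omega>) = (if spans (set (drop m \<omega>)) B
    then f (gen (insert a A) (merge_list a B (take m \<omega>))) * g (gen B (drop m \<omega>)) else 0)"
proof -
  note ar = arity_composable[OF c]
  let ?x = "gen (insert a A) (merge_list a B (take m \<omega>))" and ?y = "gen B (drop m \<omega>)"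
  have *: "gen (A \<union> B) \<omega> \<in> graftings A a B x y \<longleftrightarrow> spans (set (drop m \<omega>)) B \<and> x = ?x \<and> y = ?y"
    if xy: "x \<in> tree_gens (insert a A) m" "y \<in> tree_gens B n" for x y
  proof -
    obtain \<omega>1 \<omega>2 where x: "x = gen (insert a A) \<omega>1" "\<omega>1 \<in> edge_lists (insert a A) m"
      and y: "y = gen B \<omega>2" "\<omega>2 \<in> edge_lists B n"
      using xy by (auto simp: tree_gens_eq[OF ar(1)] tree_gens_eq[OF ar(3)])
    show ?thesis unfolding x(1) y(1) graftings_gen[OF c x(2) y(2)] using w by auto
  qed
  show ?thesis
  proof (cases "spans (set (drop m \<omega>)) B")
    case True
    have xy: "?x \<in> tree_gens (insert a A) m" "?y \<in> tree_gens B n"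
      using split_edge_list[OF c w True] by (simp_all add: gen_mem_tree_gens ar)
    have "tree_comp A a B m n f g (gen (A \<union> B) \<omega>)
      = (\<Sum>x\<in>tree_gens (insert a A) m. \<Sum>y\<in>tree_gens B n.
          if y = ?y then (if x = ?x then f x * g y else 0) else 0)"
      unfolding tree_comp_def by (intro sum.cong refl) (simp add: * True)
    also have "\<dots> = (\<Sum>x\<in>tree_gens (insert a A) m. if x = ?x then f x * g ?y else 0)"
      using xy by (intro sum.cong refl) (simp add: finite_tree_gens[OF ar(1)])
    also have "\<dots> = f ?x * g ?y"
      using xy by (simp add: finite_tree_gens[OF ar(3)])
    finally show ?thesis using True by simp
  next
    case False
    then show ?thesis by (simp add: tree_comp_def *)
  qed
qed

section \<open>Relabelling of edge lists and trees\<close>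

lemma relabel_edge_list:
  assumes "inj_on \<sigma> S" "\<omega> \<in> edge_lists S n"
  shows "map ((`) \<sigma>) \<omega> \<in> edge_lists (\<sigma> ` S) n"
proof -
  have t: "is_tree (S, set \<omega>)" using assms(2) by (simp add: edge_lists_def)
  have "inj_on ((`) \<sigma>) (set \<omega>)"
    using contraction_inj[OF t _ fibres_inj[OF assms(1)]] by simp
  moreover have "is_tree (\<sigma> ` S, (`) \<sigma> ` set \<omega>)"
    using contraction_tree[OF t _ fibres_inj[OF assms(1)]] by simp
  ultimately show ?thesis using assms(2) by (simp add: edge_lists_def distinct_map)
qed

lemma map_image_comp_id:
  assumes "set \<omega> \<subseteq> Pow S" "\<And>x. x \<in> S \<Longrightarrow> g x = x"
  shows "map ((`) g) \<omega> = \<omega>"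
proof (rule map_idI)
  fix e assume "e \<in> set \<omega>"
  then have "e \<subseteq> S" using assms(1) by blast
  then have "g ` e = id ` e" using assms(2) by (intro image_cong) auto
  then show "g ` e = e" by simp
qed

lemma edge_lists_Pow: "\<omega> \<in> edge_lists S n \<Longrightarrow> set \<omega> \<subseteq> Pow S"
  using tree_edges_Pow by (auto simp: edge_lists_def)

lemma tree_relabel_free:
  assumes S: "arity S" and \<sigma>: "inj_on \<sigma> S"
  shows "tree_relabel S \<sigma> n f \<in> free_module (tree_gens (\<sigma> ` S) n)"
proof -
  have ar: "arity (\<sigma> ` S)" using S by (simp add: arity_def)
  have "z \<noteq> (map_tree \<sigma> t, map ((`) \<sigma>) \<omega>)"
    if zn: "z \<notin> tree_gens (\<sigma> ` S) n" and tn: "(t, \<omega>) \<in> tree_gens S n" for z t \<omega>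
  proof
    assume z: "z = (map_tree \<sigma> t, map ((`) \<sigma>) \<omega>)"
    obtain \<nu> where "\<nu> \<in> edge_lists S n" "(t, \<omega>) = gen S \<nu>"
      using tn by (auto simp: tree_gens_eq[OF S])
    then have "z = gen (\<sigma> ` S) (map ((`) \<sigma>) \<nu>)" "map ((`) \<sigma>) \<nu> \<in> edge_lists (\<sigma> ` S) n"
      using relabel_edge_list[OF \<sigma>] z by (auto simp: gen_def map_tree_def)
    then show False using zn by (simp add: gen_mem_tree_gens[OF ar])
  qed
  then have "tree_relabel S \<sigma> n f z = 0" if "z \<notin> tree_gens (\<sigma> ` S) n" for z
    unfolding tree_relabel_def using that
    by (intro sum.neutral ballI) (simp add: basis_vec_def case_prod_beta)
  then show ?thesis by (simp add: free_module_def del: split_paired_All)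
qed

lemma tree_relabel_gen:
  fixes f :: "'a tree \<times> 'a set list \<Rightarrow> 'k::{comm_ring,comm_monoid_mult}"
  assumes S: "arity S" and \<sigma>: "inj_on \<sigma> S" and w: "\<omega> \<in> edge_lists S n"
  shows "tree_relabel S \<sigma> n f (gen (\<sigma> ` S) (map ((`) \<sigma>) \<omega>)) = f (gen S \<omega>)"
proof -
  have g: "gen S \<omega> \<in> tree_gens S n" using w by (simp add: gen_mem_tree_gens[OF S])
  have *: "(map_tree \<sigma> t, map ((`) \<sigma>) \<nu>) = gen (\<sigma> ` S) (map ((`) \<sigma>) \<omega>) \<longleftrightarrow> (t, \<nu>) = gen S \<omega>"
    if tn: "(t, \<nu>) \<in> tree_gens S n" for t \<nu>
  proof -
    have t: "t = (S, set \<nu>)" and n: "\<nu> \<in> edge_lists S n"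
      using tn by (auto simp: tree_gens_eq[OF S] gen_def)
    have "\<nu> = \<omega>" if e: "map ((`) \<sigma>) \<nu> = map ((`) \<sigma>) \<omega>"
    proof -
      have "map ((`) (inv_into S \<sigma>)) (map ((`) \<sigma>) \<mu>) = \<mu>" if "\<mu> \<in> edge_lists S n" for \<mu>
        using map_image_comp_id[OF edge_lists_Pow[OF that], of "inv_into S \<sigma> \<circ> \<sigma>"]
          inv_into_f_f[OF \<sigma>] by (simp add: image_comp comp_def)
      then show ?thesis using e n w by metis
    qed
    then show ?thesis unfolding t by (auto simp: gen_def map_tree_def)
  qed
  have "tree_relabel S \<sigma> n f (gen (\<sigma> ` S) (map ((`) \<sigma>) \<omega>))
    = (\<Sum>x\<in>tree_gens S n. if x = gen S \<omega> then f x else 0)"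
    unfolding tree_relabel_def
  proof (intro sum.cong refl)
    fix x assume x: "x \<in> tree_gens S n"
    obtain t \<nu> where xt: "x = (t, \<nu>)" by (cases x)
    show "(case x of (t, \<omega>') \<Rightarrow> f (t, \<omega>')
        * basis_vec (map_tree \<sigma> t, map ((`) \<sigma>) \<omega>') (gen (\<sigma> ` S) (map ((`) \<sigma>) \<omega>)))
      = (if x = gen S \<omega> then f x else 0)"
      using *[of t \<nu>] x unfolding xt by (auto simp: basis_vec_def eq_commute)
  qed
  also have "\<dots> = f (gen S \<omega>)" using g by (simp add: finite_tree_gens[OF S])
  finally show ?thesis .
qed

lemma edge_lists_image_cases:
  assumes \<sigma>: "inj_on \<sigma> S" and w: "\<omega> \<in> edge_lists (\<sigma> ` S) n"
  obtains \<nu> where "\<nu> \<in> edge_lists S n" "\<omega> = map ((`) \<sigma>) \<nu>"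
proof
  let ?i = "inv_into S \<sigma>"
  have im: "?i ` \<sigma> ` S = S" by (simp add: inv_into_image_cancel[OF \<sigma>])
  show "map ((`) ?i) \<omega> \<in> edge_lists S n"
    using relabel_edge_list[OF inj_on_inv_into[OF subset_refl] w] unfolding im .
  show "\<omega> = map ((`) \<sigma>) (map ((`) ?i) \<omega>)"
    using map_image_comp_id[OF edge_lists_Pow[OF w], of "\<sigma> \<circ> ?i"]
    by (simp add: f_inv_into_f image_comp comp_def)
qed

lemma tree_relabel_eqI:
  assumes S: "arity S" and \<sigma>: "inj_on \<sigma> S" and g: "g \<in> free_module (tree_gens (\<sigma> ` S) n)"
    and eq: "\<And>\<omega>. \<omega> \<in> edge_lists S n \<Longrightarrow> g (gen (\<sigma> ` S) (map ((`) \<sigma>) \<omega>)) = f (gen S \<omega>)"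
  shows "tree_relabel S \<sigma> n f = g"
proof (rule free_module_tree_gens_eqI[OF _ tree_relabel_free[OF S \<sigma>] g])
  show "arity (\<sigma> ` S)" using S by (simp add: arity_def)
  fix \<omega> assume "\<omega> \<in> edge_lists (\<sigma> ` S) n"
  then obtain \<nu> where "\<nu> \<in> edge_lists S n" "\<omega> = map ((`) \<sigma>) \<nu>" by (rule edge_lists_image_cases[OF \<sigma>])
  then show "tree_relabel S \<sigma> n f (gen (\<sigma> ` S) \<omega>) = g (gen (\<sigma> ` S) \<omega>)"
    by (simp add: tree_relabel_gen[OF S \<sigma>] eq)
qed

section \<open>Linearity and compatibility with the sign relators\<close>

lemma tree_relabel_lin:
  "tree_relabel S \<sigma> n (\<lambda>x. f x + g x) = (\<lambda>z. tree_relabel S \<sigma> n f z + tree_relabel S \<sigma> n g z)"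
  "tree_relabel S \<sigma> n (\<lambda>x. f x - g x) = (\<lambda>z. tree_relabel S \<sigma> n f z - tree_relabel S \<sigma> n g z)"
  "tree_relabel S \<sigma> n (\<lambda>x. c * f x) = (\<lambda>z. c * tree_relabel S \<sigma> n f z)"
  "tree_relabel S \<sigma> n (\<lambda>_. 0) = (\<lambda>_. 0)"
  unfolding tree_relabel_def
  by (auto simp: case_prod_beta distrib_right left_diff_distrib sum.distrib sum_subtractf
      sum_distrib_left mult.assoc)

lemma tree_comp_lin_left:
  "tree_comp A a B m n (\<lambda>x. f x + f' x) g = (\<lambda>z. tree_comp A a B m n f g z + tree_comp A a B m n f' g z)"
  "tree_comp A a B m n (\<lambda>x. f x - f' x) g = (\<lambda>z. tree_comp A a B m n f g z - tree_comp A a B m n f' g z)"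
  "tree_comp A a B m n (\<lambda>x. c * f x) g = (\<lambda>z. c * tree_comp A a B m n f g z)"
  "tree_comp A a B m n (\<lambda>_. 0) g = (\<lambda>_. 0)"
  unfolding tree_comp_def
  by (auto simp: distrib_right left_diff_distrib sum.distrib sum_subtractf sum_distrib_left mult.assoc)

lemma tree_comp_lin_right:
  "tree_comp A a B m n f (\<lambda>x. g x + g' x) = (\<lambda>z. tree_comp A a B m n f g z + tree_comp A a B m n f g' z)"
  "tree_comp A a B m n f (\<lambda>x. g x - g' x) = (\<lambda>z. tree_comp A a B m n f g z - tree_comp A a B m n f g' z)"
  "tree_comp A a B m n f (\<lambda>x. c * g x) = (\<lambda>z. c * tree_comp A a B m n f g z)"
  "tree_comp A a B m n f (\<lambda>_. 0) = (\<lambda>_. 0)"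
  unfolding tree_comp_def
  by (auto simp: distrib_right distrib_left right_diff_distrib left_diff_distrib sum.distrib sum_subtractf
      sum_distrib_left mult.assoc mult.left_commute)

text \<open>To see that a linear operation descends to classes it is enough to look at functions
  invariant under a single swap. The target \<open>Z\<close> is a swap space or, in the comparison
  with cohomology, a module of coboundaries.\<close>

lemma linear_image_swap_space:
  assumes f: "f \<in> swap_space S n" and Z: "fun_submodule Z"
    and h: "h (\<lambda>_. 0) = (\<lambda>_. 0)" "\<And>f g. h (\<lambda>x. f x + g x) = (\<lambda>z. h f z + h g z)"
      "\<And>c f. h (\<lambda>x. c * f x) = (\<lambda>z. c * h f z)"
    and gens: "\<And>i f. Suc i < n \<Longrightarrow> f \<in> swap_invariants S n i \<Longrightarrow> h f \<in> Z"
  shows "h f \<in> Z"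
  using f by induction (use h gens fun_submoduleD[OF Z] in auto)

lemma tree_relabel_swap_space:
  assumes S: "arity S" and \<sigma>: "inj_on \<sigma> S" and f: "f \<in> swap_space S n"
  shows "tree_relabel S \<sigma> n f \<in> swap_space (\<sigma> ` S) n"
proof (rule linear_image_swap_space[OF f fun_span_submodule tree_relabel_lin(4,1,3)])
  fix i and f :: "'a tree \<times> 'a set list \<Rightarrow> 'b"
  assume i: "Suc i < n" and f: "f \<in> swap_invariants S n i"
  show "tree_relabel S \<sigma> n f \<in> swap_space (\<sigma> ` S) n"
  proof (rule swap_invariants_swap_space[OF i])
    have "tree_relabel S \<sigma> n f (gen (\<sigma> ` S) (swap_nth i \<omega>)) = tree_relabel S \<sigma> n f (gen (\<sigma> ` S) \<omega>)"
      if w: "\<omega> \<in> edge_lists (\<sigma> ` S) n" for \<omega>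
    proof -
      obtain \<nu> where n: "\<nu> \<in> edge_lists S n" "\<omega> = map ((`) \<sigma>) \<nu>"
        using w by (rule edge_lists_image_cases[OF \<sigma>])
      have "swap_nth i \<omega> = map ((`) \<sigma>) (swap_nth i \<nu>)"
        using n i by (simp add: map_swap_nth edge_lists_def)
      then show ?thesis
        using n f swap_nth_edge_lists[OF i n(1)]
        by (simp add: tree_relabel_gen[OF S \<sigma>] swap_invariants_def)
    qed
    then show "tree_relabel S \<sigma> n f \<in> swap_invariants (\<sigma> ` S) n i"
      using tree_relabel_free[OF S \<sigma>] by (simp add: swap_invariants_def)
  qed
qed

text \<open>A swap at \<open>i\<close> with \<open>Suc i < m\<close> acts on the prefix only, so it
  commutes with the cut at \<open>m\<close> and leaves the spanning condition alone.\<close>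

lemma tree_comp_swap_space_left:
  assumes c: "composable A a B" and f: "f \<in> swap_space (insert a A) m"
  shows "tree_comp A a B m n f g \<in> swap_space (A \<union> B) (m + n)"
proof (rule linear_image_swap_space[OF f fun_span_submodule tree_comp_lin_left(4,1,3)])
  fix i and f :: "'a tree \<times> 'a set list \<Rightarrow> 'b"
  assume i: "Suc i < m" and f: "f \<in> swap_invariants (insert a A) m i"
  have i': "Suc i < m + n" using i by simp
  show "tree_comp A a B m n f g \<in> swap_space (A \<union> B) (m + n)"
  proof (rule swap_invariants_swap_space[OF i'])
    have "tree_comp A a B m n f g (gen (A \<union> B) (swap_nth i \<omega>)) = tree_comp A a B m n f g (gen (A \<union> B) \<omega>)"
      if w: "\<omega> \<in> edge_lists (A \<union> B) (m + n)" for \<omega>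
    proof -
      have l: "length \<omega> = m + n" using w by (simp add: edge_lists_def)
      have d: "drop m (swap_nth i \<omega>) = drop m \<omega>" "take m (swap_nth i \<omega>) = swap_nth i (take m \<omega>)"
        using i l by (simp_all add: drop_swap_nth take_swap_nth)
      have "f (gen (insert a A) (merge_list a B (swap_nth i (take m \<omega>))))
          = f (gen (insert a A) (merge_list a B (take m \<omega>)))" if s: "spans (set (drop m \<omega>)) B"
        using split_edge_list(1)[OF c w s] f i l
        by (simp add: map_swap_nth swap_invariants_def)
      then show ?thesis
        unfolding tree_comp_gen[OF c w] tree_comp_gen[OF c swap_nth_edge_lists[OF i' w]] d by simp
    qed
    then show "tree_comp A a B m n f g \<in> swap_invariants (A \<union> B) (m + n) i"
      using tree_comp_free[OF c] by (simp add: swap_invariants_def)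
  qed
qed

text \<open>A swap at \<open>i\<close> in the suffix is a swap at \<open>m + i\<close> in the whole
  list. The spanning condition survives because it depends only on the set of entries of the
  suffix.\<close>

lemma tree_comp_swap_space_right:
  assumes c: "composable A a B" and g: "g \<in> swap_space B n"
  shows "tree_comp A a B m n f g \<in> swap_space (A \<union> B) (m + n)"
proof (rule linear_image_swap_space[OF g fun_span_submodule tree_comp_lin_right(4,1,3)])
  fix i and g :: "'a tree \<times> 'a set list \<Rightarrow> 'b"
  assume i: "Suc i < n" and g: "g \<in> swap_invariants B n i"
  have i': "Suc (m + i) < m + n" using i by simp
  show "tree_comp A a B m n f g \<in> swap_space (A \<union> B) (m + n)"
  proof (rule swap_invariants_swap_space[OF i'])
    have "tree_comp A a B m n f g (gen (A \<union> B) (swap_nth (m + i) \<omega>)) = tree_comp A a B m n f g (gen (A \<union> B) \<omega>)"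
      if w: "\<omega> \<in> edge_lists (A \<union> B) (m + n)" for \<omega>
    proof -
      have l: "length \<omega> = m + n" using w by (simp add: edge_lists_def)
      have d: "drop m (swap_nth (m + i) \<omega>) = swap_nth i (drop m \<omega>)" "take m (swap_nth (m + i) \<omega>) = take m \<omega>"
        using i l by (simp_all add: drop_swap_nth take_swap_nth)
      have e: "set (swap_nth i (drop m \<omega>)) = set (drop m \<omega>)" using i l by (intro set_swap_nth) simp
      have "g (gen B (swap_nth i (drop m \<omega>))) = g (gen B (drop m \<omega>))" if s: "spans (set (drop m \<omega>)) B"
        using split_edge_list(2)[OF c w s] g by (simp add: swap_invariants_def)
      then show ?thesis
        unfolding tree_comp_gen[OF c w] tree_comp_gen[OF c swap_nth_edge_lists[OF i' w]] d e by simp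
    qed
    then show "tree_comp A a B m n f g \<in> swap_invariants (A \<union> B) (m + n) (m + i)"
      using tree_comp_free[OF c] by (simp add: swap_invariants_def)
  qed
qed

text \<open>Precomposition of coefficients with a reordering. The support is cut back to the
  generators so that the result lies in the free module for any \<open>p\<close>.\<close>

definition permuted ::
    "'a set \<Rightarrow> nat \<Rightarrow> ('a set list \<Rightarrow> 'a set list) \<Rightarrow> ('a tree \<times> 'a set list \<Rightarrow> 'k) \<Rightarrow>
     'a tree \<times> 'a set list \<Rightarrow> 'k::{comm_ring,comm_monoid_mult}" where
  "permuted S n p f = (\<lambda>x. if x \<in> tree_gens S n then f (gen S (p (snd x))) else 0)"

lemma permuted_free: "permuted S n p f \<in> free_module (tree_gens S n)"
  by (simp add: permuted_def free_module_def)

lemma permuted_gen: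
  "arity S \<Longrightarrow> \<omega> \<in> edge_lists S n \<Longrightarrow> permuted S n p f (gen S \<omega>) = f (gen S (p \<omega>))"
  by (simp add: permuted_def gen_mem_tree_gens) (simp add: gen_def)

lemma free_diff_zero:
  assumes S: "arity S" and "f \<in> free_module (tree_gens S n)" "g \<in> free_module (tree_gens S n)"
    and "\<And>\<omega>. \<omega> \<in> edge_lists S n \<Longrightarrow> g (gen S \<omega>) = f (gen S \<omega>)"
  shows "(\<lambda>x. g x - f x) \<in> swap_space S n"
proof -
  have "g = f" by (rule free_module_tree_gens_eqI[OF S assms(3,2,4)])
  then show ?thesis by (simp add: fun_span_zero)
qed

text \<open>Moving one entry to the left past \<open>m\<close> others takes \<open>m\<close>
  adjacent swaps, each contributing a factor -1.\<close>

lemma swap_space_move: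
  fixes f g :: "'a tree \<times> 'a set list \<Rightarrow> 'k::{comm_ring,comm_monoid_mult}"
  assumes S: "arity S" and f: "f \<in> free_module (tree_gens S N)" and g: "g \<in> free_module (tree_gens S N)"
    and N: "l + m < N"
    and fg: "\<And>xs ys z zs. length xs = l \<Longrightarrow> length ys = m \<Longrightarrow> xs @ ys @ z # zs \<in> edge_lists S N \<Longrightarrow>
      g (gen S (xs @ ys @ z # zs)) = f (gen S (xs @ z # ys @ zs))"
  shows "(\<lambda>x. g x - (- 1) ^ m * f x) \<in> swap_space S N"
  using g N fg
proof (induction m arbitrary: g)
  case 0
  have "g (gen S \<omega>) = f (gen S \<omega>)" if w: "\<omega> \<in> edge_lists S N" for \<omega>
  proof -
    have "l < length \<omega>" using 0(2) w by (simp add: edge_lists_def)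
    then have e: "\<omega> = take l \<omega> @ [] @ \<omega> ! l # drop (Suc l) \<omega>" by (simp add: id_take_nth_drop)
    show ?thesis
      using 0(3)[of "take l \<omega>" "[]" "\<omega> ! l" "drop (Suc l) \<omega>"] e w \<open>l < length \<omega>\<close> by simp
  qed
  then show ?case using free_diff_zero[OF S f 0(1)] by simp
next
  case (Suc m)
  define i where "i = l + m"
  have i: "Suc i < N" using Suc.prems(2) by (simp add: i_def)
  \<comment> \<open>After one swap \<open>h\<close> is congruent to \<open>-g\<close>, and
    \<open>z\<close> has only \<open>m\<close> entries left to pass.\<close>
  define h where "h = permuted S N (swap_nth i) g"
  have h: "h \<in> free_module (tree_gens S N)" unfolding h_def by (rule permuted_free)
  have hg: "h (gen S \<omega>) = g (gen S (swap_nth i \<omega>))" if "\<omega> \<in> edge_lists S N" for \<omega>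
    unfolding h_def by (rule permuted_gen[OF S that])
  have 1: "(\<lambda>x. h x - (- 1) ^ m * f x) \<in> swap_space S N"
  proof (rule Suc.IH[OF h])
    show "l + m < N" using Suc.prems(2) by simp
    fix xs ys z zs
    assume l: "length xs = l" "length ys = m" and w: "xs @ ys @ z # zs \<in> edge_lists S N"
    have "length zs \<noteq> 0" using w l Suc.prems(2) by (auto simp: edge_lists_def)
    then obtain y zs' where zs: "zs = y # zs'" by (cases zs) auto
    have sw: "swap_nth i (xs @ ys @ z # zs) = xs @ (ys @ [y]) @ z # zs'"
      using swap_nth_append[of "xs @ ys" z y zs'] l by (simp add: zs i_def)
    have "h (gen S (xs @ ys @ z # zs)) = g (gen S (xs @ (ys @ [y]) @ z # zs'))"
      using hg[OF w] sw by simp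
    also have "\<dots> = f (gen S (xs @ z # (ys @ [y]) @ zs'))"
      using swap_nth_edge_lists[OF i w] l by (intro Suc.prems(3)) (simp_all add: sw)
    finally show "h (gen S (xs @ ys @ z # zs)) = f (gen S (xs @ z # ys @ zs))" by (simp add: zs)
  qed
  have 2: "(\<lambda>x. g x + h x) \<in> swap_space S N"
    by (rule swap_plus_in_swap_space[OF S Suc.prems(1) h i hg])
  have "(\<lambda>x. (g x + h x) - (h x - (- 1) ^ m * f x)) \<in> swap_space S N"
    by (rule fun_submodule_diff[OF fun_span_submodule 2 1])
  then show ?case by (simp add: algebra_simps)
qed

text \<open>The \<open>n\<close> entries of the last block are moved one by one past the
  \<open>m\<close> entries before it. This is the origin of the Koszul sign in the parallel
  law.\<close>

lemma swap_space_rotate: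
  fixes f g :: "'a tree \<times> 'a set list \<Rightarrow> 'k::{comm_ring,comm_monoid_mult}"
  assumes S: "arity S" and f: "f \<in> free_module (tree_gens S N)" and g: "g \<in> free_module (tree_gens S N)"
    and N: "l + m + n = N"
    and fg: "\<And>xs ys zs. length xs = l \<Longrightarrow> length ys = m \<Longrightarrow> length zs = n \<Longrightarrow>
      xs @ ys @ zs \<in> edge_lists S N \<Longrightarrow> g (gen S (xs @ ys @ zs)) = f (gen S (xs @ zs @ ys))"
  shows "(\<lambda>x. g x - (- 1) ^ (m * n) * f x) \<in> swap_space S N"
  using g N fg
proof (induction n arbitrary: l g)
  case 0
  have "g (gen S \<omega>) = f (gen S \<omega>)" if w: "\<omega> \<in> edge_lists S N" for \<omega>
    using 0(3)[of "take l \<omega>" "drop l \<omega>" "[]"] w 0(2) by (simp add: edge_lists_def)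
  then show ?case using free_diff_zero[OF S f 0(1)] by simp
next
  case (Suc n)
  \<comment> \<open>\<open>p\<close> exchanges the two blocks that remain behind the first
    \<open>Suc l\<close> entries, the situation after one entry has been moved to the front.\<close>
  define p where "p \<omega> = take (Suc l) \<omega> @ drop (Suc l + m) \<omega> @ take m (drop (Suc l) \<omega>)" for \<omega> :: "'a set list"
  define h where "h = permuted S N p f"
  have h: "h \<in> free_module (tree_gens S N)" unfolding h_def by (rule permuted_free)
  have hf: "h (gen S \<omega>) = f (gen S (p \<omega>))" if "\<omega> \<in> edge_lists S N" for \<omega>
    unfolding h_def by (rule permuted_gen[OF S that])
  have 1: "(\<lambda>x. h x - (- 1) ^ (m * n) * f x) \<in> swap_space S N"
  proof (rule Suc.IH[OF h])
    show "Suc l + m + n = N" using Suc.prems(2) by simp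
    fix xs ys zs :: "'a set list"
    assume l: "length xs = Suc l" "length ys = m" "length zs = n" and w: "xs @ ys @ zs \<in> edge_lists S N"
    show "h (gen S (xs @ ys @ zs)) = f (gen S (xs @ zs @ ys))"
      using hf[OF w] l by (simp add: p_def)
  qed
  have 2: "(\<lambda>x. g x - (- 1) ^ m * h x) \<in> swap_space S N"
  proof (rule swap_space_move[OF S h Suc.prems(1)])
    show "l + m < N" using Suc.prems(2) by simp
    fix xs ys z zs
    assume l: "length xs = l" "length ys = m" and w: "xs @ ys @ z # zs \<in> edge_lists S N"
    have lz: "length (z # zs) = Suc n" using w l Suc.prems(2) by (simp add: edge_lists_def)
    have w': "xs @ z # ys @ zs \<in> edge_lists S N"
      using w by (auto simp: edge_lists_def)
    show "g (gen S (xs @ ys @ z # zs)) = h (gen S (xs @ z # ys @ zs))"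
      using Suc.prems(3)[OF l lz w] hf[OF w'] l by (simp add: p_def)
  qed
  have "(\<lambda>x. (g x - (- 1) ^ m * h x) + (- 1) ^ m * (h x - (- 1) ^ (m * n) * f x)) \<in> swap_space S N"
    by (rule fun_submodule_add[OF fun_span_submodule 2 fun_submodule_smult[OF fun_span_submodule 1]])
  then show ?case by (simp add: algebra_simps power_add)
qed

section \<open>Spanning edge sets under relabelling and merging\<close>

lemma pairs_subset_merge:
  "D \<subseteq> pairs V \<Longrightarrow> e \<in> D \<Longrightarrow> e \<subseteq> V"
  using pairs_Pow by blast

lemma image_subset_Pow_iff: "(`) f ` D \<subseteq> Pow Y \<longleftrightarrow> (\<forall>e\<in>D. f ` e \<subseteq> Y)"
  by (simp only: image_subset_iff[of "(`) f"] Pow_iff)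

lemma spans_image:
  assumes inj: "inj_on \<sigma> V" and D: "D \<subseteq> pairs V" and B: "B \<subseteq> V"
  shows "spans ((`) \<sigma> ` D) (\<sigma> ` B) \<longleftrightarrow> spans D B"
proof -
  have "\<sigma> ` e \<subseteq> \<sigma> ` B \<longleftrightarrow> e \<subseteq> B" if e: "e \<in> D" for e
  proof
    assume s: "\<sigma> ` e \<subseteq> \<sigma> ` B"
    show "e \<subseteq> B"
    proof
      fix x assume x: "x \<in> e"
      then have "x \<in> V" "\<sigma> x \<in> \<sigma> ` B" using pairs_subset_merge[OF D e] s by blast+
      then show "x \<in> B" using inj_on_image_mem_iff[OF inj _ B] by blast
    qed
  qed (rule image_mono)
  then have 1: "(`) \<sigma> ` D \<subseteq> Pow (\<sigma> ` B) \<longleftrightarrow> D \<subseteq> Pow B"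
    unfolding image_subset_Pow_iff by (simp add: subset_eq[of D])
  have 2: "(\<sigma> u, \<sigma> v) \<in> conn ((`) \<sigma> ` D) \<longleftrightarrow> (u, v) \<in> conn D" if "u \<in> B" "v \<in> B" for u v
    using conn_image_iff[OF fibres_inj[OF inj] _ D, of u v] that B by auto
  have 3: "(\<forall>u\<in>\<sigma> ` B. \<forall>v\<in>\<sigma> ` B. (u, v) \<in> conn ((`) \<sigma> ` D)) \<longleftrightarrow> (\<forall>u\<in>B. \<forall>v\<in>B. (u, v) \<in> conn D)"
    by (simp add: 2)
  show ?thesis unfolding spans_def 1 3 ..
qed

text \<open>A connected part through the merged vertex \<open>b\<close> corresponds to its preimage,
  in which \<open>b\<close> is replaced by \<open>C\<close> together with the edges
  \<open>D'\<close> that connect \<open>C\<close>. This is the geometric content of sequential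
  associativity.\<close>

lemma spans_merge:
  assumes b: "b \<notin> A" "b \<notin> B" and dis: "A \<inter> B = {}" "(A \<union> B) \<inter> C = {}" and C: "C \<noteq> {}"
    and D: "D \<subseteq> pairs (A \<union> B \<union> C)" and s: "spans D' C"
    and D': "D' \<subseteq> pairs (A \<union> B \<union> C)"
  shows "spans ((`) (merge b C) ` D) (insert b B) \<longleftrightarrow> spans (D \<union> D') (B \<union> C)"
proof -
  have bAB: "b \<notin> A \<union> B" using b by blast
  have fib: "fibres (A \<union> B \<union> C) D' (merge b C)"
    by (rule merge_fibres[OF s bAB dis(2)])
  have D'C: "D' \<subseteq> Pow C" using s by (simp add: spans_def)
  have e: "merge b C ` e \<subseteq> insert b B \<longleftrightarrow> e \<subseteq> B \<union> C" if "e \<in> D" for e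
  proof -
    have "e \<subseteq> A \<union> B \<union> C" using pairs_subset_merge[OF D that] .
    moreover have "merge b C x \<in> insert b B \<longleftrightarrow> x \<in> B \<union> C" if "x \<in> A \<union> B \<union> C" for x
      using that b dis by (auto simp: merge_def)
    ultimately show ?thesis by (metis (no_types, opaque_lifting) image_subset_iff subset_iff)
  qed
  have 1: "(`) (merge b C) ` D \<subseteq> Pow (insert b B) \<longleftrightarrow> D \<union> D' \<subseteq> Pow (B \<union> C)"
    unfolding image_subset_Pow_iff using e D'C by auto
  have 2: "(merge b C u, merge b C v) \<in> conn ((`) (merge b C) ` D) \<longleftrightarrow> (u, v) \<in> conn (D \<union> D')"
    if "u \<in> B \<union> C" "v \<in> B \<union> C" for u v
    using conn_image_iff[OF fib D' D, of u v] that by blast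
  have im: "insert b B = merge b C ` (B \<union> C)"
    using merge_image[OF C, of B] dis(2) by blast
  have 3: "(\<forall>u\<in>insert b B. \<forall>v\<in>insert b B. (u, v) \<in> conn ((`) (merge b C) ` D))
      \<longleftrightarrow> (\<forall>u\<in>B \<union> C. \<forall>v\<in>B \<union> C. (u, v) \<in> conn (D \<union> D'))"
    unfolding im ball_simps(9) using 2 by blast
  show ?thesis unfolding spans_def 1 3 ..
qed

lemma map_image_cong:
  assumes "set \<omega> \<subseteq> Pow V" "\<And>x. x \<in> V \<Longrightarrow> f x = g x"
  shows "map ((`) f) \<omega> = map ((`) g) \<omega>"
proof (rule map_cong[OF refl])
  fix e assume "e \<in> set \<omega>"
  then have "e \<subseteq> V" using assms(1) by blast
  then show "f ` e = g ` e" using assms(2) by (intro image_cong) auto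
qed

lemma map_map_image: "map ((`) f) (map ((`) g) \<omega>) = map ((`) (\<lambda>x. f (g x))) \<omega>"
  by (simp add: image_image)

lemma edge_lists_pairs: "\<omega> \<in> edge_lists S n \<Longrightarrow> set \<omega> \<subseteq> pairs S"
  using tree_pairs by (auto simp: edge_lists_def)

lemma edge_lists_singleton: "edge_lists {a} 0 = {[]}"
  by (auto simp: edge_lists_def is_tree_iff pairs_def)

lemma tree_comp_equivariant:
  fixes f g :: "'a tree \<times> 'a set list \<Rightarrow> 'k::{comm_ring,comm_monoid_mult}"
  assumes c: "composable A a B" and \<sigma>: "inj_on \<sigma> (A \<union> B)" and a': "a' \<notin> \<sigma> ` A"
  shows "tree_relabel (A \<union> B) \<sigma> (m + n) (tree_comp A a B m n f g)
    = tree_comp (\<sigma> ` A) a' (\<sigma> ` B) m n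
        (tree_relabel (insert a A) (\<sigma>(a := a')) m f) (tree_relabel B \<sigma> n g)"
proof -
  note ar = arity_composable[OF c] and C = composableD[OF c]
  let ?s = "\<sigma>(a := a')"
  have i1: "inj_on ?s (insert a A)" using \<sigma> a' C(5) by (auto simp: inj_on_def)
  have i2: "inj_on \<sigma> B" using \<sigma> by (rule inj_on_subset) blast
  have im: "?s ` insert a A = insert a' (\<sigma> ` A)" using C(5) by auto
  have c': "composable (\<sigma> ` A) a' (\<sigma> ` B)"
    using c \<sigma> a' by (auto simp: composable_def arity_def inj_on_def)
  have un: "\<sigma> ` (A \<union> B) = \<sigma> ` A \<union> \<sigma> ` B" by blast
  show ?thesis
  proof (rule tree_relabel_eqI[OF ar(2) \<sigma>])
    show "tree_comp (\<sigma> ` A) a' (\<sigma> ` B) m n (tree_relabel (insert a A) ?s m f) (tree_relabel B \<sigma> n g)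
        \<in> free_module (tree_gens (\<sigma> ` (A \<union> B)) (m + n))"
      unfolding un by (rule tree_comp_free[OF c'])
    fix \<omega> assume w: "\<omega> \<in> edge_lists (A \<union> B) (m + n)"
    have w': "map ((`) \<sigma>) \<omega> \<in> edge_lists (\<sigma> ` A \<union> \<sigma> ` B) (m + n)"
      using relabel_edge_list[OF \<sigma> w] unfolding un .
    have D: "set (drop m \<omega>) \<subseteq> pairs (A \<union> B)"
      using edge_lists_pairs[OF w] set_drop_subset[of m \<omega>] by blast
    have s: "spans (set (drop m (map ((`) \<sigma>) \<omega>))) (\<sigma> ` B) \<longleftrightarrow> spans (set (drop m \<omega>)) B"
      unfolding drop_map set_map by (rule spans_image[OF \<sigma> D]) blast
    have T: "set (take m \<omega>) \<subseteq> Pow (A \<union> B)"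
      using edge_lists_Pow[OF w] set_take_subset[of m \<omega>] by blast
    have mg: "merge a' (\<sigma> ` B) (\<sigma> x) = ?s (merge a B x)" if "x \<in> A \<union> B" for x
    proof (cases "x \<in> B")
      case False
      then have "x \<in> A" using that by blast
      then have "x \<noteq> a" "\<sigma> x \<notin> \<sigma> ` B" using C(5) False \<sigma> by (auto simp: inj_on_def)
      then show ?thesis using False by (simp add: merge_def)
    qed (simp add: merge_def)
    have ml: "merge_list a' (\<sigma> ` B) (take m (map ((`) \<sigma>) \<omega>)) = map ((`) ?s) (merge_list a B (take m \<omega>))"
      unfolding take_map map_map_image by (rule map_image_cong[OF T mg])
    show "tree_comp (\<sigma> ` A) a' (\<sigma> ` B) m n (tree_relabel (insert a A) ?s m f) (tree_relabel B \<sigma> n g)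
        (gen (\<sigma> ` (A \<union> B)) (map ((`) \<sigma>) \<omega>)) = tree_comp A a B m n f g (gen (A \<union> B) \<omega>)"
    proof (cases "spans (set (drop m \<omega>)) B")
      case True
      note sp = split_edge_list[OF c w True]
      have "tree_relabel (insert a A) ?s m f (gen (insert a' (\<sigma> ` A)) (map ((`) ?s) (merge_list a B (take m \<omega>))))
          = f (gen (insert a A) (merge_list a B (take m \<omega>)))"
        using tree_relabel_gen[OF ar(3) i1 sp(1)] unfolding im .
      moreover have "tree_relabel B \<sigma> n g (gen (\<sigma> ` B) (drop m (map ((`) \<sigma>) \<omega>))) = g (gen B (drop m \<omega>))"
        unfolding drop_map by (rule tree_relabel_gen[OF ar(1) i2 sp(2)])
      ultimately show ?thesis
        unfolding un tree_comp_gen[OF c' w'] tree_comp_gen[OF c w] s ml by simp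
    next
      case False
      then show ?thesis unfolding un tree_comp_gen[OF c' w'] tree_comp_gen[OF c w] s by simp
    qed
  qed
qed

text \<open>Both sides cut the list into blocks of lengths \<open>l\<close>, \<open>m\<close>,
  \<open>n\<close>. Either way the last block has to span \<open>C\<close> and the last two together
  have to span \<open>B \<union> C\<close>; the left side states the latter after merging
  \<open>C\<close>, which \<open>spans_merge\<close> translates.\<close>

lemma tree_comp_sequential:
  fixes f g h :: "'a tree \<times> 'a set list \<Rightarrow> 'k::{comm_ring,comm_monoid_mult}"
  assumes c1: "composable A a (insert b B)" and c2: "composable B b C" and AC: "A \<inter> C = {}"
  shows "tree_comp (A \<union> B) b C (l + m) n (tree_comp A a (insert b B) l m f g) h
    = tree_comp A a (B \<union> C) l (m + n) f (tree_comp B b C m n g h)"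
proof -
  have c3: "composable (A \<union> B) b C" and c4: "composable A a (B \<union> C)"
    using c1 c2 AC by (auto simp: composable_def arity_def)
  note C1 = composableD[OF c1] and C2 = composableD[OF c2]
  have un: "A \<union> (B \<union> C) = A \<union> B \<union> C" "l + (m + n) = l + m + n" by auto
  have un1: "A \<union> insert b B = insert b (A \<union> B)" by auto
  have ar: "arity (A \<union> B \<union> C)" by (rule arity_composable[OF c3])
  show ?thesis
  proof (rule free_module_tree_gens_eqI[OF ar])
    show "tree_comp (A \<union> B) b C (l + m) n (tree_comp A a (insert b B) l m f g) h
        \<in> free_module (tree_gens (A \<union> B \<union> C) (l + m + n))"
      by (rule tree_comp_free[OF c3])
    show "tree_comp A a (B \<union> C) l (m + n) f (tree_comp B b C m n g h)
        \<in> free_module (tree_gens (A \<union> B \<union> C) (l + m + n))"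
      using tree_comp_free[OF c4, of l "m + n"] unfolding un .
    fix \<omega> assume w: "\<omega> \<in> edge_lists (A \<union> B \<union> C) (l + m + n)"
    then have w4: "\<omega> \<in> edge_lists (A \<union> (B \<union> C)) (l + (m + n))" unfolding un .
    define \<omega>1 \<omega>2 \<omega>3 where ws: "\<omega>1 = take l \<omega>" "\<omega>2 = take m (drop l \<omega>)" "\<omega>3 = drop (l + m) \<omega>"
    have P: "set \<omega> \<subseteq> pairs (A \<union> B \<union> C)" by (rule edge_lists_pairs[OF w])
    have P2: "set \<omega>2 \<subseteq> pairs (A \<union> B \<union> C)" and P3: "set \<omega>3 \<subseteq> pairs (A \<union> B \<union> C)"
      using P set_take_subset set_drop_subset unfolding ws by (metis order_trans)+
    have d: "drop l \<omega> = \<omega>2 @ \<omega>3" and t: "take (l + m) \<omega> = \<omega>1 @ \<omega>2"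
      unfolding ws by (metis append_take_drop_id drop_drop add.commute) (simp add: take_add)
    have l: "length \<omega>1 = l" "length \<omega>2 = m"
      using w unfolding ws by (auto simp: edge_lists_def)
    have L: "tree_comp (A \<union> B) b C (l + m) n (tree_comp A a (insert b B) l m f g) h (gen (A \<union> B \<union> C) \<omega>)
      = (if spans (set \<omega>3) C then tree_comp A a (insert b B) l m f g
          (gen (insert b (A \<union> B)) (merge_list b C (\<omega>1 @ \<omega>2))) * h (gen C \<omega>3) else 0)"
      unfolding tree_comp_gen[OF c3 w] t ws(3)[symmetric] ..
    have R: "tree_comp A a (B \<union> C) l (m + n) f (tree_comp B b C m n g h) (gen (A \<union> B \<union> C) \<omega>)
      = (if spans (set \<omega>2 \<union> set \<omega>3) (B \<union> C) then f (gen (insert a A) (merge_list a (B \<union> C) \<omega>1))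
          * tree_comp B b C m n g h (gen (B \<union> C) (\<omega>2 @ \<omega>3)) else 0)"
      using tree_comp_gen[OF c4 w4] unfolding un d ws(1)[symmetric] set_append .
    show "tree_comp (A \<union> B) b C (l + m) n (tree_comp A a (insert b B) l m f g) h (gen (A \<union> B \<union> C) \<omega>)
      = tree_comp A a (B \<union> C) l (m + n) f (tree_comp B b C m n g h) (gen (A \<union> B \<union> C) \<omega>)"
    proof (cases "spans (set \<omega>3) C")
      case s3: True
      have w12: "merge_list b C (\<omega>1 @ \<omega>2) \<in> edge_lists (A \<union> insert b B) (l + m)"
        using split_edge_list(1)[OF c3 w] s3 unfolding t ws(3)[symmetric] un1 by blast
      have sp: "spans (set (merge_list b C \<omega>2)) (insert b B) \<longleftrightarrow> spans (set \<omega>2 \<union> set \<omega>3) (B \<union> C)"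
        unfolding set_map
        by (rule spans_merge[OF _ _ _ _ _ P2 s3 P3]) (use C1 C2 AC in auto)
      have t12: "take l (merge_list b C (\<omega>1 @ \<omega>2)) = merge_list b C \<omega>1"
        "drop l (merge_list b C (\<omega>1 @ \<omega>2)) = merge_list b C \<omega>2"
        using l by simp_all
      have inner: "tree_comp A a (insert b B) l m f g (gen (insert b (A \<union> B)) (merge_list b C (\<omega>1 @ \<omega>2)))
        = (if spans (set \<omega>2 \<union> set \<omega>3) (B \<union> C)
            then f (gen (insert a A) (merge_list a (insert b B) (merge_list b C \<omega>1)))
              * g (gen (insert b B) (merge_list b C \<omega>2)) else 0)"
        using tree_comp_gen[OF c1 w12] unfolding t12 sp un1 .
      have mm: "merge_list a (insert b B) (merge_list b C \<omega>1) = merge_list a (B \<union> C) \<omega>1"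
      proof -
        have "merge a (insert b B) (merge b C x) = merge a (B \<union> C) x" if "x \<in> A \<union> B \<union> C" for x
          using that C1 C2 AC by (auto simp: merge_def)
        moreover have "set \<omega>1 \<subseteq> Pow (A \<union> B \<union> C)"
          using edge_lists_Pow[OF w] set_take_subset[of l \<omega>] unfolding ws by blast
        ultimately show ?thesis
          unfolding map_map_image by (intro map_image_cong)
      qed
      show ?thesis
      proof (cases "spans (set \<omega>2 \<union> set \<omega>3) (B \<union> C)")
        case True
        have w23: "\<omega>2 @ \<omega>3 \<in> edge_lists (B \<union> C) (m + n)"
          using split_edge_list(2)[OF c4 w4] True unfolding d set_append by blast
        have "tree_comp B b C m n g h (gen (B \<union> C) (\<omega>2 @ \<omega>3))
          = g (gen (insert b B) (merge_list b C \<omega>2)) * h (gen C \<omega>3)"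
          using tree_comp_gen[OF c2 w23, of g h] s3 l by simp
        then show ?thesis unfolding L R inner mm using s3 True by (simp add: mult.assoc)
      next
        case False
        then show ?thesis unfolding L R inner by simp
      qed
    next
      case s3: False
      have "tree_comp B b C m n g h (gen (B \<union> C) (\<omega>2 @ \<omega>3)) = 0" if "spans (set \<omega>2 \<union> set \<omega>3) (B \<union> C)"
      proof -
        have w23: "\<omega>2 @ \<omega>3 \<in> edge_lists (B \<union> C) (m + n)"
          using split_edge_list(2)[OF c4 w4] that unfolding d set_append by blast
        show ?thesis using tree_comp_gen[OF c2 w23, of g h] s3 l by simp
      qed
      then show ?thesis unfolding L R using s3 by simp
    qed
  qed
qed

text \<open>Brings the nested composition into a form that is symmetric in the two inserted trees.
  The blocks do not interfere, because merging \<open>C\<close> fixes every edge inside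
  \<open>B\<close>.\<close>

lemma tree_comp_parallel_gen:
  fixes f g h :: "'a tree \<times> 'a set list \<Rightarrow> 'k::{comm_ring,comm_monoid_mult}"
  assumes c1: "composable (insert b A) a B" and c2: "composable (insert a A) b C" and BC: "B \<inter> C = {}"
    and l: "length \<omega>1 = l" "length \<omega>2 = m" "length \<omega>3 = n"
    and w: "\<omega>1 @ \<omega>2 @ \<omega>3 \<in> edge_lists (A \<union> B \<union> C) (l + m + n)"
  shows "tree_comp (A \<union> B) b C (l + m) n (tree_comp (insert b A) a B l m f g) h
      (gen (A \<union> B \<union> C) (\<omega>1 @ \<omega>2 @ \<omega>3)) =
    (if spans (set \<omega>2) B \<and> spans (set \<omega>3) C then
      f (gen (insert a (insert b A)) (merge_list a B (merge_list b C \<omega>1))) * g (gen B \<omega>2) * h (gen C \<omega>3)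
     else 0)"
proof -
  have c3: "composable (A \<union> B) b C"
    using c1 c2 BC by (auto simp: composable_def arity_def)
  note C1 = composableD[OF c1] and C2 = composableD[OF c2]
  have un: "insert b A \<union> B = insert b (A \<union> B)" by auto
  have P: "set \<omega>2 \<subseteq> Pow (A \<union> B \<union> C)" using edge_lists_Pow[OF w] by auto
  have L: "tree_comp (A \<union> B) b C (l + m) n (tree_comp (insert b A) a B l m f g) h
      (gen (A \<union> B \<union> C) (\<omega>1 @ \<omega>2 @ \<omega>3))
    = (if spans (set \<omega>3) C then tree_comp (insert b A) a B l m f g
        (gen (insert b (A \<union> B)) (merge_list b C (\<omega>1 @ \<omega>2))) * h (gen C \<omega>3) else 0)"
  proof -
    have t: "take (l + m) (\<omega>1 @ \<omega>2 @ \<omega>3) = \<omega>1 @ \<omega>2" "drop (l + m) (\<omega>1 @ \<omega>2 @ \<omega>3) = \<omega>3"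
      using l by simp_all
    show ?thesis unfolding tree_comp_gen[OF c3 w] t ..
  qed
  show ?thesis
  proof (cases "spans (set \<omega>3) C")
    case s3: True
    have w12: "merge_list b C (\<omega>1 @ \<omega>2) \<in> edge_lists (insert b A \<union> B) (l + m)"
      using split_edge_list(1)[OF c3 w] s3 l unfolding un by simp
    have mB: "merge b C ` e = e" if "e \<subseteq> B" for e
    proof -
      have "merge b C ` e = id ` e" using that BC by (intro image_cong) (auto simp: merge_def)
      then show ?thesis by simp
    qed
    have sub: "merge b C ` e \<subseteq> B \<longleftrightarrow> e \<subseteq> B" if "e \<subseteq> A \<union> B \<union> C" for e
    proof
      assume h: "merge b C ` e \<subseteq> B"
      show "e \<subseteq> B"
      proof
        fix x assume "x \<in> e"
        then have "merge b C x \<in> B" using h by blast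
        then show "x \<in> B" using C1(4) by (auto simp: merge_def split: if_splits)
      qed
    qed (simp only: mB)
    \<comment> \<open>An edge that leaves \<open>B\<close> still does so after merging, since
      \<open>b\<close> is not in \<open>B\<close>; if no edge leaves \<open>B\<close>, merging
      changes nothing.\<close>
    have sp: "spans (set (merge_list b C \<omega>2)) B \<longleftrightarrow> spans (set \<omega>2) B"
    proof (cases "set \<omega>2 \<subseteq> Pow B")
      case True
      then have "merge_list b C \<omega>2 = \<omega>2" by (intro map_idI) (use mB in blast)
      then show ?thesis by simp
    next
      case False
      then obtain e where e: "e \<in> set \<omega>2" "\<not> e \<subseteq> B" by blast
      then have "\<not> merge b C ` e \<subseteq> B" using sub P by blast
      then have "\<not> set (merge_list b C \<omega>2) \<subseteq> Pow B" using e(1) by auto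
      then show ?thesis using False by (simp add: spans_def)
    qed
    have id2: "merge_list b C \<omega>2 = \<omega>2" if "spans (set \<omega>2) B"
      using that by (intro map_idI mB) (auto simp: spans_def)
    have "tree_comp (insert b A) a B l m f g (gen (insert b (A \<union> B)) (merge_list b C (\<omega>1 @ \<omega>2)))
      = (if spans (set \<omega>2) B then f (gen (insert a (insert b A)) (merge_list a B (merge_list b C \<omega>1)))
          * g (gen B (merge_list b C \<omega>2)) else 0)"
    proof -
      have t: "take l (merge_list b C (\<omega>1 @ \<omega>2)) = merge_list b C \<omega>1"
        "drop l (merge_list b C (\<omega>1 @ \<omega>2)) = merge_list b C \<omega>2"
        using l by simp_all
      show ?thesis using tree_comp_gen[OF c1 w12] unfolding un t sp .
    qed
    then show ?thesis unfolding L using s3 id2 by simp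
  qed (simp add: L)
qed

text \<open>The coefficients on the two sides agree after exchanging the last two blocks of the
  order, so the law holds modulo the relators with the sign of that exchange.\<close>

lemma tree_comp_parallel:
  fixes f g h :: "'a tree \<times> 'a set list \<Rightarrow> 'k::{comm_ring,comm_monoid_mult}"
  assumes c1: "composable (insert b A) a B" and c2: "composable (insert a A) b C" and BC: "B \<inter> C = {}"
  shows "(\<lambda>x. tree_comp (A \<union> B) b C (l + m) n (tree_comp (insert b A) a B l m f g) h x
      - (- 1) ^ (m * n) * tree_comp (A \<union> C) a B (l + n) m (tree_comp (insert a A) b C l n f h) g x)
    \<in> swap_space (A \<union> B \<union> C) (l + m + n)"
proof -
  have c3: "composable (A \<union> B) b C" and c4: "composable (A \<union> C) a B"
    using c1 c2 BC by (auto simp: composable_def arity_def)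
  note C1 = composableD[OF c1] and C2 = composableD[OF c2]
  have ar: "arity (A \<union> B \<union> C)" by (rule arity_composable[OF c3])
  have un: "A \<union> C \<union> B = A \<union> B \<union> C" "l + n + m = l + m + n" by auto
  show ?thesis
  proof (rule swap_space_rotate[OF ar _ tree_comp_free[OF c3] refl])
    show "tree_comp (A \<union> C) a B (l + n) m (tree_comp (insert a A) b C l n f h) g
        \<in> free_module (tree_gens (A \<union> B \<union> C) (l + m + n))"
      using tree_comp_free[OF c4, of "l + n" m] unfolding un .
    fix xs ys zs :: "'a set list"
    assume l: "length xs = l" "length ys = m" "length zs = n"
      and w: "xs @ ys @ zs \<in> edge_lists (A \<union> B \<union> C) (l + m + n)"
    have w': "xs @ zs @ ys \<in> edge_lists (A \<union> C \<union> B) (l + n + m)"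
      using w unfolding un by (auto simp: edge_lists_def Un_ac)
    have "merge a B (merge b C x) = merge b C (merge a B x)" if "x \<in> A \<union> B \<union> C" for x
      using that C1 C2 BC by (auto simp: merge_def)
    moreover have "set xs \<subseteq> Pow (A \<union> B \<union> C)" using edge_lists_Pow[OF w] by auto
    ultimately have mm: "merge_list a B (merge_list b C xs) = merge_list b C (merge_list a B xs)"
      unfolding map_map_image by (intro map_image_cong)
    have ins: "insert b (insert a A) = insert a (insert b A)" by auto
    show "tree_comp (A \<union> B) b C (l + m) n (tree_comp (insert b A) a B l m f g) h
          (gen (A \<union> B \<union> C) (xs @ ys @ zs))
        = tree_comp (A \<union> C) a B (l + n) m (tree_comp (insert a A) b C l n f h) g
          (gen (A \<union> B \<union> C) (xs @ zs @ ys))"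
      using tree_comp_parallel_gen[OF c1 c2 BC l w, of f g h]
        tree_comp_parallel_gen[OF c2 c1 _ l(1,3,2) w', of f h g] BC
      unfolding un ins mm by (simp add: Int_commute mult.assoc mult.commute mult.left_commute conj_commute
          del: map_map)
  qed
qed

text \<open>The cut is at position 0: the suffix is the whole list, which spans \<open>B\<close>
  because it is the edge set of a tree on \<open>B\<close>.\<close>

lemma tree_unit_left:
  assumes B: "arity B" and g: "g \<in> free_module (tree_gens B n)"
  shows "tree_comp {} a B 0 n (basis_vec (gen {a} [])) g = g"
proof -
  have c: "composable {} a B" using B by (simp add: composable_def)
  show ?thesis
  proof (rule free_module_tree_gens_eqI[OF B _ g])
    show "tree_comp {} a B 0 n (basis_vec (gen {a} [])) g \<in> free_module (tree_gens B n)"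
      using tree_comp_free[OF c, of 0 n] by simp
    fix \<omega> assume w: "\<omega> \<in> edge_lists B n"
    then have "spans (set \<omega>) B" by (intro tree_spans) (simp add: edge_lists_def)
    then show "tree_comp {} a B 0 n (basis_vec (gen {a} [])) g (gen B \<omega>) = g (gen B \<omega>)"
      using tree_comp_gen[OF c, of \<omega> 0 n "basis_vec (gen {a} [])" g] w by (simp add: basis_vec_def)
  qed
qed

text \<open>The cut is at the end: the empty suffix spans the singleton \<open>{b}\<close>, and
  merging \<open>{b}\<close> to \<open>a\<close> inverts the renaming of \<open>a\<close> to
  \<open>b\<close>.\<close>

lemma tree_unit_right:
  assumes c: "composable A a {b}"
  shows "tree_comp A a {b} m 0 f (basis_vec (gen {b} [])) = tree_relabel (insert a A) (id(a := b)) m f"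
proof -
  note ar = arity_composable[OF c] and C = composableD[OF c]
  let ?s = "id(a := b)"
  have i: "inj_on ?s (insert a A)" using C by (auto simp: inj_on_def)
  have im: "?s ` insert a A = A \<union> {b}" using C by auto
  show ?thesis
  proof (rule tree_relabel_eqI[OF ar(3) i, symmetric])
    show "tree_comp A a {b} m 0 f (basis_vec (gen {b} [])) \<in> free_module (tree_gens (?s ` insert a A) m)"
      using tree_comp_free[OF c, of m 0] unfolding im by simp
    fix \<omega> assume w: "\<omega> \<in> edge_lists (insert a A) m"
    have w': "map ((`) ?s) \<omega> \<in> edge_lists (A \<union> {b}) (m + 0)"
      using relabel_edge_list[OF i w] unfolding im by simp
    have l: "length \<omega> = m" using w by (simp add: edge_lists_def)
    have "merge a {b} (?s x) = x" if "x \<in> insert a A" for x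
      using that C by (auto simp: merge_def)
    then have "merge_list a {b} (map ((`) ?s) \<omega>) = \<omega>"
      unfolding map_map_image by (intro map_image_comp_id[OF edge_lists_Pow[OF w]])
    then show "tree_comp A a {b} m 0 f (basis_vec (gen {b} [])) (gen (?s ` insert a A) (map ((`) ?s) \<omega>))
        = f (gen (insert a A) \<omega>)"
      unfolding im tree_comp_gen[OF c w'] using l by (simp add: spans_def basis_vec_def)
  qed
qed

lemma basis_unit_free: "basis_vec (gen {a} []) \<in> free_module (tree_gens {a} 0)"
  by (intro basis_vec_free) (simp add: gen_mem_tree_gens arity_def edge_lists_singleton)

section \<open>The operad laws for classes of trees\<close>

lemma Tree_operad_eq:
  "Tree_operad = quotient_operad (\<lambda>S n. free_module (tree_gens S n))
    (\<lambda>S n. fun_span (sign_relators S n)) tree_relabel tree_comp (\<lambda>a. basis_vec (gen {a} []))"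
  by (simp add: Tree_operad_def quotient_operad_def tree_cong_def quotient_class_def gen_def)

lemma tree_quotient:
  "arity S \<Longrightarrow> fun_quotient (free_module (tree_gens S n)) (fun_span (sign_relators S n))"
  using swap_space_subset_free[of S n]
  by (simp add: fun_quotient_def free_module_submodule fun_span_submodule span_sign_relators)

interpretation Tree: quotient_operad_data
  "\<lambda>S n. free_module (tree_gens S n) :: ('a tree \<times> 'a set list \<Rightarrow> 'k::{comm_ring,comm_monoid_mult}) set"
  "\<lambda>S n. fun_span (sign_relators S n)" tree_relabel tree_comp "\<lambda>a. basis_vec (gen {a} [])"
proof (rule quotient_operad_data.intro)
  show "fun_quotient (free_module (tree_gens S n) :: ('a tree \<times> 'a set list \<Rightarrow> 'k) set)
      (fun_span (sign_relators S n))"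
    if "arity S" for S :: "'a set" and n using that by (rule tree_quotient)
next
  fix S :: "'a set" and \<sigma> :: "'a \<Rightarrow> 'a" and f g :: "'a tree \<times> 'a set list \<Rightarrow> 'k" and n
  assume S: "arity S" "inj_on \<sigma> S"
  have S': "arity (\<sigma> ` S)" using S by (simp add: arity_def)
  show "tree_relabel S \<sigma> n f \<in> free_module (tree_gens (\<sigma> ` S) n)" by (rule tree_relabel_free[OF S])
  assume "(\<lambda>x. f x - g x) \<in> fun_span (sign_relators S n)"
  then show "(\<lambda>x. tree_relabel S \<sigma> n f x - tree_relabel S \<sigma> n g x) \<in> fun_span (sign_relators (\<sigma> ` S) n)"
    unfolding tree_relabel_lin(2)[symmetric] span_sign_relators[OF S(1)] span_sign_relators[OF S']
    by (rule tree_relabel_swap_space[OF S])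
next
  fix A B :: "'a set" and a m n and f f' g g' :: "'a tree \<times> 'a set list \<Rightarrow> 'k"
  assume c: "composable A a B"
  note ar = arity_composable[OF c]
  show "tree_comp A a B m n f g \<in> free_module (tree_gens (A \<union> B) (m + n))" by (rule tree_comp_free[OF c])
  assume f: "(\<lambda>x. f x - f' x) \<in> fun_span (sign_relators (insert a A) m)"
    and g: "(\<lambda>x. g x - g' x) \<in> fun_span (sign_relators B n)"
  \<comment> \<open>By bilinearity the difference of the compositions is split so that only one
    argument changes at a time.\<close>
  have "(\<lambda>x. tree_comp A a B m n (\<lambda>x. f x - f' x) g x + tree_comp A a B m n f' (\<lambda>x. g x - g' x) x)
      \<in> swap_space (A \<union> B) (m + n)"
    by (rule fun_submodule_add[OF fun_span_submodule tree_comp_swap_space_left[OF c] tree_comp_swap_space_right[OF c]])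
      (use f g in \<open>simp_all add: span_sign_relators ar\<close>)
  then show "(\<lambda>x. tree_comp A a B m n f g x - tree_comp A a B m n f' g' x)
      \<in> fun_span (sign_relators (A \<union> B) (m + n))"
    unfolding tree_comp_lin_left(2) tree_comp_lin_right(2) span_sign_relators[OF ar(2)] by simp
qed (rule basis_unit_free)

text \<open>After the choice of representatives every law but one is an equality of coefficient
  functions. Only the parallel law needs the relators.\<close>

theorem graded_operad_Tree:
  "graded_operad (scalars :: 'k::{comm_ring,comm_monoid_mult} ring)
    (Tree_operad :: ('a, 'k, ('a tree \<times> 'a set list \<Rightarrow> 'k) set) operad_data)"
proof -
  let ?T = "Tree.Op :: ('a, 'k, ('a tree \<times> 'a set list \<Rightarrow> 'k) set) operad_data"
  have "graded_operad scalars ?T"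
  proof (rule graded_operad.intro)
    fix S :: "'a set" and n assume S: "arity S"
    show "module scalars (op_space ?T S n)" by (rule Tree.space_module_Op[OF S])
    fix X :: "('a tree \<times> 'a set list \<Rightarrow> 'k) set" assume "X \<in> carrier (op_space ?T S n)"
    then obtain f where f: "f \<in> free_module (tree_gens S n)" "X = Tree.cls S n f"
      by (rule Tree.carrier_OpE[OF S])
    have "tree_relabel S id n f = f"
      using f(1) by (intro tree_relabel_eqI[OF S]) simp_all
    then show "op_relabel ?T S id n X = X"
      using Tree.op_relabel_cls[OF S _ f(1), of id] f(2) by simp
  next
    fix S :: "'a set" and \<sigma> :: "'a \<Rightarrow> 'a" and n assume S: "arity S" "inj_on \<sigma> S"
    have S': "arity (\<sigma> ` S)" using S by (simp add: arity_def)
    show "op_relabel ?T S \<sigma> n \<in> linear_maps scalars (op_space ?T S n) (op_space ?T (\<sigma> ` S) n)"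
    proof (rule linear_mapsI)
      show "op_relabel ?T S \<sigma> n X \<in> carrier (op_space ?T (\<sigma> ` S) n)"
        if "X \<in> carrier (op_space ?T S n)" for X
        by (rule Tree.op_relabel_carrier[OF S that])
    next
      fix X Y :: "('a tree \<times> 'a set list \<Rightarrow> 'k) set" assume "X \<in> carrier (op_space ?T S n)" "Y \<in> carrier (op_space ?T S n)"
      then obtain f g where f: "f \<in> free_module (tree_gens S n)" "X = Tree.cls S n f"
        and g: "g \<in> free_module (tree_gens S n)" "Y = Tree.cls S n g"
        by (metis Tree.carrier_OpE[OF S(1)])
      show "op_relabel ?T S \<sigma> n (X \<oplus>\<^bsub>op_space ?T S n\<^esub> Y)
        = op_relabel ?T S \<sigma> n X \<oplus>\<^bsub>op_space ?T (\<sigma> ` S) n\<^esub> op_relabel ?T S \<sigma> n Y"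
        using f g fun_submodule_add[OF free_module_submodule f(1) g(1)]
        by (simp add: Tree.add_cls[OF S(1)] Tree.add_cls[OF S'] Tree.op_relabel_cls[OF S]
            tree_relabel_free[OF S] tree_relabel_lin(1))
    next
      fix c :: 'k and X :: "('a tree \<times> 'a set list \<Rightarrow> 'k) set" assume "X \<in> carrier (op_space ?T S n)"
      then obtain f where f: "f \<in> free_module (tree_gens S n)" "X = Tree.cls S n f"
        by (rule Tree.carrier_OpE[OF S(1)])
      show "op_relabel ?T S \<sigma> n (c \<odot>\<^bsub>op_space ?T S n\<^esub> X)
        = c \<odot>\<^bsub>op_space ?T (\<sigma> ` S) n\<^esub> op_relabel ?T S \<sigma> n X"
        using f fun_submodule_smult[OF free_module_submodule f(1)]
        by (simp add: Tree.smult_cls[OF S(1)] Tree.smult_cls[OF S'] Tree.op_relabel_cls[OF S]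
            tree_relabel_free[OF S] tree_relabel_lin(3))
    qed
  next
    fix S :: "'a set" and \<sigma> \<tau> :: "'a \<Rightarrow> 'a" and n and X :: "('a tree \<times> 'a set list \<Rightarrow> 'k) set"
    assume S: "arity S" "inj_on \<sigma> S" and e: "\<And>s. s \<in> S \<Longrightarrow> \<sigma> s = \<tau> s"
      and "X \<in> carrier (op_space ?T S n)"
    from this(4) obtain f where f: "f \<in> free_module (tree_gens S n)" "X = Tree.cls S n f"
      by (rule Tree.carrier_OpE[OF S(1)])
    have im: "\<tau> ` S = \<sigma> ` S" using e by auto
    have t: "inj_on \<tau> S" using S(2) e by (auto simp: inj_on_def)
    have "tree_relabel S \<sigma> n f = tree_relabel S \<tau> n f"
    proof (rule tree_relabel_eqI[OF S])
      show "tree_relabel S \<tau> n f \<in> free_module (tree_gens (\<sigma> ` S) n)"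
        using tree_relabel_free[OF S(1) t] unfolding im .
      fix \<omega> assume w: "\<omega> \<in> edge_lists S n"
      have m: "map ((`) \<sigma>) \<omega> = map ((`) \<tau>) \<omega>" by (rule map_image_cong[OF edge_lists_Pow[OF w] e])
      show "tree_relabel S \<tau> n f (gen (\<sigma> ` S) (map ((`) \<sigma>) \<omega>)) = f (gen S \<omega>)"
        using tree_relabel_gen[OF S(1) t w] unfolding im m .
    qed
    then show "op_relabel ?T S \<sigma> n X = op_relabel ?T S \<tau> n X"
      using f Tree.op_relabel_cls[OF S f(1)] Tree.op_relabel_cls[OF S(1) t f(1)] im by simp
  next
    fix S :: "'a set" and \<sigma> \<tau> :: "'a \<Rightarrow> 'a" and n and X :: "('a tree \<times> 'a set list \<Rightarrow> 'k) set"
    assume S: "arity S" "inj_on \<sigma> S" and t: "inj_on \<tau> (\<sigma> ` S)"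
      and "X \<in> carrier (op_space ?T S n)"
    from this(4) obtain f where f: "f \<in> free_module (tree_gens S n)" "X = Tree.cls S n f"
      by (rule Tree.carrier_OpE[OF S(1)])
    have S': "arity (\<sigma> ` S)" using S by (simp add: arity_def)
    have ts: "inj_on (\<tau> \<circ> \<sigma>) S" using S(2) t by (rule comp_inj_on)
    have im: "(\<tau> \<circ> \<sigma>) ` S = \<tau> ` \<sigma> ` S" by (rule image_comp[symmetric])
    have "tree_relabel S (\<tau> \<circ> \<sigma>) n f = tree_relabel (\<sigma> ` S) \<tau> n (tree_relabel S \<sigma> n f)"
    proof (rule tree_relabel_eqI[OF S(1) ts])
      show "tree_relabel (\<sigma> ` S) \<tau> n (tree_relabel S \<sigma> n f) \<in> free_module (tree_gens ((\<tau> \<circ> \<sigma>) ` S) n)"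
        unfolding im by (rule tree_relabel_free[OF S' t])
      fix \<omega> assume w: "\<omega> \<in> edge_lists S n"
      have m: "map ((`) (\<tau> \<circ> \<sigma>)) \<omega> = map ((`) \<tau>) (map ((`) \<sigma>) \<omega>)" by (simp add: image_comp)
      show "tree_relabel (\<sigma> ` S) \<tau> n (tree_relabel S \<sigma> n f) (gen ((\<tau> \<circ> \<sigma>) ` S) (map ((`) (\<tau> \<circ> \<sigma>)) \<omega>))
          = f (gen S \<omega>)"
        unfolding im m tree_relabel_gen[OF S' t relabel_edge_list[OF S(2) w]] tree_relabel_gen[OF S w] ..
    qed
    then show "op_relabel ?T (\<sigma> ` S) \<tau> n (op_relabel ?T S \<sigma> n X) = op_relabel ?T S (\<tau> \<circ> \<sigma>) n X"
      using f Tree.op_relabel_cls[OF S f(1)] Tree.op_relabel_cls[OF S(1) ts f(1)]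
        Tree.op_relabel_cls[OF S' t tree_relabel_free[OF S]] im by simp
  next
    fix A B :: "'a set" and a m n and X :: "('a tree \<times> 'a set list \<Rightarrow> 'k) set"
    assume c: "composable A a B" and "X \<in> carrier (op_space ?T (insert a A) m)"
    note ar = arity_composable[OF c]
    obtain f where f: "f \<in> free_module (tree_gens (insert a A) m)" "X = Tree.cls (insert a A) m f"
      using \<open>X \<in> _\<close> by (rule Tree.carrier_OpE[OF ar(3)])
    show "(\<lambda>Y. op_comp ?T A a B m n X Y)
        \<in> linear_maps scalars (op_space ?T B n) (op_space ?T (A \<union> B) (m + n))"
    proof (rule linear_mapsI)
      show "op_comp ?T A a B m n X Y \<in> carrier (op_space ?T (A \<union> B) (m + n))"
        if "Y \<in> carrier (op_space ?T B n)" for Y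
        by (rule Tree.op_comp_carrier[OF c \<open>X \<in> _\<close> that])
    next
      fix Y Y' :: "('a tree \<times> 'a set list \<Rightarrow> 'k) set" assume "Y \<in> carrier (op_space ?T B n)" "Y' \<in> carrier (op_space ?T B n)"
      then obtain g g' where g: "g \<in> free_module (tree_gens B n)" "Y = Tree.cls B n g"
        and g': "g' \<in> free_module (tree_gens B n)" "Y' = Tree.cls B n g'"
        by (metis Tree.carrier_OpE[OF ar(1)])
      show "op_comp ?T A a B m n X (Y \<oplus>\<^bsub>op_space ?T B n\<^esub> Y')
        = op_comp ?T A a B m n X Y \<oplus>\<^bsub>op_space ?T (A \<union> B) (m + n)\<^esub> op_comp ?T A a B m n X Y'"
        using f g g' fun_submodule_add[OF free_module_submodule g(1) g'(1)]
        by (simp add: Tree.add_cls[OF ar(1)] Tree.add_cls[OF ar(2)] Tree.op_comp_cls[OF c]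
            tree_comp_free[OF c] tree_comp_lin_right(1))
    next
      fix k :: 'k and Y :: "('a tree \<times> 'a set list \<Rightarrow> 'k) set" assume "Y \<in> carrier (op_space ?T B n)"
      then obtain g where g: "g \<in> free_module (tree_gens B n)" "Y = Tree.cls B n g"
        by (rule Tree.carrier_OpE[OF ar(1)])
      show "op_comp ?T A a B m n X (k \<odot>\<^bsub>op_space ?T B n\<^esub> Y)
        = k \<odot>\<^bsub>op_space ?T (A \<union> B) (m + n)\<^esub> op_comp ?T A a B m n X Y"
        using f g fun_submodule_smult[OF free_module_submodule g(1)]
        by (simp add: Tree.smult_cls[OF ar(1)] Tree.smult_cls[OF ar(2)] Tree.op_comp_cls[OF c]
            tree_comp_free[OF c] tree_comp_lin_right(3))
    qed
  next
    fix A B :: "'a set" and a m n and Y :: "('a tree \<times> 'a set list \<Rightarrow> 'k) set"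
    assume c: "composable A a B" and "Y \<in> carrier (op_space ?T B n)"
    note ar = arity_composable[OF c]
    obtain g where g: "g \<in> free_module (tree_gens B n)" "Y = Tree.cls B n g"
      using \<open>Y \<in> _\<close> by (rule Tree.carrier_OpE[OF ar(1)])
    show "(\<lambda>X. op_comp ?T A a B m n X Y)
        \<in> linear_maps scalars (op_space ?T (insert a A) m) (op_space ?T (A \<union> B) (m + n))"
    proof (rule linear_mapsI)
      show "op_comp ?T A a B m n X Y \<in> carrier (op_space ?T (A \<union> B) (m + n))"
        if "X \<in> carrier (op_space ?T (insert a A) m)" for X
        by (rule Tree.op_comp_carrier[OF c that \<open>Y \<in> _\<close>])
    next
      fix X X' :: "('a tree \<times> 'a set list \<Rightarrow> 'k) set" assume "X \<in> carrier (op_space ?T (insert a A) m)" "X' \<in> carrier (op_space ?T (insert a A) m)"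
      then obtain f f' where f: "f \<in> free_module (tree_gens (insert a A) m)" "X = Tree.cls (insert a A) m f"
        and f': "f' \<in> free_module (tree_gens (insert a A) m)" "X' = Tree.cls (insert a A) m f'"
        by (metis Tree.carrier_OpE[OF ar(3)])
      show "op_comp ?T A a B m n (X \<oplus>\<^bsub>op_space ?T (insert a A) m\<^esub> X') Y
        = op_comp ?T A a B m n X Y \<oplus>\<^bsub>op_space ?T (A \<union> B) (m + n)\<^esub> op_comp ?T A a B m n X' Y"
        using f f' g fun_submodule_add[OF free_module_submodule f(1) f'(1)]
        by (simp add: Tree.add_cls[OF ar(3)] Tree.add_cls[OF ar(2)] Tree.op_comp_cls[OF c]
            tree_comp_free[OF c] tree_comp_lin_left(1))
    next
      fix k :: 'k and X :: "('a tree \<times> 'a set list \<Rightarrow> 'k) set" assume "X \<in> carrier (op_space ?T (insert a A) m)"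
      then obtain f where f: "f \<in> free_module (tree_gens (insert a A) m)" "X = Tree.cls (insert a A) m f"
        by (rule Tree.carrier_OpE[OF ar(3)])
      show "op_comp ?T A a B m n (k \<odot>\<^bsub>op_space ?T (insert a A) m\<^esub> X) Y
        = k \<odot>\<^bsub>op_space ?T (A \<union> B) (m + n)\<^esub> op_comp ?T A a B m n X Y"
        using f g fun_submodule_smult[OF free_module_submodule f(1)]
        by (simp add: Tree.smult_cls[OF ar(3)] Tree.smult_cls[OF ar(2)] Tree.op_comp_cls[OF c]
            tree_comp_free[OF c] tree_comp_lin_left(3))
    qed
  next
    fix A B :: "'a set" and a a' and \<sigma> :: "'a \<Rightarrow> 'a" and m n and X Y :: "('a tree \<times> 'a set list \<Rightarrow> 'k) set"
    assume c: "composable A a B" and s: "inj_on \<sigma> (A \<union> B)" and a': "a' \<notin> \<sigma> ` A"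
      and X: "X \<in> carrier (op_space ?T (insert a A) m)" and Y: "Y \<in> carrier (op_space ?T B n)"
    note ar = arity_composable[OF c] and C = composableD[OF c]
    obtain f where f: "f \<in> free_module (tree_gens (insert a A) m)" "X = Tree.cls (insert a A) m f"
      using X by (rule Tree.carrier_OpE[OF ar(3)])
    obtain g where g: "g \<in> free_module (tree_gens B n)" "Y = Tree.cls B n g"
      using Y by (rule Tree.carrier_OpE[OF ar(1)])
    have i1: "inj_on (\<sigma>(a := a')) (insert a A)" using s a' C(5) by (auto simp: inj_on_def)
    have i2: "inj_on \<sigma> B" using s by (rule inj_on_subset) blast
    have im: "(\<sigma>(a := a')) ` insert a A = insert a' (\<sigma> ` A)" using C(5) by auto
    have c': "composable (\<sigma> ` A) a' (\<sigma> ` B)"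
      using c s a' by (auto simp: composable_def arity_def inj_on_def)
    have fr: "tree_relabel (insert a A) (\<sigma>(a := a')) m f \<in> free_module (tree_gens (insert a' (\<sigma> ` A)) m)"
      using tree_relabel_free[OF ar(3) i1] unfolding im .
    show "op_relabel ?T (A \<union> B) \<sigma> (m + n) (op_comp ?T A a B m n X Y)
        = op_comp ?T (\<sigma> ` A) a' (\<sigma> ` B) m n
            (op_relabel ?T (insert a A) (\<sigma>(a := a')) m X) (op_relabel ?T B \<sigma> n Y)"
      unfolding f(2) g(2) Tree.op_comp_cls[OF c f(1) g(1)] Tree.op_relabel_cls[OF ar(2) s tree_comp_free[OF c]]
        Tree.op_relabel_cls[OF ar(3) i1 f(1)] Tree.op_relabel_cls[OF ar(1) i2 g(1)] im
        Tree.op_comp_cls[OF c' fr tree_relabel_free[OF ar(1) i2]] tree_comp_equivariant[OF c s a'] image_Un ..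
  next
    fix A B C :: "'a set" and a b l m n and X Y W :: "('a tree \<times> 'a set list \<Rightarrow> 'k) set"
    assume c1: "composable A a (insert b B)" and c2: "composable B b C" and AC: "A \<inter> C = {}"
      and X: "X \<in> carrier (op_space ?T (insert a A) l)"
      and Y: "Y \<in> carrier (op_space ?T (insert b B) m)" and W: "W \<in> carrier (op_space ?T C n)"
    have c3: "composable (A \<union> B) b C" and c4: "composable A a (B \<union> C)"
      using c1 c2 AC by (auto simp: composable_def arity_def)
    obtain f where f: "f \<in> free_module (tree_gens (insert a A) l)" "X = Tree.cls (insert a A) l f"
      using X by (rule Tree.carrier_OpE[OF arity_composable(3)[OF c1]])
    obtain g where g: "g \<in> free_module (tree_gens (insert b B) m)" "Y = Tree.cls (insert b B) m g"
      using Y by (rule Tree.carrier_OpE[OF arity_composable(1)[OF c1]])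
    obtain h where h: "h \<in> free_module (tree_gens C n)" "W = Tree.cls C n h"
      using W by (rule Tree.carrier_OpE[OF arity_composable(1)[OF c2]])
    have e: "A \<union> insert b B = insert b (A \<union> B)" "A \<union> B \<union> C = A \<union> (B \<union> C)" "l + m + n = l + (m + n)"
      by auto
    have fr: "tree_comp A a (insert b B) l m f g \<in> free_module (tree_gens (insert b (A \<union> B)) (l + m))"
      using tree_comp_free[OF c1] unfolding e(1) .
    show "op_comp ?T (A \<union> B) b C (l + m) n (op_comp ?T A a (insert b B) l m X Y) W
        = op_comp ?T A a (B \<union> C) l (m + n) X (op_comp ?T B b C m n Y W)"
      unfolding f(2) g(2) h(2) Tree.op_comp_cls[OF c1 f(1) g(1)] e(1) Tree.op_comp_cls[OF c3 fr h(1)]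
        Tree.op_comp_cls[OF c2 g(1) h(1)] Tree.op_comp_cls[OF c4 f(1) tree_comp_free[OF c2]]
        tree_comp_sequential[OF c1 c2 AC] e(2,3) ..
  next
    fix A B C :: "'a set" and a b l m n and X Y W :: "('a tree \<times> 'a set list \<Rightarrow> 'k) set"
    assume c1: "composable (insert b A) a B" and c2: "composable (insert a A) b C" and BC: "B \<inter> C = {}"
      and X: "X \<in> carrier (op_space ?T (insert a (insert b A)) l)"
      and Y: "Y \<in> carrier (op_space ?T B m)" and W: "W \<in> carrier (op_space ?T C n)"
    have c3: "composable (A \<union> B) b C" and c4: "composable (A \<union> C) a B"
      using c1 c2 BC by (auto simp: composable_def arity_def)
    have ar: "arity (A \<union> B \<union> C)" by (rule arity_composable[OF c3])
    obtain f where f: "f \<in> free_module (tree_gens (insert a (insert b A)) l)" "X = Tree.cls (insert a (insert b A)) l f"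
      using X by (rule Tree.carrier_OpE[OF arity_composable(3)[OF c1]])
    obtain g where g: "g \<in> free_module (tree_gens B m)" "Y = Tree.cls B m g"
      using Y by (rule Tree.carrier_OpE[OF arity_composable(1)[OF c1]])
    obtain h where h: "h \<in> free_module (tree_gens C n)" "W = Tree.cls C n h"
      using W by (rule Tree.carrier_OpE[OF arity_composable(1)[OF c2]])
    have e: "insert b A \<union> B = insert b (A \<union> B)" "insert a A \<union> C = insert a (A \<union> C)"
      "insert a (insert b A) = insert b (insert a A)"
      "A \<union> C \<union> B = A \<union> B \<union> C" "l + n + m = l + m + n"
      by auto
    note f' = f[unfolded e(3)]
    note fr1 = tree_comp_free[OF c1, of l m f g, unfolded e(1)]
    note fr2 = tree_comp_free[OF c2, of l n f h, unfolded e(2)]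
    note fr3 = tree_comp_free[OF c4, of "l + n" m "tree_comp (insert a A) b C l n f h" g, unfolded e(4,5)]
    have L: "op_comp ?T (A \<union> B) b C (l + m) n (op_comp ?T (insert b A) a B l m X Y) W
      = Tree.cls (A \<union> B \<union> C) (l + m + n) (tree_comp (A \<union> B) b C (l + m) n (tree_comp (insert b A) a B l m f g) h)"
      unfolding f(2) g(2) h(2) Tree.op_comp_cls[OF c1 f(1) g(1)] e(1) Tree.op_comp_cls[OF c3 fr1 h(1)] ..
    have R1: "op_comp ?T (insert a A) b C l n X W
      = Tree.cls (insert a (A \<union> C)) (l + n) (tree_comp (insert a A) b C l n f h)"
      unfolding f'(2) h(2) Tree.op_comp_cls[OF c2 f'(1) h(1)] e(2) ..
    have R: "op_comp ?T (A \<union> C) a B (l + n) m (op_comp ?T (insert a A) b C l n X W) Y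
      = Tree.cls (A \<union> B \<union> C) (l + m + n) (tree_comp (A \<union> C) a B (l + n) m (tree_comp (insert a A) b C l n f h) g)"
      unfolding R1 g(2) Tree.op_comp_cls[OF c4 fr2 g(1)] e(4,5) ..
    show "op_comp ?T (A \<union> B) b C (l + m) n (op_comp ?T (insert b A) a B l m X Y) W
        = ((\<ominus>\<^bsub>scalars\<^esub> \<one>\<^bsub>scalars\<^esub>) [^]\<^bsub>scalars\<^esub> (m * n)) \<odot>\<^bsub>op_space ?T (A \<union> B \<union> C) (l + m + n)\<^esub>
            op_comp ?T (A \<union> C) a B (l + n) m (op_comp ?T (insert a A) b C l n X W) Y"
      unfolding L R scalars_pow_minus_one Tree.smult_cls[OF ar fr3]
      by (rule Tree.cls_eqI[OF ar tree_comp_free[OF c3] fun_submodule_smult[OF free_module_submodule fr3]])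
        (unfold span_sign_relators[OF ar], rule tree_comp_parallel[OF c1 c2 BC])
  next
    fix a :: 'a and \<sigma> :: "'a \<Rightarrow> 'a"
    have ar: "arity {b}" for b :: 'a by (simp add: arity_def)
    show "op_unit ?T a \<in> carrier (op_space ?T {a} 0)"
      unfolding Tree.op_unit_Op by (rule Tree.cls_carrier[OF ar basis_unit_free])
    have "tree_relabel {a} \<sigma> 0 (basis_vec (gen {a} [])) = (basis_vec (gen {\<sigma> a} []) :: 'a tree \<times> 'a set list \<Rightarrow> 'k)"
      by (rule tree_relabel_eqI[OF ar])
        (use basis_unit_free in \<open>simp_all add: edge_lists_singleton basis_vec_def\<close>)
    moreover have "op_relabel ?T {a} \<sigma> 0 (Tree.cls {a} 0 (basis_vec (gen {a} [])))
        = Tree.cls (\<sigma> ` {a}) 0 (tree_relabel {a} \<sigma> 0 (basis_vec (gen {a} [])))"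
      by (rule Tree.op_relabel_cls[OF ar _ basis_unit_free]) simp
    ultimately show "op_relabel ?T {a} \<sigma> 0 (op_unit ?T a) = op_unit ?T (\<sigma> a)"
      unfolding Tree.op_unit_Op by simp
  next
    fix B :: "'a set" and a n and Y :: "('a tree \<times> 'a set list \<Rightarrow> 'k) set" assume B: "arity B" and "Y \<in> carrier (op_space ?T B n)"
    then obtain g where g: "g \<in> free_module (tree_gens B n)" "Y = Tree.cls B n g"
      by (metis Tree.carrier_OpE)
    have c: "composable {} a B" using B by (simp add: composable_def)
    show "op_comp ?T {} a B 0 n (op_unit ?T a) Y = Y"
      unfolding Tree.op_unit_Op g(2) Tree.op_comp_cls[OF c basis_unit_free g(1)]
      by (simp add: tree_unit_left[OF B g(1)])
  next
    fix A :: "'a set" and a b m and X :: "('a tree \<times> 'a set list \<Rightarrow> 'k) set"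
    assume c: "composable A a {b}" and X: "X \<in> carrier (op_space ?T (insert a A) m)"
    note ar = arity_composable[OF c] and C = composableD[OF c]
    obtain f where f: "f \<in> free_module (tree_gens (insert a A) m)" "X = Tree.cls (insert a A) m f"
      using X by (rule Tree.carrier_OpE[OF ar(3)])
    have i: "inj_on (id(a := b)) (insert a A)" using C by (auto simp: inj_on_def)
    have im: "(id(a := b)) ` insert a A = A \<union> {b}" using C by auto
    show "op_comp ?T A a {b} m 0 X (op_unit ?T b) = op_relabel ?T (insert a A) (id(a := b)) m X"
      unfolding Tree.op_unit_Op f(2) Tree.op_comp_cls[OF c f(1) basis_unit_free]
        Tree.op_relabel_cls[OF ar(3) i f(1)] im tree_unit_right[OF c] by simp
  qed
  then show ?thesis unfolding Tree_operad_eq .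
qed

section \<open>Maximal chains of multilabeled trees\<close>

definition prefix_sets :: "'e list \<Rightarrow> 'e set list" where
  "prefix_sets \<omega> = map (\<lambda>i. set (take i \<omega>)) [0..<Suc (length \<omega>)]"

lemma length_prefix_sets [simp]: "length (prefix_sets \<omega>) = Suc (length \<omega>)"
  by (simp add: prefix_sets_def)

lemma nth_prefix_sets: "i \<le> length \<omega> \<Longrightarrow> prefix_sets \<omega> ! i = set (take i \<omega>)"
  by (simp add: prefix_sets_def del: upt_Suc)

lemma set_take_Suc: "i < length \<omega> \<Longrightarrow> set (take (Suc i) \<omega>) = insert (\<omega> ! i) (set (take i \<omega>))"
  by (simp add: take_Suc_conv_app_nth)

lemma nth_notin_take: "distinct \<omega> \<Longrightarrow> i < length \<omega> \<Longrightarrow> \<omega> ! i \<notin> set (take i \<omega>)"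
  by (auto simp: in_set_conv_nth nth_eq_iff_index_eq)

lemma prefix_sets_full_chain:
  assumes "distinct \<omega>"
  shows "prefix_sets \<omega> \<in> full_chains (Pow (set \<omega>)) (\<subseteq>) (length \<omega>)"
proof -
  have "prefix_sets \<omega> ! i \<subset> prefix_sets \<omega> ! Suc i" if "Suc i < length (prefix_sets \<omega>)" for i
    using that nth_notin_take[OF assms, of i] by (auto simp: nth_prefix_sets set_take_Suc)
  then have "sorted_wrt (\<subset>) (prefix_sets \<omega>)"
    by (subst sorted_wrt_iff_nth_Suc_transp) (auto intro: transpI)
  moreover have "set (prefix_sets \<omega>) \<subseteq> Pow (set \<omega>)"
    by (auto simp: prefix_sets_def dest: in_set_takeD)
  moreover have "prefix_sets \<omega> \<noteq> []" by (simp add: prefix_sets_def)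
  ultimately show ?thesis
    by (simp add: full_chains_Pow hd_conv_nth last_conv_nth nth_prefix_sets)
qed

text \<open>Cardinalities grow by at least one at each step; this is counted once from the bottom
  and once from the top. For \<open>n = card E\<close> the two bounds force the set at position
  \<open>i\<close> to have exactly \<open>i\<close> elements.\<close>

lemma full_chain_card:
  assumes fin: "finite E" and Fs: "Fs \<in> full_chains (Pow E) (\<subseteq>) n"
  shows "\<And>i. i \<le> n \<Longrightarrow> i \<le> card (Fs ! i)" "n \<le> card E"
    "\<And>i. i \<le> n \<Longrightarrow> card (Fs ! i) + (n - i) \<le> card E"
proof -
  have F: "length Fs = Suc n" "set Fs \<subseteq> Pow E" "sorted_wrt (\<subset>) Fs" "last Fs = E"
    using Fs by (auto simp: full_chains_Pow)
  have E: "Fs ! i \<subseteq> E" if "i \<le> n" for i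
    using that F(1,2) by (metis Pow_iff less_Suc_eq_le nth_mem subsetD)
  have lt: "card (Fs ! i) < card (Fs ! Suc i)" if "Suc i \<le> n" for i
  proof (rule psubset_card_mono)
    show "finite (Fs ! Suc i)" using E[OF that] fin by (rule finite_subset)
    show "Fs ! i \<subset> Fs ! Suc i" using F(1,3) that by (simp add: sorted_wrt_iff_nth_less)
  qed
  show 1: "i \<le> card (Fs ! i)" if "i \<le> n" for i
    using that
  proof (induction i)
    case (Suc i)
    then show ?case using lt[of i] by simp
  qed simp
  have n: "Fs ! n = E"
  proof -
    have "Fs \<noteq> []" using F(1) by auto
    then show ?thesis using F(1,4) by (simp add: last_conv_nth)
  qed
  show "n \<le> card E" using 1[of n] n by simp
  show "card (Fs ! i) + (n - i) \<le> card E" if "i \<le> n" for i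
    using that
  proof (induction "n - i" arbitrary: i)
    case 0
    then show ?case using n by simp
  next
    case (Suc k)
    then have "card (Fs ! Suc i) + (n - Suc i) \<le> card E" by simp
    moreover have "Suc i \<le> n" using Suc(2) by simp
    ultimately show ?case using lt[of i] by linarith
  qed
qed

lemma full_chain_prefix_sets:
  assumes fin: "finite E" and Fs: "Fs \<in> full_chains (Pow E) (\<subseteq>) (card E)"
  obtains \<omega> where "distinct \<omega>" "set \<omega> = E" "Fs = prefix_sets \<omega>"
proof -
  let ?n = "card E"
  have F: "length Fs = Suc ?n" "set Fs \<subseteq> Pow E" "sorted_wrt (\<subset>) Fs" "hd Fs = {}" "last Fs = E"
    using Fs by (auto simp: full_chains_Pow)
  have ne: "Fs \<noteq> []" using F(1) by auto
  have E: "Fs ! i \<subseteq> E" if "i \<le> ?n" for i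
    using that F(1,2) by (metis Pow_iff less_Suc_eq_le nth_mem subsetD)
  have c: "card (Fs ! i) = i" if "i \<le> ?n" for i
    using full_chain_card(1,3)[OF fin Fs that] that by simp
  \<comment> \<open>In a chain of maximal length consecutive sets differ by a single element, which
    is the next entry of the order.\<close>
  define \<omega> where "\<omega> = map (\<lambda>i. the_elem (Fs ! Suc i - Fs ! i)) [0..<?n]"
  have l: "length \<omega> = ?n" by (simp add: \<omega>_def)
  have step: "Fs ! Suc i = insert (\<omega> ! i) (Fs ! i)" if i: "i < ?n" for i
  proof -
    have s: "Fs ! i \<subset> Fs ! Suc i" using F(1,3) i by (simp add: sorted_wrt_iff_nth_less)
    have "finite (Fs ! i)" using finite_subset[OF E fin] i by simp
    then have "card (Fs ! Suc i - Fs ! i) = 1"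
      using c[of i] c[of "Suc i"] i s by (simp add: card_Diff_subset psubset_imp_subset)
    then obtain e where e: "Fs ! Suc i - Fs ! i = {e}" by (rule card_1_singletonE)
    then have "\<omega> ! i = e" using i by (simp add: \<omega>_def)
    then show ?thesis using e s by blast
  qed
  have pre: "set (take i \<omega>) = Fs ! i" if "i \<le> ?n" for i
    using that
  proof (induction i)
    case 0
    then show ?case using F(4) ne by (simp add: hd_conv_nth)
  next
    case (Suc i)
    then show ?case using step[of i] l by (simp add: set_take_Suc)
  qed
  have sw: "set \<omega> = E" using pre[of ?n] l F(1,5) ne by (simp add: last_conv_nth)
  then have "distinct \<omega>" using l by (simp add: card_distinct)
  moreover have "Fs = prefix_sets \<omega>"
    using F(1) l pre by (intro nth_equalityI) (auto simp: nth_prefix_sets)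
  ultimately show thesis using that sw by blast
qed

lemma prefix_sets_step:
  assumes "distinct \<omega>" "i < length \<omega>"
  shows "prefix_sets \<omega> ! Suc i - prefix_sets \<omega> ! i = {\<omega> ! i}"
  using assms nth_notin_take[OF assms] by (auto simp: nth_prefix_sets set_take_Suc)

lemma prefix_sets_inj:
  assumes "distinct \<omega>" "distinct \<nu>" "prefix_sets \<omega> = prefix_sets \<nu>"
  shows "\<omega> = \<nu>"
proof (rule nth_equalityI)
  show l: "length \<omega> = length \<nu>" using arg_cong[OF assms(3), of length] by simp
  fix i assume i: "i < length \<omega>"
  then show "\<omega> ! i = \<nu> ! i"
    using prefix_sets_step[OF assms(1) i] prefix_sets_step[OF assms(2), of i] assms(3) l by simp
qed

lemma prefix_sets_map: "prefix_sets (map h \<omega>) = map ((`) h) (prefix_sets \<omega>)"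
  by (simp add: prefix_sets_def take_map del: upt_Suc)

lemma prefix_sets_take: "m \<le> length \<omega> \<Longrightarrow> take (Suc m) (prefix_sets \<omega>) = prefix_sets (take m \<omega>)"
proof (rule nth_equalityI)
  assume m: "m \<le> length \<omega>"
  show "length (take (Suc m) (prefix_sets \<omega>)) = length (prefix_sets (take m \<omega>))" using m by simp
  fix i assume "i < length (take (Suc m) (prefix_sets \<omega>))"
  then have "i \<le> m" using m by simp
  then show "take (Suc m) (prefix_sets \<omega>) ! i = prefix_sets (take m \<omega>) ! i"
    using m by (simp add: nth_prefix_sets min_absorb1)
qed

lemma set_take_add_diff:
  assumes "distinct \<omega>"
  shows "set (take (m + j) \<omega>) - set (take m \<omega>) = set (take j (drop m \<omega>))"
proof -
  have "set (take m \<omega>) \<inter> set (drop m \<omega>) = {}"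
    using assms by (metis append_take_drop_id distinct_append)
  then show ?thesis by (auto simp: take_add dest: in_set_takeD)
qed

lemma prefix_sets_drop:
  assumes "distinct \<omega>" "m \<le> length \<omega>"
  shows "map (\<lambda>F. F - set (take m \<omega>)) (drop m (prefix_sets \<omega>)) = prefix_sets (drop m \<omega>)"
proof (rule nth_equalityI)
  show "length (map (\<lambda>F. F - set (take m \<omega>)) (drop m (prefix_sets \<omega>))) = length (prefix_sets (drop m \<omega>))"
    using assms(2) by simp
  fix i assume "i < length (map (\<lambda>F. F - set (take m \<omega>)) (drop m (prefix_sets \<omega>)))"
  then have i: "m + i \<le> length \<omega>" using assms(2) by simp
  then show "map (\<lambda>F. F - set (take m \<omega>)) (drop m (prefix_sets \<omega>)) ! i = prefix_sets (drop m \<omega>) ! i"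
    using assms by (simp add: nth_prefix_sets set_take_add_diff)
qed

lemma set_take_swap_nth:
  assumes "Suc i < length \<omega>" "k \<noteq> Suc i"
  shows "set (take k (swap_nth i \<omega>)) = set (take k \<omega>)"
  using assms by (auto simp: take_swap_nth set_swap_nth)

text \<open>The swap at \<open>i\<close> alters only the prefix of length \<open>Suc i\<close>,
  which is the entry that is deleted.\<close>

lemma delete_prefix_sets_swap:
  assumes "Suc i < length \<omega>"
  shows "delete_nth (Suc i) (prefix_sets (swap_nth i \<omega>)) = delete_nth (Suc i) (prefix_sets \<omega>)"
proof (rule nth_equalityI)
  show "length (delete_nth (Suc i) (prefix_sets (swap_nth i \<omega>))) = length (delete_nth (Suc i) (prefix_sets \<omega>))"
    using assms by (simp add: length_delete_nth)
  fix k assume "k < length (delete_nth (Suc i) (prefix_sets (swap_nth i \<omega>)))"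
  then have k: "k < length \<omega>" using assms by (simp add: length_delete_nth)
  show "delete_nth (Suc i) (prefix_sets (swap_nth i \<omega>)) ! k = delete_nth (Suc i) (prefix_sets \<omega>) ! k"
    using k assms by (cases "k < Suc i") (simp_all add: nth_delete_nth nth_prefix_sets set_take_swap_nth)
qed

text \<open>The deleted position can be read off as the one cardinality that is missing from the
  chain.\<close>

lemma delete_prefix_sets_index:
  assumes "distinct \<omega>" "distinct \<nu>" "length \<omega> = length \<nu>" "a < length \<omega>" "b < length \<omega>"
    and eq: "delete_nth a (prefix_sets \<omega>) = delete_nth b (prefix_sets \<nu>)"
  shows "a = b"
proof (rule ccontr)
  assume "a \<noteq> b"
  have c: "card (delete_nth i (prefix_sets \<mu>) ! k) = (if k < i then k else Suc k)"
    if "distinct \<mu>" "i < length \<mu>" "k < length \<mu>" for i k and \<mu> :: "'a list"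
  proof -
    have "card (set (take j \<mu>)) = j" if "j \<le> length \<mu>" for j
      using that \<open>distinct \<mu>\<close> by (simp add: distinct_card)
    then show ?thesis using that by (simp add: nth_delete_nth nth_prefix_sets)
  qed
  have e: "card (delete_nth a (prefix_sets \<omega>) ! k) = card (delete_nth b (prefix_sets \<nu>) ! k)" for k
    using eq by simp
  show False
  proof (cases "a < b")
    case True
    then show False using e[of a] c[OF assms(1,4), of a] c[OF assms(2), of b a] assms(3,4,5) by simp
  next
    case False
    then show False
      using \<open>a \<noteq> b\<close> e[of b] c[OF assms(1,4), of b] c[OF assms(2), of b b] assms(3,4,5) by simp
  qed
qed

text \<open>All prefixes agree except the one of length \<open>Suc i\<close>. Differences of
  consecutive prefixes then give all entries but two, and the unordered pair at \<open>i\<close> and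
  \<open>Suc i\<close>.\<close>

lemma delete_prefix_sets_eqD:
  assumes d: "distinct \<omega>" "distinct \<nu>" and l: "length \<omega> = length \<nu>" and i: "Suc i < length \<omega>"
    and eq: "delete_nth (Suc i) (prefix_sets \<omega>) = delete_nth (Suc i) (prefix_sets \<nu>)"
  shows "\<nu> = \<omega> \<or> \<nu> = swap_nth i \<omega>"
proof -
  have t: "set (take k \<omega>) = set (take k \<nu>)" if "k \<le> length \<omega>" "k \<noteq> Suc i" for k
  proof -
    \<comment> \<open>The position of the prefix of length \<open>k\<close> in the shortened
      chain.\<close>
    define j where "j = (if k < Suc i then k else k - 1)"
    have j: "j < length \<omega>" "(if j < Suc i then j else Suc j) = k" using that i by (auto simp: j_def)
    have "delete_nth (Suc i) (prefix_sets \<omega>) ! j = delete_nth (Suc i) (prefix_sets \<nu>) ! j"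
      using eq by simp
    then show ?thesis
      using j i l that by (simp add: nth_delete_nth nth_prefix_sets split: if_splits)
  qed
  have nth: "{\<mu> ! k} = set (take (Suc k) \<mu>) - set (take k \<mu>)"
    if "distinct \<mu>" "k < length \<mu>" for k and \<mu> :: "'a list"
    using that nth_notin_take[of \<mu> k] by (auto simp: set_take_Suc)
  have same: "\<omega> ! k = \<nu> ! k" if "k < length \<omega>" "k \<noteq> i" "k \<noteq> Suc i" for k
  proof -
    have "{\<omega> ! k} = {\<nu> ! k}"
      using nth[OF d(1), of k] nth[OF d(2), of k] t[of k] t[of "Suc k"] that l by simp
    then show ?thesis by simp
  qed
  have two: "{\<mu> ! i, \<mu> ! Suc i} = set (take (Suc (Suc i)) \<mu>) - set (take i \<mu>)"
    if "distinct \<mu>" "Suc i < length \<mu>" for \<mu> :: "'a list"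
    using that nth_notin_take[of \<mu> i] nth_notin_take[of \<mu> "Suc i"] by (auto simp: set_take_Suc)
  have "{\<omega> ! i, \<omega> ! Suc i} = {\<nu> ! i, \<nu> ! Suc i}"
    using two[OF d(1) i] two[OF d(2)] t[of i] t[of "Suc (Suc i)"] i l by simp
  then consider "\<omega> ! i = \<nu> ! i" "\<omega> ! Suc i = \<nu> ! Suc i" | "\<omega> ! i = \<nu> ! Suc i" "\<omega> ! Suc i = \<nu> ! i"
    by (auto simp: doubleton_eq_iff)
  then show ?thesis
  proof cases
    case 1
    have "\<nu> ! k = \<omega> ! k" if "k < length \<omega>" for k
      using same[OF that] 1 by (cases "k = i"; cases "k = Suc i") auto
    then show ?thesis using l by (metis nth_equalityI)
  next
    case 2
    have "\<nu> ! k = swap_nth i \<omega> ! k" if "k < length \<omega>" for k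
      using same[OF that] 2 that i by (cases "k = i"; cases "k = Suc i") (auto simp: swap_nth_def nth_list_update)
    then show ?thesis using l by (metis length_swap_nth nth_equalityI)
  qed
qed

definition tree_chain :: "'a set \<Rightarrow> 'a set list \<Rightarrow> 'a set tree list" where
  "tree_chain S \<omega> = map (quotient_tree S (set \<omega>)) (prefix_sets \<omega>)"

lemma edge_lists_prefix_sets:
  "\<omega> \<in> edge_lists S n \<Longrightarrow> prefix_sets \<omega> \<in> full_chains (Pow (set \<omega>)) (\<subseteq>) n"
  using prefix_sets_full_chain by (auto simp: edge_lists_def)

lemma tree_chain_full_chain:
  assumes "\<omega> \<in> edge_lists S n"
  shows "tree_chain S \<omega> \<in> full_chains (MLT S) mlt_le n"
  unfolding tree_chain_def
  by (rule full_chains_MLT_I[OF _ edge_lists_prefix_sets[OF assms]])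
    (use assms in \<open>simp add: edge_lists_def\<close>)

lemma tree_chain_inj: "inj_on (tree_chain S) (edge_lists S n)"
proof (rule inj_onI)
  fix \<omega> \<nu> assume w: "\<omega> \<in> edge_lists S n" "\<nu> \<in> edge_lists S n" and eq: "tree_chain S \<omega> = tree_chain S \<nu>"
  have "is_tree (S, set \<omega>)" "is_tree (S, set \<nu>)" using w by (simp_all add: edge_lists_def)
  from chain_MLT_inj[OF this edge_lists_prefix_sets[OF w(1)] edge_lists_prefix_sets[OF w(2)]]
  have "prefix_sets \<omega> = prefix_sets \<nu>" using eq by (simp add: tree_chain_def)
  then show "\<omega> = \<nu>" using w prefix_sets_inj by (auto simp: edge_lists_def)
qed

lemma tree_finite_edges: "finite S \<Longrightarrow> is_tree (S, E) \<Longrightarrow> finite E"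
  using tree_edges_Pow by (metis finite_Pow_iff finite_subset)

lemma card_edges_arity: "arity S \<Longrightarrow> is_tree (S, E) \<Longrightarrow> card E = card S - 1"
  using tree_card_edges[of S E] by (simp add: arity_def)

lemma full_chains_MLT_rank:
  assumes S: "arity S" and z: "z \<in> full_chains (MLT S) mlt_le n"
  shows "n \<le> card S - 1"
proof -
  obtain E Fs where E: "is_tree (S, E)" "Fs \<in> full_chains (Pow E) (\<subseteq>) n"
    using z by (rule full_chains_MLT_E)
  have "finite E" using tree_finite_edges[OF _ E(1)] S by (simp add: arity_def)
  then show ?thesis using full_chain_card(2)[OF _ E(2)] card_edges_arity[OF S E(1)] by simp
qed

lemma full_chains_MLT_top:
  assumes S: "arity S" and n: "n = card S - 1"
  shows "full_chains (MLT S) mlt_le n = tree_chain S ` edge_lists S n"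
proof (intro equalityI subsetI)
  fix z assume "z \<in> full_chains (MLT S) mlt_le n"
  then obtain E Fs where E: "is_tree (S, E)" "Fs \<in> full_chains (Pow E) (\<subseteq>) n"
    "z = map (quotient_tree S E) Fs"
    by (rule full_chains_MLT_E)
  have fin: "finite E" using tree_finite_edges[OF _ E(1)] S by (simp add: arity_def)
  have c: "n = card E" using card_edges_arity[OF S E(1)] n by simp
  obtain \<omega> where w: "distinct \<omega>" "set \<omega> = E" "Fs = prefix_sets \<omega>"
    using full_chain_prefix_sets[OF fin E(2)[unfolded c]] .
  then have "\<omega> \<in> edge_lists S n" using E(1) c distinct_card[OF w(1)] by (simp add: edge_lists_def)
  moreover have "z = tree_chain S \<omega>" using E(3) w by (simp add: tree_chain_def)
  ultimately show "z \<in> tree_chain S ` edge_lists S n" by blast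
qed (use tree_chain_full_chain in blast)

section \<open>Vanishing of the cohomology below the top degree\<close>

lemma cochainsD: "f \<in> cochains P leq n \<Longrightarrow> z \<notin> full_chains P leq n \<Longrightarrow> f z = 0"
  by (simp add: cochains_def free_module_def)

lemma cochains_eqI:
  assumes "f \<in> cochains P leq n" "g \<in> cochains P leq n"
    "\<And>z. z \<in> full_chains P leq n \<Longrightarrow> f z = g z"
  shows "f = g"
  using assms cochainsD by (metis ext)

lemma cocycles_face_sum:
  "f \<in> cocycles P leq n \<Longrightarrow> z \<in> full_chains P leq (Suc n) \<Longrightarrow> face_sum n f z = 0"
  using coboundary_eq[of P leq n f z] by (simp add: cocycles_def)

lemma cocyclesI:
  assumes "f \<in> cochains P leq n" "\<And>z. z \<in> full_chains P leq (Suc n) \<Longrightarrow> face_sum n f z = 0"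
  shows "f \<in> cocycles P leq n"
proof -
  have "coboundary P leq n f = (\<lambda>_. 0)" using assms(2) by (auto simp: coboundary_eq)
  then show ?thesis using assms(1) by (simp add: cocycles_def)
qed

text \<open>Primitives found over the individual labeled trees can be glued: deleting an inner
  element keeps the top of a chain, so all faces stay over the same tree.\<close>

lemma MLT_cocycle_coboundary:
  fixes f :: "'a set tree list \<Rightarrow> 'k::{comm_ring,comm_monoid_mult}"
  assumes S: "arity S" and n: "n < card S - 1" and f: "f \<in> cocycles (MLT S) mlt_le n"
  shows "f \<in> coboundaries (MLT S) mlt_le n"
proof -
  have fc: "f \<in> cochains (MLT S) mlt_le n" using f by (simp add: cocycles_def)
  define p where "p E Fs = (if Fs \<in> full_chains (Pow E) (\<subseteq>) n then f (map (quotient_tree S E) Fs) else 0)" for E Fs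
  have p: "p E \<in> coboundaries (Pow E) (\<subseteq>) n" if t: "is_tree (S, E)" for E
  proof (rule pow_cocycle_coboundary)
    show "finite E" using tree_finite_edges[OF _ t] S by (simp add: arity_def)
    show "n < card E" using card_edges_arity[OF S t] n by simp
    show "p E \<in> cocycles (Pow E) (\<subseteq>) n"
    proof (rule cocyclesI)
      show "p E \<in> cochains (Pow E) (\<subseteq>) n" by (simp add: cochains_def free_module_def p_def)
      fix Fs assume Fs: "Fs \<in> full_chains (Pow E) (\<subseteq>) (Suc n)"
      have "face_sum n (p E) Fs = face_sum n f (map (quotient_tree S E) Fs)"
        unfolding face_sum_def
        by (intro sum.cong refl) (simp add: p_def full_chains_delete_nth[OF Fs] map_delete_nth)
      then show "face_sum n (p E) Fs = 0"
        using cocycles_face_sum[OF f full_chains_MLT_I[OF t Fs]] by simp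
    qed
  qed
  show ?thesis
  proof (cases n)
    \<comment> \<open>In degree 0 the only coboundary is zero, so the restriction of
      \<open>f\<close> over each labeled tree vanishes.\<close>
    case 0
    have "f z = 0" for z
    proof (cases "z \<in> full_chains (MLT S) mlt_le n")
      case True
      then obtain E Fs where E: "is_tree (S, E)" "Fs \<in> full_chains (Pow E) (\<subseteq>) n"
        "z = map (quotient_tree S E) Fs" by (rule full_chains_MLT_E)
      have "p E = (\<lambda>_. 0)" using p[OF E(1)] 0 by (simp add: coboundaries_def)
      then show ?thesis using E(2,3) by (metis p_def)
    qed (rule cochainsD[OF fc])
    then have "f = (\<lambda>_. 0)" by blast
    then show ?thesis using 0 by (simp add: coboundaries_def)
  next
    case (Suc k)
    have "\<exists>g. p E = coboundary (Pow E) (\<subseteq>) k g" if "is_tree (S, E)" for E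
      using p[OF that] Suc by (auto simp: coboundaries_def)
    then obtain g where g: "\<And>E. is_tree (S, E) \<Longrightarrow> p E = coboundary (Pow E) (\<subseteq>) k (g E)" by metis
    \<comment> \<open>Recovers the tree and the chain of edge sets from a chain of quotients; by
      \<open>chain_MLT_inj\<close> the choice is the only one possible.\<close>
    define D where "D z = (SOME x. is_tree (S, fst x) \<and> snd x \<in> full_chains (Pow (fst x)) (\<subseteq>) k
      \<and> z = map (quotient_tree S (fst x)) (snd x))" for z
    have D: "D (map (quotient_tree S E) Fs) = (E, Fs)"
      if t: "is_tree (S, E)" and Fs: "Fs \<in> full_chains (Pow E) (\<subseteq>) k" for E Fs
    proof -
      let ?z = "map (quotient_tree S E) Fs" and ?x = "D (map (quotient_tree S E) Fs)"
      have "is_tree (S, fst ?x) \<and> snd ?x \<in> full_chains (Pow (fst ?x)) (\<subseteq>) k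
          \<and> ?z = map (quotient_tree S (fst ?x)) (snd ?x)"
        unfolding D_def by (rule someI[of _ "(E, Fs)"]) (use that in simp)
      then show ?thesis using chain_MLT_inj[OF t _ Fs] by (metis prod.collapse)
    qed
    define h where "h z = (if z \<in> full_chains (MLT S) mlt_le k then g (fst (D z)) (snd (D z)) else 0)" for z
    have h: "h \<in> cochains (MLT S) mlt_le k" by (simp add: h_def cochains_def free_module_def)
    have "f = coboundary (MLT S) mlt_le k h"
    proof (rule cochains_eqI[OF fc])
      show "coboundary (MLT S) mlt_le k h \<in> cochains (MLT S) mlt_le n"
        unfolding Suc by (rule coboundary_cochain)
      fix z assume z: "z \<in> full_chains (MLT S) mlt_le n"
      then obtain E Fs where E: "is_tree (S, E)" "Fs \<in> full_chains (Pow E) (\<subseteq>) n"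
        "z = map (quotient_tree S E) Fs" by (rule full_chains_MLT_E)
      have "h (delete_nth i z) = g E (delete_nth i Fs)" if i: "1 \<le> i" "i \<le> k" for i
      proof -
        have d: "delete_nth i Fs \<in> full_chains (Pow E) (\<subseteq>) k"
          by (rule full_chains_delete_nth[OF E(2)[unfolded Suc] i])
        have "delete_nth i z = map (quotient_tree S E) (delete_nth i Fs)"
          using E(3) by (simp add: map_delete_nth)
        then show ?thesis using D[OF E(1) d] full_chains_MLT_I[OF E(1) d] by (simp add: h_def)
      qed
      then have "face_sum k h z = face_sum k (g E) Fs"
        unfolding face_sum_def by (intro sum.cong) auto
      moreover have "f z = p E Fs" using E by (simp add: p_def)
      moreover have "p E Fs = face_sum k (g E) Fs"
        using g[OF E(1)] E(2) Suc by (simp add: coboundary_eq)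
      ultimately show "f z = coboundary (MLT S) mlt_le k h z" using z Suc by (simp add: coboundary_eq)
    qed
    then show ?thesis using h Suc by (simp add: coboundaries_def)
  qed
qed

section \<open>The isomorphism\<close>

text \<open>The map behind the isomorphism, on the level of cochains. It makes sense in every
  degree: away from the top there are no generators, and it is zero.\<close>

definition tree_values ::
    "'a set \<Rightarrow> nat \<Rightarrow> ('a set tree list \<Rightarrow> 'k) \<Rightarrow> 'a tree \<times> 'a set list \<Rightarrow> 'k::{comm_ring,comm_monoid_mult}" where
  "tree_values S n f = (\<lambda>x. if x \<in> tree_gens S n then f (tree_chain S (snd x)) else 0)"

lemma tree_values_free: "tree_values S n f \<in> free_module (tree_gens S n)"
  by (simp add: tree_values_def free_module_def)

lemma tree_values_gen:
  "arity S \<Longrightarrow> \<omega> \<in> edge_lists S n \<Longrightarrow> tree_values S n f (gen S \<omega>) = f (tree_chain S \<omega>)"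
  by (simp add: tree_values_def gen_mem_tree_gens) (simp add: gen_def)

lemma tree_values_lin:
  "tree_values S n (\<lambda>x. f x + g x) = (\<lambda>z. tree_values S n f z + tree_values S n g z)"
  "tree_values S n (\<lambda>x. f x - g x) = (\<lambda>z. tree_values S n f z - tree_values S n g z)"
  "tree_values S n (\<lambda>x. c * f x) = (\<lambda>z. c * tree_values S n f z)"
  by (auto simp: tree_values_def)

section \<open>Cocycles and coboundaries as submodules\<close>

lemma cochains_submodule: "fun_submodule (cochains P leq n)"
  unfolding cochains_def by (rule free_module_submodule)

lemma cocycles_submodule: "fun_submodule (cocycles P leq n)"
  using fun_submoduleD[OF cochains_submodule[of P leq n]]
  by (auto simp: fun_submodule_def cocycles_def coboundary_add coboundary_smult coboundary_eq face_sum_def)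

lemma coboundaries_submodule: "fun_submodule (coboundaries P leq n)"
proof (cases n)
  case 0
  then show ?thesis by (simp add: coboundaries_def fun_submodule_def)
next
  case (Suc k)
  note C = fun_submoduleD[OF cochains_submodule[of P leq k]]
  have "coboundary P leq k (\<lambda>_. 0) = (\<lambda>_. 0)" by (auto simp: coboundary_eq face_sum_def)
  then have 1: "(\<lambda>_. 0) \<in> coboundary P leq k ` cochains P leq k"
    by (rule image_eqI[OF sym C(1)])
  have 2: "(\<lambda>x. f x + g x) \<in> coboundary P leq k ` cochains P leq k"
    if fg: "f \<in> coboundary P leq k ` cochains P leq k" "g \<in> coboundary P leq k ` cochains P leq k" for f g
  proof -
    obtain f' g' where "f = coboundary P leq k f'" "f' \<in> cochains P leq k"
      "g = coboundary P leq k g'" "g' \<in> cochains P leq k" using fg by blast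
    then show ?thesis by (intro image_eqI[OF _ C(2)[of f' g']]) (simp_all add: coboundary_add)
  qed
  have 3: "(\<lambda>x. c * f x) \<in> coboundary P leq k ` cochains P leq k"
    if f: "f \<in> coboundary P leq k ` cochains P leq k" for c f
  proof -
    obtain f' where "f = coboundary P leq k f'" "f' \<in> cochains P leq k" using f by blast
    then show ?thesis by (intro image_eqI[OF _ C(3)[of f' c]]) (simp_all add: coboundary_smult)
  qed
  show ?thesis
    unfolding fun_submodule_def coboundaries_def Suc nat.case by (intro conjI ballI allI 1 2 3)
qed

lemma coboundaries_subset_cocycles: "coboundaries P leq n \<subseteq> cocycles P leq n"
proof (cases n)
  case 0
  then show ?thesis using fun_submodule_zero[OF cocycles_submodule] by (simp add: coboundaries_def)
next
  case (Suc k)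
  then show ?thesis
    using coboundary_cochain coboundary_coboundary by (auto simp: coboundaries_def cocycles_def)
qed

lemma cohomology_quotient: "fun_quotient (cocycles P leq n) (coboundaries P leq n)"
  by (simp add: fun_quotient_def cocycles_submodule coboundaries_submodule coboundaries_subset_cocycles)

lemma top_cocycles:
  assumes S: "arity S"
  shows "cocycles (MLT S) mlt_le (card S - 1) = cochains (MLT S) mlt_le (card S - 1)"
proof -
  have "full_chains (MLT S) mlt_le (Suc (card S - 1)) = {}"
    using full_chains_MLT_rank[OF S] by fastforce
  then show ?thesis by (auto simp: cocycles_def coboundary_eq)
qed

text \<open>The face at \<open>Suc j\<close> forgets the one edge set that a swap at
  \<open>j\<close> changes. So every single term of the coboundary is, as a function of the order,
  invariant under an adjacent swap.\<close>

lemma tree_values_coboundary: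
  assumes S: "arity S" and f: "f \<in> coboundaries (MLT S) mlt_le n"
  shows "tree_values S n f \<in> swap_space S n"
proof (cases n)
  case 0
  then have "f = (\<lambda>_. 0)" using f by (simp add: coboundaries_def)
  then have "tree_values S n f = (\<lambda>_. 0)" by (auto simp: tree_values_def)
  then show ?thesis by (simp add: fun_span_zero)
next
  case (Suc k)
  then obtain g where g: "f = coboundary (MLT S) mlt_le k g" using f by (auto simp: coboundaries_def)
  define u where "u i = tree_values S n (\<lambda>z. g (delete_nth i z))" for i
  have u: "u i \<in> swap_space S n" if i: "i \<in> {1..k}" for i
  proof -
    obtain j where j: "i = Suc j" using i by (cases i) auto
    have jn: "Suc j < n" using i j Suc by simp
    have "u i (gen S (swap_nth j \<omega>)) = u i (gen S \<omega>)" if w: "\<omega> \<in> edge_lists S n" for \<omega>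
    proof -
      have l: "Suc j < length \<omega>" using w jn by (simp add: edge_lists_def)
      have "delete_nth i (tree_chain S (swap_nth j \<omega>)) = delete_nth i (tree_chain S \<omega>)"
        unfolding tree_chain_def map_delete_nth[symmetric] set_swap_nth[OF l] j
          delete_prefix_sets_swap[OF l] ..
      then show ?thesis
        unfolding u_def tree_values_gen[OF S w] tree_values_gen[OF S swap_nth_edge_lists[OF jn w]] by simp
    qed
    then have "u i \<in> swap_invariants S n j"
      by (simp add: swap_invariants_def u_def tree_values_free)
    then show ?thesis by (rule swap_invariants_swap_space[OF jn])
  qed
  have sum_closed: "(\<lambda>x. \<Sum>i\<in>I. (- 1) ^ i * u i x) \<in> swap_space S n" if "finite I" "I \<subseteq> {1..k}" for I
    using that
  proof (induction I rule: finite_induct)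
    case empty
    then show ?case by (simp add: fun_span_zero)
  next
    case (insert i I)
    then have "(\<lambda>x. (- 1) ^ i * u i x + (\<Sum>i\<in>I. (- 1) ^ i * u i x)) \<in> swap_space S n"
      by (intro fun_span_add fun_span_smult u) auto
    then show ?case using insert by simp
  qed
  have "tree_values S n f = (\<lambda>x. \<Sum>i\<in>{1..k}. (- 1) ^ i * u i x)"
  proof
    fix x
    show "tree_values S n f x = (\<Sum>i\<in>{1..k}. (- 1) ^ i * u i x)"
    proof (cases "x \<in> tree_gens S n")
      case True
      then obtain \<omega> where w: "x = gen S \<omega>" "\<omega> \<in> edge_lists S n" by (auto simp: tree_gens_eq[OF S])
      show ?thesis
        unfolding w(1) tree_values_gen[OF S w(2)] u_def g coboundary_eq face_sum_def
        using tree_chain_full_chain[OF w(2), unfolded Suc] by simp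
    qed (simp add: tree_values_def u_def)
  qed
  then show ?thesis using sum_closed[of "{1..k}"] by simp
qed

definition chain_values ::
    "'a set \<Rightarrow> nat \<Rightarrow> ('a tree \<times> 'a set list \<Rightarrow> 'k) \<Rightarrow> 'a set tree list \<Rightarrow> 'k::{comm_ring,comm_monoid_mult}" where
  "chain_values S n u = (\<lambda>z. if z \<in> tree_chain S ` edge_lists S n
     then u (gen S (inv_into (edge_lists S n) (tree_chain S) z)) else 0)"

lemma chain_values_chain:
  "\<omega> \<in> edge_lists S n \<Longrightarrow> chain_values S n u (tree_chain S \<omega>) = u (gen S \<omega>)"
  by (simp add: chain_values_def inv_into_f_f[OF tree_chain_inj])

lemma chain_values_cochain: "chain_values S n u \<in> cochains (MLT S) mlt_le n"
  using tree_chain_full_chain by (fastforce simp: chain_values_def cochains_def free_module_def)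

lemma chain_values_cocycle:
  assumes S: "arity S"
  shows "chain_values S n u \<in> cocycles (MLT S) mlt_le n"
proof (cases "n = card S - 1")
  case True
  then show ?thesis using chain_values_cochain top_cocycles[OF S] by metis
next
  case False
  then have "edge_lists S n = {}" using edge_lists_rank[OF S] by blast
  then have "chain_values S n u = (\<lambda>_. 0)" by (auto simp: chain_values_def)
  then show ?thesis using fun_submodule_zero[OF cocycles_submodule] by simp
qed

lemma tree_values_chain_values:
  assumes S: "arity S" and u: "u \<in> free_module (tree_gens S n)"
  shows "tree_values S n (chain_values S n u) = u"
  by (rule free_module_tree_gens_eqI[OF S tree_values_free u])
    (simp add: tree_values_gen[OF S] chain_values_chain)

lemma chain_values_tree_values:
  assumes S: "arity S" and n: "n = card S - 1" and f: "f \<in> cochains (MLT S) mlt_le n"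
  shows "chain_values S n (tree_values S n f) = f"
proof (rule cochains_eqI[OF chain_values_cochain f])
  fix z assume "z \<in> full_chains (MLT S) mlt_le n"
  then obtain \<omega> where "\<omega> \<in> edge_lists S n" "z = tree_chain S \<omega>"
    using full_chains_MLT_top[OF S n] by blast
  then show "chain_values S n (tree_values S n f) z = f z"
    by (simp add: chain_values_chain tree_values_gen[OF S])
qed

text \<open>For \<open>u\<close> invariant under the swap at \<open>i\<close>, a primitive is
  supported on the chains with the element at \<open>Suc i\<close> missing. Its value there is the
  common value of \<open>u\<close> on the two orders that complete the chain, and no other face of a
  maximal chain is of this kind.\<close>

lemma chain_values_swap_space:
  assumes S: "arity S" and u: "u \<in> swap_space S n"
  shows "chain_values S n u \<in> coboundaries (MLT S) mlt_le n"
proof (rule linear_image_swap_space[OF u coboundaries_submodule])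
  show "chain_values S n (\<lambda>_. 0) = (\<lambda>_. 0)" by (auto simp: chain_values_def)
  show "chain_values S n (\<lambda>x. f x + g x) = (\<lambda>z. chain_values S n f z + chain_values S n g z)"
    for f g :: "'a tree \<times> 'a set list \<Rightarrow> 'b" by (auto simp: chain_values_def)
  show "chain_values S n (\<lambda>x. c * f x) = (\<lambda>z. c * chain_values S n f z)"
    for c and f :: "'a tree \<times> 'a set list \<Rightarrow> 'b" by (auto simp: chain_values_def)
  fix i and u :: "'a tree \<times> 'a set list \<Rightarrow> 'b"
  assume i: "Suc i < n" and u: "u \<in> swap_invariants S n i"
  obtain k where k: "n = Suc k" using i by (cases n) auto
  define G where "G \<omega> = delete_nth (Suc i) (tree_chain S \<omega>)" for \<omega> :: "'a set list"
  \<comment> \<open>The factor \<open>(-1)^(Suc i)\<close> compensates the sign of the face at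
    \<open>Suc i\<close>; the order chosen by \<open>SOME\<close> does not matter, by invariance of
    \<open>u\<close>.\<close>
  define g where "g c = (if c \<in> G ` edge_lists S n
    then (- 1) ^ Suc i * u (gen S (SOME \<omega>. \<omega> \<in> edge_lists S n \<and> G \<omega> = c)) else 0)" for c
  \<comment> \<open>The position is recovered from the missing cardinality, and the order up to the
    swap from the remaining prefixes.\<close>
  have del: "j = Suc i \<and> (\<nu> = \<omega> \<or> \<nu> = swap_nth i \<omega>)"
    if w: "\<omega> \<in> edge_lists S n" and v: "\<nu> \<in> edge_lists S n" and j: "1 \<le> j" "j \<le> k"
      and eq: "delete_nth j (tree_chain S \<nu>) = G \<omega>" for \<omega> \<nu> j
  proof -
    have W: "is_tree (S, set \<omega>)" "distinct \<omega>" "length \<omega> = n" using w by (auto simp: edge_lists_def)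
    have V: "is_tree (S, set \<nu>)" "distinct \<nu>" "length \<nu> = n" using v by (auto simp: edge_lists_def)
    have f1: "delete_nth j (prefix_sets \<nu>) \<in> full_chains (Pow (set \<nu>)) (\<subseteq>) k"
      by (rule full_chains_delete_nth[OF edge_lists_prefix_sets[OF v, unfolded k] j])
    have f2: "delete_nth (Suc i) (prefix_sets \<omega>) \<in> full_chains (Pow (set \<omega>)) (\<subseteq>) k"
      by (rule full_chains_delete_nth[OF edge_lists_prefix_sets[OF w, unfolded k]]) (use i k in auto)
    have e: "delete_nth j (prefix_sets \<nu>) = delete_nth (Suc i) (prefix_sets \<omega>)"
      using chain_MLT_inj[OF V(1) W(1) f1 f2] eq
      by (simp add: G_def tree_chain_def map_delete_nth)
    have ji: "j = Suc i"
      by (rule delete_prefix_sets_index[OF V(2) W(2) _ _ _ e]) (use V W i j k in auto)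
    have "\<nu> = \<omega> \<or> \<nu> = swap_nth i \<omega>"
      by (rule delete_prefix_sets_eqD[OF W(2) V(2)]) (use V W i e ji in auto)
    then show ?thesis using ji by blast
  qed
  have Gu: "g (G \<omega>) = (- 1) ^ Suc i * u (gen S \<omega>)" if w: "\<omega> \<in> edge_lists S n" for \<omega>
  proof -
    define \<nu> where "\<nu> = (SOME \<nu>. \<nu> \<in> edge_lists S n \<and> G \<nu> = G \<omega>)"
    have v: "\<nu> \<in> edge_lists S n \<and> G \<nu> = G \<omega>"
      unfolding \<nu>_def by (rule someI[of _ \<omega>]) (use w in simp)
    then have "\<nu> = \<omega> \<or> \<nu> = swap_nth i \<omega>"
      using del[OF w, of \<nu> "Suc i"] i k by (simp add: G_def)
    then have "u (gen S \<nu>) = u (gen S \<omega>)" using u w by (auto simp: swap_invariants_def)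
    then show ?thesis using w unfolding g_def \<nu>_def by simp
  qed
  have "g \<in> cochains (MLT S) mlt_le k"
  proof -
    have "G \<omega> \<in> full_chains (MLT S) mlt_le k" if "\<omega> \<in> edge_lists S n" for \<omega>
      unfolding G_def
      by (rule full_chains_delete_nth[OF tree_chain_full_chain[OF that, unfolded k]]) (use i k in auto)
    then show ?thesis by (fastforce simp: cochains_def free_module_def g_def)
  qed
  moreover have "chain_values S n u = coboundary (MLT S) mlt_le k g"
  proof (rule cochains_eqI[OF chain_values_cochain])
    show "coboundary (MLT S) mlt_le k g \<in> cochains (MLT S) mlt_le n"
      unfolding k by (rule coboundary_cochain)
    fix z assume z: "z \<in> full_chains (MLT S) mlt_le n"
    show "chain_values S n u z = coboundary (MLT S) mlt_le k g z"
    proof (cases "n = card S - 1")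
      case True
      then obtain \<omega> where w: "\<omega> \<in> edge_lists S n" "z = tree_chain S \<omega>"
        using z full_chains_MLT_top[OF S True] by blast
      have "(- 1) ^ j * g (delete_nth j z) = (if j = Suc i then u (gen S \<omega>) else 0)"
        if j: "j \<in> {1..k}" for j
      proof (cases "j = Suc i")
        case True
        have "(- 1) ^ j * g (delete_nth j z) = ((- 1) ^ j * (- 1) ^ j) * u (gen S \<omega>)"
          using Gu[OF w(1)] True w(2) unfolding G_def by (simp only: mult.assoc)
        then show ?thesis unfolding if_P[OF True] by (simp only: sgn_square mult_1_left)
      next
        case False
        have "delete_nth j z \<notin> G ` edge_lists S n"
        proof
          assume "delete_nth j z \<in> G ` edge_lists S n"
          then obtain \<nu> where "\<nu> \<in> edge_lists S n" "delete_nth j z = G \<nu>" by blast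
          then show False using del[of \<nu> \<omega> j] w j False by simp
        qed
        then show ?thesis using False by (simp add: g_def)
      qed
      then have "face_sum k g z = (\<Sum>j\<in>{1..k}. if j = Suc i then u (gen S \<omega>) else 0)"
        unfolding face_sum_def by (intro sum.cong refl) simp
      also have "\<dots> = u (gen S \<omega>)" using i k by simp
      finally show ?thesis using z k w by (simp add: coboundary_eq chain_values_chain)
    next
      case False
      then have "edge_lists S n = {}" using edge_lists_rank[OF S] by blast
      then show ?thesis by (simp add: chain_values_def coboundary_eq g_def face_sum_def)
    qed
  qed
  ultimately show "chain_values S n u \<in> coboundaries (MLT S) mlt_le n"
    using k by (simp add: coboundaries_def)
qed

text \<open>Below the top degree the right side always holds by vanishing, above it there are no
  chains, and in the top degree \<open>chain_values\<close> inverts \<open>tree_values\<close>. The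
  equivalence yields both the injectivity of the isomorphism and the well-definedness of the
  operations on \<open>h_MLT\<close>.\<close>

lemma tree_values_swap_space_iff:
  assumes S: "arity S" and f: "f \<in> cocycles (MLT S) mlt_le n"
  shows "tree_values S n f \<in> swap_space S n \<longleftrightarrow> f \<in> coboundaries (MLT S) mlt_le n"
proof
  assume t: "tree_values S n f \<in> swap_space S n"
  have fc: "f \<in> cochains (MLT S) mlt_le n" using f by (simp add: cocycles_def)
  consider "n < card S - 1" | "n = card S - 1" | "n > card S - 1" by linarith
  then show "f \<in> coboundaries (MLT S) mlt_le n"
  proof cases
    case 1
    then show ?thesis by (rule MLT_cocycle_coboundary[OF S _ f])
  next
    case 2
    then show ?thesis using chain_values_swap_space[OF S t] chain_values_tree_values[OF S 2 fc] by simp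
  next
    case 3
    then have "f z = 0" for z
      using full_chains_MLT_rank[OF S, of z n] cochainsD[OF fc, of z] by fastforce
    then have "f = (\<lambda>_. 0)" by blast
    then show ?thesis using fun_submodule_zero[OF coboundaries_submodule] by simp
  qed
qed (rule tree_values_coboundary[OF S])

text \<open>Guards the sum in \<open>mlt_comp\<close>, which over an infinite index set would take
  the default value 0.\<close>

lemma finite_MLT: "finite S \<Longrightarrow> finite (MLT S)"
proof -
  assume S: "finite S"
  have "MLT S \<subseteq> (\<lambda>(E, F). quotient_tree S E F) ` (Pow (Pow S) \<times> Pow (Pow S))"
  proof
    fix t assume "t \<in> MLT S"
    then obtain E F where E: "is_tree (S, E)" "F \<subseteq> E" "t = quotient_tree S E F" by (rule MLT_cases)
    moreover have "E \<in> Pow (Pow S)" "F \<in> Pow (Pow S)" using tree_edges_Pow[OF E(1)] E(2) by auto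
    ultimately show "t \<in> (\<lambda>(E, F). quotient_tree S E F) ` (Pow (Pow S) \<times> Pow (Pow S))" by blast
  qed
  then show ?thesis using S by (meson finite_Pow_iff finite_SigmaI finite_imageI finite_subset)
qed

text \<open>
  In terms of sets of edges, these are the images under \<open>\<phi>\<^sub>t\<close> and \<open>\<psi>\<^sub>t\<close> of the two halves of a chain of
  multilabeled trees through \<open>t\<close>.
\<close>

definition outer_chain :: "'a \<Rightarrow> 'a set \<Rightarrow> nat \<Rightarrow> 'a set set list \<Rightarrow> 'a set set list" where
  "outer_chain a B m Fs = map ((`) ((`) (merge a B))) (take (Suc m) Fs)"

definition inner_chain :: "nat \<Rightarrow> 'a set set list \<Rightarrow> 'a set set list" where
  "inner_chain m Fs = map (\<lambda>F. F - Fs ! m) (drop m Fs)"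

section \<open>Cutting full chains at a given position\<close>

lemma full_chain_nth_mono:
  assumes "Fs \<in> full_chains (Pow E) (\<subseteq>) n" "i < j" "j \<le> n"
  shows "Fs ! i \<subset> Fs ! j"
  using assms by (auto simp: full_chains_Pow sorted_wrt_iff_nth_less)

lemma full_chain_nth_subset:
  assumes "Fs \<in> full_chains (Pow E) (\<subseteq>) n" "i \<le> n"
  shows "Fs ! i \<subseteq> E"
  using assms by (metis Pow_iff full_chains_Pow less_Suc_eq_le nth_mem subsetD)

lemma full_chain_ends:
  assumes "Fs \<in> full_chains (Pow E) (\<subseteq>) n"
  shows "Fs ! 0 = {}" "Fs ! n = E"
proof -
  have "length Fs = Suc n" "hd Fs = {}" "last Fs = E" using assms by (auto simp: full_chains_Pow)
  moreover from this have "Fs \<noteq> []" by auto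
  ultimately show "Fs ! 0 = {}" "Fs ! n = E" by (simp_all add: hd_conv_nth last_conv_nth)
qed

lemma full_chains_PowI:
  assumes "length Fs = Suc n" "\<And>i. i < n \<Longrightarrow> Fs ! i \<subset> Fs ! Suc i" "Fs ! 0 = {}" "Fs ! n = E"
  shows "Fs \<in> full_chains (Pow E) (\<subseteq>) n"
proof -
  have s: "sorted_wrt (\<subset>) Fs"
    by (subst sorted_wrt_iff_nth_Suc_transp) (use assms in \<open>auto intro: transpI\<close>)
  have nth: "Fs ! i \<subseteq> E" if "i \<le> n" for i
  proof (cases "i = n")
    case False
    then have "Fs ! i \<subset> Fs ! n" using s that assms(1) by (simp add: sorted_wrt_iff_nth_less)
    then show ?thesis using assms(4) by (simp add: psubset_imp_subset)
  qed (use assms(4) in simp)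
  have "set Fs \<subseteq> Pow E"
  proof
    fix F assume "F \<in> set Fs"
    then obtain i where "i \<le> n" "F = Fs ! i"
      using assms(1) by (auto simp: in_set_conv_nth less_Suc_eq_le)
    then show "F \<in> Pow E" using nth by simp
  qed
  moreover have "Fs \<noteq> []" using assms(1) by auto
  ultimately show ?thesis using s assms by (simp add: full_chains_Pow hd_conv_nth last_conv_nth)
qed

text \<open>Inclusions stay strict because merging is injective on the edges that survive at the
  cut.\<close>

lemma outer_chain_full:
  assumes Fs: "Fs \<in> full_chains (Pow E) (\<subseteq>) (m + n)" and inj: "inj_on ((`) (merge a B)) (Fs ! m)"
  shows "outer_chain a B m Fs \<in> full_chains (Pow ((`) (merge a B) ` (Fs ! m))) (\<subseteq>) m"
proof (rule full_chains_PowI)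
  let ?h = "(`) ((`) (merge a B))"
  have l: "length Fs = Suc (m + n)" using Fs by (simp add: full_chains_Pow)
  have nth: "outer_chain a B m Fs ! i = ?h (Fs ! i)" if "i \<le> m" for i
    using that l by (simp add: outer_chain_def)
  show "length (outer_chain a B m Fs) = Suc m" using l by (simp add: outer_chain_def)
  show "outer_chain a B m Fs ! 0 = {}" "outer_chain a B m Fs ! m = ?h (Fs ! m)"
    using full_chain_ends(1)[OF Fs] by (simp_all add: nth)
  fix i assume i: "i < m"
  have 1: "Fs ! i \<subset> Fs ! Suc i" using full_chain_nth_mono[OF Fs, of i "Suc i"] i by simp
  have 2: "Fs ! Suc i \<subseteq> Fs ! m"
    using full_chain_nth_mono[OF Fs, of "Suc i" m] i by (cases "Suc i = m") auto
  have "?h (Fs ! i) \<subset> ?h (Fs ! Suc i)"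
    by (rule image_strict_mono[OF inj_on_subset[OF inj 2] 1])
  then show "outer_chain a B m Fs ! i \<subset> outer_chain a B m Fs ! Suc i"
    using i by (simp add: nth)
qed

lemma inner_chain_full:
  assumes Fs: "Fs \<in> full_chains (Pow E) (\<subseteq>) (m + n)"
  shows "inner_chain m Fs \<in> full_chains (Pow (E - Fs ! m)) (\<subseteq>) n"
proof (rule full_chains_PowI)
  have l: "length Fs = Suc (m + n)" using Fs by (simp add: full_chains_Pow)
  have nth: "inner_chain m Fs ! i = Fs ! (m + i) - Fs ! m" if "i \<le> n" for i
    using that l by (simp add: inner_chain_def)
  show "length (inner_chain m Fs) = Suc n" using l by (simp add: inner_chain_def)
  show "inner_chain m Fs ! 0 = {}" "inner_chain m Fs ! n = E - Fs ! m"
    using full_chain_ends(2)[OF Fs] by (simp_all add: nth)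
  fix i assume i: "i < n"
  have 1: "Fs ! (m + i) \<subset> Fs ! Suc (m + i)" using full_chain_nth_mono[OF Fs, of "m + i" "Suc (m + i)"] i by simp
  have 2: "Fs ! m \<subseteq> Fs ! (m + i)"
    using full_chain_nth_mono[OF Fs, of m "m + i"] i by (cases "i = 0") auto
  show "inner_chain m Fs ! i \<subset> inner_chain m Fs ! Suc i"
    using i 1 2 by (auto simp: nth)
qed

text \<open>The pullback along \<phi> tests fullness in the interval below the cut and not in the
  whole poset; here and in \<open>full_chain_above\<close> the two halves of a full chain are shown
  to pass this test.\<close>

lemma full_chain_below:
  assumes t: "is_tree (S, E)" and Fs: "Fs \<in> full_chains (Pow E) (\<subseteq>) (m + n)"
  shows "map (quotient_tree S E) (take (Suc m) Fs)
    \<in> full_chains (mlt_below S (quotient_tree S E (Fs ! m))) mlt_le m"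
proof -
  have l: "length Fs = Suc (m + n)" "set Fs \<subseteq> Pow E" "sorted_wrt (\<subset>) Fs"
    using Fs by (auto simp: full_chains_Pow)
  let ?z = "map (quotient_tree S E) (take (Suc m) Fs)" and ?G = "Fs ! m"
  have G: "?G \<subseteq> E" by (rule full_chain_nth_subset[OF Fs]) simp
  have sub: "F \<subseteq> ?G" if F: "F \<in> set (take (Suc m) Fs)" for F
  proof -
    obtain i where i: "i < Suc m" "F = Fs ! i" using F l(1) by (auto simp: in_set_conv_nth)
    then show ?thesis using full_chain_nth_mono[OF Fs, of i m] by (cases "i = m") auto
  qed
  have ne: "take (Suc m) Fs \<noteq> []" using l(1) by auto
  have hd: "hd ?z = quotient_tree S E {}"
    using full_chain_ends(1)[OF Fs] ne l(1) by (simp add: hd_map hd_conv_nth)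
  have last: "last ?z = quotient_tree S E ?G"
    using ne l(1) by (simp add: last_map last_conv_nth)
  have "set ?z \<subseteq> mlt_below S (quotient_tree S E ?G)"
  proof
    fix x assume "x \<in> set ?z"
    then obtain F where F: "F \<in> set (take (Suc m) Fs)" "x = quotient_tree S E F" by auto
    then show "x \<in> mlt_below S (quotient_tree S E ?G)"
      using quotient_tree_MLT[OF t, of F] quotient_tree_le[OF t G, of x] sub[OF F(1)] G
      by (auto simp: mlt_below_def)
  qed
  moreover have "sorted_wrt (\<lambda>x y. mlt_le x y \<and> x \<noteq> y) ?z"
  proof (subst sorted_wrt_quotient_tree[OF t])
    show "set (take (Suc m) Fs) \<subseteq> Pow E" using l(2) set_take_subset[of "Suc m" Fs] by blast
    show "sorted_wrt (\<subset>) (take (Suc m) Fs)" by (rule sorted_wrt_take[OF l(3)])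
  qed
  moreover have "y = hd ?z" if "mlt_le y (hd ?z)" for y
    using that quotient_tree_le[OF t, of "{}" y] unfolding hd by auto
  moreover have "y = last ?z" if y: "y \<in> mlt_below S (quotient_tree S E ?G)" and le: "mlt_le (last ?z) y" for y
  proof -
    obtain F where F: "F \<subseteq> ?G" "y = quotient_tree S E F"
      using y quotient_tree_le[OF t G, of y] by (auto simp: mlt_below_def)
    have "?G \<subseteq> F"
      using le quotient_tree_le_iff[OF t G, of F] F G unfolding last by blast
    then show ?thesis using F last by auto
  qed
  moreover have "length ?z = Suc m" using l(1) by simp
  ultimately show ?thesis unfolding full_chains_def by blast
qed

lemma full_chain_above:
  assumes t: "is_tree (S, E)" and Fs: "Fs \<in> full_chains (Pow E) (\<subseteq>) (m + n)"
  shows "map (quotient_tree S E) (drop m Fs)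
    \<in> full_chains (mlt_above S (quotient_tree S E (Fs ! m))) mlt_le n"
proof -
  have l: "length Fs = Suc (m + n)" "set Fs \<subseteq> Pow E" "sorted_wrt (\<subset>) Fs"
    using Fs by (auto simp: full_chains_Pow)
  let ?z = "map (quotient_tree S E) (drop m Fs)" and ?G = "Fs ! m"
  have G: "?G \<subseteq> E" by (rule full_chain_nth_subset[OF Fs]) simp
  have sub: "?G \<subseteq> F \<and> F \<subseteq> E" if F: "F \<in> set (drop m Fs)" for F
  proof -
    obtain i where i: "i \<le> n" "F = Fs ! (m + i)" using F l(1) by (auto simp: in_set_conv_nth less_Suc_eq_le)
    then show ?thesis
      using full_chain_nth_mono[OF Fs, of m "m + i"] full_chain_nth_subset[OF Fs, of "m + i"]
      by (cases "i = 0") auto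
  qed
  have ne: "drop m Fs \<noteq> []" using l(1) by auto
  have hd: "hd ?z = quotient_tree S E ?G"
    using ne l(1) by (simp add: hd_map hd_drop_conv_nth)
  have last: "last ?z = quotient_tree S E E"
    using full_chain_ends(2)[OF Fs] ne l(1) by (simp add: last_map last_conv_nth)
  have "set ?z \<subseteq> mlt_above S (quotient_tree S E ?G)"
  proof
    fix x assume "x \<in> set ?z"
    then obtain F where F: "F \<in> set (drop m Fs)" "x = quotient_tree S E F" by auto
    then show "x \<in> mlt_above S (quotient_tree S E ?G)"
      using quotient_tree_MLT[OF t, of F] quotient_tree_le_iff[OF t G, of F] sub[OF F(1)]
      by (auto simp: mlt_above_def)
  qed
  moreover have "sorted_wrt (\<lambda>x y. mlt_le x y \<and> x \<noteq> y) ?z"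
  proof (subst sorted_wrt_quotient_tree[OF t])
    show "set (drop m Fs) \<subseteq> Pow E" using l(2) set_drop_subset[of m Fs] by blast
    show "sorted_wrt (\<subset>) (drop m Fs)" by (rule sorted_wrt_drop[OF l(3)])
  qed
  moreover have "y = hd ?z" if y: "y \<in> mlt_above S (quotient_tree S E ?G)" and le: "mlt_le y (hd ?z)" for y
  proof -
    obtain F where F: "F \<subseteq> ?G" "y = quotient_tree S E F"
      using le quotient_tree_le[OF t G, of y] unfolding hd by auto
    have "?G \<subseteq> F"
      using y quotient_tree_le_iff[OF t G, of F] F G by (auto simp: mlt_above_def)
    then show ?thesis using F hd by auto
  qed
  moreover have "y = last ?z" if y: "y \<in> mlt_above S (quotient_tree S E ?G)" and le: "mlt_le (last ?z) y" for y
  proof -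
    have "y \<in> MLT S" using y by (simp add: mlt_above_def)
    then show ?thesis using quotient_tree_maximal[OF t _ le[unfolded last]] last by simp
  qed
  moreover have "length ?z = Suc n" using l(1) by simp
  ultimately show ?thesis unfolding full_chains_def by blast
qed

text \<open>Only the tree at position \<open>m\<close> of the chain can contribute to the sum over
  \<open>t\<close>. With \<phi> and \<psi> expressed by edge sets, this is the counterpart of
  \<open>tree_comp_gen\<close>, valid for chains that need not be maximal.\<close>

lemma mlt_comp_chain:
  fixes f g :: "'a set tree list \<Rightarrow> 'k::{comm_ring,comm_monoid_mult}"
  assumes c: "composable A a B" and t: "is_tree (A \<union> B, E)"
    and Fs: "Fs \<in> full_chains (Pow E) (\<subseteq>) (m + n)"
  shows "mlt_comp A a B m n f g (map (quotient_tree (A \<union> B) E) Fs) =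
    (if spans (E - Fs ! m) B then
      f (map (quotient_tree (insert a A) ((`) (merge a B) ` (Fs ! m))) (outer_chain a B m Fs))
      * g (map (quotient_tree B (E - Fs ! m)) (inner_chain m Fs)) else 0)"
proof -
  note C = composableD[OF c]
  let ?S = "A \<union> B" and ?G = "Fs ! m"
  let ?q = "quotient_tree ?S E" and ?z = "map (quotient_tree (A \<union> B) E) Fs"
  have l: "length Fs = Suc (m + n)" using Fs by (simp add: full_chains_Pow)
  have G: "?G \<subseteq> E" by (rule full_chain_nth_subset[OF Fs]) simp
  have zm: "?z ! m = ?q ?G" using l by simp
  have zf: "?z \<in> full_chains (MLT ?S) mlt_le (m + n)" by (rule full_chains_MLT_I[OF t Fs])
  have fin: "finite (mlt_over_partition A B)"
  proof (rule finite_subset)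
    show "mlt_over_partition A B \<subseteq> MLT ?S" by (auto simp: mlt_over_partition_def)
    show "finite (MLT ?S)" using C(1,2) by (simp add: finite_MLT)
  qed
  have "mlt_comp A a B m n f g ?z = (\<Sum>s\<in>mlt_over_partition A B. if s = ?q ?G then
      pullback (mlt_below ?S s) mlt_le m (phi_map a B) f (take (Suc m) ?z)
      * pullback (mlt_above ?S s) mlt_le n (psi_map s B) g (drop m ?z) else 0)"
    unfolding mlt_comp_def mu_map_def using zf by (intro sum.cong refl) (simp add: zm eq_commute)
  also have "\<dots> = (if ?q ?G \<in> mlt_over_partition A B then
      pullback (mlt_below ?S (?q ?G)) mlt_le m (phi_map a B) f (take (Suc m) ?z)
      * pullback (mlt_above ?S (?q ?G)) mlt_le n (psi_map (?q ?G) B) g (drop m ?z) else 0)"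
    using fin by (simp add: sum.delta)
  also have "?q ?G \<in> mlt_over_partition A B \<longleftrightarrow> spans (E - ?G) B"
    by (rule quotient_tree_over_partition[OF t G C(4,3)])
  also have "(if spans (E - ?G) B then
      pullback (mlt_below ?S (?q ?G)) mlt_le m (phi_map a B) f (take (Suc m) ?z)
      * pullback (mlt_above ?S (?q ?G)) mlt_le n (psi_map (?q ?G) B) g (drop m ?z) else 0)
    = (if spans (E - ?G) B then
      f (map (quotient_tree (insert a A) ((`) (merge a B) ` ?G)) (outer_chain a B m Fs))
      * g (map (quotient_tree B (E - ?G)) (inner_chain m Fs)) else 0)"
  proof (cases "spans (E - ?G) B")
    case s: True
    have EG: "E - (E - ?G) = ?G" using G by blast
    have low: "F \<subseteq> ?G" if F: "F \<in> set (take (Suc m) Fs)" for F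
    proof -
      obtain i where i: "i < Suc m" "F = Fs ! i" using F l by (auto simp: in_set_conv_nth)
      then show ?thesis using full_chain_nth_mono[OF Fs, of i m] by (cases "i = m") auto
    qed
    have high: "?G \<subseteq> F \<and> F \<subseteq> E" if F: "F \<in> set (drop m Fs)" for F
    proof -
      obtain i where i: "i \<le> n" "F = Fs ! (m + i)" using F l by (auto simp: in_set_conv_nth less_Suc_eq_le)
      then show ?thesis
        using full_chain_nth_mono[OF Fs, of m "m + i"] full_chain_nth_subset[OF Fs, of "m + i"]
        by (cases "i = 0") auto
    qed
    have "map (phi_map a B) (take (Suc m) ?z)
      = map (quotient_tree (insert a A) ((`) (merge a B) ` ?G)) (outer_chain a B m Fs)"
      unfolding outer_chain_def take_map map_map
    proof (rule map_cong[OF refl])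
      fix F assume F: "F \<in> set (take (Suc m) Fs)"
      show "(phi_map a B \<circ> ?q) F
        = (quotient_tree (insert a A) ((`) (merge a B) ` ?G) \<circ> (`) ((`) (merge a B))) F"
        using phi_map_quotient_tree[OF t C(4,3,5) _ s, of F] low[OF F] EG by simp
    qed
    moreover have "map (psi_map (?q ?G) B) (drop m ?z) = map (quotient_tree B (E - ?G)) (inner_chain m Fs)"
      unfolding inner_chain_def drop_map map_map
    proof (rule map_cong[OF refl])
      fix F assume F: "F \<in> set (drop m Fs)"
      show "(psi_map (?q ?G) B \<circ> ?q) F = (quotient_tree B (E - ?G) \<circ> (\<lambda>F. F - ?G)) F"
        using psi_map_quotient_tree[OF t _ s, of F] high[OF F] by simp
    qed
    moreover have "take (Suc m) ?z \<in> full_chains (mlt_below ?S (?q ?G)) mlt_le m"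
      using full_chain_below[OF t Fs] by (simp add: take_map)
    moreover have "drop m ?z \<in> full_chains (mlt_above ?S (?q ?G)) mlt_le n"
      using full_chain_above[OF t Fs] by (simp add: drop_map)
    ultimately show ?thesis by (simp only: pullback_def if_True)
  qed simp
  finally show ?thesis .
qed

lemma mlt_comp_cochain: "mlt_comp A a B m n f g \<in> cochains (MLT (A \<union> B)) mlt_le (m + n)"
  by (simp add: cochains_def free_module_def mlt_comp_def mu_map_def)

lemma outer_chain_delete:
  assumes "length Fs = Suc (Suc (m + n))" "i \<le> m"
  shows "outer_chain a B m (delete_nth i Fs) = delete_nth i (outer_chain a B (Suc m) Fs)"
proof -
  have "take (Suc m) (delete_nth i Fs) = delete_nth i (take (Suc (Suc m)) Fs)"
    using assms by (intro nth_equalityI) (auto simp: nth_delete_nth length_delete_nth)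
  then show ?thesis by (simp add: outer_chain_def map_delete_nth)
qed

lemma inner_chain_delete:
  assumes "length Fs = Suc (Suc (m + n))" "m < i" "i \<le> m + n"
  shows "inner_chain m (delete_nth i Fs) = delete_nth (i - m) (inner_chain m Fs)"
proof -
  have "drop m (delete_nth i Fs) = delete_nth (i - m) (drop m Fs)"
    using assms by (intro nth_equalityI) (auto simp: nth_delete_nth length_delete_nth)
  moreover have "delete_nth i Fs ! m = Fs ! m" using assms by (simp add: nth_delete_nth)
  ultimately show ?thesis by (simp add: inner_chain_def map_delete_nth)
qed

text \<open>
  The Leibniz rule: deleting \<open>z\<^sub>i\<close> from a chain with \<open>i \<le> m\<close> affects the outer part of the chain cut
  at \<open>z\<^sub>m\<^sub>+\<^sub>1\<close>, and deleting it with \<open>i > m\<close> affects the inner part of the chain cut at \<open>z\<^sub>m\<close>.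
\<close>

lemma mlt_comp_cocycle:
  fixes f g :: "'a set tree list \<Rightarrow> 'k::{comm_ring,comm_monoid_mult}"
  assumes c: "composable A a B" and f: "f \<in> cocycles (MLT (insert a A)) mlt_le m"
    and g: "g \<in> cocycles (MLT B) mlt_le n"
  shows "mlt_comp A a B m n f g \<in> cocycles (MLT (A \<union> B)) mlt_le (m + n)"
proof (rule cocyclesI[OF mlt_comp_cochain])
  note C = composableD[OF c]
  fix z assume "z \<in> full_chains (MLT (A \<union> B)) mlt_le (Suc (m + n))"
  then obtain E Fs where t: "is_tree (A \<union> B, E)" and Fs: "Fs \<in> full_chains (Pow E) (\<subseteq>) (Suc (m + n))"
    and z: "z = map (quotient_tree (A \<union> B) E) Fs" by (rule full_chains_MLT_E)
  have l: "length Fs = Suc (Suc (m + n))" using Fs by (simp add: full_chains_Pow)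
  have Fs1: "Fs \<in> full_chains (Pow E) (\<subseteq>) (Suc m + n)" and Fs2: "Fs \<in> full_chains (Pow E) (\<subseteq>) (m + Suc n)"
    using Fs by simp_all
  let ?X = "\<lambda>i. mlt_comp A a B m n f g (delete_nth i z)"
  have X: "?X i = (if spans (E - delete_nth i Fs ! m) B then
      f (map (quotient_tree (insert a A) ((`) (merge a B) ` (delete_nth i Fs ! m))) (outer_chain a B m (delete_nth i Fs)))
      * g (map (quotient_tree B (E - delete_nth i Fs ! m)) (inner_chain m (delete_nth i Fs))) else 0)"
    if "1 \<le> i" "i \<le> m + n" for i
    using mlt_comp_chain[OF c t full_chains_delete_nth[OF Fs that], of f g] z by (simp add: map_delete_nth)
  have "(\<Sum>i = 1..m. (- 1) ^ i * ?X i) = 0"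
  proof (cases "spans (E - Fs ! Suc m) B")
    case s: True
    let ?G = "Fs ! Suc m"
    let ?q = "quotient_tree (insert a A) ((`) (merge a B) ` ?G)"
    define y where "y = g (map (quotient_tree B (E - ?G)) (inner_chain (Suc m) Fs))"
    have G: "?G \<subseteq> E" by (rule full_chain_nth_subset[OF Fs]) simp
    have EG: "E - (E - ?G) = ?G" using G by blast
    have fib: "fibres (A \<union> B) (E - ?G) (merge a B)" by (rule merge_fibres[OF s C(5,4)])
    have t': "is_tree (insert a A, (`) (merge a B) ` ?G)"
      using contraction_tree[OF t Diff_subset fib] by (simp add: EG merge_image[OF C(3,4)])
    have inj: "inj_on ((`) (merge a B)) ?G"
      using contraction_inj[OF t Diff_subset fib] by (simp add: EG)
    have ch: "map ?q (outer_chain a B (Suc m) Fs) \<in> full_chains (MLT (insert a A)) mlt_le (Suc m)"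
      by (rule full_chains_MLT_I[OF t' outer_chain_full[OF Fs1 inj]])
    have "?X i = f (delete_nth i (map ?q (outer_chain a B (Suc m) Fs))) * y" if i: "i \<in> {1..m}" for i
    proof -
      have d: "delete_nth i Fs ! m = ?G" using i l by (simp add: nth_delete_nth)
      have dr: "drop m (delete_nth i Fs) = drop (Suc m) Fs"
        using i l by (intro nth_equalityI) (auto simp: nth_delete_nth length_delete_nth)
      have "inner_chain m (delete_nth i Fs) = inner_chain (Suc m) Fs"
        by (simp add: inner_chain_def d dr)
      moreover have "outer_chain a B m (delete_nth i Fs) = delete_nth i (outer_chain a B (Suc m) Fs)"
        using i l by (intro outer_chain_delete) auto
      ultimately show ?thesis using X[of i] i s by (simp add: d y_def map_delete_nth)
    qed
    then have "(\<Sum>i = 1..m. (- 1) ^ i * ?X i)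
        = face_sum m f (map ?q (outer_chain a B (Suc m) Fs)) * y"
      unfolding face_sum_def sum_distrib_right by (intro sum.cong refl) (simp add: mult.assoc)
    then show ?thesis using cocycles_face_sum[OF f ch] by simp
  next
    case False
    have "?X i = 0" if i: "i \<in> {1..m}" for i
    proof -
      have "delete_nth i Fs ! m = Fs ! Suc m" using i l by (simp add: nth_delete_nth)
      then show ?thesis using X[of i] i False by simp
    qed
    then show ?thesis by simp
  qed
  moreover have "(\<Sum>i = Suc m..m + n. (- 1) ^ i * ?X i) = 0"
  proof (cases "spans (E - Fs ! m) B")
    case s: True
    let ?G = "Fs ! m"
    let ?q = "quotient_tree B (E - ?G)"
    define y where "y = f (map (quotient_tree (insert a A) ((`) (merge a B) ` ?G)) (outer_chain a B m Fs))"
    have t': "is_tree (B, E - ?G)" by (rule subtree[OF t Diff_subset s])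
    have ch: "map ?q (inner_chain m Fs) \<in> full_chains (MLT B) mlt_le (Suc n)"
      by (rule full_chains_MLT_I[OF t' inner_chain_full[OF Fs2]])
    have Xi: "?X (i + m) = y * g (delete_nth i (map ?q (inner_chain m Fs)))" if i: "i \<in> {1..n}" for i
    proof -
      have d: "delete_nth (i + m) Fs ! m = ?G" using i l by (simp add: nth_delete_nth)
      have tk: "take (Suc m) (delete_nth (i + m) Fs) = take (Suc m) Fs"
        using i l by (intro nth_equalityI) (auto simp: nth_delete_nth length_delete_nth)
      have "outer_chain a B m (delete_nth (i + m) Fs) = outer_chain a B m Fs"
        by (simp add: outer_chain_def tk)
      moreover have "inner_chain m (delete_nth (i + m) Fs) = delete_nth i (inner_chain m Fs)"
        using inner_chain_delete[OF l, of "i + m"] i by simp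
      ultimately show ?thesis using X[of "i + m"] i s by (simp add: d y_def map_delete_nth)
    qed
    have "(\<Sum>i = Suc m..m + n. (- 1) ^ i * ?X i) = (\<Sum>i = 1 + m..n + m. (- 1) ^ i * ?X i)"
      by (simp add: add.commute)
    \<comment> \<open>Shifting the index by \<open>m\<close> releases the sign \<open>(-1)^m\<close>
      of the Leibniz rule.\<close>
    also have "\<dots> = (\<Sum>i = 1..n. (- 1) ^ (i + m) * ?X (i + m))"
      by (rule sum.shift_bounds_cl_nat_ivl)
    also have "\<dots> = (- 1) ^ m * y * face_sum n g (map ?q (inner_chain m Fs))"
      unfolding face_sum_def sum_distrib_left
      by (intro sum.cong refl) (simp only: Xi power_add mult.assoc mult.left_commute)
    finally show ?thesis using cocycles_face_sum[OF g ch] by simp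
  next
    case False
    have "?X i = 0" if i: "i \<in> {Suc m..m + n}" for i
    proof -
      have "delete_nth i Fs ! m = Fs ! m" using i l by (simp add: nth_delete_nth)
      then show ?thesis using X[of i] i False by simp
    qed
    then show ?thesis by simp
  qed
  \<comment> \<open>The inner positions of the two cut chains are \<open>1..m\<close> and
    \<open>1..n\<close>, so the two sums exhaust all faces and no boundary term is left.\<close>
  ultimately show "face_sum (m + n) (mlt_comp A a B m n f g) z = 0"
    unfolding face_sum_def using sum.ub_add_nat[of 1 m "\<lambda>i. (- 1) ^ i * ?X i" n] by simp
qed

text \<open>For the chain of prefixes, \<open>outer_chain\<close> is the chain of the merged prefix
  of the order and \<open>inner_chain\<close> that of its suffix, so the closed formulas for the two
  compositions coincide.\<close>

lemma tree_values_mlt_comp: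
  fixes f g :: "'a set tree list \<Rightarrow> 'k::{comm_ring,comm_monoid_mult}"
  assumes c: "composable A a B"
  shows "tree_values (A \<union> B) (m + n) (mlt_comp A a B m n f g)
    = tree_comp A a B m n (tree_values (insert a A) m f) (tree_values B n g)"
proof (rule free_module_tree_gens_eqI[OF arity_composable(2)[OF c] tree_values_free tree_comp_free[OF c]])
  note ar = arity_composable[OF c]
  fix \<omega> assume w: "\<omega> \<in> edge_lists (A \<union> B) (m + n)"
  have W: "distinct \<omega>" "is_tree (A \<union> B, set \<omega>)" "length \<omega> = m + n"
    using w by (auto simp: edge_lists_def)
  have G: "prefix_sets \<omega> ! m = set (take m \<omega>)" using W(3) by (simp add: nth_prefix_sets)
  have EG: "set \<omega> - set (take m \<omega>) = set (drop m \<omega>)"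
    using set_take_drop_distinct[OF W(1), of m] set_drop_subset[of m \<omega>] by blast
  have o: "outer_chain a B m (prefix_sets \<omega>) = prefix_sets (merge_list a B (take m \<omega>))"
    using W(3) by (simp add: outer_chain_def prefix_sets_take prefix_sets_map)
  have i: "inner_chain m (prefix_sets \<omega>) = prefix_sets (drop m \<omega>)"
    unfolding inner_chain_def G using W by (intro prefix_sets_drop) auto
  have "mlt_comp A a B m n f g (tree_chain (A \<union> B) \<omega>) = (if spans (set (drop m \<omega>)) B then
      f (tree_chain (insert a A) (merge_list a B (take m \<omega>))) * g (tree_chain B (drop m \<omega>)) else 0)"
    using mlt_comp_chain[OF c W(2) edge_lists_prefix_sets[OF w], of f g]
    unfolding G EG o i by (simp add: tree_chain_def)
  then show "tree_values (A \<union> B) (m + n) (mlt_comp A a B m n f g) (gen (A \<union> B) \<omega>)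
      = tree_comp A a B m n (tree_values (insert a A) m f) (tree_values B n g) (gen (A \<union> B) \<omega>)"
    unfolding tree_values_gen[OF ar(2) w] tree_comp_gen[OF c w]
    using split_edge_list[OF c w] by (simp add: tree_values_gen ar)
qed

definition mlt_relabel ::
    "'a set \<Rightarrow> ('a \<Rightarrow> 'a) \<Rightarrow> nat \<Rightarrow> ('a set tree list \<Rightarrow> 'k) \<Rightarrow> 'a set tree list \<Rightarrow> 'k::{comm_ring,comm_monoid_mult}" where
  "mlt_relabel S \<sigma> n = pullback (MLT (\<sigma> ` S)) mlt_le n (map_tree ((`) (inv_into S \<sigma>)))"

section \<open>Relabelling of multilabeled trees\<close>

lemma map_tree_quotient_tree:
  assumes t: "is_tree (S, E)" and h: "inj_on h S" and F: "F \<subseteq> E"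
  shows "map_tree ((`) h) (quotient_tree S E F) = quotient_tree (h ` S) ((`) h ` E) ((`) h ` F)"
  using quotient_tree_contraction[OF t _ fibres_inj[OF h], of F] F by simp

lemma map_tree_full_chain:
  assumes h: "inj_on h S" and z: "z \<in> full_chains (MLT S) mlt_le n"
  shows "map (map_tree ((`) h)) z \<in> full_chains (MLT (h ` S)) mlt_le n"
proof -
  obtain E Fs where t: "is_tree (S, E)" and Fs: "Fs \<in> full_chains (Pow E) (\<subseteq>) n"
    and zE: "z = map (quotient_tree S E) Fs" using z by (rule full_chains_MLT_E)
  have t': "is_tree (h ` S, (`) h ` E)" using contraction_tree[OF t _ fibres_inj[OF h]] by simp
  have inj: "inj_on ((`) h) E" using contraction_inj[OF t _ fibres_inj[OF h]] by simp
  have l: "length Fs = Suc n" using Fs by (simp add: full_chains_Pow)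
  have eq: "map (map_tree ((`) h)) z = map (quotient_tree (h ` S) ((`) h ` E)) (map ((`) ((`) h)) Fs)"
    unfolding zE map_map
  proof (rule map_cong[OF refl])
    fix F assume "F \<in> set Fs"
    then have "F \<subseteq> E" using Fs by (auto simp: full_chains_Pow)
    then show "(map_tree ((`) h) \<circ> quotient_tree S E) F
        = (quotient_tree (h ` S) ((`) h ` E) \<circ> (`) ((`) h)) F"
      using map_tree_quotient_tree[OF t h] by simp
  qed
  have "map ((`) ((`) h)) Fs \<in> full_chains (Pow ((`) h ` E)) (\<subseteq>) n"
  proof (rule full_chains_PowI)
    fix i assume i: "i < n"
    have "(`) h ` (Fs ! i) \<subset> (`) h ` (Fs ! Suc i)"
    proof (rule image_strict_mono)
      show "inj_on ((`) h) (Fs ! Suc i)"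
        by (rule inj_on_subset[OF inj full_chain_nth_subset[OF Fs]]) (use i in simp)
      show "Fs ! i \<subset> Fs ! Suc i" using full_chain_nth_mono[OF Fs, of i "Suc i"] i by simp
    qed
    then show "map ((`) ((`) h)) Fs ! i \<subset> map ((`) ((`) h)) Fs ! Suc i" using i l by simp
  qed (use l full_chain_ends[OF Fs] in simp_all)
  then show ?thesis unfolding eq by (rule full_chains_MLT_I[OF t'])
qed

lemma mlt_relabel_cocycle:
  assumes \<sigma>: "inj_on \<sigma> S" and f: "f \<in> cocycles (MLT S) mlt_le n"
  shows "mlt_relabel S \<sigma> n f \<in> cocycles (MLT (\<sigma> ` S)) mlt_le n"
proof (rule cocyclesI)
  let ?h = "map_tree ((`) (inv_into S \<sigma>)) :: 'a set tree \<Rightarrow> 'a set tree"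
  have im: "inv_into S \<sigma> ` \<sigma> ` S = S" by (simp add: inv_into_image_cancel[OF \<sigma>])
  show "mlt_relabel S \<sigma> n f \<in> cochains (MLT (\<sigma> ` S)) mlt_le n"
    by (simp add: mlt_relabel_def pullback_def cochains_def free_module_def)
  fix z assume z: "z \<in> full_chains (MLT (\<sigma> ` S)) mlt_le (Suc n)"
  have "face_sum n (mlt_relabel S \<sigma> n f) z = face_sum n f (map ?h z)"
    unfolding face_sum_def
    by (intro sum.cong refl)
      (simp add: mlt_relabel_def pullback_def full_chains_delete_nth[OF z] map_delete_nth)
  moreover have "map ?h z \<in> full_chains (MLT S) mlt_le (Suc n)"
    using map_tree_full_chain[OF inj_on_inv_into[OF subset_refl] z] unfolding im .
  ultimately show "face_sum n (mlt_relabel S \<sigma> n f) z = 0"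
    using cocycles_face_sum[OF f] by simp
qed

lemma tree_chain_relabel:
  assumes h: "inj_on h S" and w: "\<omega> \<in> edge_lists S n"
  shows "map (map_tree ((`) h)) (tree_chain S \<omega>) = tree_chain (h ` S) (map ((`) h) \<omega>)"
proof -
  have t: "is_tree (S, set \<omega>)" using w by (simp add: edge_lists_def)
  show ?thesis
    unfolding tree_chain_def prefix_sets_map map_map
  proof (rule map_cong[OF refl])
    fix F assume "F \<in> set (prefix_sets \<omega>)"
    then have "F \<subseteq> set \<omega>" using edge_lists_prefix_sets[OF w] by (auto simp: full_chains_Pow)
    then show "(map_tree ((`) h) \<circ> quotient_tree S (set \<omega>)) F
        = (quotient_tree (h ` S) (set (map ((`) h) \<omega>)) \<circ> (`) ((`) h)) F"
      using map_tree_quotient_tree[OF t h] by simp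
  qed
qed

lemma tree_values_mlt_relabel:
  assumes S: "arity S" and \<sigma>: "inj_on \<sigma> S"
  shows "tree_values (\<sigma> ` S) n (mlt_relabel S \<sigma> n f) = tree_relabel S \<sigma> n (tree_values S n f)"
proof (rule tree_relabel_eqI[OF S \<sigma> tree_values_free, symmetric])
  let ?i = "inv_into S \<sigma>"
  have ar: "arity (\<sigma> ` S)" using S by (simp add: arity_def)
  have im: "?i ` \<sigma> ` S = S" by (simp add: inv_into_image_cancel[OF \<sigma>])
  fix \<omega> assume w: "\<omega> \<in> edge_lists S n"
  have w': "map ((`) \<sigma>) \<omega> \<in> edge_lists (\<sigma> ` S) n" by (rule relabel_edge_list[OF \<sigma> w])
  have id: "map ((`) ?i) (map ((`) \<sigma>) \<omega>) = \<omega>"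
    unfolding map_map_image
    by (rule map_image_comp_id[OF edge_lists_Pow[OF w]]) (simp add: inv_into_f_f[OF \<sigma>])
  have "map (map_tree ((`) ?i)) (tree_chain (\<sigma> ` S) (map ((`) \<sigma>) \<omega>)) = tree_chain S \<omega>"
    using tree_chain_relabel[OF inj_on_inv_into[OF subset_refl] w'] unfolding im id .
  then show "tree_values (\<sigma> ` S) n (mlt_relabel S \<sigma> n f) (gen (\<sigma> ` S) (map ((`) \<sigma>) \<omega>))
      = tree_values S n f (gen S \<omega>)"
    unfolding tree_values_gen[OF ar w'] tree_values_gen[OF S w]
    using tree_chain_full_chain[OF w'] by (simp add: mlt_relabel_def pullback_def)
qed

abbreviation mlt_unit :: "'a \<Rightarrow> 'a set tree list \<Rightarrow> 'k::{comm_ring,comm_monoid_mult}" where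
  "mlt_unit a \<equiv> basis_vec [({{a}}, {})]"

lemma tree_chain_singleton: "tree_chain {a} [] = [({{a}}, {})]"
  by (simp add: tree_chain_def prefix_sets_def quotient_tree_def map_tree_def)

lemma arity_singleton: "arity {a}"
  by (simp add: arity_def)

text \<open>For a one-element set degree 0 is already the top degree, where every cochain is a
  cocycle.\<close>

lemma mlt_unit_cocycle:
  "(mlt_unit a :: 'a set tree list \<Rightarrow> 'k::{comm_ring,comm_monoid_mult}) \<in> cocycles (MLT {a}) mlt_le 0"
proof -
  have "tree_chain {a} [] \<in> full_chains (MLT {a}) mlt_le 0"
    by (rule tree_chain_full_chain) (simp add: edge_lists_singleton)
  then have "(mlt_unit a :: _ \<Rightarrow> 'k) \<in> cochains (MLT {a}) mlt_le (card {a} - 1)"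
    unfolding tree_chain_singleton cochains_def by (simp add: basis_vec_free)
  then have "(mlt_unit a :: _ \<Rightarrow> 'k) \<in> cocycles (MLT {a}) mlt_le (card {a} - 1)"
    unfolding top_cocycles[OF arity_singleton] .
  then show ?thesis by simp
qed

lemma tree_values_mlt_unit: "tree_values {a} 0 (mlt_unit a) = basis_vec (gen {a} [])"
  by (rule free_module_tree_gens_eqI[OF arity_singleton tree_values_free basis_unit_free])
    (auto simp: edge_lists_singleton tree_values_gen[OF arity_singleton] tree_chain_singleton basis_vec_def)

section \<open>Passage to cohomology classes\<close>

lemma h_MLT_eq:
  "h_MLT = quotient_operad (\<lambda>S n. cocycles (MLT S) mlt_le n) (\<lambda>S n. coboundaries (MLT S) mlt_le n)
    mlt_relabel mlt_comp mlt_unit"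
  by (simp add: h_MLT_def quotient_operad_def cohomology_def cohomologous_def quotient_class_def mlt_relabel_def)

text \<open>The two congruences correspond to each other under \<open>tree_values\<close>, in both
  directions; questions about classes can thus be moved to trees and back.\<close>

lemma tree_values_diff_span:
  assumes S: "arity S" and "f \<in> cocycles (MLT S) mlt_le n" "g \<in> cocycles (MLT S) mlt_le n"
  shows "(\<lambda>x. tree_values S n f x - tree_values S n g x) \<in> fun_span (sign_relators S n)
    \<longleftrightarrow> (\<lambda>x. f x - g x) \<in> coboundaries (MLT S) mlt_le n"
  using tree_values_swap_space_iff[OF S fun_submodule_diff[OF cocycles_submodule assms(2,3)]]
  by (simp add: tree_values_lin(2) span_sign_relators[OF S])

text \<open>That cocycles are preserved is checked directly. Independence of the representatives is
  moved to \<open>Tree\<close>, settled there, and moved back, so no primitives of differences have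
  to be written down.\<close>

interpretation MLT: quotient_operad_data
  "\<lambda>S n. cocycles (MLT S) mlt_le n :: ('a set tree list \<Rightarrow> 'k::{comm_ring,comm_monoid_mult}) set"
  "\<lambda>S n. coboundaries (MLT S) mlt_le n" mlt_relabel mlt_comp mlt_unit
proof (rule quotient_operad_data.intro)
  show "fun_quotient (cocycles (MLT S) mlt_le n :: ('a set tree list \<Rightarrow> 'k) set)
      (coboundaries (MLT S) mlt_le n)" for S :: "'a set" and n
    by (rule cohomology_quotient)
next
  fix S :: "'a set" and \<sigma> :: "'a \<Rightarrow> 'a" and f g :: "'a set tree list \<Rightarrow> 'k" and n
  assume S: "arity S" "inj_on \<sigma> S" and f: "f \<in> cocycles (MLT S) mlt_le n"
  have S': "arity (\<sigma> ` S)" using S by (simp add: arity_def)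
  show rf: "mlt_relabel S \<sigma> n f \<in> cocycles (MLT (\<sigma> ` S)) mlt_le n" by (rule mlt_relabel_cocycle[OF S(2) f])
  assume g: "g \<in> cocycles (MLT S) mlt_le n" and fg: "(\<lambda>x. f x - g x) \<in> coboundaries (MLT S) mlt_le n"
  have "(\<lambda>x. tree_values S n f x - tree_values S n g x) \<in> fun_span (sign_relators S n)"
    using fg tree_values_diff_span[OF S(1) f g] by simp
  from Tree.rel_cong[OF S tree_values_free tree_values_free this]
  show "(\<lambda>x. mlt_relabel S \<sigma> n f x - mlt_relabel S \<sigma> n g x) \<in> coboundaries (MLT (\<sigma> ` S)) mlt_le n"
    using tree_values_diff_span[OF S' rf mlt_relabel_cocycle[OF S(2) g]]
    by (simp add: tree_values_mlt_relabel[OF S])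
next
  fix A B :: "'a set" and a m n and f f' g g' :: "'a set tree list \<Rightarrow> 'k"
  assume c: "composable A a B" and f: "f \<in> cocycles (MLT (insert a A)) mlt_le m"
    and g: "g \<in> cocycles (MLT B) mlt_le n"
  note ar = arity_composable[OF c]
  show "mlt_comp A a B m n f g \<in> cocycles (MLT (A \<union> B)) mlt_le (m + n)"
    by (rule mlt_comp_cocycle[OF c f g])
next
  fix A B :: "'a set" and a m n and f f' g g' :: "'a set tree list \<Rightarrow> 'k"
  assume c: "composable A a B" and f: "f \<in> cocycles (MLT (insert a A)) mlt_le m"
    and f': "f' \<in> cocycles (MLT (insert a A)) mlt_le m"
    and g: "g \<in> cocycles (MLT B) mlt_le n" and g': "g' \<in> cocycles (MLT B) mlt_le n"
    and ff: "(\<lambda>x. f x - f' x) \<in> coboundaries (MLT (insert a A)) mlt_le m"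
    and gg: "(\<lambda>x. g x - g' x) \<in> coboundaries (MLT B) mlt_le n"
  note ar = arity_composable[OF c]
  have 1: "(\<lambda>x. tree_values (insert a A) m f x - tree_values (insert a A) m f' x)
      \<in> fun_span (sign_relators (insert a A) m)"
    using ff tree_values_diff_span[OF ar(3) f f'] by simp
  have 2: "(\<lambda>x. tree_values B n g x - tree_values B n g' x) \<in> fun_span (sign_relators B n)"
    using gg tree_values_diff_span[OF ar(1) g g'] by simp
  from Tree.cmp_cong[OF c tree_values_free tree_values_free tree_values_free tree_values_free 1 2]
  show "(\<lambda>x. mlt_comp A a B m n f g x - mlt_comp A a B m n f' g' x)
      \<in> coboundaries (MLT (A \<union> B)) mlt_le (m + n)"
    using tree_values_diff_span[OF ar(2) mlt_comp_cocycle[OF c f g] mlt_comp_cocycle[OF c f' g']]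
    by (simp add: tree_values_mlt_comp[OF c])
qed (rule mlt_unit_cocycle)

definition tree_class ::
    "'a set \<Rightarrow> nat \<Rightarrow> ('a set tree list \<Rightarrow> 'k) set \<Rightarrow> ('a tree \<times> 'a set list \<Rightarrow> 'k::{comm_ring,comm_monoid_mult}) set" where
  "tree_class S n X = (\<Union>f\<in>X. Tree.cls S n (tree_values S n f))"

lemma tree_class_cls:
  assumes S: "arity S" and f: "f \<in> cocycles (MLT S) mlt_le n"
  shows "tree_class S n (MLT.cls S n f) = Tree.cls S n (tree_values S n f)"
  unfolding tree_class_def
proof (rule fun_quotient.UN_cl[OF cohomology_quotient f])
  fix g assume g: "g \<in> cocycles (MLT S) mlt_le n" "(\<lambda>x. f x - g x) \<in> coboundaries (MLT S) mlt_le n"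
  show "Tree.cls S n (tree_values S n g) = Tree.cls S n (tree_values S n f)"
    by (rule Tree.cls_eqI[symmetric, OF S tree_values_free tree_values_free])
      (use g tree_values_diff_span[OF S f g(1)] in blast)
qed

theorem proposition5p13:
  shows "\<exists>\<Phi>. graded_operad_iso (scalars :: 'k::{comm_ring,comm_monoid_mult} ring)
    (h_MLT :: ('a, 'k, ('a set tree list \<Rightarrow> 'k) set) operad_data)
    (Tree_operad :: ('a, 'k, ('a tree \<times> 'a set list \<Rightarrow> 'k) set) operad_data) \<Phi>"
proof -
  let ?P = "MLT.Op :: ('a, 'k, ('a set tree list \<Rightarrow> 'k) set) operad_data"
  let ?Q = "Tree.Op :: ('a, 'k, ('a tree \<times> 'a set list \<Rightarrow> 'k) set) operad_data"
  have "graded_operad_iso scalars ?P ?Q tree_class"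
  proof (rule graded_operad_iso_transfer)
    show "graded_operad scalars ?Q" using graded_operad_Tree unfolding Tree_operad_eq .
    show "module scalars (op_space ?P S n)" if "arity S" for S n by (rule MLT.space_module_Op[OF that])
    show "op_relabel ?P S \<sigma> n X \<in> carrier (op_space ?P (\<sigma> ` S) n)"
      if "arity S" "inj_on \<sigma> S" "X \<in> carrier (op_space ?P S n)" for S \<sigma> n X
      by (rule MLT.op_relabel_carrier[OF that])
    show "op_comp ?P A a B m n X Y \<in> carrier (op_space ?P (A \<union> B) (m + n))"
      if "composable A a B" "X \<in> carrier (op_space ?P (insert a A) m)" "Y \<in> carrier (op_space ?P B n)"
      for A a B m n X Y
      by (rule MLT.op_comp_carrier[OF that])
    show "op_unit ?P a \<in> carrier (op_space ?P {a} 0)" for a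
      unfolding MLT.op_unit_Op by (rule MLT.cls_carrier[OF arity_singleton mlt_unit_cocycle])
    show "tree_class {a} 0 (op_unit ?P a) = op_unit ?Q a" for a
      unfolding MLT.op_unit_Op Tree.op_unit_Op tree_class_cls[OF arity_singleton mlt_unit_cocycle]
        tree_values_mlt_unit ..
  next
    fix S :: "'a set" and n assume S: "arity S"
    show "tree_class S n \<in> linear_maps scalars (op_space ?P S n) (op_space ?Q S n)"
    proof (rule linear_mapsI)
      fix X assume "X \<in> carrier (op_space ?P S n)"
      then obtain f where f: "f \<in> cocycles (MLT S) mlt_le n" "X = MLT.cls S n f"
        by (rule MLT.carrier_OpE[OF S])
      show "tree_class S n X \<in> carrier (op_space ?Q S n)"
        unfolding f(2) tree_class_cls[OF S f(1)] by (rule Tree.cls_carrier[OF S tree_values_free])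
      show "tree_class S n (c \<odot>\<^bsub>op_space ?P S n\<^esub> X) = c \<odot>\<^bsub>op_space ?Q S n\<^esub> tree_class S n X" for c
        unfolding f(2) MLT.smult_cls[OF S f(1)] tree_class_cls[OF S f(1)]
          tree_class_cls[OF S fun_submodule_smult[OF cocycles_submodule f(1)]]
          Tree.smult_cls[OF S tree_values_free] tree_values_lin(3) ..
      fix Y assume "Y \<in> carrier (op_space ?P S n)"
      then obtain g where g: "g \<in> cocycles (MLT S) mlt_le n" "Y = MLT.cls S n g"
        by (rule MLT.carrier_OpE[OF S])
      show "tree_class S n (X \<oplus>\<^bsub>op_space ?P S n\<^esub> Y)
          = tree_class S n X \<oplus>\<^bsub>op_space ?Q S n\<^esub> tree_class S n Y"
        unfolding f(2) g(2) MLT.add_cls[OF S f(1) g(1)] tree_class_cls[OF S f(1)] tree_class_cls[OF S g(1)]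
          tree_class_cls[OF S fun_submodule_add[OF cocycles_submodule f(1) g(1)]]
          Tree.add_cls[OF S tree_values_free tree_values_free] tree_values_lin(1) ..
    qed
    show "bij_betw (tree_class S n) (carrier (op_space ?P S n)) (carrier (op_space ?Q S n))"
      unfolding bij_betw_def
    proof
      show "inj_on (tree_class S n) (carrier (op_space ?P S n))"
      proof (rule inj_onI)
        fix X Y assume "X \<in> carrier (op_space ?P S n)" "Y \<in> carrier (op_space ?P S n)"
          and eq: "tree_class S n X = tree_class S n Y"
        then obtain f g where f: "f \<in> cocycles (MLT S) mlt_le n" "X = MLT.cls S n f"
          and g: "g \<in> cocycles (MLT S) mlt_le n" "Y = MLT.cls S n g"
          by (metis MLT.carrier_OpE[OF S])
        have "(\<lambda>x. tree_values S n f x - tree_values S n g x) \<in> fun_span (sign_relators S n)"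
          using eq fun_quotient.cl_eq_iff[OF tree_quotient[OF S] tree_values_free tree_values_free]
          unfolding f(2) g(2) tree_class_cls[OF S f(1)] tree_class_cls[OF S g(1)] by blast
        then show "X = Y"
          unfolding f(2) g(2) using tree_values_diff_span[OF S f(1) g(1)]
          by (intro MLT.cls_eqI[OF S f(1) g(1)]) blast
      qed
      show "tree_class S n ` carrier (op_space ?P S n) = carrier (op_space ?Q S n)"
      proof (intro equalityI subsetI)
        fix X assume "X \<in> tree_class S n ` carrier (op_space ?P S n)"
        then obtain f where "f \<in> cocycles (MLT S) mlt_le n" "X = tree_class S n (MLT.cls S n f)"
          unfolding MLT.carrier_Op[OF S] by blast
        then show "X \<in> carrier (op_space ?Q S n)"
          using tree_class_cls[OF S] Tree.cls_carrier[OF S tree_values_free] by metis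
      next
        fix X assume "X \<in> carrier (op_space ?Q S n)"
        then obtain u where u: "u \<in> free_module (tree_gens S n)" "X = Tree.cls S n u"
          by (rule Tree.carrier_OpE[OF S])
        \<comment> \<open>A preimage is available in all degrees at once, since
          \<open>chain_values\<close> is zero outside the top degree and every cochain is a cocycle
          in it.\<close>
        have "X = tree_class S n (MLT.cls S n (chain_values S n u))"
          unfolding tree_class_cls[OF S chain_values_cocycle[OF S]] tree_values_chain_values[OF S u(1)] u(2) ..
        then show "X \<in> tree_class S n ` carrier (op_space ?P S n)"
          using MLT.cls_carrier[OF S chain_values_cocycle[OF S]] by blast
      qed
    qed
  next
    fix S :: "'a set" and \<sigma> :: "'a \<Rightarrow> 'a" and n and X :: "('a set tree list \<Rightarrow> 'k) set"
    assume S: "arity S" "inj_on \<sigma> S" and "X \<in> carrier (op_space ?P S n)"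
    then obtain f where f: "f \<in> cocycles (MLT S) mlt_le n" "X = MLT.cls S n f"
      by (metis MLT.carrier_OpE)
    have S': "arity (\<sigma> ` S)" using S by (simp add: arity_def)
    show "tree_class (\<sigma> ` S) n (op_relabel ?P S \<sigma> n X) = op_relabel ?Q S \<sigma> n (tree_class S n X)"
      unfolding f(2) MLT.op_relabel_cls[OF S f(1)] tree_class_cls[OF S(1) f(1)]
        tree_class_cls[OF S' mlt_relabel_cocycle[OF S(2) f(1)]] tree_values_mlt_relabel[OF S]
        Tree.op_relabel_cls[OF S tree_values_free] ..
  next
    fix A B :: "'a set" and a m n and X Y :: "('a set tree list \<Rightarrow> 'k) set"
    assume c: "composable A a B" and X: "X \<in> carrier (op_space ?P (insert a A) m)"
      and Y: "Y \<in> carrier (op_space ?P B n)"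
    note ar = arity_composable[OF c]
    obtain f where f: "f \<in> cocycles (MLT (insert a A)) mlt_le m" "X = MLT.cls (insert a A) m f"
      using X by (rule MLT.carrier_OpE[OF ar(3)])
    obtain g where g: "g \<in> cocycles (MLT B) mlt_le n" "Y = MLT.cls B n g"
      using Y by (rule MLT.carrier_OpE[OF ar(1)])
    show "tree_class (A \<union> B) (m + n) (op_comp ?P A a B m n X Y)
        = op_comp ?Q A a B m n (tree_class (insert a A) m X) (tree_class B n Y)"
      unfolding f(2) g(2) MLT.op_comp_cls[OF c f(1) g(1)] tree_class_cls[OF ar(3) f(1)]
        tree_class_cls[OF ar(1) g(1)] tree_class_cls[OF ar(2) mlt_comp_cocycle[OF c f(1) g(1)]]
        tree_values_mlt_comp[OF c] Tree.op_comp_cls[OF c tree_values_free tree_values_free] ..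
  qed
  then show ?thesis unfolding h_MLT_eq Tree_operad_eq by blast
qed

end
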